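(* For every subgroup $\Gamma$ of $\mathrm{PC}_{\mathbf{Proj}}(\mathbf{R}/\mathbf{Z})$ with Property FW, there exist $n\ge 0$, a finite index subgroup $\Gamma'$ of $\Gamma$ and a homomorphism $\Gamma'\to\mathrm{PSL}_2(\mathbf{R})^n$ with finite kernel, such that each of the $n$ projections $\Gamma'\to\mathrm{PSL}_2(\mathbf{R})$ has Zariski-dense image. In particular, $\Gamma$ is either finite or has a non-abelian free subgroup.
   Context: $\mathrm{PC}_{\mathbf{Proj}}(\mathbf{R}/\mathbf{Z})$ is the group of piecewise projective self-transformations of $\mathbf{R}/\mathbf{Z}$ (discontinuities allowed): its elements are homeomorphisms $f:(\mathbf{R}/\mathbf{Z})\smallsetminus F\to(\mathbf{R}/\mathbf{Z})\smallsetminus F'$ with $F,F'$ finite, which in the local coordinates given by local inverses of $\mathbf{R}\to\mathbf{R}/\mathbf{Z}$ are locally of the form $x\mapsto (ax+b)/(cx+d)$ with $ad-bc\ne 0$, two of these being identified if they agree on a cofinite subset; the group law is induced by composition. Property FW: given a (discrete) group $G$ acting on a set $Y$, a subset $M\subset Y$ is commensurated if $M\bigtriangleup gM$ is finite for every $g\in G$, and transfixed if there is a $G$-invariant $M_0\subset Y$ with $M\bigtriangleup M_0$ finite. $G$ has Property FW if for every $G$-set $Y$, every commensurated subset of $Y$ is transfixed. *)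

theory Defs
  imports "HOL-Analysis.Analysis" "HOL-Algebra.Algebra"
begin

section \<open>The circle \<open>\<real>/\<int>\<close> with its quotient topology\<close>

quotient_type circle = real / "\<lambda>x y::real. x - y \<in> \<int>"
proof (rule equivpI)
  show "reflp (\<lambda>x y::real. x - y \<in> \<int>)"
    by (simp add: reflp_def)
  show "symp (\<lambda>x y::real. x - y \<in> \<int>)"
    unfolding symp_def by (metis Ints_minus minus_diff_eq)
  show "transp (\<lambda>x y::real. x - y \<in> \<int>)"
    unfolding transp_def
  proof (intro allI impI)
    fix x y z :: real
    assume "x - y \<in> \<int>" "y - z \<in> \<int>"
    then have "(x - y) + (y - z) \<in> \<int>" by (rule Ints_add)
    then show "x - z \<in> \<int>" by simp
  qed
qed

abbreviation proj :: "real \<Rightarrow> circle" where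
  "proj \<equiv> abs_circle"

instantiation circle :: topological_space
begin

definition open_circle :: "circle set \<Rightarrow> bool" where
  "open_circle U \<longleftrightarrow> open (proj -` U)"

instance
proof
  show "open (UNIV :: circle set)"
    by (simp add: open_circle_def)
  show "open (S \<inter> T)" if "open S" "open T" for S T :: "circle set"
    using that by (simp add: open_circle_def open_Int)
  show "open (\<Union>K)" if "\<forall>S\<in>K. open S" for K :: "circle set set"
    using that by (auto simp: open_circle_def vimage_Union)
qed

end

lemma proj_eq_iff: "proj x = proj y \<longleftrightarrow> x - y \<in> \<int>"
  by (rule circle.abs_eq_iff)

lemma proj_surj: obtains t where "proj t = z"
  by (metis Quotient_circle Quotient_abs_rep)

lemma open_Compl_finite_circle:
  fixes F :: "circle set"
  assumes "finite F"
  shows "open (- F)"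
proof -
  have one: "open (- {z :: circle})" for z
  proof -
    obtain t where t: "proj t = z" by (rule proj_surj)
    have "proj -` {z} = (\<lambda>x. x - t) -` \<int>"
      by (auto simp: t[symmetric] proj_eq_iff)
    moreover have "closed ((\<lambda>x::real. x - t) -` \<int>)"
      by (intro closed_vimage closed_Ints continuous_intros)
    ultimately have "closed (proj -` {z})" by simp
    then show ?thesis
      by (simp add: open_circle_def vimage_Compl open_Compl)
  qed
  have "- F = (\<Inter>z\<in>F. - {z})" by auto
  then show ?thesis using assms one by auto
qed

section \<open>The group of piecewise projective self-transformations of the circle\<close>

text \<open>
  The lifts \<open>t\<close> of a point \<open>x\<close> correspond to the local charts at \<open>x\<close> given by the local inverses
  of \<open>proj\<close>; choosing another chart around the image point changes \<open>(a, b, c, d)\<close> only by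
  an integer translation.
\<close>

definition locally_projective_at :: "(circle \<Rightarrow> circle) \<Rightarrow> circle \<Rightarrow> bool" where
  "locally_projective_at f x \<longleftrightarrow>
     (\<forall>t. proj t = x \<longrightarrow>
       (\<exists>a b c d :: real. a * d - b * c \<noteq> 0 \<and> c * t + d \<noteq> 0 \<and>
          (\<forall>\<^sub>F u in nhds t. f (proj u) = proj ((a * u + b) / (c * u + d)))))"

text \<open>
  A homeomorphism \<open>f : -F \<rightarrow> -F'\<close> is represented by any total function extending it: its
  values on the finite set \<open>F\<close> are irrelevant modulo agreement on a cofinite subset.
\<close>

definition piecewise_projective :: "(circle \<Rightarrow> circle) \<Rightarrow> bool" where
  "piecewise_projective f \<longleftrightarrow>
     (\<exists>F F'. finite F \<and> finite F' \<and> (\<exists>g. homeomorphism (- F) (- F') f g) \<and>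
        (\<forall>x\<in>- F. locally_projective_at f x))"

definition cofinite_eq :: "((circle \<Rightarrow> circle) \<times> (circle \<Rightarrow> circle)) set" where
  "cofinite_eq = {(f, g). finite {x. f x \<noteq> g x}}"

definition PC_Proj :: "(circle \<Rightarrow> circle) set monoid" where
  "PC_Proj = \<lparr>
     carrier = {cofinite_eq `` {f} | f. piecewise_projective f},
     mult = (\<lambda>A B. \<Union>f\<in>A. \<Union>g\<in>B. cofinite_eq `` {f \<circ> g}),
     one = cofinite_eq `` {id}\<rparr>"

lemma equiv_cofinite_eq: "equiv UNIV cofinite_eq"
proof (rule equivI)
  show "cofinite_eq \<subseteq> UNIV \<times> UNIV" by simp
  show "refl cofinite_eq" by (simp add: refl_on_def cofinite_eq_def)
  show "sym cofinite_eq" by (simp add: sym_def cofinite_eq_def eq_commute)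
  show "trans cofinite_eq"
    unfolding trans_def cofinite_eq_def
  proof (clarsimp)
    fix f g h :: "circle \<Rightarrow> circle"
    assume "finite {x. f x \<noteq> g x}" "finite {x. g x \<noteq> h x}"
    then have "finite ({x. f x \<noteq> g x} \<union> {x. g x \<noteq> h x})" by simp
    then show "finite {x. f x \<noteq> h x}" by (rule rev_finite_subset) auto
  qed
qed

lemma cofinite_class_eq_iff:
  "cofinite_eq `` {f} = cofinite_eq `` {g} \<longleftrightarrow> finite {x. f x \<noteq> g x}"
  using equiv_class_eq_iff[OF equiv_cofinite_eq, of f g] by (simp add: cofinite_eq_def)

lemma locally_projective_cong:
  assumes "open U" "x \<in> U" "\<And>z. z \<in> U \<Longrightarrow> f z = g z" "locally_projective_at f x"
  shows "locally_projective_at g x"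
  unfolding locally_projective_at_def
proof (intro allI impI)
  fix t assume t: "proj t = x"
  then obtain a b c d :: real where *: "a * d - b * c \<noteq> 0" "c * t + d \<noteq> 0"
      "\<forall>\<^sub>F u in nhds t. f (proj u) = proj ((a * u + b) / (c * u + d))"
    using assms(4) unfolding locally_projective_at_def by blast
  have "open (proj -` U)" "t \<in> proj -` U"
    using assms(1,2) t by (auto simp: open_circle_def)
  then have "\<forall>\<^sub>F u in nhds t. proj u \<in> U"
    using eventually_nhds_in_open by force
  with *(3) have "\<forall>\<^sub>F u in nhds t. g (proj u) = proj ((a * u + b) / (c * u + d))"
    by eventually_elim (use assms(3) in force)
  with * show "\<exists>a b c d :: real. a * d - b * c \<noteq> 0 \<and> c * t + d \<noteq> 0 \<and>
          (\<forall>\<^sub>F u in nhds t. g (proj u) = proj ((a * u + b) / (c * u + d)))"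
    by blast
qed

lemma piecewise_projective_cong:
  assumes "piecewise_projective f" "finite {x. f x \<noteq> g x}"
  shows "piecewise_projective g"
proof -
  obtain F F' f' where F: "finite F" "finite F'" "homeomorphism (- F) (- F') f f'"
      "\<And>x. x \<notin> F \<Longrightarrow> locally_projective_at f x"
    using assms(1) unfolding piecewise_projective_def by blast
  define D where "D = {x. f x \<noteq> g x}"
  have D: "finite D" using assms(2) by (simp add: D_def)
  have *: "homeomorphism (- (F \<union> D)) (- (F' \<union> f ` (D - F))) f f'"
  proof (rule homeomorphism_of_subsets[OF F(3)])
    show "f ` (- (F \<union> D)) = - (F' \<union> f ` (D - F))"
    proof
      have inj: "f x = f y \<Longrightarrow> x = y" if "x \<notin> F" "y \<notin> F" for x y
        using F(3) that unfolding homeomorphism_def by (metis ComplI)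
      have "f x \<notin> F'" if "x \<notin> F" for x
        using F(3) that by (auto simp: homeomorphism_def)
      then show "f ` (- (F \<union> D)) \<subseteq> - (F' \<union> f ` (D - F))" using inj by blast
      have "f ` (- F) = - F'" using F(3) by (simp add: homeomorphism_def)
      then show "- (F' \<union> f ` (D - F)) \<subseteq> f ` (- (F \<union> D))" by blast
    qed
  qed auto
  have "homeomorphism (- (F \<union> D)) (- (F' \<union> f ` (D - F))) g f'"
    by (rule homeomorphism_cong[OF *]) (auto simp: D_def)
  moreover have "locally_projective_at g x" if "x \<in> - (F \<union> D)" for x
    by (rule locally_projective_cong[of "- (F \<union> D)" x f])
       (use that F D in \<open>auto intro: open_Compl_finite_circle simp: D_def\<close>)
  ultimately show ?thesis
    unfolding piecewise_projective_def using F(1,2) D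
    by (intro exI[of _ "F \<union> D"] exI[of _ "F' \<union> f ` (D - F)"]) auto
qed

lemma in_PC_Proj_iff:
  "A \<in> carrier PC_Proj \<longleftrightarrow> (\<exists>f. piecewise_projective f \<and> A = cofinite_eq `` {f})"
  by (auto simp: PC_Proj_def)

lemma piecewise_projective_finite_vimage:
  assumes "piecewise_projective g" "finite A"
  shows "finite {x. g x \<in> A}"
proof -
  obtain F F' f' where F: "finite F" "homeomorphism (- F) (- F') g f'"
    using assms(1) unfolding piecewise_projective_def by blast
  have "{x. g x \<in> A} \<subseteq> F \<union> f' ` A"
    using F(2) by (force simp: homeomorphism_def)
  then show ?thesis using F(1) assms(2) by (meson finite_Un finite_imageI finite_subset)
qed

lemma PC_Proj_mult:
  assumes "piecewise_projective g"
  shows "cofinite_eq `` {f} \<otimes>\<^bsub>PC_Proj\<^esub> cofinite_eq `` {g} = cofinite_eq `` {f \<circ> g}"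
proof -
  have "cofinite_eq `` {f1 \<circ> g1} = cofinite_eq `` {f \<circ> g}"
    if "f1 \<in> cofinite_eq `` {f}" "g1 \<in> cofinite_eq `` {g}" for f1 g1
  proof -
    have 1: "finite {x. f x \<noteq> f1 x}" "finite {x. g x \<noteq> g1 x}"
      using that by (auto simp: cofinite_eq_def)
    have "{x. (f1 \<circ> g1) x \<noteq> (f \<circ> g) x} \<subseteq> {x. g x \<noteq> g1 x} \<union> {x. g x \<in> {x. f x \<noteq> f1 x}}"
      by auto
    then have "finite {x. (f1 \<circ> g1) x \<noteq> (f \<circ> g) x}"
      using 1 piecewise_projective_finite_vimage[OF assms 1(1)] by (meson finite_Un finite_subset)
    then show ?thesis by (simp only: cofinite_class_eq_iff)
  qed
  then have "(\<Union>f1\<in>cofinite_eq `` {f}. \<Union>g1\<in>cofinite_eq `` {g}. cofinite_eq `` {f1 \<circ> g1})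
      = (\<Union>f1\<in>cofinite_eq `` {f}. \<Union>g1\<in>cofinite_eq `` {g}. cofinite_eq `` {f \<circ> g})"
    by (intro SUP_cong refl) simp
  also have "\<dots> = cofinite_eq `` {f \<circ> g}"
  proof -
    have "cofinite_eq `` {f} \<noteq> {}" "cofinite_eq `` {g} \<noteq> {}"
      using equiv_class_self[OF equiv_cofinite_eq] by blast+
    then show ?thesis by (simp only: UN_constant if_False)
  qed
  finally show ?thesis by (simp add: PC_Proj_def)
qed

lemma locally_projective_comp:
  assumes "locally_projective_at g x" "locally_projective_at f (g x)"
  shows "locally_projective_at (f \<circ> g) x"
  unfolding locally_projective_at_def
proof (intro allI impI)
  fix t assume t: "proj t = x"
  obtain a b c d :: real where g: "a * d - b * c \<noteq> 0" "c * t + d \<noteq> 0"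
      "\<forall>\<^sub>F u in nhds t. g (proj u) = proj ((a * u + b) / (c * u + d))"
    using assms(1) t unfolding locally_projective_at_def by blast
  define s where "s = (a * t + b) / (c * t + d)"
  have "proj s = g x"
    using eventually_nhds_x_imp_x[OF g(3)] t by (simp add: s_def)
  then obtain a' b' c' d' :: real where f: "a' * d' - b' * c' \<noteq> 0" "c' * s + d' \<noteq> 0"
      "\<forall>\<^sub>F u in nhds s. f (proj u) = proj ((a' * u + b') / (c' * u + d'))"
    using assms(2) unfolding locally_projective_at_def by blast
  have lim: "((\<lambda>u. (a * u + b) / (c * u + d)) \<longlongrightarrow> s) (nhds t)"
    unfolding s_def by (intro tendsto_intros filterlim_ident g(2))
  have "((\<lambda>u. c * u + d) \<longlongrightarrow> c * t + d) (nhds t)"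
    by (intro tendsto_intros filterlim_ident)
  then have nz: "\<forall>\<^sub>F u in nhds t. c * u + d \<noteq> 0"
    using g(2) tendsto_imp_eventually_ne by blast
  have "\<forall>\<^sub>F u in nhds t. f (proj ((a * u + b) / (c * u + d))) =
      proj ((a' * ((a * u + b) / (c * u + d)) + b') / (c' * ((a * u + b) / (c * u + d)) + d'))"
    using f(3) lim by (rule eventually_compose_filterlim)
  with g(3) nz have "\<forall>\<^sub>F u in nhds t. (f \<circ> g) (proj u) =
      proj (((a' * a + b' * c) * u + (a' * b + b' * d)) / ((c' * a + d' * c) * u + (c' * b + d' * d)))"
  proof eventually_elim
    case (elim u)
    have "(a' * ((a * u + b) / (c * u + d)) + b') / (c' * ((a * u + b) / (c * u + d)) + d')
        = ((a' * (a * u + b) + b' * (c * u + d)) / (c * u + d)) /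
          ((c' * (a * u + b) + d' * (c * u + d)) / (c * u + d))"
    proof -
      have "p * (n / m) + q = (p * n + q * m) / m" if "m \<noteq> 0" for p q n m :: real
        using that by (simp add: field_simps)
      then show ?thesis using elim(2) by simp
    qed
    also have "\<dots> = (a' * (a * u + b) + b' * (c * u + d)) / (c' * (a * u + b) + d' * (c * u + d))"
      using elim(2) by simp
    also have "\<dots> = ((a' * a + b' * c) * u + (a' * b + b' * d)) / ((c' * a + d' * c) * u + (c' * b + d' * d))"
      by (simp add: algebra_simps)
    finally show ?case using elim by simp
  qed
  moreover have "(a' * a + b' * c) * (c' * b + d' * d) - (a' * b + b' * d) * (c' * a + d' * c) \<noteq> 0"
  proof -
    have "(a' * a + b' * c) * (c' * b + d' * d) - (a' * b + b' * d) * (c' * a + d' * c)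
       = (a' * d' - b' * c') * (a * d - b * c)" by (simp add: algebra_simps)
    then show ?thesis using f(1) g(1) by simp
  qed
  moreover have "(c' * a + d' * c) * t + (c' * b + d' * d) \<noteq> 0"
  proof -
    have "(c' * a + d' * c) * t + (c' * b + d' * d) = c' * (a * t + b) + d' * (c * t + d)"
      by (simp add: algebra_simps)
    also have "\<dots> = (c' * s + d') * (c * t + d)"
      using g(2) by (simp add: s_def field_simps)
    finally show ?thesis using f(2) g(2) by simp
  qed
  ultimately show "\<exists>a b c d :: real. a * d - b * c \<noteq> 0 \<and> c * t + d \<noteq> 0 \<and>
          (\<forall>\<^sub>F u in nhds t. (f \<circ> g) (proj u) = proj ((a * u + b) / (c * u + d)))"
    by blast
qed

lemma piecewise_projective_comp:
  assumes "piecewise_projective f" "piecewise_projective g"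
  shows "piecewise_projective (f \<circ> g)"
proof -
  obtain F F' f' where f: "finite F" "finite F'" "homeomorphism (- F) (- F') f f'"
      "\<And>x. x \<notin> F \<Longrightarrow> locally_projective_at f x"
    using assms(1) unfolding piecewise_projective_def by blast
  obtain G G' g' where g: "finite G" "finite G'" "homeomorphism (- G) (- G') g g'"
      "\<And>x. x \<notin> G \<Longrightarrow> locally_projective_at g x"
    using assms(2) unfolding piecewise_projective_def by blast
  define C where "C = - (G \<union> g' ` (F - G'))"
  define C' where "C' = - (F' \<union> f ` (G' - F))"
  have gg: "g' (g x) = x" "g x \<notin> G'" if "x \<notin> G" for x
    using g(3) that by (auto simp: homeomorphism_def)
  have gg': "g (g' y) = y" "g' y \<notin> G" if "y \<notin> G'" for y
    using g(3) that by (auto simp: homeomorphism_def)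
  have ff: "f' (f x) = x" "f x \<notin> F'" if "x \<notin> F" for x
    using f(3) that by (auto simp: homeomorphism_def)
  have ff': "f (f' y) = y" "f' y \<notin> F" if "y \<notin> F'" for y
    using f(3) that by (auto simp: homeomorphism_def)
  have "g ` C \<subseteq> - (G' \<union> F)"
    using gg by (force simp: C_def)
  moreover have "y \<in> g ` C" if "y \<in> - (G' \<union> F)" for y
  proof
    show "y = g (g' y)" using gg' that by simp
    have "g' y \<noteq> g' x" if "x \<in> F - G'" for x
      using gg' that \<open>y \<in> - (G' \<union> F)\<close> by (metis Compl_iff DiffD1 DiffD2 UnCI)
    then show "g' y \<in> C" using gg' that by (auto simp: C_def)
  qed
  ultimately have "g ` C = - (G' \<union> F)" by blast
  then have hg: "homeomorphism C (- (G' \<union> F)) g g'"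
    by (intro homeomorphism_of_subsets[OF g(3)]) (auto simp: C_def)
  have "f ` (- (G' \<union> F)) \<subseteq> C'"
  proof
    fix y assume "y \<in> f ` (- (G' \<union> F))"
    then obtain x where x: "x \<notin> G'" "x \<notin> F" "y = f x" by auto
    have "f x \<noteq> f z" if "z \<in> G' - F" for z
      using ff x that by (metis DiffD1 DiffD2)
    then show "y \<in> C'" using ff x by (auto simp: C'_def)
  qed
  moreover have "y \<in> f ` (- (G' \<union> F))" if "y \<in> C'" for y
  proof
    have y: "y \<notin> F'" "y \<notin> f ` (G' - F)" using that by (auto simp: C'_def)
    show y_eq: "y = f (f' y)" using ff' y by simp
    show "f' y \<in> - (G' \<union> F)" using ff' y y_eq by (metis ComplI DiffI UnE image_eqI)
  qed
  ultimately have "f ` (- (G' \<union> F)) = C'" by blast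
  then have hf: "homeomorphism (- (G' \<union> F)) C' f f'"
    by (intro homeomorphism_of_subsets[OF f(3)]) (auto simp: C'_def)
  have "homeomorphism C C' (f \<circ> g) (g' \<circ> f')"
    using homeomorphism_compose[OF hg hf] .
  moreover have "locally_projective_at (f \<circ> g) x" if "x \<in> C" for x
  proof (rule locally_projective_comp)
    show "locally_projective_at g x" using that by (auto simp: C_def intro: g(4))
    have "g x \<in> - (G' \<union> F)" using hg that by (auto simp: homeomorphism_def)
    then show "locally_projective_at f (g x)" by (auto intro: f(4))
  qed
  ultimately show ?thesis
    unfolding piecewise_projective_def
    by (intro exI[of _ "G \<union> g' ` (F - G')"] exI[of _ "F' \<union> f ` (G' - F)"])
       (auto simp: C_def C'_def f g)
qed

lemma piecewise_projective_id: "piecewise_projective id"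
proof -
  have "locally_projective_at id x" for x
    unfolding locally_projective_at_def
    by (intro allI impI exI[of _ 1] exI[of _ 0]) auto
  then show ?thesis
    unfolding piecewise_projective_def
    by (intro exI[of _ "{}"]) (auto intro!: exI[of _ id] simp: homeomorphism_def)
qed

lemma piecewise_projective_inverse:
  assumes "piecewise_projective f"
  obtains g where "piecewise_projective g" "finite {x. (g \<circ> f) x \<noteq> x}"
proof -
  obtain F F' g where f: "finite F" "finite F'" "homeomorphism (- F) (- F') f g"
      "\<And>x. x \<notin> F \<Longrightarrow> locally_projective_at f x"
    using assms(1) unfolding piecewise_projective_def by blast
  have "locally_projective_at g y" if y: "y \<notin> F'" for y
    unfolding locally_projective_at_def
  proof (intro allI impI)
    fix s assume s: "proj s = y"
    obtain t where t: "proj t = g y" by (rule proj_surj)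
    have gy: "g y \<notin> F" "f (g y) = y" using f(3) y by (auto simp: homeomorphism_def)
    obtain a b c d :: real where *: "a * d - b * c \<noteq> 0" "c * t + d \<noteq> 0"
      "\<forall>\<^sub>F u in nhds t. f (proj u) = proj ((a * u + b) / (c * u + d))"
      using f(4)[OF gy(1)] t unfolding locally_projective_at_def by blast
    have "proj ((a * t + b) / (c * t + d)) = proj s"
      using eventually_nhds_x_imp_x[OF *(3)] t gy(2) s by simp
    then have kint: "(a * t + b) / (c * t + d) - s \<in> \<int>" by (simp add: proj_eq_iff)
    define k where "k = (a * t + b) / (c * t + d) - s"
    define a' b' where "a' = a - k * c" and "b' = b - k * d"
    have det: "a' * d - b' * c \<noteq> 0"
      using *(1) by (simp add: a'_def b'_def algebra_simps)
    have s_eq: "a' * t + b' = s * (c * t + d)"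
    proof -
      have "a * t + b = (k + s) * (c * t + d)" using *(2) by (simp add: k_def)
      then show ?thesis by (simp add: a'_def b'_def algebra_simps)
    qed
    have den: "(- c * s + a') * (c * t + d) = a' * d - b' * c"
    proof -
      have "(- c * s + a') * (c * t + d) = - c * (s * (c * t + d)) + a' * (c * t + d)"
        by (simp add: algebra_simps)
      then show ?thesis unfolding s_eq[symmetric] by (simp add: algebra_simps)
    qed
    have den0: "- c * s + a' \<noteq> 0" using den det by auto
    have ts: "(d * s + - b') / (- c * s + a') = t"
    proof -
      have "(d * s - b') * (c * t + d) = d * (s * (c * t + d)) - b' * (c * t + d)" by (simp add: algebra_simps)
      also have "\<dots> = t * (a' * d - b' * c)" unfolding s_eq[symmetric] by (simp add: algebra_simps)
      also have "\<dots> = (t * (- c * s + a')) * (c * t + d)" unfolding den[symmetric] by (simp only: ac_simps)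
      finally have "d * s - b' = t * (- c * s + a')" using *(2) by simp
      then show ?thesis using den0 by (simp add: field_simps)
    qed
    have lim: "((\<lambda>v. (d * v + - b') / (- c * v + a')) \<longlongrightarrow> t) (nhds s)"
      unfolding ts[symmetric] by (intro tendsto_intros filterlim_ident den0)
    have "((\<lambda>v. - c * v + a') \<longlongrightarrow> - c * s + a') (nhds s)"
      by (intro tendsto_intros filterlim_ident)
    then have nz: "\<forall>\<^sub>F v in nhds s. - c * v + a' \<noteq> 0"
      using den0 tendsto_imp_eventually_ne by blast
    have "open (proj -` (- F))" "t \<in> proj -` (- F)"
      using open_Compl_finite_circle[OF f(1)] t gy(1) by (auto simp: open_circle_def)
    then have "\<forall>\<^sub>F u in nhds t. proj u \<notin> F"
      using eventually_nhds_in_open by force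
    then have ev1: "\<forall>\<^sub>F v in nhds s. proj ((d * v + - b') / (- c * v + a')) \<notin> F"
      using lim by (rule eventually_compose_filterlim)
    have ev2: "\<forall>\<^sub>F v in nhds s. f (proj ((d * v + - b') / (- c * v + a'))) =
      proj ((a * ((d * v + - b') / (- c * v + a')) + b) / (c * ((d * v + - b') / (- c * v + a')) + d))"
      using *(3) lim by (rule eventually_compose_filterlim)
    from ev1 ev2 nz
    have "\<forall>\<^sub>F v in nhds s. g (proj v) = proj ((d * v + - b') / (- c * v + a'))"
    proof eventually_elim
      case (elim v)
      define w where "w = (d * v + - b') / (- c * v + a')"
      have w: "w * (- c * v + a') = d * v - b'" using elim(3) by (simp add: w_def)
      have nz': "c * w + d \<noteq> 0"
      proof
        assume "c * w + d = 0"
        then have "(c * w + d) * (- c * v + a') = 0" by simp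
        then have "c * (w * (- c * v + a')) + d * (- c * v + a') = 0" by (simp add: algebra_simps)
        then have "a' * d - b' * c = 0" unfolding w by (simp add: algebra_simps)
        then show False using det by simp
      qed
      have "a * w + b = (v + k) * (c * w + d)"
        using w by (simp add: a'_def b'_def algebra_simps)
      then have "(a * w + b) / (c * w + d) = v + k" using nz' by simp
      then have "f (proj w) = proj (v + k)" using elim(2) by (simp add: w_def)
      also have "\<dots> = proj v" using kint by (simp add: proj_eq_iff k_def)
      finally have "f (proj w) = proj v" .
      moreover have "g (f (proj w)) = proj w"
        using elim(1) f(3) by (auto simp: homeomorphism_def w_def)
      ultimately show ?case by (simp add: w_def)
    qed
    moreover have "d * a' - (- b') * (- c) \<noteq> 0" using det by (simp add: algebra_simps)
    ultimately show "\<exists>a b c d :: real. a * d - b * c \<noteq> 0 \<and> c * s + d \<noteq> 0 \<and>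
          (\<forall>\<^sub>F u in nhds s. g (proj u) = proj ((a * u + b) / (c * u + d)))"
      using den0 by blast
  qed
  then have "piecewise_projective g"
    unfolding piecewise_projective_def using f(1,2) homeomorphism_symD[OF f(3)] by blast
  moreover have "{x. (g \<circ> f) x \<noteq> x} \<subseteq> F" using f(3) by (auto simp: homeomorphism_def)
  then have "finite {x. (g \<circ> f) x \<noteq> x}" using f(1) finite_subset by blast
  ultimately show ?thesis by (rule that)
qed

theorem group_PC_Proj: "group PC_Proj"
proof (rule groupI)
  have one: "\<one>\<^bsub>PC_Proj\<^esub> = cofinite_eq `` {id}" by (simp add: PC_Proj_def)
  show "\<one>\<^bsub>PC_Proj\<^esub> \<in> carrier PC_Proj"
    unfolding one in_PC_Proj_iff using piecewise_projective_id by blast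
  show "A \<otimes>\<^bsub>PC_Proj\<^esub> B \<in> carrier PC_Proj"
    if "A \<in> carrier PC_Proj" "B \<in> carrier PC_Proj" for A B
    using that unfolding in_PC_Proj_iff by (metis PC_Proj_mult piecewise_projective_comp)
  show "A \<otimes>\<^bsub>PC_Proj\<^esub> B \<otimes>\<^bsub>PC_Proj\<^esub> C = A \<otimes>\<^bsub>PC_Proj\<^esub> (B \<otimes>\<^bsub>PC_Proj\<^esub> C)"
    if "A \<in> carrier PC_Proj" "B \<in> carrier PC_Proj" "C \<in> carrier PC_Proj" for A B C
  proof -
    from that obtain f g h where *: "piecewise_projective g" "piecewise_projective h"
      "A = cofinite_eq `` {f}" "B = cofinite_eq `` {g}" "C = cofinite_eq `` {h}"
      unfolding in_PC_Proj_iff by blast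
    show ?thesis
      unfolding *(3-5)
      by (simp only: PC_Proj_mult * piecewise_projective_comp comp_assoc)
  qed
  show "\<one>\<^bsub>PC_Proj\<^esub> \<otimes>\<^bsub>PC_Proj\<^esub> A = A" if "A \<in> carrier PC_Proj" for A
    using that unfolding in_PC_Proj_iff one by (metis PC_Proj_mult id_comp)
  show "\<exists>B\<in>carrier PC_Proj. B \<otimes>\<^bsub>PC_Proj\<^esub> A = \<one>\<^bsub>PC_Proj\<^esub>"
    if A: "A \<in> carrier PC_Proj" for A
  proof -
    obtain f where f: "piecewise_projective f" "A = cofinite_eq `` {f}"
      using A unfolding in_PC_Proj_iff by auto
    obtain g where g: "piecewise_projective g" "finite {x. (g \<circ> f) x \<noteq> x}"
      using piecewise_projective_inverse[OF f(1)] by blast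
    have "cofinite_eq `` {g} \<otimes>\<^bsub>PC_Proj\<^esub> A = \<one>\<^bsub>PC_Proj\<^esub>"
      unfolding f(2) one PC_Proj_mult[OF f(1)] cofinite_class_eq_iff using g(2) by simp
    moreover have "cofinite_eq `` {g} \<in> carrier PC_Proj"
      unfolding in_PC_Proj_iff by (rule exI[of _ g]) (simp add: g(1))
    ultimately show ?thesis by (rule bexI)
  qed
qed

section \<open>Property FW\<close>

definition commensurated ::
  "('g, 'm) monoid_scheme \<Rightarrow> ('g \<Rightarrow> 'y \<Rightarrow> 'y) \<Rightarrow> 'y set \<Rightarrow> bool" where
  "commensurated G \<phi> M \<longleftrightarrow> (\<forall>g\<in>carrier G. finite (sym_diff M (\<phi> g ` M)))"

definition transfixed ::
  "('g, 'm) monoid_scheme \<Rightarrow> 'y set \<Rightarrow> ('g \<Rightarrow> 'y \<Rightarrow> 'y) \<Rightarrow> 'y set \<Rightarrow> bool" where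
  "transfixed G Y \<phi> M \<longleftrightarrow>
     (\<exists>M0\<subseteq>Y. (\<forall>g\<in>carrier G. \<phi> g ` M0 = M0) \<and> finite (sym_diff M M0))"

definition property_FW_on :: "'y itself \<Rightarrow> ('g, 'm) monoid_scheme \<Rightarrow> bool" where
  "property_FW_on _ G \<longleftrightarrow>
     (\<forall>(Y :: 'y set) \<phi> M. group_action G Y \<phi> \<and> M \<subseteq> Y \<and> commensurated G \<phi> M
        \<longrightarrow> transfixed G Y \<phi> M)"

text \<open>
  A formula cannot quantify over all types, so the \<open>G\<close>-sets are taken in one fixed type.
  This type is large enough: the theorem \<open>property_FW_imp_on\<close> below shows that the
  property for it implies the property for \<open>G\<close>-sets in an arbitrary type.
\<close>

definition property_FW :: "('g, 'm) monoid_scheme \<Rightarrow> bool" where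
  "property_FW G \<longleftrightarrow> property_FW_on TYPE('g \<times> 'g \<times> nat) G"

lemma group_action_transport:
  assumes act: "group_action G Y \<phi>" and sub: "Y' \<subseteq> Y"
    and inv: "\<And>g y. g \<in> carrier G \<Longrightarrow> y \<in> Y' \<Longrightarrow> \<phi> g y \<in> Y'"
    and i: "inj_on i Y'"
  shows "group_action G (i ` Y') (\<lambda>g. \<lambda>z\<in>i ` Y'. i (\<phi> g (inv_into Y' i z)))"
    (is "group_action G ?Z ?\<psi>")
proof -
  interpret A: group_action G Y \<phi> by (rule act)
  have grp: "group G" using A.group_hom by (simp add: group_hom_def)
  interpret G: group G by (rule grp)
  have psi: "?\<psi> g (i y) = i (\<phi> g y)" if "y \<in> Y'" for g y
    using that i by simp
  have comp: "\<phi> (g \<otimes>\<^bsub>G\<^esub> h) y = \<phi> g (\<phi> h y)"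
    if "y \<in> Y'" "g \<in> carrier G" "h \<in> carrier G" for g h y
    using A.composition_rule that sub by blast
  have one: "\<phi> \<one>\<^bsub>G\<^esub> y = y" if "y \<in> Y'" for y
    using A.id_eq_one that sub by (metis restrict_apply' subsetD)
  have bij: "?\<psi> g \<in> Bij ?Z" if g: "g \<in> carrier G" for g
  proof -
    have "bij_betw (?\<psi> g) ?Z ?Z"
    proof (rule bij_betw_byWitness[where f' = "?\<psi> (inv\<^bsub>G\<^esub> g)"])
      show "\<forall>a\<in>?Z. ?\<psi> (inv\<^bsub>G\<^esub> g) (?\<psi> g a) = a"
      proof clarify
        fix y assume y: "y \<in> Y'"
        have "?\<psi> (inv\<^bsub>G\<^esub> g) (?\<psi> g (i y)) = i (\<phi> (inv\<^bsub>G\<^esub> g) (\<phi> g y))"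
          using psi inv y g by metis
        also have "\<dots> = i y" using comp[OF y, of "inv\<^bsub>G\<^esub> g" g] one[OF y] g by simp
        finally show "?\<psi> (inv\<^bsub>G\<^esub> g) (?\<psi> g (i y)) = i y" .
      qed
      show "\<forall>a\<in>?Z. ?\<psi> g (?\<psi> (inv\<^bsub>G\<^esub> g) a) = a"
      proof clarify
        fix y assume y: "y \<in> Y'"
        have "?\<psi> g (?\<psi> (inv\<^bsub>G\<^esub> g) (i y)) = i (\<phi> g (\<phi> (inv\<^bsub>G\<^esub> g) y))"
          using psi inv y g by (metis G.inv_closed)
        also have "\<dots> = i y" using comp[OF y, of g "inv\<^bsub>G\<^esub> g"] one[OF y] g by simp
        finally show "?\<psi> g (?\<psi> (inv\<^bsub>G\<^esub> g) (i y)) = i y" .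
      qed
      show "?\<psi> g ` ?Z \<subseteq> ?Z" using inv[OF g] i by auto
      show "?\<psi> (inv\<^bsub>G\<^esub> g) ` ?Z \<subseteq> ?Z" using inv[of "inv\<^bsub>G\<^esub> g"] g i by auto
    qed
    then show ?thesis by (simp add: Bij_def)
  qed
  have "?\<psi> \<in> hom G (BijGroup ?Z)"
  proof (rule homI)
    show "?\<psi> g \<in> carrier (BijGroup ?Z)" if "g \<in> carrier G" for g
      using bij[OF that] by (simp add: BijGroup_def)
    show "?\<psi> (g \<otimes>\<^bsub>G\<^esub> h) = ?\<psi> g \<otimes>\<^bsub>BijGroup ?Z\<^esub> ?\<psi> h"
      if g: "g \<in> carrier G" and h: "h \<in> carrier G" for g h
    proof
      fix z
      have R: "?\<psi> g \<otimes>\<^bsub>BijGroup ?Z\<^esub> ?\<psi> h = compose ?Z (?\<psi> g) (?\<psi> h)"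
        using bij[OF g] bij[OF h] by (simp add: BijGroup_def)
      show "?\<psi> (g \<otimes>\<^bsub>G\<^esub> h) z = (?\<psi> g \<otimes>\<^bsub>BijGroup ?Z\<^esub> ?\<psi> h) z"
      proof (cases "z \<in> ?Z")
        case True
        then obtain y where y: "y \<in> Y'" "z = i y" by auto
        have "?\<psi> (g \<otimes>\<^bsub>G\<^esub> h) z = i (\<phi> g (\<phi> h y))"
          unfolding y(2) psi[OF y(1)] comp[OF y(1) g h] ..
        also have "\<dots> = ?\<psi> g (?\<psi> h z)"
          unfolding y(2) psi[OF y(1)] psi[OF inv[OF h y(1)]] ..
        also have "\<dots> = compose ?Z (?\<psi> g) (?\<psi> h) z"
          unfolding compose_def using True by simp
        finally show ?thesis unfolding R .
      next
        case False
        then show ?thesis unfolding R by (simp add: compose_def)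
      qed
    qed
  qed
  then show ?thesis
    unfolding group_action_def group_hom_def group_hom_axioms_def
    using grp group_BijGroup by blast
qed

theorem property_FW_imp_on:
  fixes G :: "('g, 'm) monoid_scheme"
  assumes "property_FW G"
  shows "property_FW_on TYPE('y) G"
  unfolding property_FW_on_def
proof (intro allI impI, elim conjE)
  fix Y :: "'y set" and \<phi> M
  assume act: "group_action G Y \<phi>" and M: "M \<subseteq> Y" and com: "commensurated G \<phi> M"
  interpret A: group_action G Y \<phi> by (rule act)
  have grp: "group G" using A.group_hom by (simp add: group_hom_def)
  interpret G: group G by (rule grp)
  define D where "D = (\<lambda>g. sym_diff M (\<phi> g ` M))"
  have Dfin: "finite (D g)" if "g \<in> carrier G" for g
    using com that by (simp add: commensurated_def D_def)
  have DY: "D g \<subseteq> Y" if "g \<in> carrier G" for g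
    using M A.surj_prop[OF that] by (auto simp: D_def)
  define Y' where "Y' = {\<phi> h s | h s g. h \<in> carrier G \<and> g \<in> carrier G \<and> s \<in> D g}"
  have comp: "\<phi> (g \<otimes>\<^bsub>G\<^esub> h) y = \<phi> g (\<phi> h y)"
    if "y \<in> Y" "g \<in> carrier G" "h \<in> carrier G" for g h y
    using A.composition_rule that by blast
  have one: "\<phi> \<one>\<^bsub>G\<^esub> y = y" if "y \<in> Y" for y
    using A.id_eq_one that by (metis restrict_apply')
  have inv1: "\<phi> (inv\<^bsub>G\<^esub> g) (\<phi> g y) = y" if "y \<in> Y" "g \<in> carrier G" for g y
    using comp[of y "inv\<^bsub>G\<^esub> g" g] one that by simp
  have inv2: "\<phi> g (\<phi> (inv\<^bsub>G\<^esub> g) y) = y" if "y \<in> Y" "g \<in> carrier G" for g y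
    using comp[of y g "inv\<^bsub>G\<^esub> g"] one that by simp
  have actY: "\<phi> g y \<in> Y" if "y \<in> Y" "g \<in> carrier G" for g y
    using A.surj_prop[OF that(2)] that(1) by auto
  have Y'Y: "Y' \<subseteq> Y" using actY DY by (force simp: Y'_def)
  have inv: "\<phi> g y \<in> Y'" if g: "g \<in> carrier G" and y: "y \<in> Y'" for g y
  proof -
    obtain h s k where *: "y = \<phi> h s" "h \<in> carrier G" "k \<in> carrier G" "s \<in> D k"
      using y by (auto simp: Y'_def)
    have "\<phi> g y = \<phi> (g \<otimes>\<^bsub>G\<^esub> h) s" using comp[of s g h] DY[OF *(3)] * g by auto
    then show ?thesis unfolding Y'_def using * g by blast
  qed
  have DY': "D g \<subseteq> Y'" if "g \<in> carrier G" for g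
  proof
    fix s assume s: "s \<in> D g"
    then have "s = \<phi> \<one>\<^bsub>G\<^esub> s" using one[of s] DY[OF that] by auto
    then show "s \<in> Y'" unfolding Y'_def using s that G.one_closed by blast
  qed
  define e where "e = (\<lambda>(h, g, n). \<phi> h (from_nat_into (D g) n))"
  have "Y' \<subseteq> range e"
  proof
    fix y assume "y \<in> Y'"
    then obtain h s k where *: "y = \<phi> h s" "h \<in> carrier G" "k \<in> carrier G" "s \<in> D k"
      by (auto simp: Y'_def)
    obtain n where "from_nat_into (D k) n = s"
      using from_nat_into_surj[OF countable_finite[OF Dfin[OF *(3)]] *(4)] by blast
    then have "y = e (h, k, n)" by (simp add: e_def *)
    then show "y \<in> range e" by blast
  qed
  then have inj: "inj_on (inv_into UNIV e) Y'" by (rule inj_on_inv_into)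
  define i where "i = inv_into UNIV e"
  have i: "inj_on i Y'" using inj by (simp add: i_def)
  define Z where "Z = i ` Y'"
  define \<psi> where "\<psi> = (\<lambda>g. \<lambda>z\<in>i ` Y'. i (\<phi> g (inv_into Y' i z)))"
  have act': "group_action G Z \<psi>"
    unfolding Z_def \<psi>_def by (rule group_action_transport[OF act Y'Y inv i])
  have psi: "\<psi> g (i y) = i (\<phi> g y)" if "y \<in> Y'" for g y
    using that i by (simp add: \<psi>_def)
  have psi_im: "\<psi> g ` (i ` B) = i ` (\<phi> g ` B)" if "B \<subseteq> Y'" for g B
    unfolding image_image by (rule image_cong[OF refl]) (use psi that in blast)
  have com': "commensurated G \<psi> (i ` (M \<inter> Y'))"
    unfolding commensurated_def
  proof
    fix g assume g: "g \<in> carrier G"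
    have im: "\<psi> g ` (i ` (M \<inter> Y')) = i ` (\<phi> g ` (M \<inter> Y'))" by (rule psi_im) simp
    have sub: "M \<inter> Y' - \<phi> g ` (M \<inter> Y') \<subseteq> D g"
    proof
      fix y assume y: "y \<in> M \<inter> Y' - \<phi> g ` (M \<inter> Y')"
      have "y \<notin> \<phi> g ` M"
      proof
        assume "y \<in> \<phi> g ` M"
        then obtain m where m: "m \<in> M" "y = \<phi> g m" by auto
        then have "m = \<phi> (inv\<^bsub>G\<^esub> g) y" using inv1[of m g] g M by auto
        then have "m \<in> Y'" using inv[of "inv\<^bsub>G\<^esub> g" y] g y by auto
        then show False using y m by auto
      qed
      then show "y \<in> D g" using y by (auto simp: D_def)
    qed
    have sub2: "\<phi> g ` (M \<inter> Y') - M \<inter> Y' \<subseteq> D g"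
      using inv[OF g] by (auto simp: D_def)
    have "sym_diff (i ` (M \<inter> Y')) (\<psi> g ` (i ` (M \<inter> Y'))) \<subseteq> i ` D g"
      unfolding im using sub sub2 by blast
    then show "finite (sym_diff (i ` (M \<inter> Y')) (\<psi> g ` (i ` (M \<inter> Y'))))"
      using Dfin[OF g] finite_subset by blast
  qed
  have "i ` (M \<inter> Y') \<subseteq> Z" by (auto simp: Z_def)
  then have "transfixed G Z \<psi> (i ` (M \<inter> Y'))"
    using assms act' com' unfolding property_FW_def property_FW_on_def by blast
  then obtain N0 where N0: "N0 \<subseteq> Z" "\<And>g. g \<in> carrier G \<Longrightarrow> \<psi> g ` N0 = N0"
      "finite (sym_diff (i ` (M \<inter> Y')) N0)"
    unfolding transfixed_def by blast
  obtain N where N: "N \<subseteq> Y'" "N0 = i ` N" using N0(1) unfolding Z_def subset_image_iff by blast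
  have Ninv: "\<phi> g ` N = N" if g: "g \<in> carrier G" for g
  proof -
    have "i ` (\<phi> g ` N) = i ` N" using N0(2)[OF g] unfolding N(2) psi_im[OF N(1)] .
    moreover have "\<phi> g ` N \<subseteq> Y'" using inv[OF g] N(1) by auto
    ultimately show ?thesis using inj_on_image_eq_iff[OF i _ N(1)] by (simp only:)
  qed
  have Minv1: "\<phi> g y \<in> M - Y'" if g: "g \<in> carrier G" and y: "y \<in> M - Y'" for g y
  proof -
    have yY: "y \<in> Y" using y M by auto
    have a: "\<phi> g y \<notin> Y'" using inv[of "inv\<^bsub>G\<^esub> g" "\<phi> g y"] inv1[OF yY g] g y by auto
    have "\<phi> g y \<in> M"
    proof (rule ccontr)
      assume "\<phi> g y \<notin> M"
      then have "\<phi> g y \<in> D g" using y by (auto simp: D_def)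
      then show False using DY'[OF g] a by auto
    qed
    with a show ?thesis by simp
  qed
  have Minv: "\<phi> g ` (M - Y') = M - Y'" if g: "g \<in> carrier G" for g
  proof
    show "\<phi> g ` (M - Y') \<subseteq> M - Y'" using Minv1[OF g] by auto
    show "M - Y' \<subseteq> \<phi> g ` (M - Y')"
    proof
      fix y assume y: "y \<in> M - Y'"
      have "y = \<phi> g (\<phi> (inv\<^bsub>G\<^esub> g) y)" using inv2[of y g] y M g by auto
      moreover have "\<phi> (inv\<^bsub>G\<^esub> g) y \<in> M - Y'" using Minv1[of "inv\<^bsub>G\<^esub> g" y] y g by auto
      ultimately show "y \<in> \<phi> g ` (M - Y')" by blast
    qed
  qed
  have "i ` (sym_diff (M \<inter> Y') N) = sym_diff (i ` (M \<inter> Y')) N0"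
    unfolding N(2) image_Un
    using inj_on_image_set_diff[OF i, of "M \<inter> Y'" N] inj_on_image_set_diff[OF i, of N "M \<inter> Y'"] N(1)
    by (metis (no_types, lifting) Diff_subset inf_le2 subset_trans)
  then have "finite (i ` (sym_diff (M \<inter> Y') N))" using N0(3) by (simp only:)
  moreover have "inj_on i (sym_diff (M \<inter> Y') N)"
    by (rule inj_on_subset[OF i]) (use N(1) in auto)
  ultimately have fin: "finite (sym_diff (M \<inter> Y') N)" by (rule finite_imageD)
  show "transfixed G Y \<phi> M"
    unfolding transfixed_def
  proof (intro exI[of _ "(M - Y') \<union> N"] conjI ballI)
    show "(M - Y') \<union> N \<subseteq> Y" using M N(1) Y'Y by auto
    show "\<phi> g ` ((M - Y') \<union> N) = (M - Y') \<union> N" if "g \<in> carrier G" for g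
      using Minv[OF that] Ninv[OF that] by (simp only: image_Un)
    have "sym_diff M ((M - Y') \<union> N) \<subseteq> sym_diff (M \<inter> Y') N" using N(1) by auto
    then show "finite (sym_diff M ((M - Y') \<union> N))" using fin by (rule finite_subset)
  qed
qed

section \<open>\<open>PSL\<^sub>2(\<real>)\<close> and its Zariski topology\<close>

definition SL2 :: "(real^2^2) monoid" where
  "SL2 = \<lparr>carrier = {A. det A = 1}, mult = (**), one = mat 1\<rparr>"

definition PSL2 :: "(real^2^2) set monoid" where
  "PSL2 = SL2 Mod {mat 1, - mat 1}"

lemma group_SL2: "group SL2"
proof (rule groupI)
  fix A assume A: "A \<in> carrier SL2"
  then have "det A \<noteq> 0" by (simp add: SL2_def)
  then have "invertible A" by (simp add: invertible_det_nz)
  then obtain B where B: "A ** B = mat 1" "B ** A = mat 1" by (auto simp: invertible_def)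
  have "det B * det A = 1" using B(2) by (metis det_mul det_I)
  then have "det B = 1" using A by (simp add: SL2_def)
  with B show "\<exists>B\<in>carrier SL2. B \<otimes>\<^bsub>SL2\<^esub> A = \<one>\<^bsub>SL2\<^esub>" by (auto simp: SL2_def)
qed (auto simp: SL2_def det_mul matrix_mul_assoc)

lemma matrix_minus_mult: "- A ** B = - (A ** B)" "A ** - B = - (A ** B)"
  for A B :: "real^2^2"
  by (auto simp: matrix_matrix_mult_def vec_eq_iff sum_negf)

lemma normal_center_SL2: "{mat 1, - mat 1} \<lhd> SL2"
proof -
  interpret group SL2 by (rule group_SL2)
  have neg: "- mat 1 \<in> carrier SL2" by (simp add: SL2_def det_2 mat_def)
  have sub: "subgroup {mat 1, - mat 1} SL2"
  proof (rule subgroupI)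
    show "{mat 1, - mat 1} \<subseteq> carrier SL2" using neg by (auto simp: SL2_def)
    show "a \<otimes>\<^bsub>SL2\<^esub> b \<in> {mat 1, - mat 1}" if "a \<in> {mat 1, - mat 1}" "b \<in> {mat 1, - mat 1}" for a b
      using that by (auto simp: SL2_def matrix_minus_mult)
    have "inv\<^bsub>SL2\<^esub> (- mat 1) = - mat 1"
      using neg by (intro inv_equality) (auto simp: SL2_def matrix_minus_mult)
    moreover have "inv\<^bsub>SL2\<^esub> (mat 1) = mat 1" using inv_one by (simp add: SL2_def)
    ultimately show "inv\<^bsub>SL2\<^esub> a \<in> {mat 1, - mat 1}" if "a \<in> {mat 1, - mat 1}" for a
      using that by auto
  qed auto
  show ?thesis
  proof (rule normalI[OF sub], rule ballI)
    show "{mat 1, - mat 1} #>\<^bsub>SL2\<^esub> x = x <#\<^bsub>SL2\<^esub> {mat 1, - mat 1}" if "x \<in> carrier SL2" for x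
      by (auto simp: r_coset_def l_coset_def SL2_def matrix_minus_mult)
  qed
qed

lemma group_PSL2: "group PSL2"
  unfolding PSL2_def using normal.factorgroup_is_group[OF normal_center_SL2] .

text \<open>
  The elements of \<open>PSL2\<close> are the cosets \<open>{A, -A}\<close>, so \<open>\<Union>C\<close> is the preimage of \<open>C\<close> in
  \<open>SL2\<close>. Closed sets are those whose preimage is the zero locus of a set of polynomials in
  the four matrix entries. By splitting polynomials into even and odd parts (and squaring the
  odd ones), these are the zero loci in \<open>PSL2\<close> of even polynomials, i.e. of regular functions
  on the algebraic group \<open>PSL2 = SL2/{1, -1}\<close>.
\<close>

definition zariski_closed_PSL2 :: "(real^2^2) set set \<Rightarrow> bool" where
  "zariski_closed_PSL2 C \<longleftrightarrow> C \<subseteq> carrier PSL2 \<and>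
     (\<exists>P. (\<forall>p\<in>P. real_polynomial_function p) \<and>
          \<Union>C = {A \<in> carrier SL2. \<forall>p\<in>P. p A = 0})"

definition zariski_dense_PSL2 :: "(real^2^2) set set \<Rightarrow> bool" where
  "zariski_dense_PSL2 S \<longleftrightarrow> S \<subseteq> carrier PSL2 \<and>
     (\<forall>C. zariski_closed_PSL2 C \<and> S \<subseteq> C \<longrightarrow> C = carrier PSL2)"

section \<open>Free groups\<close>

text \<open>The letter \<open>(x, True)\<close> stands for \<open>x\<close>, and \<open>(x, False)\<close> for its inverse.\<close>

definition word_value :: "('g, 'm) monoid_scheme \<Rightarrow> ('g \<times> bool) list \<Rightarrow> 'g" where
  "word_value G w =
     foldr (\<lambda>(x, e) y. (if e then x else inv\<^bsub>G\<^esub> x) \<otimes>\<^bsub>G\<^esub> y) w \<one>\<^bsub>G\<^esub>"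

definition reduced_word :: "('g \<times> bool) list \<Rightarrow> bool" where
  "reduced_word w \<longleftrightarrow> successively (\<lambda>(x, e) (y, e'). \<not> (x = y \<and> e \<noteq> e')) w"

definition free_generating_set :: "('g, 'm) monoid_scheme \<Rightarrow> 'g set \<Rightarrow> bool" where
  "free_generating_set G S \<longleftrightarrow> S \<subseteq> carrier G \<and> generate G S = carrier G \<and>
     (\<forall>w. w \<noteq> [] \<and> fst ` set w \<subseteq> S \<and> reduced_word w \<longrightarrow> word_value G w \<noteq> \<one>\<^bsub>G\<^esub>)"

definition free_group :: "('g, 'm) monoid_scheme \<Rightarrow> bool" where
  "free_group G \<longleftrightarrow> group G \<and> (\<exists>S. free_generating_set G S)"

end

theory Submission
  imports Defs
begin

text \<open>
  Let \<open>\<Gamma>\<close> act on the set of all two-sided projective germs, i.e. pairs of a left and a right germ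
  of a projective map into the circle, up to orientation-preserving projective reparametrisation.
  The germs that come from a single projective map form a subset that is commensurated, since an
  element of \<open>\<Gamma>\<close> has finitely many singularities. Transfixing it yields a \<open>\<Gamma>\<close>-invariant set of
  germs, that is, another way of regluing the circle at finitely many points which gives a closed
  projective curve with finitely many connected components, on which \<open>\<Gamma>\<close> acts by projective
  homeomorphisms. Each component is developed along an open interval \<open>U\<close> of the universal cover
  \<open>\<real>\<close> of the projective line, and the stabiliser of the component acts on \<open>U\<close> by lifts of projective
  maps, modulo the deck group.

  If \<open>U\<close> has an end point, it is fixed and the action is metabelian. If \<open>U = \<real>\<close>, the deck group has
  a least positive element \<open>T\<close>, which is centralised. Either \<open>T\<close> is not a translation by a multiple
  of \<open>\<pi>\<close>, and then its centraliser is metabelian, or the action modulo \<open>T\<close> is an extension of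
  a subgroup of \<open>PSL2\<close> by a finite group. Property FW makes metabelian quotients finite; by the same
  token a subgroup of \<open>PSL2\<close> with Property FW is finite or contains a hyperbolic element
  together with one moving both its fixed points off themselves, whence Zariski density and a
  ping-pong pair.
\<close>

text \<open>At a singularity of a group element, composing a projective germ with that element gives
  a left and a right germ belonging to different projective maps; hence pairs of independent
  half-germs as the ambient set. Property FW controls the invariant set only up to finitely many
  germs, so it may contain two germs with a common half. Regluing needs each half to determine the
  other. Germs with a competitor are therefore discarded; this is an invariant operation, and it
  costs only finitely many projective germs. The circle is R/Z and not the projective line: in the
  angle \<theta> with coordinate \<open>tan \<theta>\<close>, the pole is not a point of the circle,
  and integer translations are the only ambiguity when maps into the circle are lifted. The standard
  circle itself develops along the bounded interval \<open>BB\<close>, so end points of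
  \<open>U\<close> occur even without regluing. Since \<Gamma> may be uncountable, finiteness of
  abelian groups with Property FW is needed in every cardinality.\<close>

section \<open>Property FW for actions given by plain functions\<close>

lemma property_FW_D:
  fixes G :: "('g, 'm) monoid_scheme" and act :: "'g \<Rightarrow> 'y \<Rightarrow> 'y"
  assumes FW: "property_FW G" and grp: "group G"
    and cl: "\<And>g y. g \<in> carrier G \<Longrightarrow> y \<in> Y \<Longrightarrow> act g y \<in> Y"
    and one: "\<And>y. y \<in> Y \<Longrightarrow> act \<one>\<^bsub>G\<^esub> y = y"
    and mult: "\<And>g h y. g \<in> carrier G \<Longrightarrow> h \<in> carrier G \<Longrightarrow> y \<in> Y
      \<Longrightarrow> act (g \<otimes>\<^bsub>G\<^esub> h) y = act g (act h y)"
    and M: "M \<subseteq> Y" and com: "\<And>g. g \<in> carrier G \<Longrightarrow> finite (act g ` M - M)"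
  shows "\<exists>M0\<subseteq>Y. (\<forall>g\<in>carrier G. \<forall>y\<in>M0. act g y \<in> M0) \<and> finite (sym_diff M M0)"
proof -
  interpret group G by (rule grp)
  \<comment> \<open>Elements of \<open>BijGroup Y\<close> are undefined outside \<open>Y\<close>;
    restricting \<open>act\<close> supplies this convention.\<close>
  define \<phi> where "\<phi> = (\<lambda>g. \<lambda>y\<in>Y. act g y)"
  have inv1: "act (inv\<^bsub>G\<^esub> g) (act g y) = y" if "g \<in> carrier G" "y \<in> Y" for g y
    using mult[of "inv\<^bsub>G\<^esub> g" g y] one that by simp
  have inv2: "act g (act (inv\<^bsub>G\<^esub> g) y) = y" if "g \<in> carrier G" "y \<in> Y" for g y
    using mult[of g "inv\<^bsub>G\<^esub> g" y] one that by simp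
  have bij: "\<phi> g \<in> Bij Y" if g: "g \<in> carrier G" for g
  proof -
    have "bij_betw (\<phi> g) Y Y"
      by (rule bij_betw_byWitness[where f' = "\<phi> (inv\<^bsub>G\<^esub> g)"])
         (use inv1 inv2 cl g in \<open>auto simp: \<phi>_def\<close>)
    then show ?thesis by (simp add: Bij_def \<phi>_def)
  qed
  have "\<phi> \<in> hom G (BijGroup Y)"
  proof (rule homI)
    show "\<phi> g \<in> carrier (BijGroup Y)" if "g \<in> carrier G" for g
      using bij that by (simp add: BijGroup_def)
    show "\<phi> (g \<otimes>\<^bsub>G\<^esub> h) = \<phi> g \<otimes>\<^bsub>BijGroup Y\<^esub> \<phi> h" if "g \<in> carrier G" "h \<in> carrier G" for g h
      using bij that by (auto simp: BijGroup_def \<phi>_def compose_def mult cl fun_eq_iff restrict_def)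
  qed
  then have ga: "group_action G Y \<phi>"
    unfolding group_action_def group_hom_def group_hom_axioms_def
    using grp group_BijGroup by blast
  have "commensurated G \<phi> M"
    unfolding commensurated_def
  proof
    fix g assume g: "g \<in> carrier G"
    have im: "\<phi> h ` A = act h ` A" if "A \<subseteq> Y" for h A
      using that by (auto simp: \<phi>_def image_iff subset_iff) 
    \<comment> \<open>The second half of the symmetric difference is the translate by
      \<open>g\<close> of the first half for the inverse of \<open>g\<close>, so finiteness of the
      first halves suffices.\<close>
    have "M - act g ` M \<subseteq> act g ` (act (inv\<^bsub>G\<^esub> g) ` M - M)"
    proof
      fix y assume y: "y \<in> M - act g ` M"
      then have "y = act g (act (inv\<^bsub>G\<^esub> g) y)" using inv2[OF g] M by auto
      moreover have "act (inv\<^bsub>G\<^esub> g) y \<notin> M" using y calculation by (metis DiffD2 imageI)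
      ultimately show "y \<in> act g ` (act (inv\<^bsub>G\<^esub> g) ` M - M)" using y by blast
    qed
    then have "finite (M - act g ` M)"
      using com[of "inv\<^bsub>G\<^esub> g"] g by (meson finite_imageI finite_subset inv_closed)
    then show "finite (sym_diff M (\<phi> g ` M))" using com[OF g] im[OF M] by simp
  qed
  then have "transfixed G Y \<phi> M"
    using property_FW_imp_on[OF FW] ga M unfolding property_FW_on_def by blast
  then obtain M0 where M0: "M0 \<subseteq> Y" "\<forall>g\<in>carrier G. \<phi> g ` M0 = M0" "finite (sym_diff M M0)"
    unfolding transfixed_def by blast
  have "act g y \<in> M0" if "g \<in> carrier G" "y \<in> M0" for g y
  proof -
    have "\<phi> g y \<in> M0" using M0(2) that by blast
    then show ?thesis using that M0(1) by (auto simp: \<phi>_def)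
  qed
  then show ?thesis using M0 by blast
qed

text \<open>Counterpart of \<open>property_FW_D\<close> for establishing the property, over the one
  type fixed in its definition. Inclusion \<open>act g y \<in> M0\<close> for every \<open>g\<close>
  already yields equality of \<open>M0\<close> with its translates, by applying it to
  inverses.\<close>

lemma property_FW_I:
  fixes G :: "('g, 'm) monoid_scheme"
  assumes ex: "\<And>(Y :: ('g \<times> 'g \<times> nat) set) act M.
     \<lbrakk>\<And>g y. g \<in> carrier G \<Longrightarrow> y \<in> Y \<Longrightarrow> act g y \<in> Y;
      \<And>y. y \<in> Y \<Longrightarrow> act \<one>\<^bsub>G\<^esub> y = y;
      \<And>g h y. g \<in> carrier G \<Longrightarrow> h \<in> carrier G \<Longrightarrow> y \<in> Y
        \<Longrightarrow> act (g \<otimes>\<^bsub>G\<^esub> h) y = act g (act h y);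
      M \<subseteq> Y; \<And>g. g \<in> carrier G \<Longrightarrow> finite (act g ` M - M)\<rbrakk>
     \<Longrightarrow> \<exists>M0\<subseteq>Y. (\<forall>g\<in>carrier G. \<forall>y\<in>M0. act g y \<in> M0) \<and> finite (sym_diff M M0)"
  shows "property_FW G"
  unfolding property_FW_def property_FW_on_def
proof (intro allI impI, elim conjE)
  fix Y :: "('g \<times> 'g \<times> nat) set" and \<phi> M
  assume act: "group_action G Y \<phi>" and M: "M \<subseteq> Y" and com: "commensurated G \<phi> M"
  interpret A: group_action G Y \<phi> by (rule act)
  interpret group G using A.group_hom by (simp add: group_hom_def)
  have comp: "\<phi> (g \<otimes>\<^bsub>G\<^esub> h) y = \<phi> g (\<phi> h y)"
    if "g \<in> carrier G" "h \<in> carrier G" "y \<in> Y" for g h y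
    using A.composition_rule that by blast
  have one: "\<phi> \<one>\<^bsub>G\<^esub> y = y" if "y \<in> Y" for y
    using A.id_eq_one that by (metis restrict_apply')
  have cl: "\<phi> g y \<in> Y" if "g \<in> carrier G" "y \<in> Y" for g y
    using A.surj_prop[OF that(1)] that(2) by auto
  have fin: "finite (\<phi> g ` M - M)" if "g \<in> carrier G" for g
    using com that by (auto simp: commensurated_def)
  obtain M0 where M0: "M0 \<subseteq> Y" "\<And>g y. g \<in> carrier G \<Longrightarrow> y \<in> M0 \<Longrightarrow> \<phi> g y \<in> M0"
      "finite (sym_diff M M0)"
    using ex[of Y \<phi> M, OF cl one comp M fin] by blast
  have "\<phi> g ` M0 = M0" if g: "g \<in> carrier G" for g
  proof
    show "\<phi> g ` M0 \<subseteq> M0" using M0(2) g by blast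
    show "M0 \<subseteq> \<phi> g ` M0"
    proof
      fix y assume y: "y \<in> M0"
      have "y = \<phi> g (\<phi> (inv\<^bsub>G\<^esub> g) y)"
        using comp[of g "inv\<^bsub>G\<^esub> g" y] one[of y] y M0(1) g by auto
      then show "y \<in> \<phi> g ` M0" using M0(2)[of "inv\<^bsub>G\<^esub> g" y] y g by auto
    qed
  qed
  then show "transfixed G Y \<phi> M"
    unfolding transfixed_def using M0 by blast
qed

lemma property_FW_surj_image:
  assumes FW: "property_FW G" and grp: "group G" and hom: "h \<in> hom G K" and grpK: "group K"
    and surj: "h ` carrier G = carrier K"
  shows "property_FW K"
proof (rule property_FW_I)
  fix Y act M
  assume A: "\<And>g y. g \<in> carrier K \<Longrightarrow> y \<in> Y \<Longrightarrow> act g y \<in> Y"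
      "\<And>y. y \<in> Y \<Longrightarrow> act \<one>\<^bsub>K\<^esub> y = y"
      "\<And>g h y. g \<in> carrier K \<Longrightarrow> h \<in> carrier K \<Longrightarrow> y \<in> Y
        \<Longrightarrow> act (g \<otimes>\<^bsub>K\<^esub> h) y = act g (act h y)"
      "M \<subseteq> Y" "\<And>g. g \<in> carrier K \<Longrightarrow> finite (act g ` M - M)"
  have hc: "h g \<in> carrier K" if "g \<in> carrier G" for g using hom that by (auto simp: hom_def)
  have "\<exists>M0\<subseteq>Y. (\<forall>g\<in>carrier G. \<forall>y\<in>M0. act (h g) y \<in> M0) \<and> finite (sym_diff M M0)"
  proof (rule property_FW_D[OF FW grp, of Y "\<lambda>g. act (h g)" M])
    show "act (h \<one>\<^bsub>G\<^esub>) y = y" if "y \<in> Y" for y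
      using A(2) that hom_one[OF hom grp grpK] by simp
    show "act (h (x \<otimes>\<^bsub>G\<^esub> y)) z = act (h x) (act (h y) z)"
      if "x \<in> carrier G" "y \<in> carrier G" "z \<in> Y" for x y z
      using A(3) hom_mult[OF hom] hc that by simp
  qed (use A hc in auto)
  then show "\<exists>M0\<subseteq>Y. (\<forall>g\<in>carrier K. \<forall>y\<in>M0. act g y \<in> M0) \<and> finite (sym_diff M M0)"
    using surj by (metis (no_types, lifting) imageE)
qed

subsection \<open>Finite index\<close>

context group
begin

lemma inv_cancel_left:
  assumes "x \<in> carrier G" "y \<in> carrier G"
  shows "inv x \<otimes> (x \<otimes> y) = y" "x \<otimes> (inv x \<otimes> y) = y"
  using assms by (simp_all flip: m_assoc)

abbreviation FW :: "'a set \<Rightarrow> bool" where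
  "FW H \<equiv> property_FW (G\<lparr>carrier := H\<rparr>)"

text \<open>A finite colouring in which equal colours force equal left cosets. In this form the
  notion makes sense for arbitrary sets, and intersections and chains are handled by combining
  colours. The colours lie in \<open>'a set\<close> because a definition cannot hide a type
  variable; \<open>fin_indexI\<close> accepts any type of colours by replacing a colour with its
  fibre.\<close>

definition fin_index :: "'a set \<Rightarrow> 'a set \<Rightarrow> bool" where
  "fin_index H K \<longleftrightarrow> (\<exists>\<phi> :: 'a \<Rightarrow> 'a set. finite (\<phi> ` H) \<and>
     (\<forall>x\<in>H. \<forall>y\<in>H. \<phi> x = \<phi> y \<longrightarrow> inv x \<otimes> y \<in> K))"

lemma fin_indexI:
  fixes \<phi> :: "'a \<Rightarrow> 'v"
  assumes fin: "finite (\<phi> ` H)" and H: "H \<subseteq> carrier G"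
    and *: "\<And>x y. x \<in> H \<Longrightarrow> y \<in> H \<Longrightarrow> \<phi> x = \<phi> y \<Longrightarrow> inv x \<otimes> y \<in> K"
  shows "fin_index H K"
proof -
  define \<psi> where "\<psi> = (\<lambda>x. {y \<in> H. \<phi> y = \<phi> x})"
  have "\<psi> ` H = (\<lambda>v. {y \<in> H. \<phi> y = v}) ` (\<phi> ` H)" by (auto simp: \<psi>_def)
  then have "finite (\<psi> ` H)" using fin by simp
  moreover have "inv x \<otimes> y \<in> K" if "x \<in> H" "y \<in> H" "\<psi> x = \<psi> y" for x y
    using that * by (auto simp: \<psi>_def)
  ultimately show ?thesis unfolding fin_index_def by blast
qed

lemma fin_index_trans:
  assumes H: "H \<subseteq> carrier G" and K: "subgroup K G" "K \<subseteq> H"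
    and HK: "fin_index H K" and KL: "fin_index K L"
  shows "fin_index H L"
proof -
  obtain \<phi> :: "'a \<Rightarrow> 'a set" where \<phi>: "finite (\<phi> ` H)"
      "\<And>x y. x \<in> H \<Longrightarrow> y \<in> H \<Longrightarrow> \<phi> x = \<phi> y \<Longrightarrow> inv x \<otimes> y \<in> K"
    using HK unfolding fin_index_def by blast
  obtain \<psi> :: "'a \<Rightarrow> 'a set" where \<psi>: "finite (\<psi> ` K)"
      "\<And>x y. x \<in> K \<Longrightarrow> y \<in> K \<Longrightarrow> \<psi> x = \<psi> y \<Longrightarrow> inv x \<otimes> y \<in> L"
    using KL unfolding fin_index_def by blast
  \<comment> \<open>\<open>r x\<close> depends only on the colour of \<open>x\<close>, so after
    equality of the first colours both quotients \<open>inv (r x) \<otimes> x\<close> are taken with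
    the same representative.\<close>
  define r where "r = (\<lambda>x. SOME z. z \<in> H \<and> \<phi> z = \<phi> x)"
  have r: "r x \<in> H" "\<phi> (r x) = \<phi> x" if "x \<in> H" for x
    using someI[of "\<lambda>z. z \<in> H \<and> \<phi> z = \<phi> x" x] that by (auto simp: r_def)
  have rK: "inv (r x) \<otimes> x \<in> K" if "x \<in> H" for x using \<phi>(2) r that by blast
  show ?thesis
  proof (rule fin_indexI[of "\<lambda>x. (\<phi> x, \<psi> (inv (r x) \<otimes> x))"])
    have "(\<lambda>x. (\<phi> x, \<psi> (inv (r x) \<otimes> x))) ` H \<subseteq> \<phi> ` H \<times> \<psi> ` K" using rK by auto
    then show "finite ((\<lambda>x. (\<phi> x, \<psi> (inv (r x) \<otimes> x))) ` H)"
      using \<phi>(1) \<psi>(1) finite_subset by blast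
    fix x y assume x: "x \<in> H" and y: "y \<in> H"
      and eq: "(\<phi> x, \<psi> (inv (r x) \<otimes> x)) = (\<phi> y, \<psi> (inv (r y) \<otimes> y))"
    have rr: "r x = r y" using eq by (simp add: r_def)
    have c: "x \<in> carrier G" "y \<in> carrier G" "r y \<in> carrier G" using x y r H by auto
    have "inv (inv (r y) \<otimes> x) \<otimes> (inv (r y) \<otimes> y) \<in> L"
      using \<psi>(2)[OF rK[OF x] rK[OF y]] eq rr by simp
    moreover have "inv (inv (r y) \<otimes> x) \<otimes> (inv (r y) \<otimes> y) = inv x \<otimes> y"
      using c by (simp add: inv_mult_group m_assoc inv_cancel_left)
    ultimately show "inv x \<otimes> y \<in> L" by simp
  qed (rule H)
qed

lemma fin_index_mono:
  assumes "fin_index H K" "H' \<subseteq> H" "K \<subseteq> K'"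
  shows "fin_index H' K'"
  using assms unfolding fin_index_def by (meson finite_subset image_mono subsetD)

lemma fin_index_INT:
  assumes "finite I" "H \<subseteq> carrier G" "\<And>i. i \<in> I \<Longrightarrow> fin_index H (K i)"
  shows "fin_index H (H' \<inter> (\<Inter>i\<in>I. K i)) \<longleftrightarrow> fin_index H H'"
proof
  assume "fin_index H H'"
  then obtain \<phi>0 :: "'a \<Rightarrow> 'a set" where \<phi>0: "finite (\<phi>0 ` H)"
      "\<And>x y. x \<in> H \<Longrightarrow> y \<in> H \<Longrightarrow> \<phi>0 x = \<phi>0 y \<Longrightarrow> inv x \<otimes> y \<in> H'"
    unfolding fin_index_def by blast
  have "\<forall>i\<in>I. \<exists>\<phi> :: 'a \<Rightarrow> 'a set. finite (\<phi> ` H) \<and> (\<forall>x\<in>H. \<forall>y\<in>H. \<phi> x = \<phi> y \<longrightarrow> inv x \<otimes> y \<in> K i)"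
    using assms(3) unfolding fin_index_def by blast
  then obtain \<phi> :: "_ \<Rightarrow> 'a \<Rightarrow> 'a set" where \<phi>: "\<And>i. i \<in> I \<Longrightarrow> finite (\<phi> i ` H)"
     "\<And>i x y. i \<in> I \<Longrightarrow> x \<in> H \<Longrightarrow> y \<in> H \<Longrightarrow> \<phi> i x = \<phi> i y \<Longrightarrow> inv x \<otimes> y \<in> K i"
    by metis
  show "fin_index H (H' \<inter> (\<Inter>i\<in>I. K i))"
  proof (rule fin_indexI[of "\<lambda>x. (\<phi>0 x, \<lambda>i\<in>I. \<phi> i x)"])
    have "(\<lambda>x. (\<phi>0 x, \<lambda>i\<in>I. \<phi> i x)) ` H \<subseteq> \<phi>0 ` H \<times> (\<Pi>\<^sub>E i\<in>I. \<phi> i ` H)" by auto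
    moreover have "finite (\<phi>0 ` H \<times> (\<Pi>\<^sub>E i\<in>I. \<phi> i ` H))"
      using \<phi>0(1) \<phi>(1) assms(1) by (intro finite_cartesian_product finite_PiE) auto
    ultimately show "finite ((\<lambda>x. (\<phi>0 x, \<lambda>i\<in>I. \<phi> i x)) ` H)" using finite_subset by blast
    show "inv x \<otimes> y \<in> H' \<inter> (\<Inter>i\<in>I. K i)"
      if "x \<in> H" "y \<in> H" "(\<phi>0 x, \<lambda>i\<in>I. \<phi> i x) = (\<phi>0 y, \<lambda>i\<in>I. \<phi> i y)" for x y
    proof -
      have "\<phi> i x = \<phi> i y" if "i \<in> I" for i
        using \<open>(\<phi>0 x, \<lambda>i\<in>I. \<phi> i x) = (\<phi>0 y, \<lambda>i\<in>I. \<phi> i y)\<close> that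
        by (metis (mono_tags, lifting) restrict_apply' prod.inject)
      then show ?thesis using that \<phi>0(2) \<phi>(2) by auto
    qed
  qed (rule assms(2))
next
  assume "fin_index H (H' \<inter> (\<Inter>i\<in>I. K i))"
  then show "fin_index H H'" by (rule fin_index_mono) auto
qed

text \<open>By induction of actions: an action of \<open>K\<close> on \<open>Y\<close> induces one
  of \<open>H\<close> on \<open>T \<times> Y\<close>, with \<open>T\<close> a transversal of the
  left cosets. The set \<open>T \<times> M\<close> is commensurated because \<open>T\<close> is
  finite, and the fibre of the resulting invariant set over the trivial coset is the set
  sought.\<close>

lemma property_FW_fin_index:
  assumes H: "subgroup H G" and K: "subgroup K G" "K \<subseteq> H" and fi: "fin_index H K"
    and FW: "FW H"
  shows "FW K"
proof (rule property_FW_I)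
  fix Y :: "('a \<times> 'a \<times> nat) set" and act M
  assume "\<And>g y. g \<in> carrier (G\<lparr>carrier := K\<rparr>) \<Longrightarrow> y \<in> Y \<Longrightarrow> act g y \<in> Y"
      "\<And>y. y \<in> Y \<Longrightarrow> act \<one>\<^bsub>G\<lparr>carrier := K\<rparr>\<^esub> y = y"
      "\<And>g h y. g \<in> carrier (G\<lparr>carrier := K\<rparr>) \<Longrightarrow> h \<in> carrier (G\<lparr>carrier := K\<rparr>) \<Longrightarrow> y \<in> Y
        \<Longrightarrow> act (g \<otimes>\<^bsub>G\<lparr>carrier := K\<rparr>\<^esub> h) y = act g (act h y)"
      and M: "M \<subseteq> Y" and "\<And>g. g \<in> carrier (G\<lparr>carrier := K\<rparr>) \<Longrightarrow> finite (act g ` M - M)"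
  then have A: "\<And>g y. g \<in> K \<Longrightarrow> y \<in> Y \<Longrightarrow> act g y \<in> Y"
      "\<And>y. y \<in> Y \<Longrightarrow> act \<one> y = y"
      "\<And>g h y. g \<in> K \<Longrightarrow> h \<in> K \<Longrightarrow> y \<in> Y \<Longrightarrow> act (g \<otimes> h) y = act g (act h y)"
      "\<And>g. g \<in> K \<Longrightarrow> finite (act g ` M - M)" by auto
  have Hc: "\<And>h. h \<in> H \<Longrightarrow> h \<in> carrier G" using subgroup.subset[OF H] by blast
  have Kc: "\<And>h. h \<in> K \<Longrightarrow> h \<in> carrier G" using subgroup.subset[OF K(1)] by blast
  note Hs = subgroup.m_closed[OF H] subgroup.m_inv_closed[OF H] subgroup.one_closed[OF H]
  note Ks = subgroup.m_closed[OF K(1)] subgroup.m_inv_closed[OF K(1)] subgroup.one_closed[OF K(1)]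
  obtain \<phi> :: "'a \<Rightarrow> 'a set" where \<phi>: "finite (\<phi> ` H)"
      "\<And>x y. x \<in> H \<Longrightarrow> y \<in> H \<Longrightarrow> \<phi> x = \<phi> y \<Longrightarrow> inv x \<otimes> y \<in> K"
    using fi unfolding fin_index_def by blast
  define cs where "cs = (\<lambda>x. {z \<in> H. inv x \<otimes> z \<in> K})"
  define s where "s = (\<lambda>x. SOME z. z \<in> cs x)"
  have s: "s x \<in> H" "inv x \<otimes> s x \<in> K" "inv (s x) \<otimes> x \<in> K" if x: "x \<in> H" for x
  proof -
    have "x \<in> cs x" using x Hc Ks by (simp add: cs_def)
    then have "s x \<in> cs x" unfolding s_def by (rule someI)
    then show "s x \<in> H" "inv x \<otimes> s x \<in> K" by (auto simp: cs_def)
    moreover have "inv (s x) \<otimes> x = inv (inv x \<otimes> s x)"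
      using calculation x Hc by (simp add: inv_mult_group)
    ultimately show "inv (s x) \<otimes> x \<in> K" using Ks by simp
  qed
  have cseq: "cs x = cs y" if x: "x \<in> H" and y: "y \<in> H" and xy: "inv x \<otimes> y \<in> K" for x y
  proof -
    have "inv y \<otimes> z \<in> K \<longleftrightarrow> inv x \<otimes> z \<in> K" if z: "z \<in> H" for z
    proof
      assume "inv y \<otimes> z \<in> K"
      then have "(inv x \<otimes> y) \<otimes> (inv y \<otimes> z) \<in> K" using xy Ks by blast
      moreover have "(inv x \<otimes> y) \<otimes> (inv y \<otimes> z) = inv x \<otimes> z"
        using x y z Hc by (simp add: m_assoc inv_cancel_left)
      ultimately show "inv x \<otimes> z \<in> K" by simp
    next
      assume "inv x \<otimes> z \<in> K"
      then have "inv (inv x \<otimes> y) \<otimes> (inv x \<otimes> z) \<in> K" using xy Ks by blast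
      moreover have "inv (inv x \<otimes> y) \<otimes> (inv x \<otimes> z) = inv y \<otimes> z"
        using x y z Hc by (simp add: inv_mult_group m_assoc inv_cancel_left)
      ultimately show "inv y \<otimes> z \<in> K" by simp
    qed
    then show ?thesis by (auto simp: cs_def)
  qed
  have seq: "s x = s y" if "x \<in> H" "y \<in> H" "inv x \<otimes> y \<in> K" for x y
    using cseq[OF that] by (simp add: s_def)
  define T where "T = s ` H"
  have "T \<subseteq> (\<lambda>v. s (SOME x. x \<in> H \<and> \<phi> x = v)) ` (\<phi> ` H)"
  proof
    fix t assume "t \<in> T"
    then obtain x where x: "x \<in> H" "t = s x" by (auto simp: T_def)
    define x' where "x' = (SOME z. z \<in> H \<and> \<phi> z = \<phi> x)"
    have "x' \<in> H" "\<phi> x' = \<phi> x"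
      using someI[of "\<lambda>z. z \<in> H \<and> \<phi> z = \<phi> x" x] x by (auto simp: x'_def)
    then have "s x' = s x" using seq \<phi>(2) x by blast
    then show "t \<in> (\<lambda>v. s (SOME x. x \<in> H \<and> \<phi> x = v)) ` (\<phi> ` H)"
      by (intro image_eqI[of _ _ "\<phi> x"] imageI) (use x in \<open>simp_all add: x'_def\<close>)
  qed
  then have Tfin: "finite T" using \<phi>(1) finite_subset by blast
  have TH: "t \<in> H" if "t \<in> T" for t using that s by (auto simp: T_def)
  have sT: "s t = t" if "t \<in> T" for t
    using that by (metis (no_types, lifting) T_def imageE s(1) s(3) seq)
  \<comment> \<open>The cocycle of the transversal: \<open>h \<otimes> t\<close> is its
    representative times \<open>k h t\<close>.\<close>
  define k where "k = (\<lambda>h t. inv (s (h \<otimes> t)) \<otimes> (h \<otimes> t))"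
  have kK: "k h t \<in> K" if "h \<in> H" "t \<in> T" for h t
    unfolding k_def by (rule s(3)[OF Hs(1)[OF that(1) TH[OF that(2)]]])
  define act' where "act' = (\<lambda>h (t, y). (s (h \<otimes> t), act (k h t) y))"
  have sT': "s (h \<otimes> t) \<in> T" if "h \<in> H" "t \<in> T" for h t using that TH Hs by (auto simp: T_def)
  have grpH: "group (G\<lparr>carrier := H\<rparr>)" using H by (rule subgroup_imp_group)
  have "\<exists>N\<subseteq>T \<times> Y. (\<forall>g\<in>carrier (G\<lparr>carrier := H\<rparr>). \<forall>y\<in>N. act' g y \<in> N)
      \<and> finite (sym_diff (T \<times> M) N)"
  proof (rule property_FW_D[OF FW grpH, of "T \<times> Y" act' "T \<times> M"])
    show "act' g y \<in> T \<times> Y" if "g \<in> carrier (G\<lparr>carrier := H\<rparr>)" "y \<in> T \<times> Y" for g y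
      using that A(1) kK sT' by (auto simp: act'_def)
    show "act' \<one>\<^bsub>G\<lparr>carrier := H\<rparr>\<^esub> y = y" if "y \<in> T \<times> Y" for y
      using that sT TH Hc A(2) by (auto simp: act'_def k_def)
    show "act' (g \<otimes>\<^bsub>G\<lparr>carrier := H\<rparr>\<^esub> h) y = act' g (act' h y)"
      if gh: "g \<in> carrier (G\<lparr>carrier := H\<rparr>)" "h \<in> carrier (G\<lparr>carrier := H\<rparr>)" and y: "y \<in> T \<times> Y" for g h y
    proof -
      obtain t z where tz: "y = (t, z)" "t \<in> T" "z \<in> Y" using y by auto
      have g: "g \<in> H" and h: "h \<in> H" using gh by auto
      have c: "g \<in> carrier G" "h \<in> carrier G" "t \<in> carrier G" "s (h \<otimes> t) \<in> carrier G"
        using g h tz TH sT' Hc by auto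
      have ht: "h \<otimes> t \<in> H" "g \<otimes> (h \<otimes> t) \<in> H" "g \<otimes> s (h \<otimes> t) \<in> H"
        using g h tz(2) TH Hs s by auto
      have "inv (g \<otimes> (h \<otimes> t)) \<otimes> (g \<otimes> s (h \<otimes> t)) = inv (h \<otimes> t) \<otimes> s (h \<otimes> t)"
        using c by (simp add: inv_mult_group m_assoc inv_cancel_left)
      then have e1: "s (g \<otimes> (h \<otimes> t)) = s (g \<otimes> s (h \<otimes> t))"
        using seq[OF ht(2,3)] s(2)[OF ht(1)] by simp
      have c': "s (g \<otimes> s (h \<otimes> t)) \<in> carrier G" using s(1)[OF ht(3)] Hc by blast
      have "k g (s (h \<otimes> t)) \<otimes> k h t = k (g \<otimes> h) t"
        using c c' by (simp add: k_def m_assoc e1 inv_cancel_left)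
      then show ?thesis
        using tz A(3)[OF kK[OF g sT'[OF h tz(2)]] kK[OF h tz(2)] tz(3)] c e1
        by (simp add: act'_def m_assoc)
    qed
    show "T \<times> M \<subseteq> T \<times> Y" using M by auto
    show "finite (act' g ` (T \<times> M) - T \<times> M)" if "g \<in> carrier (G\<lparr>carrier := H\<rparr>)" for g
    proof (rule finite_subset)
      show "act' g ` (T \<times> M) - T \<times> M \<subseteq> (\<Union>t\<in>T. {s (g \<otimes> t)} \<times> (act (k g t) ` M - M))"
        using sT' that by (auto simp: act'_def)
      show "finite (\<Union>t\<in>T. {s (g \<otimes> t)} \<times> (act (k g t) ` M - M))"
        using Tfin A(4) kK that by auto
    qed
  qed
  then obtain N where N: "N \<subseteq> T \<times> Y" "\<And>g y. g \<in> H \<Longrightarrow> y \<in> N \<Longrightarrow> act' g y \<in> N"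
      "finite (sym_diff (T \<times> M) N)"
    by (auto simp del: finite_Un finite_Diff2)
  \<comment> \<open>The representative of the trivial coset lies in \<open>K\<close> but may differ
    from \<open>\<one>\<close>; the action on its fibre is therefore untwisted below by conjugating
    with \<open>t\<close>.\<close>
  define t where "t = s \<one>"
  have t: "t \<in> T" "t \<in> K" "t \<in> carrier G"
    using s[of \<one>] Hs Hc by (auto simp: t_def T_def)
  define M0 where "M0 = {y \<in> Y. (t, y) \<in> N}"
  have "act g y \<in> M0" if g: "g \<in> K" and y: "y \<in> M0" for g y
  proof -
    define g' where "g' = t \<otimes> g \<otimes> inv t"
    have g': "g' \<in> K" using g t Ks by (simp add: g'_def)
    have cc: "g' \<in> carrier G" "g \<in> carrier G" using g g' Kc by auto
    have "inv (g' \<otimes> t) \<otimes> \<one> \<in> K" using g' t Ks cc by simp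
    then have "s (g' \<otimes> t) = t" unfolding t_def
      using seq[of "g' \<otimes> t" \<one>] g' t K(2) Hs by (simp add: t_def subsetD)
    moreover have "k g' t = g"
      using calculation t cc by (simp add: k_def g'_def m_assoc inv_solve_left')
    ultimately have "act' g' (t, y) = (t, act g y)" by (simp add: act'_def)
    then have "(t, act g y) \<in> N" using N(2)[of g' "(t, y)"] g' K(2) y by (auto simp: M0_def)
    then show ?thesis using N(1) by (auto simp: M0_def)
  qed
  moreover have "finite (sym_diff M M0)"
  proof (rule finite_subset)
    show "sym_diff M M0 \<subseteq> snd ` (sym_diff (T \<times> M) N)"
      using t M by (force simp: M0_def)
    show "finite (snd ` (sym_diff (T \<times> M) N))" using N(3) by simp
  qed
  moreover have "M0 \<subseteq> Y" by (auto simp: M0_def)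
  ultimately show "\<exists>M0\<subseteq>Y. (\<forall>g\<in>carrier (G\<lparr>carrier := K\<rparr>). \<forall>y\<in>M0. act g y \<in> M0) \<and> finite (sym_diff M M0)"
    by (intro exI[of _ M0]) simp
qed

text \<open>A group with Property FW is not a strictly increasing union of countably many subgroups.
  It acts on the disjoint union of its coset spaces modulo \<open>A n\<close>; the base points form
  a commensurated set, since each element fixes all but finitely many of them. An invariant set
  close to it consists, at some level \<open>n\<close>, of the base point alone, which is then fixed
  by all of \<open>H\<close>.\<close>

lemma property_FW_chain:
  fixes A :: "nat \<Rightarrow> 'a set"
  assumes H: "subgroup H G" and FW: "FW H" and A: "\<And>n. subgroup (A n) G"
    and inc: "\<And>n. A n \<subseteq> A (Suc n)" and un: "(\<Union>n. A n) = H"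
  shows "\<exists>n. A n = H"
proof -
  have mono: "A m \<subseteq> A n" if "m \<le> n" for m n using lift_Suc_mono_le[of A, OF inc that] .
  have Ac: "A n \<subseteq> carrier G" for n using A subgroup.subset by blast
  have Hc: "\<And>h. h \<in> H \<Longrightarrow> h \<in> carrier G" using subgroup.subset[OF H] by blast
  define Y where "Y = {(n, g <# A n) | n g. g \<in> H}"
  define act where "act = (\<lambda>g (n :: nat, C :: 'a set). (n, g <# C))"
  define M where "M = range (\<lambda>n. (n, A n))"
  have one: "\<one> <# A n = A n" for n using lcos_mult_one[OF Ac] .
  have MY: "M \<subseteq> Y" unfolding M_def Y_def using one subgroup.one_closed[OF H] by force
  have grpH: "group (G\<lparr>carrier := H\<rparr>)" using H by (rule subgroup_imp_group)
  have "\<exists>N\<subseteq>Y. (\<forall>g\<in>carrier (G\<lparr>carrier := H\<rparr>). \<forall>y\<in>N. act g y \<in> N) \<and> finite (sym_diff M N)"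
  proof (rule property_FW_D[OF FW grpH, of Y act M])
    show "act g y \<in> Y" if "g \<in> carrier (G\<lparr>carrier := H\<rparr>)" "y \<in> Y" for g y
    proof -
      obtain n h where h: "y = (n, h <# A n)" "h \<in> H" using \<open>y \<in> Y\<close> by (auto simp: Y_def)
      then have "act g y = (n, (g \<otimes> h) <# A n)" using lcos_m_assoc[OF Ac Hc Hc] that by (simp add: act_def)
      then show ?thesis unfolding Y_def using subgroup.m_closed[OF H, of g h] h that by auto
    qed
    show "act \<one>\<^bsub>G\<lparr>carrier := H\<rparr>\<^esub> y = y" if "y \<in> Y" for y
      using that lcos_m_assoc[OF Ac one_closed Hc] Hc by (auto simp: Y_def act_def)
    show "act (g \<otimes>\<^bsub>G\<lparr>carrier := H\<rparr>\<^esub> h) y = act g (act h y)"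
      if "g \<in> carrier (G\<lparr>carrier := H\<rparr>)" "h \<in> carrier (G\<lparr>carrier := H\<rparr>)" "y \<in> Y" for g h y
      using that lcos_m_assoc[OF l_coset_subset_G[OF Ac Hc] Hc Hc] by (auto simp: Y_def act_def)
    show "finite (act g ` M - M)" if g: "g \<in> carrier (G\<lparr>carrier := H\<rparr>)" for g
    proof -
      obtain m where m: "g \<in> A m" using g un by auto
      have "act g ` M - M \<subseteq> (\<lambda>n. (n, g <# A n)) ` {..<m}"
      proof
        fix y assume y: "y \<in> act g ` M - M"
        then obtain n where n: "y = (n, g <# A n)" by (auto simp: act_def M_def)
        have "n < m"
        proof (rule ccontr)
          assume "\<not> n < m"
          then have "g \<in> A n" using m mono by (meson not_less subsetD)
          then have "g <# A n = A n" using coset_join3[OF _ A] subsetD[OF Ac] by blast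
          then show False using y n by (auto simp: M_def)
        qed
        then show "y \<in> (\<lambda>n. (n, g <# A n)) ` {..<m}" using n by auto
      qed
      then show ?thesis using finite_subset by blast
    qed
  qed (rule MY)
  then obtain N where N: "N \<subseteq> Y" "\<And>g y. g \<in> H \<Longrightarrow> y \<in> N \<Longrightarrow> act g y \<in> N"
      "finite (sym_diff M N)"
    by (auto simp del: finite_Un finite_Diff2)
  have "finite (fst ` (sym_diff M N))" using N(3) by simp
  then obtain n where n: "n \<notin> fst ` (sym_diff M N)" using ex_new_if_finite[OF infinite_UNIV_nat] by blast
  have n': "(n, C) \<in> M \<longleftrightarrow> (n, C) \<in> N" for C using n by force
  have "h \<in> A n" if h: "h \<in> H" for h
  proof -
    have "(n, A n) \<in> N" using n' by (auto simp: M_def)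
    then have "(n, h <# A n) \<in> N" using N(2)[of h "(n, A n)"] h by (auto simp: act_def)
    then have "h <# A n = A n" using n' by (auto simp: M_def)
    moreover have "h \<otimes> \<one> \<in> h <# A n" using subgroup.one_closed[OF A] by (auto simp: l_coset_def)
    ultimately show ?thesis using h Hc by simp
  qed
  then have "A n = H" using un by blast
  then show ?thesis by blast
qed

end

section \<open>Abelian groups with Property FW\<close>

context group
begin

definition zext :: "'a set \<Rightarrow> 'a \<Rightarrow> 'a set" where
  "zext K x = {k \<otimes> x [^] (j :: int) | k j. k \<in> K}"

lemma zext_supset: "K \<subseteq> carrier G \<Longrightarrow> K \<subseteq> zext K x"
proof
  fix k assume "K \<subseteq> carrier G" "k \<in> K"
  then have "k = k \<otimes> x [^] (0 :: int)" by auto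
  then show "k \<in> zext K x" using \<open>k \<in> K\<close> unfolding zext_def by blast
qed

lemma countable_zext:
  assumes "countable K"
  shows "countable (zext K x)"
proof -
  have "zext K x = (\<lambda>(k, j :: int). k \<otimes> x [^] j) ` (K \<times> UNIV)" by (auto simp: zext_def)
  then show ?thesis using assms by auto
qed

end

context comm_group
begin

lemma subgroup_zext:
  assumes K: "subgroup K G" and x: "x \<in> carrier G"
  shows "subgroup (zext K x) G"
proof (rule subgroupI)
  have Kc: "\<And>k. k \<in> K \<Longrightarrow> k \<in> carrier G" using subgroup.subset[OF K] by blast
  show "zext K x \<subseteq> carrier G" using Kc x by (auto simp: zext_def)
  show "zext K x \<noteq> {}" using subgroup.one_closed[OF K] by (auto simp: zext_def)
  show "inv a \<in> zext K x" if "a \<in> zext K x" for a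
  proof -
    obtain k j where a: "a = k \<otimes> x [^] (j :: int)" "k \<in> K" using \<open>a \<in> zext K x\<close> unfolding zext_def by blast
    then have "inv a = inv k \<otimes> x [^] (- j)"
      using Kc x by (simp add: inv_mult int_pow_neg)
    then show ?thesis using a subgroup.m_inv_closed[OF K] by (auto simp: zext_def)
  qed
  show "a \<otimes> b \<in> zext K x" if ab: "a \<in> zext K x" "b \<in> zext K x" for a b
  proof -
    obtain k j l i where a: "a = k \<otimes> x [^] (j :: int)" "k \<in> K" "b = l \<otimes> x [^] (i :: int)" "l \<in> K"
      using ab unfolding zext_def by blast
    then have "a \<otimes> b = (k \<otimes> l) \<otimes> x [^] (j + i)"
      using Kc x by (simp add: int_pow_mult m_ac)
    then show ?thesis using a subgroup.m_closed[OF K] unfolding zext_def by blast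
  qed
qed

lemma zext_mem: "subgroup K G \<Longrightarrow> x \<in> carrier G \<Longrightarrow> x \<in> zext K x"
proof -
  assume "subgroup K G" "x \<in> carrier G"
  then have "\<one> \<in> K" "x = \<one> \<otimes> x [^] (1 :: int)" using subgroup.one_closed by auto
  then show ?thesis unfolding zext_def by blast
qed

text \<open>The quotient by \<open>K\<close> is cyclic. If it were infinite cyclic, the integers
  would act by translation on themselves with the half-line \<open>{0..}\<close> commensurated,
  whereas the only invariant sets are empty or everything.\<close>

lemma fin_index_zext:
  assumes K: "subgroup K G" and x: "x \<in> carrier G" and FW: "FW (zext K x)"
  shows "fin_index (zext K x) K"
proof -
  define L where "L = zext K x"
  have Kc: "\<And>k. k \<in> K \<Longrightarrow> k \<in> carrier G" using subgroup.subset[OF K] by blast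
  have L: "subgroup L G" unfolding L_def by (rule subgroup_zext[OF K x])
  have Lc: "\<And>k. k \<in> L \<Longrightarrow> k \<in> carrier G" using subgroup.subset[OF L] by blast
  \<comment> \<open>The exponent of \<open>l\<close> modulo \<open>K\<close>, determined up to the
    order of \<open>x\<close> modulo \<open>K\<close>: a homomorphism to the integers if that order
    is infinite, and a finite colouring after reduction otherwise.\<close>
  define e where "e = (\<lambda>l. SOME j :: int. l \<otimes> x [^] (- j) \<in> K)"
  have e: "l \<otimes> x [^] (- e l) \<in> K" if l: "l \<in> L" for l
  proof -
    obtain k j where "l = k \<otimes> x [^] (j :: int)" "k \<in> K" using l by (auto simp: zext_def L_def)
    then have "l \<otimes> x [^] (- j) \<in> K" using x Kc by (simp add: m_assoc flip: int_pow_mult)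
    then show ?thesis unfolding e_def by (rule someI)
  qed
  have pow_diff: "x [^] (i - j) \<in> K" if "l \<in> L" "l \<otimes> x [^] (- i) \<in> K" "l \<otimes> x [^] (- j) \<in> K" for l and i j :: int
  proof -
    have "(l \<otimes> x [^] (- j)) \<otimes> inv (l \<otimes> x [^] (- i)) \<in> K"
      using that K by (simp add: subgroup.m_closed subgroup.m_inv_closed)
    moreover have "(l \<otimes> x [^] (- j)) \<otimes> inv (l \<otimes> x [^] (- i)) = x [^] (i - j)"
    proof -
      have "(l \<otimes> x [^] (- j)) \<otimes> inv (l \<otimes> x [^] (- i)) = (l \<otimes> inv l) \<otimes> (x [^] i \<otimes> x [^] (- j))"
        using Lc[OF that(1)] x by (simp add: inv_mult int_pow_neg m_ac del: l_inv r_inv Units_l_inv Units_r_inv)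
      then show ?thesis using Lc[OF that(1)] x by (simp flip: int_pow_mult)
    qed
    ultimately show ?thesis by simp
  qed
  show ?thesis
  proof (cases "\<exists>n>0. x [^] (n :: int) \<in> K")
    case True
    then obtain n :: int where n: "n > 0" "x [^] n \<in> K" by blast
    have nk: "x [^] (n * k) \<in> K" for k
    proof -
      have "x [^] (n * k) = (x [^] n) [^] k" using x by (simp add: int_pow_pow)
      then show ?thesis using n(2) K by (simp add: subgroup_int_pow_closed)
    qed
    show ?thesis
    proof (rule fin_indexI[of "\<lambda>l. e l mod n"])
      have "(\<lambda>l. e l mod n) ` zext K x \<subseteq> {0..<n}" using n by auto
      then show "finite ((\<lambda>l. e l mod n) ` zext K x)" using finite_subset by blast
      show "zext K x \<subseteq> carrier G" using Lc L_def by blast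
      fix l m assume l: "l \<in> zext K x" and m: "m \<in> zext K x" and eq: "e l mod n = e m mod n"
      obtain q where q: "e m - e l = n * q" using eq by (metis mod_eq_dvd_iff dvd_def)
      have lm: "l \<in> L" "m \<in> L" using l m by (auto simp: L_def)
      have "inv (l \<otimes> x [^] (- e l)) \<otimes> (m \<otimes> x [^] (- e m)) \<otimes> x [^] (n * q) \<in> K"
        using e[OF lm(1)] e[OF lm(2)] nk K by (simp add: subgroup.m_closed subgroup.m_inv_closed)
      moreover have "inv (l \<otimes> x [^] (- e l)) \<otimes> (m \<otimes> x [^] (- e m)) \<otimes> x [^] (n * q)
         = (inv l \<otimes> m) \<otimes> (x [^] (e l) \<otimes> x [^] (- e m) \<otimes> x [^] (e m - e l))"
        using lm Lc x q by (simp add: inv_mult int_pow_neg m_ac)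
      moreover have "x [^] (e l) \<otimes> x [^] (- e m) \<otimes> x [^] (e m - e l) = \<one>"
        using x by (simp flip: int_pow_mult)
      ultimately show "inv l \<otimes> m \<in> K" using lm Lc by simp
    qed
  next
    case False
    have tor: "n = 0" if "x [^] (n :: int) \<in> K" for n
    proof (rule ccontr)
      assume "n \<noteq> 0"
      moreover have "x [^] (- n) \<in> K" using that K x by (simp add: int_pow_neg subgroup.m_inv_closed)
      ultimately show False using False that by (metis linorder_neqE neg_0_less_iff_less)
    qed
    have eI: "e l = j" if "l \<in> L" "l \<otimes> x [^] (- j) \<in> K" for l j
      using tor[OF pow_diff[OF that(1) e[OF that(1)] that(2)]] by simp
    have eh: "e (l \<otimes> m) = e l + e m" if "l \<in> L" "m \<in> L" for l m
    proof (rule eI)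
      show "l \<otimes> m \<in> L" using that L by (simp add: subgroup.m_closed)
      have "(l \<otimes> x [^] (- e l)) \<otimes> (m \<otimes> x [^] (- e m)) \<in> K"
        using e that K by (simp add: subgroup.m_closed)
      moreover have "(l \<otimes> x [^] (- e l)) \<otimes> (m \<otimes> x [^] (- e m)) = (l \<otimes> m) \<otimes> (x [^] (- e l) \<otimes> x [^] (- e m))"
        using that Lc x by (simp add: m_ac del: l_inv r_inv Units_l_inv Units_r_inv)
      ultimately show "l \<otimes> m \<otimes> x [^] (- (e l + e m)) \<in> K" using x by (simp flip: int_pow_mult)
    qed
    have xL: "x \<in> L" unfolding L_def by (rule zext_mem[OF K x])
    have ex: "e x = 1" "e (inv x) = - 1"
      using eI[OF xL, of 1] eI[of "inv x" "- 1"] subgroup.m_inv_closed[OF L xL] x subgroup.one_closed[OF K]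
      by (simp_all add: int_pow_neg)
    have grpL: "group (G\<lparr>carrier := L\<rparr>)" using L by (rule subgroup_imp_group)
    have carL: "carrier (G\<lparr>carrier := L\<rparr>) = L" by simp
    have "\<exists>N\<subseteq>UNIV. (\<forall>g\<in>carrier (G\<lparr>carrier := L\<rparr>). \<forall>y\<in>N. y + e g \<in> N) \<and> finite (sym_diff {0..} N)"
    proof (rule property_FW_D[OF FW[folded L_def] grpL, of UNIV "\<lambda>g y. y + e g" "{0..}"])
      show "y + e \<one>\<^bsub>G\<lparr>carrier := L\<rparr>\<^esub> = y" for y :: int
        using eI[of \<one> 0] subgroup.one_closed[OF L] subgroup.one_closed[OF K] by simp
      show "y + e (g \<otimes>\<^bsub>G\<lparr>carrier := L\<rparr>\<^esub> h) = y + e h + e g"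
        if "g \<in> carrier (G\<lparr>carrier := L\<rparr>)" "h \<in> carrier (G\<lparr>carrier := L\<rparr>)" for g h y
        using that eh by simp
      show "finite ((\<lambda>y. y + e g) ` {0..} - {0..})" for g
      proof (rule finite_subset)
        show "(\<lambda>y. y + e g) ` {0..} - {0..} \<subseteq> {e g..<0}"
          by (intro subsetI) (elim DiffE imageE, simp)
      qed simp
    qed simp_all
    then obtain N :: "int set" where N: "\<And>g y. g \<in> L \<Longrightarrow> y \<in> N \<Longrightarrow> y + e g \<in> N"
      "finite (sym_diff {0..} N)"
      unfolding carL by blast
    have up: "y + 1 \<in> N" "y - 1 \<in> N" if "y \<in> N" for y
      using N(1)[of x y] N(1)[of "inv x" y] that xL ex subgroup.m_inv_closed[OF L xL] by auto
    have all: "z \<in> N" if "y \<in> N" for y z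
      by (rule int_induct[of "\<lambda>z. z \<in> N" y z]) (simp_all add: that up)
    have False
    proof (cases "N = {}")
      case True
      then show False using N(2) infinite_Ici[of "0 :: int"] by (simp only: Diff_empty Un_empty_right empty_Diff)
    next
      case False
      then have "z \<in> N" for z using all by blast
      then have "{..<0} \<subseteq> sym_diff {0..} N" by fastforce
      then show False using N(2) infinite_Iio[of "0 :: int"] finite_subset by blast
    qed
    then show ?thesis ..
  qed
qed

text \<open>Coset representatives are adjoined to \<open>K\<close> one by one. By
  \<open>property_FW_chain\<close> the process reaches \<open>L\<close> after finitely many steps,
  and each single step has a cyclic quotient.\<close>

lemma fin_index_countable:
  assumes L: "subgroup L G" and K: "subgroup K G" "K \<subseteq> L" and FW: "FW L"
    and C: "countable C" "C \<subseteq> L" "\<And>l. l \<in> L \<Longrightarrow> \<exists>c\<in>C. l \<otimes> inv c \<in> K"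
  shows "fin_index L K"
proof -
  have Lc: "\<And>k. k \<in> L \<Longrightarrow> k \<in> carrier G" using subgroup.subset[OF L] by blast
  have "C \<noteq> {}" using C(3) subgroup.one_closed[OF L] by blast
  define y where "y = from_nat_into C"
  have yC: "range y = C" unfolding y_def using C(1) \<open>C \<noteq> {}\<close> by (rule range_from_nat_into[rotated])
  have yc: "y n \<in> L" "y n \<in> carrier G" for n using yC C(2) Lc by auto
  define A where "A = rec_nat K (\<lambda>n A. zext A (y n))"
  have A0: "A 0 = K" and AS: "\<And>n. A (Suc n) = zext (A n) (y n)" by (simp_all add: A_def)
  have sub: "subgroup (A n) G" for n
    by (induction n) (simp_all add: A0 AS K subgroup_zext yc)
  have inc: "A n \<subseteq> A (Suc n)" for n unfolding AS by (rule zext_supset[OF subgroup.subset[OF sub]])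
  have mono: "A m \<subseteq> A n" if "m \<le> n" for m n using lift_Suc_mono_le[of A, OF inc that] .
  have AL: "A n \<subseteq> L" for n
  proof (induction n)
    case (Suc n)
    have "y n [^] (j :: int) \<in> L" for j using subgroup_int_pow_closed[OF L yc(1)] .
    then show ?case using Suc subgroup.m_closed[OF L] by (auto simp: AS zext_def)
  qed (simp add: A0 K)
  have un: "(\<Union>n. A n) = L"
  proof
    show "(\<Union>n. A n) \<subseteq> L" using AL by blast
    show "L \<subseteq> (\<Union>n. A n)"
    proof
      fix l assume l: "l \<in> L"
      then obtain n where n: "l \<otimes> inv (y n) \<in> K" using C(3) yC by blast
      have "y n \<in> A (Suc n)" unfolding AS by (rule zext_mem[OF sub yc(2)])
      moreover have "l \<otimes> inv (y n) \<in> A (Suc n)" using n mono[of 0 "Suc n"] A0 by auto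
      ultimately have "(l \<otimes> inv (y n)) \<otimes> y n \<in> A (Suc n)" using subgroup.m_closed[OF sub] by blast
      then show "l \<in> (\<Union>n. A n)" using l Lc yc by (auto simp: m_assoc)
    qed
  qed
  obtain n where n: "A n = L" using property_FW_chain[OF L FW sub inc un] by blast
  \<comment> \<open>The induction descends from the top: only the last group is known to have
    Property FW, and finite index of each step passes it on to the previous group.\<close>
  have "FW (A n) \<Longrightarrow> fin_index (A n) K" for n
  proof (induction n)
    case 0
    show ?case unfolding A0
      by (rule fin_indexI[of "\<lambda>_. ()"]) (use subgroup.subset[OF K(1)] subgroup.m_closed[OF K(1)] subgroup.m_inv_closed[OF K(1)] in auto)
  next
    case (Suc n)
    have fi: "fin_index (A (Suc n)) (A n)"
      using fin_index_zext[OF sub yc(2)] Suc.prems unfolding AS by blast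
    then have "FW (A n)" by (rule property_FW_fin_index[OF sub sub inc _ Suc.prems])
    then show ?case using fin_index_trans[OF subgroup.subset[OF sub] sub inc fi] Suc.IH by blast
  qed
  then show ?thesis using n FW by blast
qed

lemma subgroup_Union_chain:
  assumes "\<C> \<noteq> {}" "\<And>K. K \<in> \<C> \<Longrightarrow> subgroup K G" "\<And>K L. K \<in> \<C> \<Longrightarrow> L \<in> \<C> \<Longrightarrow> K \<subseteq> L \<or> L \<subseteq> K"
  shows "subgroup (\<Union>\<C>) G"
proof (rule subgroupI)
  show "\<Union>\<C> \<subseteq> carrier G" using assms(2) subgroup.subset by blast
  show "\<Union>\<C> \<noteq> {}" using assms(1,2) subgroup.one_closed by blast
  show "inv a \<in> \<Union>\<C>" if a: "a \<in> \<Union>\<C>" for a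
  proof -
    obtain K where K: "K \<in> \<C>" "a \<in> K" using a by blast
    show ?thesis using subgroup.m_inv_closed[OF assms(2)[OF K(1)] K(2)] K(1) by blast
  qed
  show "a \<otimes> b \<in> \<Union>\<C>" if ab: "a \<in> \<Union>\<C>" "b \<in> \<Union>\<C>" for a b
  proof -
    obtain K L where KL: "K \<in> \<C>" "a \<in> K" "L \<in> \<C>" "b \<in> L" using ab by blast
    then consider "a \<in> L" | "b \<in> K" using assms(3) by blast
    then show ?thesis
    proof cases
      case 1
      show ?thesis using subgroup.m_closed[OF assms(2)[OF KL(3)] 1 KL(4)] KL(3) by blast
    next
      case 2
      show ?thesis using subgroup.m_closed[OF assms(2)[OF KL(1)] KL(2) 2] KL(1) by blast
    qed
  qed
qed

text \<open>
  A subgroup \<open>K\<close> maximal with respect to \<open>K \<inter> B = {1}\<close>, for a countably infinite subgroup \<open>B\<close>,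
  has countable index, because \<open>G/K\<close> is an essential extension of \<open>B\<close>. This reduces the
  general case to the countable one.
\<close>

theorem property_FW_imp_finite:
  assumes FW: "property_FW G"
  shows "finite (carrier G)"
proof (rule ccontr)
  assume "infinite (carrier G)"
  then obtain y :: "nat \<Rightarrow> 'a" where y: "inj y" "range y \<subseteq> carrier G"
    unfolding infinite_iff_countable_subset by blast
  have yc: "y n \<in> carrier G" for n using y by blast
  define A where "A = rec_nat {\<one>} (\<lambda>n A. zext A (y n))"
  have A0: "A 0 = {\<one>}" and AS: "\<And>n. A (Suc n) = zext (A n) (y n)" by (simp_all add: A_def)
  have sub: "subgroup (A n) G" for n
    by (induction n) (simp_all add: A0 AS triv_subgroup subgroup_zext yc)
  have inc: "A n \<subseteq> A (Suc n)" for n unfolding AS by (rule zext_supset[OF subgroup.subset[OF sub]])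
  have mono: "A m \<subseteq> A n" if "m \<le> n" for m n using lift_Suc_mono_le[of A, OF inc that] .
  define B where "B = (\<Union>n. A n)"
  have B: "subgroup B G"
    unfolding B_def
  proof (rule subgroup_Union_chain)
    fix K L assume "K \<in> range A" "L \<in> range A"
    then obtain m n where "K = A m" "L = A n" by blast
    then show "K \<subseteq> L \<or> L \<subseteq> K" using mono[of m n] mono[of n m] nat_le_linear[of m n] by blast
  qed (use sub in auto)
  have "countable (A n)" for n
    by (induction n) (auto simp: A0 AS countable_zext)
  then have Bcount: "countable B" by (auto simp: B_def)
  have "y n \<in> B" for n
    using zext_mem[OF sub yc, of n n] unfolding B_def AS[symmetric] by blast
  then have Binf: "infinite B" using range_inj_infinite[OF y(1)] finite_subset[of "range y" B] by blast
  define KK where "KK = {K. subgroup K G \<and> K \<inter> B = {\<one>}}"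
  have "\<exists>K\<in>KK. \<forall>Z\<in>KK. K \<subseteq> Z \<longrightarrow> Z = K"
  proof (rule subset_Zorn)
    fix \<C> assume \<C>: "subset.chain KK \<C>"
    show "\<exists>U\<in>KK. \<forall>Z\<in>\<C>. Z \<subseteq> U"
    proof (cases "\<C> = {}")
      case True
      then show ?thesis using triv_subgroup subgroup.one_closed[OF B] by (auto simp: KK_def)
    next
      case False
      have inKK: "subgroup K G" "K \<inter> B = {\<one>}" if "K \<in> \<C>" for K
        using \<C> that by (auto simp: subset_chain_def KK_def)
      have "subgroup (\<Union>\<C>) G"
      proof (rule subgroup_Union_chain[OF False inKK(1)])
        show "K \<subseteq> L \<or> L \<subseteq> K" if "K \<in> \<C>" "L \<in> \<C>" for K L
          using \<C> that by (auto simp: subset_chain_def)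
      qed
      moreover have "\<Union>\<C> \<inter> B = {\<one>}" using False inKK(2) by blast
      ultimately have "\<Union>\<C> \<in> KK" by (simp add: KK_def)
      then show ?thesis by blast
    qed
  qed
  then obtain K where K: "subgroup K G" "K \<inter> B = {\<one>}"
      and max: "\<And>Z. subgroup Z G \<Longrightarrow> Z \<inter> B = {\<one>} \<Longrightarrow> K \<subseteq> Z \<Longrightarrow> Z = K"
    by (auto simp: KK_def)
  have Kc: "\<And>k. k \<in> K \<Longrightarrow> k \<in> carrier G" using subgroup.subset[OF K(1)] by blast
  have Bc: "\<And>k. k \<in> B \<Longrightarrow> k \<in> carrier G" using subgroup.subset[OF B] by blast
  \<comment> \<open>By maximality, adjoining \<open>x\<close> creates a nontrivial element
    \<open>k \<otimes> x [^] j\<close> of \<open>B\<close>; here \<open>x [^] j\<close> is outside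
    \<open>K\<close>, since otherwise that element would lie in \<open>K \<inter> B\<close>.\<close>
  have ess: "\<exists>k\<in>K. \<exists>j :: int. j \<noteq> 0 \<and> k \<otimes> x [^] j \<in> B \<and> x [^] j \<notin> K" if x: "x \<in> carrier G" "x \<notin> K" for x
  proof (rule ccontr)
    assume neg: "\<not> ?thesis"
    have "zext K x \<inter> B = {\<one>}"
    proof
      show "{\<one>} \<subseteq> zext K x \<inter> B"
        using subgroup.one_closed[OF B] subgroup.one_closed[OF subgroup_zext[OF K(1) x(1)]] by auto
      show "zext K x \<inter> B \<subseteq> {\<one>}"
      proof
        fix b assume b: "b \<in> zext K x \<inter> B"
        then obtain k j where kj: "b = k \<otimes> x [^] (j :: int)" "k \<in> K" by (auto simp: zext_def)
        then have "j = 0 \<or> x [^] j \<in> K" using neg b by blast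
        then have "x [^] j \<in> K" using subgroup.one_closed[OF K(1)] by auto
        then have "b \<in> K" using kj subgroup.m_closed[OF K(1)] by auto
        then show "b \<in> {\<one>}" using K(2) b by auto
      qed
    qed
    then have "zext K x = K"
      by (intro max subgroup_zext[OF K(1) x(1)] zext_supset[OF subgroup.subset[OF K(1)]])
    then show False using zext_mem[OF K(1) x(1)] x(2) by blast
  qed
  \<comment> \<open>Elements of prime order modulo \<open>K\<close> come from \<open>B\<close>: as
    \<open>x [^] j\<close> is not in \<open>K\<close>, the exponent \<open>j\<close> is coprime to
    \<open>p\<close>, and by Bezout \<open>x\<close> is modulo \<open>K\<close> a power of an
    element of \<open>B\<close>.\<close>
  have prime_case: "\<exists>b\<in>B. x \<otimes> inv b \<in> K" if x: "x \<in> carrier G" and p: "normalization_semidom_class.prime p" "x [^] (p :: nat) \<in> K" for x p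
  proof (cases "x \<in> K")
    case True
    then show ?thesis using subgroup.one_closed[OF B] Kc by (intro bexI[of _ \<one>]) auto
  next
    case False
    then obtain k and j :: int where kj: "k \<in> K" "k \<otimes> x [^] j \<in> B" "x [^] j \<notin> K" using ess x by blast
    have xp: "x [^] (int p * i) \<in> K" for i
    proof -
      have "x [^] (int p * i) = (x [^] p) [^] i" using x by (simp add: int_pow_int flip: int_pow_pow)
      then show ?thesis using p K by (simp add: subgroup_int_pow_closed)
    qed
    have "\<not> int p dvd j" using kj(3) xp by (auto simp: dvd_def)
    then have "coprime (int p) j" using p(1) by (simp add: prime_imp_coprime)
    then have "gcd (int p) j = 1" by simp
    then obtain u v where "int p * u + j * v = 1" using bezout_int[of "int p" j] by (auto simp: mult.commute)
    then have xe: "x = x [^] (int p * u) \<otimes> (x [^] j) [^] v"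
      using x by (metis int_pow_1 int_pow_mult int_pow_pow)
    define b where "b = (k \<otimes> x [^] j) [^] v"
    have b: "b \<in> B" unfolding b_def using subgroup_int_pow_closed[OF B kj(2)] .
    have "b = k [^] v \<otimes> (x [^] j) [^] v" unfolding b_def using kj Kc x by (simp add: int_pow_distrib)
    then have "x \<otimes> inv b = x [^] (int p * u) \<otimes> (x [^] j) [^] v \<otimes> (inv (k [^] v) \<otimes> inv ((x [^] j) [^] v))"
      using xe kj Kc x by (simp add: inv_mult)
    also have "\<dots> = x [^] (int p * u) \<otimes> inv (k [^] v) \<otimes> ((x [^] j) [^] v \<otimes> inv ((x [^] j) [^] v))"
      using kj Kc x by (simp add: m_ac del: l_inv r_inv Units_l_inv Units_r_inv)
    also have "\<dots> = x [^] (int p * u) \<otimes> inv (k [^] v)" using kj Kc x by simp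
    finally have "x \<otimes> inv b \<in> K"
      using xp kj K(1) by (simp add: subgroup.m_closed subgroup.m_inv_closed subgroup_int_pow_closed)
    then show ?thesis using b by blast
  qed
  \<comment> \<open>The \<open>n\<close>-torsion modulo \<open>K\<close> is countable, by stripping
    off one prime factor at a time. For \<open>n = m * p\<close> the element \<open>x [^] m\<close>
    comes from some \<open>b\<close> in the countable group \<open>B\<close>. Dividing
    \<open>x\<close> by one fixed \<open>m\<close>-th root \<open>r b\<close> of \<open>b\<close>
    modulo \<open>K\<close> leaves an element of the \<open>m\<close>-torsion.\<close>
  have pow_case: "\<exists>C. countable C \<and> C \<subseteq> carrier G \<and> (\<forall>x\<in>carrier G. x [^] n \<in> K \<longrightarrow> (\<exists>c\<in>C. x \<otimes> inv c \<in> K))"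
    if "n > 0" for n :: nat
    using that
  proof (induction n rule: less_induct)
    case (less n)
    show ?case
    proof (cases "n = 1")
      case True
      then show ?thesis by (intro exI[of _ "{\<one>}"]) auto
    next
      case False
      then obtain p where p: "normalization_semidom_class.prime p" "p dvd n" using prime_factor_nat by blast
      then obtain m where m: "n = m * p" by (metis dvd_def mult.commute)
      have m0: "0 < m" "m < n" using less.prems m p(1) prime_gt_1_nat by auto
      obtain C where C: "countable C" "C \<subseteq> carrier G"
          "\<And>x. x \<in> carrier G \<Longrightarrow> x [^] m \<in> K \<Longrightarrow> \<exists>c\<in>C. x \<otimes> inv c \<in> K"
        using less.IH[OF m0(2,1)] by blast
      define r where "r = (\<lambda>b. SOME z. z \<in> carrier G \<and> z [^] m \<otimes> inv b \<in> K)"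
      define D where "D = (\<lambda>(c, b). c \<otimes> r b) ` (C \<times> {b \<in> B. r b \<in> carrier G})"
      show ?thesis
      proof (intro exI[of _ D] conjI ballI impI)
        show "countable D" using C(1) Bcount by (auto simp: D_def)
        show "D \<subseteq> carrier G" using C(2) by (auto simp: D_def)
        fix x assume x: "x \<in> carrier G" "x [^] n \<in> K"
        have "(x [^] m) [^] p \<in> K" using x m by (simp add: nat_pow_pow)
        then obtain b where b: "b \<in> B" "x [^] m \<otimes> inv b \<in> K" using prime_case[OF _ p(1)] x by blast
        have r: "r b \<in> carrier G" "r b [^] m \<otimes> inv b \<in> K"
          using someI[of "\<lambda>z. z \<in> carrier G \<and> z [^] m \<otimes> inv b \<in> K" x] x b by (auto simp: r_def)
        have "(x [^] m \<otimes> inv b) \<otimes> inv (r b [^] m \<otimes> inv b) \<in> K"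
          using b r K(1) by (simp add: subgroup.m_closed subgroup.m_inv_closed)
        moreover have "(x [^] m \<otimes> inv b) \<otimes> inv (r b [^] m \<otimes> inv b) = x [^] m \<otimes> inv (r b [^] m) \<otimes> (inv b \<otimes> b)"
          using x r b Bc by (simp add: inv_mult m_ac del: l_inv r_inv Units_l_inv Units_r_inv)
        ultimately have "(x \<otimes> inv (r b)) [^] m \<in> K"
          using x r b Bc by (simp add: nat_pow_distrib nat_pow_inv)
        then obtain c where c: "c \<in> C" "(x \<otimes> inv (r b)) \<otimes> inv c \<in> K"
          using C(3)[of "x \<otimes> inv (r b)"] x r by auto
        have "c \<in> carrier G" using c C(2) by blast
        then have "x \<otimes> inv (c \<otimes> r b) \<in> K" using c x r by (simp add: inv_mult m_ac del: l_inv r_inv Units_l_inv Units_r_inv)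
        moreover have "c \<otimes> r b \<in> D" using c b r by (auto simp: D_def)
        ultimately show "\<exists>c\<in>D. x \<otimes> inv c \<in> K" by blast
      qed
    qed
  qed
  define P where "P = (\<lambda>n C. countable C \<and> C \<subseteq> carrier G \<and> (\<forall>x\<in>carrier G. x [^] (n :: nat) \<in> K \<longrightarrow> (\<exists>c\<in>C. x \<otimes> inv c \<in> K)))"
  define Cn where "Cn = (\<lambda>n. SOME C. P n C)"
  have Cn: "P n (Cn n)" if n: "n > 0" for n
  proof -
    have "\<exists>C. P n C" unfolding P_def by (rule pow_case[OF n])
    then show ?thesis unfolding Cn_def by (rule someI_ex)
  qed
  define r where "r = (\<lambda>n b. SOME z. z \<in> carrier G \<and> z [^] (n :: nat) \<otimes> inv b \<in> K)"
  define D where "D = insert \<one> (\<Union>n\<in>{0<..}. (\<lambda>(c, b). c \<otimes> r n b) ` (Cn n \<times> {b \<in> B. r n b \<in> carrier G}))"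
  have Dcount: "countable D"
  proof -
    have "countable (Cn n \<times> {b \<in> B. r n b \<in> carrier G})" if "n \<in> {0<..}" for n
      using Cn[of n] that Bcount by (simp add: P_def)
    then show ?thesis unfolding D_def by (intro countable_insert countable_UN countable_image) auto
  qed
  have Dc: "D \<subseteq> carrier G"
  proof -
    have "Cn n \<subseteq> carrier G" if "n \<in> {0<..}" for n using Cn[of n] that by (simp add: P_def)
    then show ?thesis unfolding D_def by (intro insert_subsetI one_closed UN_least) auto
  qed
  \<comment> \<open>Every element has a positive power in the product of \<open>K\<close> and
    \<open>B\<close>, by \<open>ess\<close>; the same division by a chosen root reduces it to
    torsion modulo \<open>K\<close>. So \<open>K\<close> has countable index.\<close>
  have Dex: "\<exists>c\<in>D. x \<otimes> inv c \<in> K" if x: "x \<in> carrier G" for x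
  proof (cases "x \<in> K")
    case True
    then show ?thesis using x by (intro bexI[of _ \<one>]) (auto simp: D_def)
  next
    case False
    then obtain k and j :: int where kj: "k \<in> K" "k \<otimes> x [^] j \<in> B" "j \<noteq> 0" using ess x by blast
    have "\<exists>b\<in>B. x [^] (nat \<bar>j\<bar>) \<otimes> inv b \<in> K"
    proof (cases "j > 0")
      case True
      then have e: "x [^] j = x [^] (nat \<bar>j\<bar>)" using x by (metis abs_of_pos int_nat_eq int_pow_int order_less_imp_le)
      have "x [^] j \<otimes> inv (k \<otimes> x [^] j) = inv k \<otimes> (x [^] j \<otimes> inv (x [^] j))"
        using kj Kc x by (simp add: inv_mult m_ac del: l_inv r_inv Units_l_inv Units_r_inv)
      then have "x [^] j \<otimes> inv (k \<otimes> x [^] j) \<in> K" using kj Kc x K(1) by (simp add: subgroup.m_inv_closed)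
      then show ?thesis using kj(2) e by metis
    next
      case False
      then have "j < 0" using kj(3) by linarith
      then have e: "inv (x [^] j) = x [^] (nat \<bar>j\<bar>)"
        using x by (metis abs_of_neg int_nat_eq int_pow_int int_pow_neg less_imp_le neg_0_le_iff_le)
      have "inv (x [^] j) \<otimes> inv (inv (k \<otimes> x [^] j)) = k \<otimes> (x [^] j \<otimes> inv (x [^] j))"
        using kj Kc x by (simp add: inv_mult m_ac del: l_inv r_inv Units_l_inv Units_r_inv)
      then have "inv (x [^] j) \<otimes> inv (inv (k \<otimes> x [^] j)) \<in> K" using kj Kc x by simp
      then show ?thesis using subgroup.m_inv_closed[OF B kj(2)] e by metis
    qed
    then obtain b where b: "b \<in> B" "x [^] (nat \<bar>j\<bar>) \<otimes> inv b \<in> K" by blast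
    define m where "m = nat \<bar>j\<bar>"
    have m0: "m > 0" using kj(3) by (simp add: m_def)
    have r: "r m b \<in> carrier G" "r m b [^] m \<otimes> inv b \<in> K"
      using someI[of "\<lambda>z. z \<in> carrier G \<and> z [^] m \<otimes> inv b \<in> K" x] x b by (auto simp: r_def m_def)
    have "(x [^] m \<otimes> inv b) \<otimes> inv (r m b [^] m \<otimes> inv b) \<in> K"
      using b r K(1) by (simp add: subgroup.m_closed subgroup.m_inv_closed m_def)
    moreover have "(x [^] m \<otimes> inv b) \<otimes> inv (r m b [^] m \<otimes> inv b) = x [^] m \<otimes> inv (r m b [^] m) \<otimes> (inv b \<otimes> b)"
      using x r b Bc by (simp add: inv_mult m_ac del: l_inv r_inv Units_l_inv Units_r_inv)
    ultimately have "(x \<otimes> inv (r m b)) [^] m \<in> K"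
      using x r b Bc by (simp add: nat_pow_distrib nat_pow_inv)
    then obtain c where c: "c \<in> Cn m" "(x \<otimes> inv (r m b)) \<otimes> inv c \<in> K"
      using Cn[OF m0] x r unfolding P_def by blast
    have cc: "c \<in> carrier G" using c Cn[OF m0] by (auto simp: P_def)
    then have "x \<otimes> inv (c \<otimes> r m b) \<in> K" using c x r by (simp add: inv_mult m_ac del: l_inv r_inv Units_l_inv Units_r_inv)
    moreover have "c \<otimes> r m b \<in> D" using c b r m0 by (force simp: D_def)
    ultimately show ?thesis by blast
  qed
  have "FW (carrier G)" using FW by simp
  then have "fin_index (carrier G) K"
    using fin_index_countable[OF subgroup_self K(1) subgroup.subset[OF K(1)] _ Dcount Dc] Dex by blast
  then obtain \<phi> :: "'a \<Rightarrow> 'a set" where \<phi>: "finite (\<phi> ` carrier G)"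
      "\<And>x y. x \<in> carrier G \<Longrightarrow> y \<in> carrier G \<Longrightarrow> \<phi> x = \<phi> y \<Longrightarrow> inv x \<otimes> y \<in> K"
    unfolding fin_index_def by blast
  \<comment> \<open>Finite index of \<open>K\<close> is absurd, since distinct elements of the
    infinite group \<open>B\<close> lie in distinct cosets of \<open>K\<close>.\<close>
  have "inj_on \<phi> B"
  proof (rule inj_onI)
    fix x y assume xy: "x \<in> B" "y \<in> B" "\<phi> x = \<phi> y"
    then have "inv x \<otimes> y \<in> K \<inter> B" using \<phi>(2) Bc B by (simp add: subgroup.m_closed subgroup.m_inv_closed)
    then have "inv x \<otimes> y = \<one>" using K(2) by blast
    then show "x = y" using xy Bc by (metis inv_closed inv_equality inv_inv)
  qed
  moreover have "finite (\<phi> ` B)" using \<phi>(1) Bc by (meson finite_subset image_mono subsetI)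
  ultimately show False using Binf finite_imageD by blast
qed

end

text \<open>A subgroup containing all commutators is normal with abelian quotient, and the quotient
  inherits Property FW, hence is finite. Each abelian layer of a solvable quotient is disposed of by
  one application.\<close>

theorem (in group) fin_index_commutators:
  assumes H: "subgroup H G" and K: "subgroup K G" "K \<subseteq> H" and FW: "FW H"
    and comm: "\<And>x y. x \<in> H \<Longrightarrow> y \<in> H \<Longrightarrow> x \<otimes> y \<otimes> inv x \<otimes> inv y \<in> K"
  shows "fin_index H K"
proof -
  have Hc: "\<And>h. h \<in> H \<Longrightarrow> h \<in> carrier G" using subgroup.subset[OF H] by blast
  interpret H: group "G\<lparr>carrier := H\<rparr>" using H by (rule subgroup_imp_group)
  have KH: "subgroup K (G\<lparr>carrier := H\<rparr>)" using subgroup_incl[OF K(1) H K(2)] .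
  have inv: "inv\<^bsub>G\<lparr>carrier := H\<rparr>\<^esub> x = inv x" if "x \<in> H" for x
    using m_inv_consistent[OF H that] .
  have "K \<lhd> G\<lparr>carrier := H\<rparr>"
  proof (rule H.normal_invI[OF KH])
    fix x k assume "x \<in> carrier (G\<lparr>carrier := H\<rparr>)" "k \<in> K"
    then have x: "x \<in> H" "k \<in> H" "k \<in> K" using K(2) by auto
    have "(x \<otimes> k \<otimes> inv x \<otimes> inv k) \<otimes> k \<in> K" using comm[OF x(1,2)] x K(1) by (simp add: subgroup.m_closed)
    moreover have "(x \<otimes> k \<otimes> inv x \<otimes> inv k) \<otimes> k = x \<otimes> k \<otimes> inv x"
      using x Hc by (simp add: m_assoc)
    ultimately show "x \<otimes>\<^bsub>G\<lparr>carrier := H\<rparr>\<^esub> k \<otimes>\<^bsub>G\<lparr>carrier := H\<rparr>\<^esub> inv\<^bsub>G\<lparr>carrier := H\<rparr>\<^esub> x \<in> K"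
      using inv x by simp
  qed
  then interpret N: normal K "G\<lparr>carrier := H\<rparr>" .
  define Q where "Q = G\<lparr>carrier := H\<rparr> Mod K"
  have grpQ: "group Q" unfolding Q_def by (rule N.factorgroup_is_group)
  have hom: "(\<lambda>x. K #>\<^bsub>G\<lparr>carrier := H\<rparr>\<^esub> x) \<in> hom (G\<lparr>carrier := H\<rparr>) Q"
    unfolding Q_def by (rule N.r_coset_hom_Mod)
  have surj: "(\<lambda>x. K #>\<^bsub>G\<lparr>carrier := H\<rparr>\<^esub> x) ` carrier (G\<lparr>carrier := H\<rparr>) = carrier Q"
    unfolding Q_def carrier_FactGroup ..
  have FWQ: "property_FW Q" by (rule property_FW_surj_image[OF FW H.is_group hom grpQ surj])
  have eqI: "K #>\<^bsub>G\<lparr>carrier := H\<rparr>\<^esub> x = K #>\<^bsub>G\<lparr>carrier := H\<rparr>\<^esub> y \<longleftrightarrow> x \<otimes> inv y \<in> K" if "x \<in> H" "y \<in> H" for x y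
  proof -
    have "K #>\<^bsub>G\<lparr>carrier := H\<rparr>\<^esub> x = K #>\<^bsub>G\<lparr>carrier := H\<rparr>\<^esub> y \<longleftrightarrow> x \<in> K #>\<^bsub>G\<lparr>carrier := H\<rparr>\<^esub> y"
      using H.repr_independence[OF _ _ KH, of x y] H.rcos_self[OF _ KH, of x] that by auto
    also have "\<dots> \<longleftrightarrow> x \<otimes> inv y \<in> K"
    proof
      assume "x \<in> K #>\<^bsub>G\<lparr>carrier := H\<rparr>\<^esub> y"
      then obtain k where "k \<in> K" "x = k \<otimes> y" by (auto simp: r_coset_def)
      then show "x \<otimes> inv y \<in> K" using that Hc K(2) by (simp add: m_assoc subset_iff)
    next
      assume "x \<otimes> inv y \<in> K"
      moreover have "x = (x \<otimes> inv y) \<otimes> y" using that Hc by (simp add: m_assoc)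
      ultimately show "x \<in> K #>\<^bsub>G\<lparr>carrier := H\<rparr>\<^esub> y" by (auto simp: r_coset_def)
    qed
    finally show ?thesis .
  qed
  have "comm_group Q"
  proof (rule group.group_comm_groupI[OF grpQ])
    fix a b assume "a \<in> carrier Q" "b \<in> carrier Q"
    then obtain x y where xy: "x \<in> H" "y \<in> H" "a = K #>\<^bsub>G\<lparr>carrier := H\<rparr>\<^esub> x" "b = K #>\<^bsub>G\<lparr>carrier := H\<rparr>\<^esub> y"
      unfolding surj[symmetric] by (elim imageE) simp
    have "(x \<otimes> y) \<otimes> inv (y \<otimes> x) \<in> K" using comm[OF xy(1,2)] xy Hc by (simp add: inv_mult_group m_assoc)
    then have "K #>\<^bsub>G\<lparr>carrier := H\<rparr>\<^esub> (x \<otimes> y) = K #>\<^bsub>G\<lparr>carrier := H\<rparr>\<^esub> (y \<otimes> x)"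
      using eqI xy subgroup.m_closed[OF H] by simp
    then show "a \<otimes>\<^bsub>Q\<^esub> b = b \<otimes>\<^bsub>Q\<^esub> a"
      using hom_mult[OF hom, of x y] hom_mult[OF hom, of y x] xy by simp
  qed
  then have "finite (carrier Q)" using comm_group.property_FW_imp_finite FWQ by blast
  \<comment> \<open>\<open>fin_index\<close> speaks of left cosets while the quotient consists of
    right cosets, so an element is coloured by the coset of its inverse.\<close>
  moreover have "(\<lambda>x. K #>\<^bsub>G\<lparr>carrier := H\<rparr>\<^esub> inv x) ` H \<subseteq> carrier Q"
  proof (rule image_subsetI)
    fix x assume "x \<in> H"
    then have "inv x \<in> carrier (G\<lparr>carrier := H\<rparr>)" using subgroup.m_inv_closed[OF H] by simp
    then show "K #>\<^bsub>G\<lparr>carrier := H\<rparr>\<^esub> inv x \<in> carrier Q" unfolding surj[symmetric] by (rule imageI)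
  qed
  ultimately have fin: "finite ((\<lambda>x. K #>\<^bsub>G\<lparr>carrier := H\<rparr>\<^esub> inv x) ` H)"
    by (rule finite_subset[rotated])
  show ?thesis
  proof (rule fin_indexI[OF fin])
    show "H \<subseteq> carrier G" using Hc by blast
    show "inv x \<otimes> y \<in> K"
      if "x \<in> H" "y \<in> H" "K #>\<^bsub>G\<lparr>carrier := H\<rparr>\<^esub> inv x = K #>\<^bsub>G\<lparr>carrier := H\<rparr>\<^esub> inv y" for x y
      using that eqI[of "inv x" "inv y"] subgroup.m_inv_closed[OF H] Hc by simp
  qed
qed

section \<open>Real matrices of size two, up to sign\<close>

definition mt :: "real \<Rightarrow> real \<Rightarrow> real \<Rightarrow> real \<Rightarrow> real^2^2" where
  "mt a b c d = vector [vector [a, b], vector [c, d]]"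

lemma mt_nth [simp]:
  "mt a b c d $ 1 $ 1 = a" "mt a b c d $ 1 $ 2 = b" "mt a b c d $ 2 $ 1 = c" "mt a b c d $ 2 $ 2 = d"
  by (simp_all add: mt_def vector_2)

lemma mat2_eq_iff:
  "A = B \<longleftrightarrow> A $ 1 $ 1 = B $ 1 $ 1 \<and> A $ 1 $ 2 = B $ 1 $ 2 \<and> A $ 2 $ 1 = B $ 2 $ 1 \<and> A $ 2 $ 2 = B $ 2 $ 2"
  for A B :: "real^2^2"
  by (auto simp: vec_eq_iff forall_2)

lemma mt_eta: "mt (A $ 1 $ 1) (A $ 1 $ 2) (A $ 2 $ 1) (A $ 2 $ 2) = A"
  by (simp add: mat2_eq_iff)

lemma mt_cases: obtains a b c d where "A = mt a b c d"
  using mt_eta[of A] by metis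

lemma mt_eq_iff [simp]: "mt a b c d = mt a' b' c' d' \<longleftrightarrow> a = a' \<and> b = b' \<and> c = c' \<and> d = d'"
  by (auto simp: mat2_eq_iff)

lemma mt_mult [simp]:
  "mt a b c d ** mt a' b' c' d' = mt (a * a' + b * c') (a * b' + b * d') (c * a' + d * c') (c * b' + d * d')"
  by (simp add: mat2_eq_iff matrix_matrix_mult_def sum_2)

lemma det_mt [simp]: "det (mt a b c d) = a * d - b * c"
  by (simp add: det_2)

lemma mat_1_eq_mt: "mat 1 = mt 1 0 0 1"
  by (simp add: mat2_eq_iff mat_def)

lemma minus_mt [simp]: "- mt a b c d = mt (- a) (- b) (- c) (- d)"
  by (simp add: mat2_eq_iff)

text \<open>The adjugate inverts matrices of determinant 1 and, unlike the inverse, is linear in the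
  entries; this makes Zariski closures stable under inversion.\<close>

definition adj :: "real^2^2 \<Rightarrow> real^2^2" where
  "adj A = mt (A $ 2 $ 2) (- (A $ 1 $ 2)) (- (A $ 2 $ 1)) (A $ 1 $ 1)"

lemma adj_mt [simp]: "adj (mt a b c d) = mt d (- b) (- c) a"
  by (simp add: adj_def)

lemma adj_minus: "adj (- A) = - adj A"
  by (cases A rule: mt_cases) simp

lemma adj_mult_self: "det A = 1 \<Longrightarrow> adj A ** A = mat 1" "det A = 1 \<Longrightarrow> A ** adj A = mat 1"
  by (cases A rule: mt_cases; simp add: mat_1_eq_mt algebra_simps)+

lemma det_adj [simp]: "det (adj A) = det A"
  by (cases A rule: mt_cases) (simp add: algebra_simps)

definition pm :: "real^2^2 \<Rightarrow> real^2^2 \<Rightarrow> bool" where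
  "pm A B \<longleftrightarrow> A = B \<or> A = - B"

lemma pm_refl [simp]: "pm A A" by (simp add: pm_def)
lemma pm_sym: "pm A B \<Longrightarrow> pm B A" by (auto simp: pm_def)
lemma pm_trans [trans]: "pm A B \<Longrightarrow> pm B C \<Longrightarrow> pm A C" by (auto simp: pm_def)
lemma pm_minus [simp]: "pm (- A) B \<longleftrightarrow> pm A B" "pm A (- B) \<longleftrightarrow> pm A B"
  by (auto simp: pm_def)
lemma pm_mult: "pm A B \<Longrightarrow> pm C D \<Longrightarrow> pm (A ** C) (B ** D)"
  by (auto simp: pm_def matrix_minus_mult)
lemma pm_adj: "pm A B \<Longrightarrow> pm (adj A) (adj B)"
  by (auto simp: pm_def adj_minus)

subsection \<open>Projective representations\<close>

context group
begin

text \<open>A homomorphism from \<open>H\<close> to PSL_2(R), presented by an arbitrary choice of a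
  matrix for each element; multiplicativity can then hold only up to sign. \<open>pker\<close> is
  its kernel.\<close>

definition prep :: "'a set \<Rightarrow> ('a \<Rightarrow> real^2^2) \<Rightarrow> bool" where
  "prep H m \<longleftrightarrow> (\<forall>x\<in>H. det (m x) = 1) \<and> (\<forall>x\<in>H. \<forall>y\<in>H. pm (m (x \<otimes> y)) (m x ** m y))"

definition pker :: "'a set \<Rightarrow> ('a \<Rightarrow> real^2^2) \<Rightarrow> 'a set" where
  "pker H m = {x \<in> H. pm (m x) (mat 1)}"

lemma prep_subset: "prep H m \<Longrightarrow> K \<subseteq> H \<Longrightarrow> prep K m"
  by (auto simp: prep_def)

lemma prep_det: "prep H m \<Longrightarrow> x \<in> H \<Longrightarrow> det (m x) = 1"
  by (simp add: prep_def)

lemma prep_mult: "prep H m \<Longrightarrow> x \<in> H \<Longrightarrow> y \<in> H \<Longrightarrow> pm (m (x \<otimes> y)) (m x ** m y)"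
  by (simp add: prep_def)

lemma prep_conj:
  assumes "prep H m" "P ** P' = mat 1" "P' ** P = mat 1"
  shows "prep H (\<lambda>x. P' ** m x ** P)"
  unfolding prep_def
proof (intro conjI ballI)
  have "det P' * det P = 1" using assms(3) by (metis det_mul det_I)
  then show "det (P' ** m x ** P) = 1" if "x \<in> H" for x
    using prep_det[OF assms(1) that] by (simp add: det_mul mult.commute)
  fix x y assume xy: "x \<in> H" "y \<in> H"
  have "(P' ** m x ** P) ** (P' ** m y ** P) = P' ** m x ** (P ** P') ** m y ** P"
    by (simp add: matrix_mul_assoc)
  also have "\<dots> = P' ** (m x ** m y) ** P" by (simp add: assms(2) matrix_mul_assoc)
  finally show "pm (P' ** m (x \<otimes> y) ** P) (P' ** m x ** P ** (P' ** m y ** P))"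
    using pm_mult[OF pm_mult[OF pm_refl prep_mult[OF assms(1) xy], of P'] pm_refl, of P] by simp
qed

lemma pker_conj:
  assumes "P ** P' = mat 1" "P' ** P = mat 1"
  shows "pker H (\<lambda>x. P' ** m x ** P) = pker H m"
proof -
  have "pm (P' ** A ** P) (mat 1) \<longleftrightarrow> pm A (mat 1)" for A
  proof
    assume "pm (P' ** A ** P) (mat 1)"
    then have "pm (P ** (P' ** A ** P) ** P') (P ** mat 1 ** P')" by (intro pm_mult pm_refl)
    moreover have "P ** (P' ** A ** P) ** P' = (P ** P') ** A ** (P ** P')" by (simp add: matrix_mul_assoc)
    ultimately show "pm A (mat 1)" by (simp add: assms)
  next
    assume "pm A (mat 1)"
    then have "pm (P' ** A ** P) (P' ** mat 1 ** P)" by (intro pm_mult pm_refl)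
    then show "pm (P' ** A ** P) (mat 1)" by (simp add: assms)
  qed
  then show ?thesis by (simp add: pker_def)
qed

context
  fixes H m assumes H: "subgroup H G" and m: "prep H m"
begin

lemma prep_carrier: "x \<in> H \<Longrightarrow> x \<in> carrier G" using subgroup.subset[OF H] by blast

lemma prep_one: "pm (m \<one>) (mat 1)"
proof -
  have o: "\<one> \<in> H" by (rule subgroup.one_closed[OF H])
  have "pm (m \<one>) (m \<one> ** m \<one>)" using prep_mult[OF m o o] by simp
  then have "pm (adj (m \<one>) ** m \<one>) (adj (m \<one>) ** (m \<one> ** m \<one>))" by (intro pm_mult pm_refl)
  then show ?thesis
    using adj_mult_self(1)[OF prep_det[OF m o]] by (simp add: matrix_mul_assoc pm_sym)
qed

lemma prep_inv: "x \<in> H \<Longrightarrow> pm (m (inv x)) (adj (m x))"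
proof -
  assume x: "x \<in> H"
  have i: "inv x \<in> H" by (rule subgroup.m_inv_closed[OF H x])
  have "pm (m \<one>) (m (inv x) ** m x)" using prep_mult[OF m i x] prep_carrier[OF x] by simp
  then have "pm (m (inv x) ** m x) (mat 1)" using prep_one pm_sym pm_trans by blast
  then have "pm ((m (inv x) ** m x) ** adj (m x)) (mat 1 ** adj (m x))" by (intro pm_mult pm_refl)
  then show ?thesis
    using adj_mult_self(2)[OF prep_det[OF m x]] by (simp add: matrix_mul_assoc[symmetric])
qed

lemma prep_inv_mult:
  assumes "x \<in> H" "y \<in> H" shows "pm (m (inv x \<otimes> y)) (adj (m x) ** m y)"
  using prep_mult[OF m subgroup.m_inv_closed[OF H assms(1)] assms(2)]
    pm_mult[OF prep_inv[OF assms(1)] pm_refl[of "m y"]] by (rule pm_trans)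

lemma prep_commutator:
  assumes x: "x \<in> H" and y: "y \<in> H"
  shows "pm (m (x \<otimes> y \<otimes> inv x \<otimes> inv y)) (m x ** m y ** adj (m x) ** adj (m y))"
proof -
  note i = subgroup.m_inv_closed[OF H] and c = subgroup.m_closed[OF H]
  have 1: "pm (m (x \<otimes> y)) (m x ** m y)" by (rule prep_mult[OF m x y])
  have 2: "pm (m (x \<otimes> y \<otimes> inv x)) (m x ** m y ** adj (m x))"
    by (rule pm_trans[OF prep_mult[OF m c[OF x y] i[OF x]]]) (intro pm_mult 1 prep_inv x)
  show ?thesis
    by (rule pm_trans[OF prep_mult[OF m c[OF c[OF x y] i[OF x]] i[OF y]]]) (intro pm_mult 2 prep_inv y)
qed

lemma subgroup_prep_pred:
  assumes "\<And>A. Q (- A) \<longleftrightarrow> Q A" "Q (mat 1)"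
    "\<And>x y. x \<in> H \<Longrightarrow> y \<in> H \<Longrightarrow> Q (m x) \<Longrightarrow> Q (m y) \<Longrightarrow> Q (m x ** m y)"
    "\<And>x. x \<in> H \<Longrightarrow> Q (m x) \<Longrightarrow> Q (adj (m x))"
  shows "subgroup {x \<in> H. Q (m x)} G"
proof (rule subgroupI)
  have Qpm: "Q A \<longleftrightarrow> Q B" if "pm A B" for A B using that assms(1)[of B] by (metis pm_def)
  show "{x \<in> H. Q (m x)} \<subseteq> carrier G" using prep_carrier by blast
  show "{x \<in> H. Q (m x)} \<noteq> {}" using subgroup.one_closed[OF H] Qpm[OF prep_one] assms(2) by blast
  show "inv a \<in> {x \<in> H. Q (m x)}" if a: "a \<in> {x \<in> H. Q (m x)}" for a
    using a subgroup.m_inv_closed[OF H, of a] Qpm[OF prep_inv, of a] assms(4)[of a] by simp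
  show "a \<otimes> b \<in> {x \<in> H. Q (m x)}" if a: "a \<in> {x \<in> H. Q (m x)}" "b \<in> {x \<in> H. Q (m x)}" for a b
    using a subgroup.m_closed[OF H, of a b] Qpm[OF prep_mult[OF m], of a b] assms(3)[of a b] by simp
qed

lemma subgroup_pker: "subgroup (pker H m) G"
  unfolding pker_def
proof (rule subgroup_prep_pred)
  show "pm (m x ** m y) (mat 1)" if "pm (m x) (mat 1)" "pm (m y) (mat 1)" for x y
    using pm_mult[OF that] by simp
  show "pm (adj (m x)) (mat 1)" if "pm (m x) (mat 1)" for x
    using pm_adj[OF that] by (simp add: mat_1_eq_mt)
qed simp_all

text \<open>Solvability of length two suffices, thanks to Property FW.\<close>

lemma fin_index_pker_metabelian:
  assumes FW: "FW H"
    and Q: "\<And>A. Q (- A) \<longleftrightarrow> Q A" "Q (mat 1)"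
    "\<And>x y. x \<in> H \<Longrightarrow> y \<in> H \<Longrightarrow> Q (m x) \<Longrightarrow> Q (m y) \<Longrightarrow> Q (m x ** m y)"
    "\<And>x. x \<in> H \<Longrightarrow> Q (m x) \<Longrightarrow> Q (adj (m x))"
    and fi: "fin_index H {x \<in> H. Q (m x)}"
    and comm: "\<And>x y. x \<in> H \<Longrightarrow> y \<in> H \<Longrightarrow> Q (m x) \<Longrightarrow> Q (m y) \<Longrightarrow> m x ** m y = m y ** m x"
  shows "fin_index H (pker H m)"
proof -
  define L where "L = {x \<in> H. Q (m x)}"
  have L: "subgroup L G" unfolding L_def by (rule subgroup_prep_pred[OF Q])
  have LH: "L \<subseteq> H" by (auto simp: L_def)
  have FWL: "FW L" by (rule property_FW_fin_index[OF H L LH fi[folded L_def] FW])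
  have kL: "pker H m \<subseteq> L" 
  proof
    fix x assume x: "x \<in> pker H m"
    then have "m x = mat 1 \<or> m x = - mat 1" by (simp add: pker_def pm_def)
    then have "Q (m x)" using Q(1)[of "mat 1"] Q(2) by metis
    then show "x \<in> L" using x by (simp add: L_def pker_def)
  qed
  have "fin_index L (pker H m)"
  proof (rule fin_index_commutators[OF L subgroup_pker kL FWL])
    fix x y assume "x \<in> L" "y \<in> L"
    then have xy: "x \<in> H" "y \<in> H" "Q (m x)" "Q (m y)" by (auto simp: L_def)
    have "m x ** m y ** adj (m x) ** adj (m y) = m y ** (m x ** adj (m x)) ** adj (m y)"
      by (simp add: comm[OF xy] matrix_mul_assoc)
    also have "\<dots> = mat 1" using prep_det[OF m] xy by (simp add: adj_mult_self)
    finally have "pm (m (x \<otimes> y \<otimes> inv x \<otimes> inv y)) (mat 1)" using prep_commutator[OF xy(1,2)] by simp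
    then show "x \<otimes> y \<otimes> inv x \<otimes> inv y \<in> pker H m"
      using xy subgroup.m_closed[OF H] subgroup.m_inv_closed[OF H] by (simp add: pker_def)
  qed
  then show ?thesis
    using fin_index_trans[OF subgroup.subset[OF H] L LH] fi by (simp add: L_def)
qed

lemma fin_index_pker_commuting:
  assumes FW: "FW H" and comm: "\<And>x y. x \<in> H \<Longrightarrow> y \<in> H \<Longrightarrow> m x ** m y = m y ** m x"
  shows "fin_index H (pker H m)"
proof (rule fin_index_pker_metabelian[OF FW, of "\<lambda>_. True"])
  show "fin_index H {x \<in> H. True}"
    by (rule fin_indexI[of "\<lambda>_. ()"])
       (use subgroup.m_inv_closed[OF H] subgroup.m_closed[OF H] prep_carrier in auto)
qed (use comm in auto)

text \<open>The image lies in a Borel subgroup. Commutators of upper triangular matrices are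
  unipotent up to sign, and such matrices commute; \<open>Q\<close> below singles them out.\<close>

lemma fin_index_pker_upper:
  assumes FW: "FW H" and up: "\<And>x. x \<in> H \<Longrightarrow> m x $ 2 $ 1 = 0"
  shows "fin_index H (pker H m)"
proof -
  define Q where "Q = (\<lambda>A :: real^2^2. A $ 2 $ 1 = 0 \<and> \<bar>A $ 1 $ 1\<bar> = 1 \<and> A $ 1 $ 1 = A $ 2 $ 2)"
  have Qmult: "Q (A ** B)" if "Q A" "Q B" for A B
    using that by (cases A rule: mt_cases, cases B rule: mt_cases) (auto simp: Q_def abs_mult)
  have Qadj: "Q (adj A)" if "Q A" for A
    using that by (cases A rule: mt_cases) (auto simp: Q_def)
  have Qminus: "Q (- A) \<longleftrightarrow> Q A" for A by (cases A rule: mt_cases) (auto simp: Q_def)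
  have Q1: "Q (mat 1)" by (simp add: Q_def mat_1_eq_mt)
  have Qpm: "Q A \<longleftrightarrow> Q B" if "pm A B" for A B using that Qminus[of B] by (metis pm_def)
  have sub: "subgroup {x \<in> H. Q (m x)} G"
    by (rule subgroup_prep_pred[OF Qminus Q1 Qmult Qadj])
  have fi: "fin_index H {x \<in> H. Q (m x)}"
  proof (rule fin_index_commutators[OF H sub _ FW])
    fix x y assume xy: "x \<in> H" "y \<in> H"
    obtain a b c d where x: "m x = mt a b c d" by (rule mt_cases)
    obtain a' b' c' d' where y: "m y = mt a' b' c' d'" by (rule mt_cases)
    have [simp]: "c = 0" "c' = 0" using up[OF xy(1)] up[OF xy(2)] x y by auto
    have dt: "a * d = 1" "a' * d' = 1" using prep_det[OF m xy(1)] prep_det[OF m xy(2)] x y by auto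
    have "a * a' * d * d' = (a * d) * (a' * d')" "d * d' * a * a' = (a * d) * (a' * d')" by (simp_all only: ac_simps)
    then have "Q (m x ** m y ** adj (m x) ** adj (m y))"
      unfolding x y using dt by (simp add: Q_def)
    then have "Q (m (x \<otimes> y \<otimes> inv x \<otimes> inv y))" using Qpm[OF prep_commutator[OF xy]] by simp
    then show "x \<otimes> y \<otimes> inv x \<otimes> inv y \<in> {x \<in> H. Q (m x)}"
      using xy subgroup.m_closed[OF H] subgroup.m_inv_closed[OF H] by simp
  qed auto
  show ?thesis
  proof (rule fin_index_pker_metabelian[OF FW Qminus Q1 Qmult Qadj fi])
    fix x y assume "Q (m x)" "Q (m y)"
    then show "m x ** m y = m y ** m x"
      by (cases "m x" rule: mt_cases, cases "m y" rule: mt_cases) (auto simp: Q_def algebra_simps)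
  qed
qed

text \<open>The image lies in the normaliser of the diagonal torus, in which the commutative group
  of diagonal matrices has index at most two.\<close>

lemma fin_index_pker_monomial:
  assumes FW: "FW H"
    and mono: "\<And>x. x \<in> H \<Longrightarrow> (m x $ 1 $ 2 = 0 \<and> m x $ 2 $ 1 = 0) \<or> (m x $ 1 $ 1 = 0 \<and> m x $ 2 $ 2 = 0)"
  shows "fin_index H (pker H m)"
proof -
  define Q where "Q = (\<lambda>A :: real^2^2. A $ 1 $ 2 = 0 \<and> A $ 2 $ 1 = 0)"
  have Qmult: "Q (A ** B)" if "Q A" "Q B" for A B
    using that by (cases A rule: mt_cases, cases B rule: mt_cases) (auto simp: Q_def)
  have Qadj: "Q (adj A)" if "Q A" for A
    using that by (cases A rule: mt_cases) (auto simp: Q_def)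
  have Qminus: "Q (- A) \<longleftrightarrow> Q A" for A by (cases A rule: mt_cases) (auto simp: Q_def)
  have Q1: "Q (mat 1)" by (simp add: Q_def mat_1_eq_mt)
  have Qpm: "Q A \<longleftrightarrow> Q B" if "pm A B" for A B using that Qminus[of B] by (metis pm_def)
  have fi: "fin_index H {x \<in> H. Q (m x)}"
  proof (rule fin_indexI[of "\<lambda>x. Q (m x)"])
    show "H \<subseteq> carrier G" using prep_carrier by blast
    fix x y assume xy: "x \<in> H" "y \<in> H" and eq: "Q (m x) = Q (m y)"
    have "Q (adj (m x) ** m y)"
      using mono[OF xy(1)] mono[OF xy(2)] eq
      by (cases "m x" rule: mt_cases, cases "m y" rule: mt_cases) (auto simp: Q_def)
    then show "inv x \<otimes> y \<in> {x \<in> H. Q (m x)}"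
      using Qpm[OF prep_inv_mult[OF xy]] xy subgroup.m_closed[OF H] subgroup.m_inv_closed[OF H] by simp
  qed simp
  show ?thesis
  proof (rule fin_index_pker_metabelian[OF FW Qminus Q1 Qmult Qadj fi])
    fix x y assume "Q (m x)" "Q (m y)"
    then show "m x ** m y = m y ** m x"
      by (cases "m x" rule: mt_cases, cases "m y" rule: mt_cases) (auto simp: Q_def algebra_simps)
  qed
qed

end

end

section \<open>Conjugacy types of matrices of determinant 1\<close>

lemma trace_commutator:
  "trace (A ** B ** adj A ** adj B) = 2 * det A * det B - det (A ** B - B ** A)" for A B :: "real^2^2"
proof -
  obtain a b c d where A: "A = mt a b c d" by (rule mt_cases)
  obtain a' b' c' d' where B: "B = mt a' b' c' d'" by (rule mt_cases)
  show ?thesis unfolding A B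
    by (simp add: trace_def sum_2 det_2) (simp add: algebra_simps)
qed

text \<open>By \<open>trace_commutator\<close> the hypothesis says that
  \<open>A ** B - B ** A\<close> has nonnegative determinant. On traceless matrices the negated
  determinant is a form of signature (2,1). The traceless part of an elliptic \<open>A\<close> is a
  negative vector, and the commutator is orthogonal to it, hence in a positive definite plane. There
  the form is nonnegative and vanishes only at zero, so the commutator is zero.\<close>

lemma elliptic_commute:
  assumes A: "(trace A)\<^sup>2 < 4" "det A = 1" and B: "det B = 1"
    and C: "\<bar>trace (A ** B ** adj A ** adj B)\<bar> \<le> 2"
  shows "A ** B = B ** A"
proof -
  obtain a b c d where A': "A = mt a b c d" by (rule mt_cases)
  obtain x y z w where B': "B = mt x y z w" by (rule mt_cases)
  define e where "e = a - d"
  define P where "P = b * z - c * y"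
  define Q where "Q = y * e - b * (x - w)"
  define R where "R = c * (x - w) - z * e"
  have "det (A ** B - B ** A) \<ge> 0" using trace_commutator[of A B] A(2) B C by simp
  moreover have "det (A ** B - B ** A) = - (P * P + Q * R)"
    unfolding A' B' by (simp add: det_2 P_def Q_def R_def e_def algebra_simps)
  ultimately have 1: "P * P + Q * R \<le> 0" by simp
  \<comment> \<open>\<open>P\<close>, \<open>Q\<close>, \<open>R\<close> are the entries of the
    commutator; this equation is its orthogonality to the traceless part of
    \<open>A\<close>.\<close>
  have lin: "e * P = - (b * R + c * Q)" by (simp add: P_def Q_def R_def algebra_simps)
  have "(a + d)\<^sup>2 < 4" using A(1) by (simp add: A' trace_def sum_2)
  moreover have "a * d - b * c = 1" using A(2) by (simp add: A')
  ultimately have 2: "e * e + 4 * (b * c) < 0" by (simp add: e_def power2_eq_square algebra_simps)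
  have bc: "b * c < 0" using 2 zero_le_square[of e] by linarith
  have QR: "Q * R \<le> 0" using 1 zero_le_square[of P] by linarith
  have sq: "(e * P) * (e * P) \<ge> 4 * ((b * c) * (Q * R))"
  proof -
    have "(b * R + c * Q)\<^sup>2 - 4 * ((b * R) * (c * Q)) = (b * R - c * Q)\<^sup>2"
      by (simp add: power2_eq_square algebra_simps)
    then have "(b * R + c * Q)\<^sup>2 \<ge> 4 * ((b * R) * (c * Q))" using zero_le_power2[of "b * R - c * Q"] by linarith
    then show ?thesis unfolding lin minus_mult_minus power2_eq_square by (simp add: ac_simps)
  qed
  have P0: "P = 0"
  proof (rule ccontr)
    assume "P \<noteq> 0"
    then have PP: "P * P > 0" using not_real_square_gt_zero by blast
    have "(b * c) * (Q * R) \<ge> (b * c) * (- (P * P))"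
      using 1 bc by (intro mult_left_mono_neg) auto
    then have "(e * e) * (P * P) \<ge> 4 * ((b * c) * (- (P * P)))" using sq by (simp add: ac_simps)
    then have "(e * e + 4 * (b * c)) * (P * P) \<ge> 0" by (simp add: algebra_simps)
    moreover have "(e * e + 4 * (b * c)) * (P * P) < 0" using 2 PP by (rule mult_neg_pos)
    ultimately show False by linarith
  qed
  have br: "b * R = - (c * Q)" using lin P0 by simp
  have b0: "b \<noteq> 0" "c \<noteq> 0" using bc by auto
  have "(b * c) * (Q * R) = - ((c * Q) * (c * Q))"
  proof -
    have "(b * c) * (Q * R) = (b * R) * (c * Q)" by (simp only: ac_simps)
    then show ?thesis unfolding br by simp
  qed
  moreover have "(b * c) * (Q * R) \<ge> 0" using bc QR by (simp add: mult_nonpos_nonpos)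
  ultimately have "(c * Q) * (c * Q) \<le> 0" by linarith
  then have "c * Q = 0" by (metis mult_eq_0_iff order_antisym zero_le_square)
  then have Q0: "Q = 0" using b0 by simp
  then have R0: "R = 0" using br b0 by simp
  show ?thesis unfolding A' B'
    using P0 Q0 R0 by (simp add: P_def Q_def R_def e_def algebra_simps)
qed

lemma diagonalize_via:
  fixes A P D :: "real^2^2"
  assumes "det P \<noteq> 0" "A ** P = P ** D"
  shows "\<exists>P'. P ** P' = mat 1 \<and> P' ** P = mat 1 \<and> P' ** A ** P = D"
proof -
  have "invertible P" using assms(1) by (simp add: invertible_det_nz)
  then obtain P' where P': "P ** P' = mat 1" "P' ** P = mat 1" by (auto simp: invertible_def)
  have "P' ** A ** P = P' ** (P ** D)" by (simp add: assms(2) flip: matrix_mul_assoc)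
  also have "\<dots> = D" by (simp add: matrix_mul_assoc P')
  finally show ?thesis using P' by blast
qed

lemma hyperbolic_diagonalizable:
  fixes A :: "real^2^2"
  assumes "det A = 1" "\<bar>trace A\<bar> > 2"
  shows "\<exists>P P' l. P ** P' = mat 1 \<and> P' ** P = mat 1 \<and> \<bar>l\<bar> > 1 \<and> P' ** A ** P = mt l 0 0 (1 / l)"
proof -
  obtain a b c d where A: "A = mt a b c d" by (rule mt_cases)
  define t where "t = a + d"
  have t: "\<bar>t\<bar> > 2" using assms(2) by (simp add: A trace_def sum_2 t_def)
  have dt: "a * d - b * c = 1" using assms(1) by (simp add: A)
  have "2 * 2 < \<bar>t\<bar> * \<bar>t\<bar>" using t by (intro mult_strict_mono) auto
  then have disc: "t * t - 4 > 0" by simp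
  define r where "r = sqrt (t * t - 4)"
  have r: "r > 0" "r * r = t * t - 4" using disc by (auto simp: r_def)
  have "\<exists>l. \<bar>l\<bar> > 1 \<and> l + 1 / l = t"
  proof -
    define l1 where "l1 = (t + r) / 2"
    define l2 where "l2 = (t - r) / 2"
    have p: "l1 * l2 = 1" using r by (simp add: l1_def l2_def algebra_simps)
    have s: "l1 + l2 = t" by (simp add: l1_def l2_def field_simps)
    have ne: "l1 \<noteq> l2" using r by (simp add: l1_def l2_def)
    have n0: "l1 \<noteq> 0" "l2 \<noteq> 0" using p by auto
    have i: "l2 = 1 / l1" "l1 = 1 / l2" using p n0 by (simp_all add: field_simps)
    have "\<bar>l1\<bar> * \<bar>l2\<bar> = 1" using p by (metis abs_mult abs_one)
    have "\<bar>l1\<bar> > 1 \<or> \<bar>l2\<bar> > 1"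
    proof (rule ccontr)
      assume "\<not> ?thesis"
      then have le: "\<bar>l1\<bar> \<le> 1" "\<bar>l2\<bar> \<le> 1" by auto
      have "\<bar>l1\<bar> * \<bar>l2\<bar> \<le> \<bar>l1\<bar> * 1" using le by (intro mult_left_mono) auto
      then have "\<bar>l1\<bar> = 1" using le \<open>\<bar>l1\<bar> * \<bar>l2\<bar> = 1\<close> by linarith
      then have "l1 = 1 \<or> l1 = - 1" by linarith
      then show False using i(1) ne by (elim disjE) simp_all
    qed
    moreover have "l1 + 1 / l1 = t" "l2 + 1 / l2 = t" using s i by (metis add.commute)+
    ultimately show ?thesis by blast
  qed
  then obtain l where l: "\<bar>l\<bar> > 1" "l + 1 / l = t" by blast
  define k where "k = 1 / l"
  have l0: "l \<noteq> 0" using l(1) by auto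
  have lk: "l * k = 1" "l + k = a + d" using l l0 by (auto simp: k_def t_def)
  have "l \<noteq> k"
  proof
    assume "l = k"
    then have "\<bar>l\<bar> * \<bar>l\<bar> = 1" using lk by (metis abs_mult abs_one)
    moreover have "1 * 1 < \<bar>l\<bar> * \<bar>l\<bar>" using l by (intro mult_strict_mono) auto
    ultimately show False by simp
  qed
  \<comment> \<open>The columns of \<open>P\<close> are eigenvectors for \<open>l\<close> and
    \<open>k\<close>. For \<open>b = 0\<close> the matrix is triangular, and its diagonal is formed
    by the two eigenvalues in one of the two orders.\<close>
  have "\<exists>P. det P \<noteq> 0 \<and> A ** P = P ** mt l 0 0 k"
  proof (cases "b = 0")
    case False
    have bc: "b * c = a * d - 1" using dt by simp
    have d: "d = l + k - a" using lk(2) by simp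
    show ?thesis
      by (rule exI[of _ "mt b b (l - a) (k - a)"])
         (use False \<open>l \<noteq> k\<close> bc lk in \<open>simp add: A d algebra_simps\<close>)
  next
    case True
    have "(a - l) * (a - k) = a * a - a * (l + k) + l * k" by (simp add: algebra_simps)
    also have "\<dots> = 0" using True dt lk by (simp add: algebra_simps)
    finally consider "a = l" "d = k" | "a = k" "d = l" using lk(2) by fastforce
    then show ?thesis
    proof cases
      case 1
      then show ?thesis using True \<open>l \<noteq> k\<close>
        by (intro exI[of _ "mt (l - k) 0 c 1"]) (simp add: A algebra_simps)
    next
      case 2
      then show ?thesis using True \<open>l \<noteq> k\<close>
        by (intro exI[of _ "mt 0 (k - l) 1 c"]) (simp add: A algebra_simps)
    qed
  qed
  then obtain P where P: "det P \<noteq> 0" "A ** P = P ** mt l 0 0 k" by blast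
  show ?thesis using diagonalize_via[OF P] l(1) unfolding k_def by blast
qed

lemma parabolic_triangularizable:
  fixes A :: "real^2^2"
  assumes "det A = 1" "\<bar>trace A\<bar> = 2" "\<not> pm A (mat 1)"
  shows "\<exists>P P' e r. P ** P' = mat 1 \<and> P' ** P = mat 1 \<and> (e = 1 \<or> e = - 1) \<and> r \<noteq> 0 \<and> P' ** A ** P = mt e r 0 e"
proof -
  obtain a b c d where A: "A = mt a b c d" by (rule mt_cases)
  define e where "e = (a + d) / 2"
  have e: "e = 1 \<or> e = - 1" using assms(2) by (auto simp: A trace_def sum_2 e_def)
  have ee: "e * e = 1" using e by auto
  have d: "d = 2 * e - a" by (simp add: e_def field_simps)
  have dt: "a * d - b * c = 1" using assms(1) by (simp add: A)
  \<comment> \<open>For \<open>c \<noteq> 0\<close> the columns form a Jordan chain: the second is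
    the first basis vector, the first its image under \<open>A\<close> minus
    \<open>e\<close>.\<close>
  have "\<exists>P r. det P \<noteq> 0 \<and> r \<noteq> 0 \<and> A ** P = P ** mt e r 0 e"
  proof (cases "c = 0")
    case False
    have "b * c = a * d - 1" using dt by simp
    then show ?thesis
      by (intro exI[of _ "mt (a - e) 1 c 0"] exI[of _ 1])
         (use False ee in \<open>simp add: A d algebra_simps\<close>)
  next
    case True
    have "(a - e) * (a - e) = 0" using dt True ee by (simp add: d algebra_simps)
    then have ad: "a = e" "d = e" using d by auto
    have "b \<noteq> 0"
    proof
      assume "b = 0"
      then show False using assms(3) e True ad by (auto simp: A pm_def mat_1_eq_mt)
    qed
    then show ?thesis using True ad
      by (intro exI[of _ "mt 1 0 0 1"] exI[of _ b]) (simp add: A)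
  qed
  then obtain P r where P: "det P \<noteq> 0" "r \<noteq> 0" "A ** P = P ** mt e r 0 e" by blast
  show ?thesis using diagonalize_via[OF P(1,3)] P(2) e by blast
qed

lemma trace_conj:
  fixes A P P' :: "real^2^2"
  assumes "P ** P' = mat 1"
  shows "trace (P' ** A ** P) = trace A"
proof -
  have "trace (P' ** A ** P) = trace (P ** (P' ** A))" by (rule trace_mul_sym)
  then show ?thesis by (simp add: matrix_mul_assoc assms)
qed

text \<open>Multiplied by \<open>l ^ n\<close>, each expression becomes \<open>p\<close> times a
  power of \<open>l ^ 2\<close>, plus \<open>q\<close>; since \<open>l ^ 2 > 1\<close>, it vanishes
  for at most one \<open>n\<close>. It is used to make all entries of a product nonzero
  simultaneously.\<close>

lemma power_avoids:
  fixes l :: real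
  assumes l: "\<bar>l\<bar> > 1" and F: "finite F" "\<And>p q. (p, q) \<in> F \<Longrightarrow> p \<noteq> 0 \<or> q \<noteq> 0"
  shows "\<exists>n. \<forall>(p, q)\<in>F. p * l ^ n + q / l ^ n \<noteq> 0"
proof -
  have l0: "l \<noteq> 0" using l by auto
  have inj: "m = n" if "(l ^ 2) ^ m = (l ^ 2) ^ n" for m n :: nat
  proof -
    have "1 < l ^ 2" using l by (metis abs_square_less_1 linorder_neqE_linordered_idom not_less_iff_gr_or_eq one_less_power pos2 power2_abs)
    then show ?thesis using that by (simp add: power_inject_exp)
  qed
  have "finite {n. p * l ^ n + q / l ^ n = 0}" if "(p, q) \<in> F" for p q
  proof -
    have "m = n" if m: "p * l ^ m + q / l ^ m = 0" and n: "p * l ^ n + q / l ^ n = 0" for m n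
    proof -
      have e: "p * (l ^ 2) ^ k = - q" if "p * l ^ k + q / l ^ k = 0" for k
      proof -
        have "(p * l ^ k + q / l ^ k) * l ^ k = p * (l ^ 2) ^ k + q"
          using l0 by (simp add: distrib_right power_mult_distrib power2_eq_square)
        then show ?thesis using that by simp
      qed
      have "p \<noteq> 0" using e[OF m] F(2)[OF \<open>(p, q) \<in> F\<close>] by auto
      then show "m = n" using inj e[OF m] e[OF n] by (metis mult_left_cancel)
    qed
    then have "\<exists>k. {n. p * l ^ n + q / l ^ n = 0} \<subseteq> {k}" by blast
    then show ?thesis using finite_subset by blast
  qed
  then have "finite (\<Union>(p, q)\<in>F. {n. p * l ^ n + q / l ^ n = 0})" using F(1) by (intro finite_UN_I) auto
  then obtain n where "n \<notin> (\<Union>(p, q)\<in>F. {n. p * l ^ n + q / l ^ n = 0})"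
    using ex_new_if_finite[OF infinite_UNIV_nat] by blast
  then show ?thesis by (intro exI[of _ n]) auto
qed

section \<open>Subgroups of PSL_2(R) with Property FW\<close>

context group
begin

context
  fixes H m assumes H: "subgroup H G" and m: "prep H m"
begin

lemma prep_diag_power:
  assumes a: "a \<in> H" "m a = mt l 0 0 (1 / l)"
  shows "a [^] (n :: nat) \<in> H \<and> pm (m (a [^] n)) (mt (l ^ n) 0 0 (1 / l ^ n))"
proof (induction n)
  case 0
  show ?case using prep_one[OF H m] subgroup.one_closed[OF H] by (simp add: mat_1_eq_mt)
next
  case (Suc n)
  have "pm (m (a [^] n \<otimes> a)) (m (a [^] n) ** m a)" using prep_mult[OF m] Suc a by blast
  also have "pm (m (a [^] n) ** m a) (mt (l ^ n) 0 0 (1 / l ^ n) ** m a)" using Suc by (intro pm_mult) auto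
  also have "mt (l ^ n) 0 0 (1 / l ^ n) ** m a = mt (l ^ Suc n) 0 0 (1 / l ^ Suc n)" by (simp add: a)
  finally show ?case using subgroup.m_closed[OF H] Suc a by simp
qed

text \<open>The first column is the image of the first basis vector. If all these images lay on the
  coordinate axes, an element \<open>g0\<close> carrying the first axis to the second would show
  that the group permutes the two axes, so that all its matrices would be monomial.\<close>

lemma prep_first_column:
  assumes nup: "\<not> (\<forall>x\<in>H. m x $ 2 $ 1 = 0)"
    and nmono: "\<not> (\<forall>x\<in>H. (m x $ 1 $ 2 = 0 \<and> m x $ 2 $ 1 = 0) \<or> (m x $ 1 $ 1 = 0 \<and> m x $ 2 $ 2 = 0))"
  shows "\<exists>g\<in>H. m g $ 1 $ 1 \<noteq> 0 \<and> m g $ 2 $ 1 \<noteq> 0"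
proof (rule ccontr)
  assume "\<not> ?thesis"
  then have no: "m g $ 1 $ 1 = 0 \<or> m g $ 2 $ 1 = 0" if "g \<in> H" for g using that by blast
  have prod: "(m g ** m h) $ 1 $ 1 = 0 \<or> (m g ** m h) $ 2 $ 1 = 0" if gh: "g \<in> H" "h \<in> H" for g h
  proof -
    have "m (g \<otimes> h) = m g ** m h \<or> m (g \<otimes> h) = - (m g ** m h)"
      using prep_mult[OF m gh] by (simp add: pm_def)
    then show ?thesis using no[OF subgroup.m_closed[OF H gh]] by auto
  qed
  obtain g0 where g0: "g0 \<in> H" "m g0 $ 2 $ 1 \<noteq> 0" using nup by blast
  obtain x y z w where M0: "m g0 = mt x y z w" by (rule mt_cases)
  have z: "z \<noteq> 0" "x = 0" using g0 no[OF g0(1)] M0 by auto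
  have y: "y \<noteq> 0" using prep_det[OF m g0(1)] M0 z by auto
  have "(m x $ 1 $ 2 = 0 \<and> m x $ 2 $ 1 = 0) \<or> (m x $ 1 $ 1 = 0 \<and> m x $ 2 $ 2 = 0)" if g: "g \<in> H" "x = g" for g x
  proof -
    obtain a b c d where M: "m g = mt a b c d" by (rule mt_cases)
    have dt: "a * d - b * c = 1" using prep_det[OF m g(1)] M by simp
    show ?thesis
    proof (cases "c = 0")
      case True
      then have "d \<noteq> 0" using dt by auto
      then have "b = 0" using prod[OF g(1) g0(1)] z True by (simp add: M M0)
      then show ?thesis using True g M by simp
    next
      case False
      then have a: "a = 0" using no[OF g(1)] M by simp
      then have "b \<noteq> 0" using dt by auto
      then have "d = 0" using prod[OF g(1) g(1)] False a by (simp add: M)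
      then show ?thesis using a g M by simp
    qed
  qed
  then show False using nmono by blast
qed

end

lemma prep_swap:
  assumes "prep H m"
  shows "prep H (\<lambda>x. mt 0 1 1 0 ** m x ** mt 0 1 1 0)"
    "pker H (\<lambda>x. mt 0 1 1 0 ** m x ** mt 0 1 1 0) = pker H m"
  by (rule prep_conj[OF assms] pker_conj; simp add: mat_1_eq_mt)+

lemma swap_nth:
  "(mt 0 1 1 0 ** A ** mt 0 1 1 0) $ 1 $ 1 = A $ 2 $ 2" "(mt 0 1 1 0 ** A ** mt 0 1 1 0) $ 1 $ 2 = A $ 2 $ 1"
  "(mt 0 1 1 0 ** A ** mt 0 1 1 0) $ 2 $ 1 = A $ 1 $ 2" "(mt 0 1 1 0 ** A ** mt 0 1 1 0) $ 2 $ 2 = A $ 1 $ 1"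
  by (cases A rule: mt_cases; simp)+

text \<open>One element \<open>g\<close> has no zero in its first column and, after exchanging the
  coordinates, another element \<open>h\<close> has none in its second. High powers of
  \<open>a\<close> inserted between them prevent cancellation: the entries of \<open>g a^n h\<close>
  have the shape treated by \<open>power_avoids\<close>. If the upper left entry of \<open>h\<close>
  vanishes, \<open>h a^n h\<close> serves instead.\<close>

lemma prep_generic_element:
  assumes H: "subgroup H G" and m: "prep H m" and FW: "FW H"
    and a: "a \<in> H" "m a = mt l 0 0 (1 / l)" "\<bar>l\<bar> > 1"
    and nfi: "\<not> fin_index H (pker H m)"
  shows "\<exists>g\<in>H. m g $ 1 $ 1 \<noteq> 0 \<and> m g $ 1 $ 2 \<noteq> 0 \<and> m g $ 2 $ 1 \<noteq> 0 \<and> m g $ 2 $ 2 \<noteq> 0"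
proof -
  define m' where "m' = (\<lambda>x. mt 0 1 1 0 ** m x ** mt 0 1 1 0)"
  note sw = prep_swap[OF m, folded m'_def] and nth = swap_nth[of "m x" for x]
  have nth': "m' x $ 1 $ 1 = m x $ 2 $ 2" "m' x $ 1 $ 2 = m x $ 2 $ 1"
    "m' x $ 2 $ 1 = m x $ 1 $ 2" "m' x $ 2 $ 2 = m x $ 1 $ 1" for x
    by (simp_all add: m'_def swap_nth)
  have nup: "\<not> (\<forall>x\<in>H. m x $ 2 $ 1 = 0)" using fin_index_pker_upper[OF H m FW] nfi by blast
  have nlow: "\<not> (\<forall>x\<in>H. m' x $ 2 $ 1 = 0)" using fin_index_pker_upper[OF H sw(1) FW] nfi sw(2) by metis
  have nmono: "\<not> (\<forall>x\<in>H. (m x $ 1 $ 2 = 0 \<and> m x $ 2 $ 1 = 0) \<or> (m x $ 1 $ 1 = 0 \<and> m x $ 2 $ 2 = 0))"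
    using fin_index_pker_monomial[OF H m FW] nfi by blast
  have nmono': "\<not> (\<forall>x\<in>H. (m' x $ 1 $ 2 = 0 \<and> m' x $ 2 $ 1 = 0) \<or> (m' x $ 1 $ 1 = 0 \<and> m' x $ 2 $ 2 = 0))"
    using nmono unfolding nth' by (simp add: conj_commute)
  obtain g where g: "g \<in> H" "m g $ 1 $ 1 \<noteq> 0" "m g $ 2 $ 1 \<noteq> 0"
    using prep_first_column[OF H m nup nmono] by blast
  obtain h where h: "h \<in> H" "m h $ 2 $ 2 \<noteq> 0" "m h $ 1 $ 2 \<noteq> 0"
    using prep_first_column[OF H sw(1) nlow nmono'] unfolding nth' by blast
  have prod: "\<exists>g\<in>H. m g $ 1 $ 1 \<noteq> 0 \<and> m g $ 1 $ 2 \<noteq> 0 \<and> m g $ 2 $ 1 \<noteq> 0 \<and> m g $ 2 $ 2 \<noteq> 0"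
    if u: "u \<in> H" "m u = mt x y z w" and v: "v \<in> H" "m v = mt x' y' z' w'"
      and nz: "x * x' \<noteq> 0 \<or> y * z' \<noteq> 0" "x * y' \<noteq> 0 \<or> y * w' \<noteq> 0" "z * x' \<noteq> 0 \<or> w * z' \<noteq> 0" "z * y' \<noteq> 0 \<or> w * w' \<noteq> 0"
    for u v x y z w x' y' z' w'
  proof -
    define F where "F = {(x * x', y * z'), (x * y', y * w'), (z * x', w * z'), (z * y', w * w')}"
    have "p \<noteq> 0 \<or> q \<noteq> 0" if "(p, q) \<in> F" for p q
      using that nz by (simp only: F_def insert_iff empty_iff prod.inject) metis
    moreover have "finite F" by (simp add: F_def)
    ultimately obtain n where nF: "\<forall>(p, q)\<in>F. p * l ^ n + q / l ^ n \<noteq> 0"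
      using power_avoids[OF a(3), of F] by metis
    have n: "x * x' * l ^ n + y * z' / l ^ n \<noteq> 0" "x * y' * l ^ n + y * w' / l ^ n \<noteq> 0"
      "z * x' * l ^ n + w * z' / l ^ n \<noteq> 0" "z * y' * l ^ n + w * w' / l ^ n \<noteq> 0"
      using nF by (simp_all add: F_def)
    have an: "a [^] n \<in> H" "pm (m (a [^] n)) (mt (l ^ n) 0 0 (1 / l ^ n))" using prep_diag_power[OF H m a(1,2)] by auto
    define q where "q = u \<otimes> a [^] n \<otimes> v"
    have q: "q \<in> H" unfolding q_def by (intro subgroup.m_closed[OF H] u v an)
    have "pm (m q) (m (u \<otimes> a [^] n) ** m v)" unfolding q_def
      by (intro prep_mult[OF m] subgroup.m_closed[OF H] u v an)
    also have "pm (m (u \<otimes> a [^] n) ** m v) (m u ** m (a [^] n) ** m v)"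
      by (intro pm_mult prep_mult[OF m] u an pm_refl)
    also have "pm (m u ** m (a [^] n) ** m v) (m u ** mt (l ^ n) 0 0 (1 / l ^ n) ** m v)"
      by (intro pm_mult an pm_refl)
    also have "m u ** mt (l ^ n) 0 0 (1 / l ^ n) ** m v =
      mt (x * x' * l ^ n + y * z' / l ^ n) (x * y' * l ^ n + y * w' / l ^ n)
         (z * x' * l ^ n + w * z' / l ^ n) (z * y' * l ^ n + w * w' / l ^ n)"
      by (simp add: u v)
    finally show ?thesis using q n by (intro bexI[of _ q]) (auto simp: pm_def)
  qed
  obtain x y z w where mg: "m g = mt x y z w" by (rule mt_cases)
  obtain x' y' z' w' where mh: "m h = mt x' y' z' w'" by (rule mt_cases)
  have nz: "x \<noteq> 0" "z \<noteq> 0" "w' \<noteq> 0" "y' \<noteq> 0" using g h mg mh by auto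
  show ?thesis
  proof (cases "x' = 0")
    case False
    show ?thesis by (rule prod[OF g(1) mg h(1) mh]) (use nz False in auto)
  next
    case True
    then have "z' \<noteq> 0" using prep_det[OF m h(1)] mh by auto
    then show ?thesis by (intro prod[OF h(1) mh h(1) mh]) (use nz True in auto)
  qed
qed

text \<open>Without hyperbolic elements the image is small. A parabolic element forces all others to
  share its fixed point, for otherwise traces of products with its powers would be unbounded. If
  there is no parabolic element either, every commutator has trace at most 2 in modulus and
  \<open>elliptic_commute\<close> makes the image commutative.\<close>

theorem prep_dichotomy:
  assumes H: "subgroup H G" and m: "prep H m" and FW: "FW H"
  shows "fin_index H (pker H m) \<or>
    (\<exists>P P' a g l. P ** P' = mat 1 \<and> P' ** P = mat 1 \<and> a \<in> H \<and> g \<in> H \<and> \<bar>l\<bar> > 1 \<and>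
       P' ** m a ** P = mt l 0 0 (1 / l) \<and>
       (\<forall>i j. (P' ** m g ** P) $ i $ j \<noteq> 0))"
proof (cases "fin_index H (pker H m)")
  case nfi: False
  show ?thesis
  proof (cases "\<exists>a\<in>H. \<bar>trace (m a)\<bar> > 2")
    case True
    then obtain a where a: "a \<in> H" "\<bar>trace (m a)\<bar> > 2" by blast
    obtain P P' l where P: "P ** P' = mat 1" "P' ** P = mat 1" "\<bar>l\<bar> > 1" "P' ** m a ** P = mt l 0 0 (1 / l)"
      using hyperbolic_diagonalizable[OF prep_det[OF m a(1)] a(2)] by blast
    have nfi': "\<not> fin_index H (pker H (\<lambda>x. P' ** m x ** P))"
      using nfi pker_conj[OF P(1,2)] by simp
    obtain g where g: "g \<in> H" "(P' ** m g ** P) $ 1 $ 1 \<noteq> 0" "(P' ** m g ** P) $ 1 $ 2 \<noteq> 0"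
        "(P' ** m g ** P) $ 2 $ 1 \<noteq> 0" "(P' ** m g ** P) $ 2 $ 2 \<noteq> 0"
      using prep_generic_element[OF H prep_conj[OF m P(1,2)] FW a(1) P(4,3) nfi'] by blast
    have "\<forall>i j. (P' ** m g ** P) $ i $ j \<noteq> 0" using g by (simp add: forall_2)
    then show ?thesis using P a(1) g(1) by blast
  next
    case False
    then have tr: "\<bar>trace (m x)\<bar> \<le> 2" if "x \<in> H" for x using that by force
    have tr': "\<bar>trace A\<bar> \<le> 2" if "x \<in> H" "pm (m x) A" for x A
    proof -
      have "trace (- A) = - trace A" by (simp add: trace_def sum_negf)
      then show ?thesis using tr[OF that(1)] that(2) by (auto simp: pm_def)
    qed
    show ?thesis
    proof (cases "\<exists>u\<in>H. \<bar>trace (m u)\<bar> = 2 \<and> \<not> pm (m u) (mat 1)")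
      case True
      then obtain u where u: "u \<in> H" "\<bar>trace (m u)\<bar> = 2" "\<not> pm (m u) (mat 1)" by blast
      obtain P P' e r where P: "P ** P' = mat 1" "P' ** P = mat 1" "e = 1 \<or> e = - 1" "r \<noteq> 0" "P' ** m u ** P = mt e r 0 e"
        using parabolic_triangularizable[OF prep_det[OF m u(1)] u(2,3)] by blast
      define m' where "m' = (\<lambda>x. P' ** m x ** P)"
      have m': "prep H m'" unfolding m'_def by (rule prep_conj[OF m P(1,2)])
      define s where "s = r * e"
      have s: "s \<noteq> 0" using P by (auto simp: s_def)
      have mu: "pm (m' u) (mt 1 s 0 1)" using P(3,5) by (auto simp: m'_def pm_def s_def)
      \<comment> \<open>Multiplying \<open>m' x\<close> by these powers adds \<open>n * s\<close>
        times its lower left entry to the trace, so that entry must vanish.\<close>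
      have pow: "\<exists>y\<in>H. pm (m' y) (mt 1 (real n * s) 0 1)" for n
      proof (induction n)
        case 0
        show ?case using prep_one[OF H m'] subgroup.one_closed[OF H] by (auto simp: mat_1_eq_mt)
      next
        case (Suc n)
        then obtain y where y: "y \<in> H" "pm (m' y) (mt 1 (real n * s) 0 1)" by blast
        have "pm (m' (y \<otimes> u)) (m' y ** m' u)" by (rule prep_mult[OF m' y(1) u(1)])
        also have "pm (m' y ** m' u) (mt 1 (real n * s) 0 1 ** mt 1 s 0 1)" by (intro pm_mult y mu)
        finally have "pm (m' (y \<otimes> u)) (mt 1 (real (Suc n) * s) 0 1)" by (simp add: algebra_simps)
        then show ?case using subgroup.m_closed[OF H y(1) u(1)] by blast
      qed
      have "m' x $ 2 $ 1 = 0" if x: "x \<in> H" for x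
      proof (rule ccontr)
        obtain a b c d where mx: "m' x = mt a b c d" by (rule mt_cases)
        assume "m' x $ 2 $ 1 \<noteq> 0"
        then have "s * c \<noteq> 0" using mx s by simp
        then obtain n where n: "real n * \<bar>s * c\<bar> > 2 + \<bar>a + d\<bar>"
          using reals_Archimedean3[of "\<bar>s * c\<bar>"] by auto
        obtain y where y: "y \<in> H" "pm (m' y) (mt 1 (real n * s) 0 1)" using pow by blast
        have "pm (m' (y \<otimes> x)) (mt 1 (real n * s) 0 1 ** m' x)"
          using pm_trans[OF prep_mult[OF m' y(1) x] pm_mult[OF y(2) pm_refl]] .
        moreover have "\<bar>trace (m' (y \<otimes> x))\<bar> \<le> 2"
          unfolding m'_def trace_conj[OF P(1)] by (rule tr[OF subgroup.m_closed[OF H y(1) x]])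
        moreover have "trace (- (mt 1 (real n * s) 0 1 ** m' x)) = - trace (mt 1 (real n * s) 0 1 ** m' x)"
          by (simp add: trace_def sum_negf)
        ultimately have "\<bar>trace (mt 1 (real n * s) 0 1 ** m' x)\<bar> \<le> 2" by (auto simp: pm_def)
        then have "\<bar>a + d + real n * (s * c)\<bar> \<le> 2" by (simp add: mx trace_def sum_2 algebra_simps)
        moreover have "\<bar>real n * (s * c)\<bar> = real n * \<bar>s * c\<bar>" by (simp add: abs_mult)
        ultimately show False using n by linarith
      qed
      then have "fin_index H (pker H m')" using fin_index_pker_upper[OF H m' FW] by blast
      then show ?thesis using nfi pker_conj[OF P(1,2)] by (simp add: m'_def)
    next
      case ell: False
      have "m x ** m y = m y ** m x" if xy: "x \<in> H" "y \<in> H" for x y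
      proof (cases "pm (m x) (mat 1)")
        case True
        then show ?thesis by (auto simp: pm_def matrix_minus_mult)
      next
        case False
        then have "\<bar>trace (m x)\<bar> < 2" using ell tr xy(1) by force
        then have "(trace (m x))\<^sup>2 < 4" using abs_square_less_1[of "trace (m x) / 2"] by (simp add: power_divide)
        moreover have "\<bar>trace (m x ** m y ** adj (m x) ** adj (m y))\<bar> \<le> 2"
          by (rule tr'[OF _ prep_commutator[OF H m xy]])
             (intro subgroup.m_closed[OF H] subgroup.m_inv_closed[OF H] xy)
        ultimately show ?thesis using elliptic_commute prep_det[OF m] xy by blast
      qed
      then show ?thesis using fin_index_pker_commuting[OF H m FW] by blast
    qed
  qed
qed blast

end

subsection \<open>Zariski density\<close>

text \<open>Laurent polynomials, regarded away from \<open>0\<close> and with denominators cleared.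
  A polynomial in the entries, evaluated on the diagonal torus, is of this kind, hence vanishes on
  the whole torus as soon as it has infinitely many zeros there.\<close>

definition laurent :: "(real \<Rightarrow> real) \<Rightarrow> bool" where
  "laurent f \<longleftrightarrow> (\<exists>N q. \<forall>t. t \<noteq> 0 \<longrightarrow> f t * t ^ N = poly q t)"

lemma laurentI: "(\<And>t. t \<noteq> 0 \<Longrightarrow> f t * t ^ N = poly q t) \<Longrightarrow> laurent f"
  unfolding laurent_def by blast

lemma laurent_const: "laurent (\<lambda>_. c)"
  by (rule laurentI[where N = 0 and q = "[:c:]"]) simp

lemma laurent_id: "laurent (\<lambda>t. t)"
  by (rule laurentI[where N = 0 and q = "[:0, 1:]"]) simp

lemma laurent_inverse: "laurent (\<lambda>t. 1 / t)"
  by (rule laurentI[where N = 1 and q = "[:1:]"]) simp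

lemma laurent_add:
  assumes "laurent f" "laurent g" shows "laurent (\<lambda>t. f t + g t)"
proof -
  obtain N q M r where *: "\<And>t. t \<noteq> 0 \<Longrightarrow> f t * t ^ N = poly q t" "\<And>t. t \<noteq> 0 \<Longrightarrow> g t * t ^ M = poly r t"
    using assms unfolding laurent_def by blast
  show ?thesis
  proof (rule laurentI[where N = "N + M" and q = "q * Polynomial.monom 1 M + r * Polynomial.monom 1 N"])
    fix t :: real assume t: "t \<noteq> 0"
    have "(f t + g t) * t ^ (N + M) = (f t * t ^ N) * t ^ M + (g t * t ^ M) * t ^ N"
      by (simp add: power_add algebra_simps)
    then show "(f t + g t) * t ^ (N + M) = poly (q * Polynomial.monom 1 M + r * Polynomial.monom 1 N) t"
      using *[OF t] by (simp add: Polynomial.poly_monom)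
  qed
qed

lemma laurent_mult:
  assumes "laurent f" "laurent g" shows "laurent (\<lambda>t. f t * g t)"
proof -
  obtain N q M r where *: "\<And>t. t \<noteq> 0 \<Longrightarrow> f t * t ^ N = poly q t" "\<And>t. t \<noteq> 0 \<Longrightarrow> g t * t ^ M = poly r t"
    using assms unfolding laurent_def by blast
  show ?thesis
  proof (rule laurentI[where N = "N + M" and q = "q * r"])
    fix t :: real assume t: "t \<noteq> 0"
    have "f t * g t * t ^ (N + M) = (f t * t ^ N) * (g t * t ^ M)"
      by (simp add: power_add algebra_simps)
    then show "f t * g t * t ^ (N + M) = poly (q * r) t"
      using *[OF t] by simp
  qed
qed

lemma laurent_zero:
  assumes "laurent f" "infinite {t. t \<noteq> 0 \<and> f t = 0}" "t \<noteq> 0"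
  shows "f t = 0"
proof -
  obtain N q where *: "\<And>t. t \<noteq> 0 \<Longrightarrow> f t * t ^ N = poly q t"
    using assms unfolding laurent_def by blast
  have "{t. t \<noteq> 0 \<and> f t = 0} \<subseteq> {t. poly q t = 0}" using *[symmetric] by auto
  then have "infinite {t. poly q t = 0}" using assms(2) finite_subset by blast
  then have "q = 0" using poly_roots_finite by blast
  then show ?thesis using *[OF assms(3)] assms(3) by simp
qed

lemma laurent_real_polynomial_function:
  fixes F :: "real \<Rightarrow> real^2^2"
  assumes "real_polynomial_function p" "\<And>i j. laurent (\<lambda>t. F t $ i $ j)"
  shows "laurent (\<lambda>t. p (F t))"
  using assms(1)
proof induction
  case (linear f)
  interpret bounded_linear f by (rule linear)
  have "f A = A $ 1 $ 1 * f (mt 1 0 0 0) + A $ 1 $ 2 * f (mt 0 1 0 0)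
      + A $ 2 $ 1 * f (mt 0 0 1 0) + A $ 2 $ 2 * f (mt 0 0 0 1)" for A
  proof -
    have "A = (A $ 1 $ 1) *\<^sub>R mt 1 0 0 0 + (A $ 1 $ 2) *\<^sub>R mt 0 1 0 0
      + (A $ 2 $ 1) *\<^sub>R mt 0 0 1 0 + (A $ 2 $ 2) *\<^sub>R mt 0 0 0 1"
      by (simp add: mat2_eq_iff)
    then have "f A = f ((A $ 1 $ 1) *\<^sub>R mt 1 0 0 0 + (A $ 1 $ 2) *\<^sub>R mt 0 1 0 0
      + (A $ 2 $ 1) *\<^sub>R mt 0 0 1 0 + (A $ 2 $ 2) *\<^sub>R mt 0 0 0 1)" by simp
    also have "\<dots> = A $ 1 $ 1 * f (mt 1 0 0 0) + A $ 1 $ 2 * f (mt 0 1 0 0)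
      + A $ 2 $ 1 * f (mt 0 0 1 0) + A $ 2 $ 2 * f (mt 0 0 0 1)"
      unfolding add scaleR by simp
    finally show ?thesis .
  qed
  then have e: "(\<lambda>t. f (F t)) = (\<lambda>t. F t $ 1 $ 1 * f (mt 1 0 0 0) + F t $ 1 $ 2 * f (mt 0 1 0 0)
      + F t $ 2 $ 1 * f (mt 0 0 1 0) + F t $ 2 $ 2 * f (mt 0 0 0 1))" by blast
  show ?case unfolding e by (intro laurent_add laurent_mult laurent_const assms(2))
qed (intro laurent_add laurent_mult laurent_const; assumption)+

lemma real_polynomial_function_linear_compose:
  fixes f :: "real^2^2 \<Rightarrow> real^2^2"
  assumes "real_polynomial_function p" "linear f"
  shows "real_polynomial_function (\<lambda>A. p (f A))"
proof -
  have "polynomial_function f" using assms(2) by (simp add: linear_conv_bounded_linear polynomial_function_bounded_linear)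
  then have "real_polynomial_function (p \<circ> f)" using assms(1) by (rule real_polynomial_function_compose)
  then show ?thesis by (simp add: o_def)
qed

lemma linear_matrix_mult_left: "linear (\<lambda>B :: real^2^2. A ** B)" for A :: "real^2^2"
  by (rule linearI) (simp_all add: mat2_eq_iff matrix_matrix_mult_def sum_2 algebra_simps)

lemma linear_matrix_mult_right: "linear (\<lambda>B :: real^2^2. B ** A)" for A :: "real^2^2"
  by (rule linearI) (simp_all add: mat2_eq_iff matrix_matrix_mult_def sum_2 algebra_simps)

lemma linear_adj: "linear adj"
  by (rule linearI) (simp_all add: mat2_eq_iff adj_def)

lemma linear_uminus_matrix: "linear (\<lambda>B :: real^2^2. - B)"
  by (rule linearI) simp_all

text \<open>
  For a torus in diagonal form and its conjugate by a matrix with nonzero entries, two elements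
  of the conjugate torus and one of the diagonal torus multiply to a non-diagonal upper
  triangular matrix.
\<close>

lemma tori_generate_upper:
  fixes x y z w :: real
  assumes dt: "x * w - y * z = 1" and nz: "x \<noteq> 0" "y \<noteq> 0" "z \<noteq> 0" "w \<noteq> 0"
  shows "\<exists>s s' t. s \<noteq> 0 \<and> s' \<noteq> 0 \<and> t \<noteq> 0 \<and>
    (mt x y z w ** mt s' 0 0 (1 / s') ** mt w (- y) (- z) x ** mt t 0 0 (1 / t)
       ** (mt x y z w ** mt s 0 0 (1 / s) ** mt w (- y) (- z) x)) $ 2 $ 1 = 0 \<and>
    (mt x y z w ** mt s' 0 0 (1 / s') ** mt w (- y) (- z) x ** mt t 0 0 (1 / t)
       ** (mt x y z w ** mt s 0 0 (1 / s) ** mt w (- y) (- z) x)) $ 1 $ 2 \<noteq> 0"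
proof -
  define q where "q = y * z"
  have q: "q \<noteq> 0" "q \<noteq> - 1" "x * w = 1 + q" using nz dt by (auto simp: q_def)
  \<comment> \<open>\<open>A s\<close>, \<open>D s\<close> and multiples of
    \<open>\<sigma> s\<close> are the entries of the conjugated torus element with parameter
    \<open>s\<close>.\<close>
  define \<sigma> where "\<sigma> = (\<lambda>s :: real. s - 1 / s)"
  define A where "A = (\<lambda>s :: real. (1 + q) * s - q / s)"
  define D where "D = (\<lambda>s :: real. (1 + q) / s - q * s)"
  have b: "mt x y z w ** mt s 0 0 (1 / s) ** mt w (- y) (- z) x
      = mt (A s) (- (x * y) * \<sigma> s) (z * w * \<sigma> s) (D s)" if "s \<noteq> 0" for s
  proof -
    have "A s = x * w * s - y * z / s" "D s = x * w / s - y * z * s"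
      by (simp_all only: A_def D_def q(3)[symmetric]) (simp_all only: q_def)
    then show ?thesis by (simp add: \<sigma>_def algebra_simps)
  qed
  have AD: "A s * D s = 1 - q * (1 + q) * (\<sigma> s)\<^sup>2" if "s \<noteq> 0" for s
    using that by (simp add: A_def D_def \<sigma>_def power2_eq_square field_simps)
  \<comment> \<open>For parameters in the range up to \<open>1 + \<delta>\<close> the correction
    \<open>q * \<sigma> s\<close> stays below 1 in modulus, so the diagonal entries involved remain
    positive and the square root defining \<open>t\<close> exists.\<close>
  define \<delta> where "\<delta> = min 1 (1 / (4 * \<bar>q\<bar>))"
  have \<delta>: "\<delta> > 0" "\<delta> \<le> 1" "\<bar>q\<bar> * (2 * \<delta>) < 1"
  proof -
    show "\<delta> > 0" "\<delta> \<le> 1" using q by (auto simp: \<delta>_def)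
    have "\<bar>q\<bar> * (2 * \<delta>) \<le> \<bar>q\<bar> * (2 * (1 / (4 * \<bar>q\<bar>)))" by (intro mult_left_mono) (auto simp: \<delta>_def)
    also have "\<dots> < 1" using q by simp
    finally show "\<bar>q\<bar> * (2 * \<delta>) < 1" .
  qed
  have pos: "\<sigma> s > 0" "A s > 0" "D (1 / s) > 0" if s: "1 < s" "s \<le> 1 + \<delta>" for s
  proof -
    have i: "1 / s < 1" "1 / s > 0" using s by auto
    show s0: "\<sigma> s > 0" unfolding \<sigma>_def using s i by linarith
    have "(1 - \<delta>) * s \<le> 1"
    proof -
      have "(1 - \<delta>) * s \<le> (1 - \<delta>) * (1 + \<delta>)" using s \<delta> by (intro mult_left_mono) auto
      also have "\<dots> = 1 - \<delta> * \<delta>" by (simp add: algebra_simps)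
      finally show ?thesis using zero_le_square[of \<delta>] by linarith
    qed
    then have "1 - \<delta> \<le> 1 / s" using s by (simp add: field_simps)
    then have "\<sigma> s \<le> 2 * \<delta>" unfolding \<sigma>_def using s by linarith
    then have "\<bar>q\<bar> * \<sigma> s \<le> \<bar>q\<bar> * (2 * \<delta>)" by (intro mult_left_mono) auto
    then have "\<bar>q * \<sigma> s\<bar> < 1" using \<delta>(3) s0 by (simp add: abs_mult)
    moreover have e: "A s = s + q * \<sigma> s" by (simp add: A_def \<sigma>_def algebra_simps)
    ultimately show "A s > 0" using s by linarith
    then show "D (1 / s) > 0" using s by (simp add: A_def D_def algebra_simps)
  qed
  define s where "s = 1 + \<delta>"
  define r where "r = 1 + \<delta> / 2"
  have s: "1 < s" "s \<le> 1 + \<delta>" and r: "1 < r" "r \<le> 1 + \<delta>" using \<delta> by (auto simp: s_def r_def)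
  have s0: "s \<noteq> 0" "r \<noteq> 0" using s r by auto
  note ps = pos[OF s] and pr = pos[OF r]
  have \<sigma>ne: "\<sigma> r < \<sigma> s"
  proof -
    have "r < s" using \<delta> by (simp add: s_def r_def)
    moreover have "1 / s < 1 / r" using calculation r by (intro divide_strict_left_mono) auto
    ultimately show ?thesis by (simp add: \<sigma>_def)
  qed
  \<comment> \<open>The square of the torus parameter, solved from the requirement that the lower
    left entry vanish.\<close>
  define T where "T = A r * \<sigma> s / (\<sigma> r * A s)"
  have T: "T > 0" using ps pr by (simp add: T_def)
  define t where "t = sqrt T"
  have t: "t > 0" "t * t = T" using T by (auto simp: t_def)
  have DA: "D (1 / r) = A r" "A (1 / r) = D r" "\<sigma> (1 / r) = - \<sigma> r" by (simp_all add: A_def D_def \<sigma>_def algebra_simps add_divide_distrib)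
  have low: "z * w * \<sigma> (1 / r) * t * A s + D (1 / r) / t * (z * w * \<sigma> s) = 0"
  proof -
    have "\<sigma> r * A s * (t * t) = A r * \<sigma> s" unfolding t(2) T_def using ps pr by simp
    then have "\<sigma> r * A s * t = A r * \<sigma> s / t" using t(1) by (simp add: field_simps)
    moreover have "z * w * (- \<sigma> r) * t * A s + A r / t * (z * w * \<sigma> s)
        = z * w * (A r * \<sigma> s / t - \<sigma> r * A s * t)" by (simp add: algebra_simps)
    ultimately show ?thesis unfolding DA by simp
  qed
  \<comment> \<open>If the other off-diagonal entry vanished too, eliminating \<open>T\<close> and
    using that the conjugated elements have determinant 1, in the form \<open>AD\<close>, would give
    equal squares of \<open>\<sigma> r\<close> and \<open>\<sigma> s\<close>; two different
    parameters were chosen to exclude this.\<close>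
  have up: "A (1 / r) * t * (- (x * y) * \<sigma> s) + - (x * y) * \<sigma> (1 / r) / t * D s \<noteq> 0"
  proof
    assume "A (1 / r) * t * (- (x * y) * \<sigma> s) + - (x * y) * \<sigma> (1 / r) / t * D s = 0"
    then have "(x * y) * (\<sigma> r * D s / t - D r * t * \<sigma> s) = 0" unfolding DA by (simp add: algebra_simps)
    then have "\<sigma> r * D s / t = D r * t * \<sigma> s" using nz by simp
    then have "\<sigma> r * D s = D r * \<sigma> s * T" using t by (simp add: field_simps)
    then have "\<sigma> r * D s * (\<sigma> r * A s) = D r * \<sigma> s * (A r * \<sigma> s)" using ps pr by (simp add: T_def field_simps)
    then have "(\<sigma> r)\<^sup>2 * (A s * D s) = (\<sigma> s)\<^sup>2 * (A r * D r)" by (simp add: power2_eq_square ac_simps)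
    then have "(\<sigma> r)\<^sup>2 = (\<sigma> s)\<^sup>2" unfolding AD[OF s0(1)] AD[OF s0(2)] by (simp add: algebra_simps)
    then show False using \<sigma>ne pr(1) by (simp add: power2_eq_iff_nonneg)
  qed
  have r0: "1 / r \<noteq> 0" using s0 by simp
  show ?thesis
  proof (rule exI[of _ s], rule exI[of _ "1 / r"], rule exI[of _ t], intro conjI)
    show "(mt x y z w ** mt (1 / r) 0 0 (1 / (1 / r)) ** mt w (- y) (- z) x ** mt t 0 0 (1 / t)
       ** (mt x y z w ** mt s 0 0 (1 / s) ** mt w (- y) (- z) x)) $ 2 $ 1 = 0"
      unfolding b[OF r0] b[OF s0(1)] using low by simp
    show "(mt x y z w ** mt (1 / r) 0 0 (1 / (1 / r)) ** mt w (- y) (- z) x ** mt t 0 0 (1 / t)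
       ** (mt x y z w ** mt s 0 0 (1 / s) ** mt w (- y) (- z) x)) $ 1 $ 2 \<noteq> 0"
      unfolding b[OF r0] b[OF s0(1)] using up by simp
  qed (use s0 t in auto)
qed

text \<open>The Zariski closure of the image is a semigroup closed under \<open>adj\<close>. It
  contains the whole diagonal torus because the powers of \<open>l\<close> are infinitely many, then
  a nondiagonal upper triangular matrix by \<open>tori_generate_upper\<close>, then all upper
  unipotents, and finally, with the help of \<open>g\<close>, every matrix of determinant 1.\<close>

theorem (in group) prep_zariski:
  assumes H: "subgroup H G" and m: "prep H m" and P: "P ** P' = mat 1" "P' ** P = mat 1"
    and a: "a \<in> H" "\<bar>l\<bar> > 1" "P' ** m a ** P = mt l 0 0 (1 / l)"
    and g: "g \<in> H" "\<And>i j. (P' ** m g ** P) $ i $ j \<noteq> 0"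
    and p: "real_polynomial_function p" "\<And>x. x \<in> H \<Longrightarrow> p (m x) = 0 \<and> p (- m x) = 0"
    and A: "det A = 1"
  shows "p A = 0"
proof -
  define m' where "m' = (\<lambda>x. P' ** m x ** P)"
  have m': "prep H m'" unfolding m'_def by (rule prep_conj[OF m P])
  have ma: "m' a = mt l 0 0 (1 / l)" using a by (simp add: m'_def)
  define van where "van = (\<lambda>p. real_polynomial_function p \<and> (\<forall>x\<in>H. p (m' x) = 0 \<and> p (- m' x) = 0))"
  \<comment> \<open>The Zariski closure of both signs of the conjugated image.\<close>
  define Z where "Z = {A :: real^2^2. \<forall>p. van p \<longrightarrow> p A = 0}"
  have ZD: "p A = 0" if "A \<in> Z" "van p" for A p using that by (simp add: Z_def)
  have ZI: "A \<in> Z" if "\<And>p. van p \<Longrightarrow> p A = 0" for A using that by (simp add: Z_def)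
  have vanpm: "p A = 0" if "van p" "x \<in> H" "pm A (m' x)" for p x A
    using that by (auto simp: van_def pm_def)
  have vanI: "van (\<lambda>A. p (f A))" if "van p" "linear f" "\<And>x. x \<in> H \<Longrightarrow> p (f (m' x)) = 0 \<and> p (f (- m' x)) = 0" for p f
    using that real_polynomial_function_linear_compose[of p f] by (auto simp: van_def)
  have ZH: "A \<in> Z" if "x \<in> H" "pm A (m' x)" for x A using vanpm that by (intro ZI)
  have Zneg: "- A \<in> Z" if "A \<in> Z" for A
    by (rule ZI, rule ZD[OF that vanI[OF _ linear_uminus_matrix]]) (auto simp: van_def)
  have ZHmult: "m' x ** A \<in> Z" if "x \<in> H" "A \<in> Z" for x A
  proof (rule ZI, rule ZD[OF that(2) vanI[OF _ linear_matrix_mult_left]])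
    fix p y assume py: "van p" "y \<in> H"
    have "pm (m' x ** m' y) (m' (x \<otimes> y))" "pm (m' x ** - m' y) (m' (x \<otimes> y))"
      using pm_sym[OF prep_mult[OF m' that(1) py(2)]] by (simp_all add: matrix_minus_mult)
    then show "p (m' x ** m' y) = 0 \<and> p (m' x ** - m' y) = 0"
      using vanpm[OF py(1) subgroup.m_closed[OF H that(1) py(2)]] by blast
  qed
  \<comment> \<open>The usual two stages: first the left factor ranges over the image, so that left
    translation preserves the closure; then the right factor is an arbitrary fixed element of the
    closure.\<close>
  have Zmult: "A ** B \<in> Z" if "A \<in> Z" "B \<in> Z" for A B
  proof (rule ZI, rule ZD[OF that(1) vanI[OF _ linear_matrix_mult_right]])
    fix p y assume py: "van p" "y \<in> H"
    show "p (m' y ** B) = 0 \<and> p (- m' y ** B) = 0"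
      using ZD[OF ZHmult[OF py(2) that(2)] py(1)] ZD[OF Zneg[OF ZHmult[OF py(2) that(2)]] py(1)]
      by (simp add: matrix_minus_mult)
  qed
  have Zadj: "adj A \<in> Z" if "A \<in> Z" for A
  proof (rule ZI, rule ZD[OF that vanI[OF _ linear_adj]])
    fix p y assume py: "van p" "y \<in> H"
    have "pm (adj (m' y)) (m' (inv y))" "pm (adj (- m' y)) (m' (inv y))"
      using pm_sym[OF prep_inv[OF H m' py(2)]] by (simp_all add: adj_minus)
    then show "p (adj (m' y)) = 0 \<and> p (adj (- m' y)) = 0"
      using vanpm[OF py(1) subgroup.m_inv_closed[OF H py(2)]] by blast
  qed
  have l0: "l \<noteq> 0" using a(2) by auto
  have torus: "mt t 0 0 (1 / t) \<in> Z" if t: "t \<noteq> 0" for t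
  proof (rule ZI)
    fix p assume p: "van p"
    have "laurent (\<lambda>t. p (mt t 0 0 (1 / t)))"
    proof (rule laurent_real_polynomial_function)
      show "real_polynomial_function p" using p by (simp add: van_def)
      show "laurent (\<lambda>t. mt t 0 0 (1 / t) $ i $ j)" for i j
        using exhaust_2[of i] exhaust_2[of j] by (auto simp: laurent_const laurent_id laurent_inverse)
    qed
    moreover have "infinite {t. t \<noteq> 0 \<and> p (mt t 0 0 (1 / t)) = 0}"
    proof
      assume fin: "finite {t. t \<noteq> 0 \<and> p (mt t 0 0 (1 / t)) = 0}"
      have "range (\<lambda>n. l ^ n) \<subseteq> {t. t \<noteq> 0 \<and> p (mt t 0 0 (1 / t)) = 0}"
      proof (rule image_subsetI, rule CollectI, rule conjI)
        fix n
        show "l ^ n \<noteq> 0" using l0 by simp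
        show "p (mt (l ^ n) 0 0 (1 / l ^ n)) = 0"
          using vanpm[OF p _ pm_sym] prep_diag_power[OF H m' a(1) ma, of n] by blast
      qed
      moreover have "inj (\<lambda>n. l ^ n)"
      proof (rule injI)
        fix i j :: nat assume "l ^ i = l ^ j"
        then have "\<bar>l\<bar> ^ i = \<bar>l\<bar> ^ j" by (metis power_abs)
        then show "i = j" using a(2) by (simp add: power_inject_exp)
      qed
      ultimately show False using fin range_inj_infinite finite_subset by blast
    qed
    ultimately show "p (mt t 0 0 (1 / t)) = 0" using laurent_zero t by blast
  qed
  obtain x y z w where mg: "m' g = mt x y z w" by (rule mt_cases)
  have nz: "x \<noteq> 0" "y \<noteq> 0" "z \<noteq> 0" "w \<noteq> 0"
    using g(2)[of 1 1] g(2)[of 1 2] g(2)[of 2 1] g(2)[of 2 2] mg by (simp_all add: m'_def)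
  have dt: "x * w - y * z = 1" using prep_det[OF m' g(1)] mg by simp
  have gZ: "mt x y z w \<in> Z" using ZH[OF g(1)] mg by simp
  then have gZ': "mt w (- y) (- z) x \<in> Z" using Zadj by fastforce
  obtain s s' t M where *: "s \<noteq> 0" "s' \<noteq> 0" "t \<noteq> 0" "M $ 2 $ 1 = 0" "M $ 1 $ 2 \<noteq> 0"
     "M = mt x y z w ** mt s' 0 0 (1 / s') ** mt w (- y) (- z) x ** mt t 0 0 (1 / t)
       ** (mt x y z w ** mt s 0 0 (1 / s) ** mt w (- y) (- z) x)"
    using tori_generate_upper[OF dt nz] by blast
  have MZ: "M \<in> Z" unfolding *(6) using *(1-3) by (intro Zmult gZ gZ' torus)
  have "det M = 1"
    unfolding *(6) using *(1-3) dt by (simp only: det_mul det_mt) (simp add: algebra_simps)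
  then obtain u v u' where uvu: "M = mt u v 0 u'" "v \<noteq> 0" "u * u' = 1"
    using *(4,5) by (cases M rule: mt_cases) auto
  note uu = uvu(3) and v0 = uvu(2)
  have U: "mt u v 0 u' \<in> Z" using MZ uvu(1) by simp
  have u0: "u \<noteq> 0" "u' \<noteq> 0" using uu by auto
  \<comment> \<open>A commutator of a torus element with the upper triangular matrix is
    unipotent.\<close>
  have e1: "mt 1 (v * u' * (t * t - 1)) 0 1 \<in> Z" if t: "t \<noteq> 0" for t
  proof -
    have "adj (mt u v 0 u') ** (mt t 0 0 (1 / t) ** mt u v 0 u' ** mt (1 / t) 0 0 (1 / (1 / t))) \<in> Z"
      using t by (intro Zmult Zadj U torus) auto
    moreover have "adj (mt u v 0 u') ** (mt t 0 0 (1 / t) ** mt u v 0 u' ** mt (1 / t) 0 0 (1 / (1 / t)))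
       = mt 1 (v * u' * (t * t - 1)) 0 1"
      using t uu by (simp add: algebra_simps)
    ultimately show ?thesis by simp
  qed
  \<comment> \<open>As \<open>t\<close> varies, \<open>t * t - 1\<close> takes every value above
    \<open>- 1\<close>.\<close>
  have e2: "mt 1 r 0 1 \<in> Z" if "r / (v * u') > - 1" for r
  proof -
    define t where "t = sqrt (1 + r / (v * u'))"
    have t: "t \<noteq> 0" "t * t = 1 + r / (v * u')" using that by (auto simp: t_def)
    have "v * u' * (t * t - 1) = r" unfolding t(2) using u0 v0 by simp
    then show ?thesis using e1[OF t(1)] by simp
  qed
  \<comment> \<open>Any real is a difference of two numbers whose quotients by \<open>k\<close> are
    nonnegative, and \<open>e2\<close> applies to both.\<close>
  have e: "mt 1 r 0 1 \<in> Z" for r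
  proof -
    define k where "k = v * u'"
    have k: "k \<noteq> 0" using u0 v0 by (simp add: k_def)
    have "mt 1 (k * \<bar>r / k\<bar> + r) 0 1 \<in> Z"
    proof (rule e2)
      have "(k * \<bar>r / k\<bar> + r) / k = \<bar>r / k\<bar> + r / k" using k by (simp add: add_divide_distrib)
      then show "(k * \<bar>r / k\<bar> + r) / (v * u') > - 1" unfolding k_def[symmetric] by linarith
    qed
    moreover have "mt 1 (k * \<bar>r / k\<bar>) 0 1 \<in> Z"
    proof (rule e2)
      have "k * \<bar>r / k\<bar> / k = \<bar>r / k\<bar>" using k by simp
      then show "(k * \<bar>r / k\<bar>) / (v * u') > - 1" unfolding k_def[symmetric] by linarith
    qed
    ultimately have "adj (mt 1 (k * \<bar>r / k\<bar>) 0 1) ** mt 1 (k * \<bar>r / k\<bar> + r) 0 1 \<in> Z"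
      by (intro Zmult Zadj)
    then show ?thesis by simp
  qed
  have upper: "mt a b 0 d \<in> Z" if "a * d = 1" for a b d
  proof -
    have a0: "a \<noteq> 0" using that by auto
    then have "d = 1 / a" using that by (simp add: field_simps)
    then have "mt a b 0 d = mt a 0 0 (1 / a) ** mt 1 (b / a) 0 1" using a0 by simp
    then show ?thesis using torus[OF a0] e Zmult by metis
  qed
  have all: "B \<in> Z" if B: "det B = 1" for B
  proof -
    obtain a b c d where B': "B = mt a b c d" by (rule mt_cases)
    have dB: "a * d - b * c = 1" using B B' by simp
    show ?thesis
    proof (cases "c = 0")
      case True
      then show ?thesis using upper[of a d b] dB B' by simp
    next
      case False
      \<comment> \<open>\<open>t\<close> and \<open>r\<close> are chosen so that \<open>h\<close>
        has the same first column as \<open>B\<close>; then \<open>adj h ** B\<close> is an upper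
        unipotent.\<close>
      define t where "t = z / c"
      define r where "r = (a / t - x) / z"
      have t: "t \<noteq> 0" using nz False by (simp add: t_def)
      define h where "h = mt t 0 0 (1 / t) ** mt 1 r 0 1 ** mt x y z w"
      have hZ: "h \<in> Z" unfolding h_def by (intro Zmult torus e gZ t)
      have dh: "det h = 1" unfolding h_def using dt t by (simp only: det_mul det_mt) simp
      obtain a' b' c' d' where h': "h = mt a' b' c' d'" by (rule mt_cases)
      have hc: "a' = a" "c' = c"
      proof -
        have "a' = t * (x + r * z)" "c' = z / t" using h' unfolding h_def by (auto simp: algebra_simps)
        moreover have "x + r * z = a / t" using nz by (simp add: r_def)
        ultimately show "a' = a" "c' = c" using t nz False by (auto simp: t_def)
      qed
      have dh': "a * d' - b' * c = 1" using dh h' hc by simp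
      have "adj h ** B = mt 1 (d' * b - b' * d) 0 1" using dh' dB hc by (simp add: h' B' algebra_simps)
      then have "h ** (adj h ** B) \<in> Z" using Zmult[OF hZ] e by simp
      then show ?thesis using adj_mult_self(2)[OF dh] by (simp add: matrix_mul_assoc)
    qed
  qed
  have "van (\<lambda>B. p (P ** B ** P'))"
    unfolding van_def
  proof (intro conjI ballI)
    have "linear (\<lambda>B. P ** B ** P')"
      using linear_compose[OF linear_matrix_mult_left[of P] linear_matrix_mult_right[of P']] by (simp add: o_def)
    then show "real_polynomial_function (\<lambda>B. p (P ** B ** P'))"
      using p(1) real_polynomial_function_linear_compose by blast
    fix x assume x: "x \<in> H"
    have "P ** m' x ** P' = (P ** P') ** m x ** (P ** P')" by (simp add: m'_def matrix_mul_assoc)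
    then have "P ** m' x ** P' = m x" by (simp add: P)
    then show "p (P ** m' x ** P') = 0" "p (P ** - m' x ** P') = 0"
      using p(2)[OF x] by (simp_all add: matrix_minus_mult)
  qed
  moreover have "det (P' ** A ** P) = 1"
  proof -
    have "det P' * det P = 1" using P(2) by (metis det_mul det_I)
    then show ?thesis using A by (simp add: det_mul)
  qed
  ultimately have "p (P ** (P' ** A ** P) ** P') = 0" using ZD[OF all] by blast
  moreover have "P ** (P' ** A ** P) ** P' = (P ** P') ** A ** (P ** P')" by (simp add: matrix_mul_assoc)
  ultimately show ?thesis by (simp add: P)
qed

subsection \<open>Ping-pong\<close>

definition av :: "real^2^2 \<Rightarrow> real \<times> real \<Rightarrow> real \<times> real" where
  "av A v = (A $ 1 $ 1 * fst v + A $ 1 $ 2 * snd v, A $ 2 $ 1 * fst v + A $ 2 $ 2 * snd v)"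

lemma av_mult: "av (A ** B) v = av A (av B v)"
  by (cases A rule: mt_cases, cases B rule: mt_cases) (simp add: av_def algebra_simps)

lemma av_one [simp]: "av (mat 1) v = v" by (simp add: av_def mat_1_eq_mt)

lemma av_minus: "av (- A) v = - av A v" by (simp add: av_def prod_eq_iff)

lemma av_uminus: "av A (- v) = - av A v" by (simp add: av_def prod_eq_iff)

text \<open>For large \<open>K\<close>, narrow neighbourhoods of the two coordinate axes, which are
  the fixed points of a diagonal matrix on the projective line. The value \<open>True\<close> of
  \<open>e\<close> stands for the first axis.\<close>

definition dcone :: "real \<Rightarrow> bool \<Rightarrow> real \<times> real \<Rightarrow> bool" where
  "dcone K e v \<longleftrightarrow> (if e then \<bar>fst v\<bar> > K * \<bar>snd v\<bar> else \<bar>snd v\<bar> > K * \<bar>fst v\<bar>)"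

lemma cone_uminus [simp]: "dcone K e (- v) \<longleftrightarrow> dcone K e v"
  by (simp add: dcone_def)

lemma cone_disjoint: "K \<ge> 1 \<Longrightarrow> dcone K e v \<Longrightarrow> \<not> dcone K (\<not> e) v"
proof -
  have *: "\<not> q > K * p" if "K \<ge> 1" "p > K * q" "p \<ge> 0" "q \<ge> 0" for p q
  proof
    assume "q > K * p"
    moreover have "K * p \<ge> 1 * p" "K * q \<ge> 1 * q" using that by (intro mult_right_mono; simp)+
    ultimately show False using that by linarith
  qed
  assume "K \<ge> 1" "dcone K e v"
  then show ?thesis using *[of "\<bar>fst v\<bar>" "\<bar>snd v\<bar>"] *[of "\<bar>snd v\<bar>" "\<bar>fst v\<bar>"]
    by (cases e) (auto simp: dcone_def)
qed

text \<open>A vector close to an axis is sent close to the corresponding column, which has nonzero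
  entries and hence is not close to an axis. The factor 2 leaves room for the contribution of the
  small coordinate. Abstract coefficients allow one statement to serve for both cones before and
  after the map.\<close>

lemma cone_disjoint_aux:
  fixes K p q :: real
  assumes K: "K \<ge> 1" and pq: "\<bar>p\<bar> > K * \<bar>q\<bar>"
    and S: "K * \<bar>\<gamma>\<bar> \<ge> 2 * S" "\<bar>\<alpha>\<bar> + \<bar>\<beta>\<bar> \<le> S" "\<bar>\<delta>\<bar> \<le> S"
  shows "\<not> \<bar>\<alpha> * p + \<beta> * q\<bar> > K * \<bar>\<gamma> * p + \<delta> * q\<bar>"
proof
  assume as: "\<bar>\<alpha> * p + \<beta> * q\<bar> > K * \<bar>\<gamma> * p + \<delta> * q\<bar>"
  have q: "\<bar>q\<bar> \<le> \<bar>p\<bar>" using mult_right_mono[OF K, of "\<bar>q\<bar>"] pq by linarith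
  have "\<bar>\<alpha> * p + \<beta> * q\<bar> \<le> \<bar>\<alpha>\<bar> * \<bar>p\<bar> + \<bar>\<beta>\<bar> * \<bar>q\<bar>" using abs_triangle_ineq[of "\<alpha> * p" "\<beta> * q"] by (simp add: abs_mult)
  also have "\<dots> \<le> \<bar>\<alpha>\<bar> * \<bar>p\<bar> + \<bar>\<beta>\<bar> * \<bar>p\<bar>" using q by (intro add_left_mono mult_left_mono) auto
  also have "\<dots> = (\<bar>\<alpha>\<bar> + \<bar>\<beta>\<bar>) * \<bar>p\<bar>" by (simp add: algebra_simps)
  also have "\<dots> \<le> S * \<bar>p\<bar>" using S(2) by (intro mult_right_mono) auto
  finally have 1: "\<bar>\<alpha> * p + \<beta> * q\<bar> \<le> S * \<bar>p\<bar>" .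
  have "\<bar>\<gamma> * p + \<delta> * q\<bar> \<ge> \<bar>\<gamma>\<bar> * \<bar>p\<bar> - \<bar>\<delta>\<bar> * \<bar>q\<bar>"
    using abs_triangle_ineq2[of "\<gamma> * p" "- (\<delta> * q)"] by (simp add: abs_mult)
  then have "K * \<bar>\<gamma> * p + \<delta> * q\<bar> \<ge> K * (\<bar>\<gamma>\<bar> * \<bar>p\<bar> - \<bar>\<delta>\<bar> * \<bar>q\<bar>)"
    using K by (intro mult_left_mono) auto
  also have "K * (\<bar>\<gamma>\<bar> * \<bar>p\<bar> - \<bar>\<delta>\<bar> * \<bar>q\<bar>) = (K * \<bar>\<gamma>\<bar>) * \<bar>p\<bar> - \<bar>\<delta>\<bar> * (K * \<bar>q\<bar>)" by (simp add: algebra_simps)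
  finally have 2: "K * \<bar>\<gamma> * p + \<delta> * q\<bar> \<ge> (K * \<bar>\<gamma>\<bar>) * \<bar>p\<bar> - \<bar>\<delta>\<bar> * (K * \<bar>q\<bar>)" .
  have 3: "(K * \<bar>\<gamma>\<bar>) * \<bar>p\<bar> \<ge> (2 * S) * \<bar>p\<bar>" using S(1) by (intro mult_right_mono) auto
  have "\<bar>\<delta>\<bar> * (K * \<bar>q\<bar>) \<le> S * \<bar>p\<bar>" using S(3) pq K by (intro mult_mono) auto
  then show False using 1 2 3 as by (simp add: algebra_simps)
qed

text \<open>The ping-pong move: everything outside the repelling cone goes into the attracting one.
  Outside it the ratio of the two coordinates is at most \<open>K\<close>; the matrix multiplies it
  in the favourable direction by the square of \<open>L\<close>, which exceeds
  \<open>K * K\<close>.\<close>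

lemma cone_diag:
  fixes L :: real
  assumes K: "K \<ge> 1" and L: "\<bar>L\<bar> > K" and v: "v \<noteq> 0" "\<not> dcone K (\<not> e) v"
  shows "dcone K e (av (if e then mt L 0 0 (1 / L) else mt (1 / L) 0 0 L) v)"
proof -
  have *: "\<bar>L * p\<bar> > K * \<bar>q / L\<bar>" if "p \<noteq> 0 \<or> q \<noteq> 0" "\<not> \<bar>q\<bar> > K * \<bar>p\<bar>" for p q :: real
  proof -
    have p0: "p \<noteq> 0" using that K by auto
    have L0: "\<bar>L\<bar> > 0" using K L by linarith
    have "K * \<bar>q\<bar> \<le> K * (K * \<bar>p\<bar>)" using that K by (intro mult_left_mono) auto
    also have "\<dots> = (K * K) * \<bar>p\<bar>" by simp
    also have "\<dots> < (\<bar>L\<bar> * \<bar>L\<bar>) * \<bar>p\<bar>"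
      using K L p0 by (intro mult_strict_right_mono mult_strict_mono) auto
    finally have "K * \<bar>q\<bar> / \<bar>L\<bar> < (\<bar>L\<bar> * \<bar>L\<bar>) * \<bar>p\<bar> / \<bar>L\<bar>" using L0 by (rule divide_strict_right_mono)
    moreover have "(\<bar>L\<bar> * \<bar>L\<bar>) * \<bar>p\<bar> / \<bar>L\<bar> = \<bar>L\<bar> * \<bar>p\<bar>"
      using L0 by (simp only: mult.assoc nonzero_mult_div_cancel_left[OF less_imp_neq[OF L0, symmetric]])
    ultimately show ?thesis by (simp add: abs_mult)
  qed
  have v': "fst v \<noteq> 0 \<or> snd v \<noteq> 0" using v(1) by (auto simp: prod_eq_iff)
  show ?thesis
    using *[OF v'] *[of "snd v" "fst v"] v' v(2) by (cases e) (auto simp: dcone_def av_def mult.commute)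
qed

lemma word_value_Cons:
  "word_value G ((s, e) # w) = (if e then s else inv\<^bsub>G\<^esub> s) \<otimes>\<^bsub>G\<^esub> word_value G w"
  by (simp add: word_value_def)

text \<open>Ping-pong between a high power of \<open>a\<close> and its conjugate by
  \<open>g\<close>. The four regions are the two cones around the axes and their images under
  \<open>g\<close>. They are pairwise disjoint because no entry of \<open>m g\<close> vanishes, that
  is, because \<open>g\<close> moves both fixed points of \<open>a\<close> off both of them.\<close>

theorem (in group) prep_free_pair:
  assumes H: "subgroup H G" and m: "prep H m"
    and a: "a \<in> H" "\<bar>l\<bar> > 1" "m a = mt l 0 0 (1 / l)"
    and g: "g \<in> H" "\<And>i j. m g $ i $ j \<noteq> 0"
  shows "\<exists>x\<in>H. \<exists>y\<in>H. x \<noteq> y \<and>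
    (\<forall>w. w \<noteq> [] \<and> fst ` set w \<subseteq> {x, y} \<and> reduced_word w \<longrightarrow> word_value G w \<noteq> \<one>)"
proof -
  obtain x y z w where mg: "m g = mt x y z w" by (rule mt_cases)
  have nz: "x \<noteq> 0" "y \<noteq> 0" "z \<noteq> 0" "w \<noteq> 0"
    using g(2)[of 1 1] g(2)[of 1 2] g(2)[of 2 1] g(2)[of 2 2] mg by simp_all
  have dt: "x * w - y * z = 1" using prep_det[OF m g(1)] mg by simp
  have detg: "det (mt x y z w) = 1" using dt by simp
  define A where "A = mt w (- y) (- z) x"
  have Ag: "A ** mt x y z w = mat 1" "mt x y z w ** A = mat 1"
    using adj_mult_self[OF detg] by (simp_all add: A_def)
  \<comment> \<open>The slope of the base vector \<open>v0\<close>: neither \<open>v0\<close> nor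
    its preimage under \<open>g\<close> may lie on a coordinate axis.\<close>
  have "\<exists>k :: real. k > 0 \<and> w - y * k \<noteq> 0 \<and> x * k - z \<noteq> 0"
  proof -
    have "finite {w / y, z / x}" by simp
    then have "infinite ({0 <..< (1 :: real)} - {w / y, z / x})" using infinite_Ioo[of 0 "1 :: real"] by (metis Diff_infinite_finite zero_less_one)
    then obtain k where "k \<in> {0 <..< (1 :: real)} - {w / y, z / x}" by (metis all_not_in_conv finite.emptyI)
    then show ?thesis using nz by (intro exI[of _ k]) (auto simp: field_simps)
  qed
  then obtain k where k: "k > 0" "w - y * k \<noteq> 0" "x * k - z \<noteq> 0" by blast
  define S where "S = \<bar>x\<bar> + \<bar>y\<bar> + \<bar>z\<bar> + \<bar>w\<bar>"
  \<comment> \<open>The terms with \<open>k\<close> keep \<open>v0\<close> out of the cones, those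
    with \<open>w - y * k\<close> and \<open>x * k - z\<close> keep it out of their images under
    \<open>g\<close>, and the last four make the two pairs of cones disjoint by
    \<open>cone_disjoint_aux\<close>.\<close>
  define K where "K = Max {1, k, 1 / k, \<bar>(w - y * k) / (x * k - z)\<bar>, \<bar>(x * k - z) / (w - y * k)\<bar>,
     2 * S / \<bar>x\<bar>, 2 * S / \<bar>y\<bar>, 2 * S / \<bar>z\<bar>, 2 * S / \<bar>w\<bar>}"
  have K': "c \<le> K" if "c \<in> {1, k, 1 / k, \<bar>(w - y * k) / (x * k - z)\<bar>, \<bar>(x * k - z) / (w - y * k)\<bar>,
     2 * S / \<bar>x\<bar>, 2 * S / \<bar>y\<bar>, 2 * S / \<bar>z\<bar>, 2 * S / \<bar>w\<bar>}" for c
    unfolding K_def using that by (intro Max_ge) auto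
  have K1: "K \<ge> 1" using K' by simp
  have KS: "K * \<bar>x\<bar> \<ge> 2 * S" "K * \<bar>y\<bar> \<ge> 2 * S" "K * \<bar>z\<bar> \<ge> 2 * S" "K * \<bar>w\<bar> \<ge> 2 * S"
    using K'[of "2 * S / \<bar>x\<bar>"] K'[of "2 * S / \<bar>y\<bar>"] K'[of "2 * S / \<bar>z\<bar>"] K'[of "2 * S / \<bar>w\<bar>"] nz
    by (simp_all add: pos_divide_le_eq)
  have "k \<le> K" "1 / k \<le> K" using K' by auto
  then have Kk: "k \<le> K * 1" "1 \<le> K * k" using k(1) by (auto simp: pos_divide_le_eq)
  have "\<bar>(w - y * k) / (x * k - z)\<bar> \<le> K" "\<bar>(x * k - z) / (w - y * k)\<bar> \<le> K" using K' by auto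
  then have Ku: "\<bar>w - y * k\<bar> \<le> K * \<bar>x * k - z\<bar>" "\<bar>x * k - z\<bar> \<le> K * \<bar>w - y * k\<bar>"
    using k(2,3) by (simp_all add: abs_divide pos_divide_le_eq)
  obtain N where N: "\<bar>l\<bar> ^ N > K" using real_arch_pow[OF a(2)] by blast
  define L where "L = l ^ N"
  have L: "\<bar>L\<bar> > K" using N by (simp add: L_def power_abs)
  have L0: "L \<noteq> 0" using L K1 by auto
  define xx where "xx = a [^] N"
  define yy where "yy = g \<otimes> xx \<otimes> inv g"
  have Xm: "xx \<in> H" "pm (m xx) (mt L 0 0 (1 / L))"
    using prep_diag_power[OF H m a(1,3), of N] by (auto simp: xx_def L_def)
  have YH: "yy \<in> H" unfolding yy_def by (intro subgroup.m_closed[OF H] subgroup.m_inv_closed[OF H] g Xm)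
  have Ym: "pm (m yy) (mt x y z w ** mt L 0 0 (1 / L) ** A)"
  proof -
    have "pm (m yy) (m (g \<otimes> xx) ** m (inv g))" unfolding yy_def
      by (intro prep_mult[OF m] subgroup.m_closed[OF H] subgroup.m_inv_closed[OF H] g Xm)
    also have "pm \<dots> (m g ** m xx ** adj (m g))"
      by (intro pm_mult prep_mult[OF m] prep_inv[OF H m] g Xm)
    also have "pm \<dots> (m g ** mt L 0 0 (1 / L) ** adj (m g))" by (intro pm_mult pm_refl Xm)
    finally show ?thesis by (simp only: mg adj_mt A_def)
  qed
  define \<Delta> where "\<Delta> = (\<lambda>e. if e then mt L 0 0 (1 / L) else mt (1 / L) 0 0 L)"
  have letX: "pm (m (if e then xx else inv xx)) (\<Delta> e)" for e
  proof (cases e)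
    case False
    have "pm (m (inv xx)) (adj (mt L 0 0 (1 / L)))"
      using pm_trans[OF prep_inv[OF H m Xm(1)] pm_adj[OF Xm(2)]] .
    then show ?thesis using False by (simp add: \<Delta>_def)
  qed (use Xm in \<open>simp add: \<Delta>_def\<close>)
  have letY: "pm (m (if e then yy else inv yy)) (mt x y z w ** \<Delta> e ** A)" for e
  proof (cases e)
    case False
    have "pm (m (inv yy)) (adj (mt x y z w ** mt L 0 0 (1 / L) ** A))"
      using pm_trans[OF prep_inv[OF H m YH] pm_adj[OF Ym]] .
    moreover have "adj (mt x y z w ** mt L 0 0 (1 / L) ** A) = mt x y z w ** mt (1 / L) 0 0 L ** A"
      by (simp add: A_def algebra_simps)
    ultimately show ?thesis using False by (simp add: \<Delta>_def)
  qed (use Ym in \<open>simp add: \<Delta>_def\<close>)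
  \<comment> \<open>The region assigned to a letter. For the conjugate \<open>yy\<close> it is the
    image of a cone under \<open>g\<close>, tested by pulling the vector back with \<open>A\<close>,
    the inverse of the matrix of \<open>g\<close>.\<close>
  define reg where "reg = (\<lambda>s e v. dcone K e (if s = xx then v else av A v))"
  have reg_minus: "reg s e (- v) \<longleftrightarrow> reg s e v" for s e v
    by (simp add: reg_def av_uminus)
  have disjXY: "\<not> dcone K e' (av A v)" if "dcone K e v" for e e' v
  proof -
    have "\<bar>w\<bar> + \<bar>- y\<bar> \<le> S" "\<bar>- z\<bar> + \<bar>x\<bar> \<le> S" "\<bar>- y\<bar> + \<bar>w\<bar> \<le> S" "\<bar>x\<bar> + \<bar>- z\<bar> \<le> S"
      "\<bar>x\<bar> \<le> S" "\<bar>- y\<bar> \<le> S" "\<bar>- z\<bar> \<le> S" "\<bar>w\<bar> \<le> S" by (auto simp: S_def)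
    note b = this
    have KS': "K * \<bar>- y\<bar> \<ge> 2 * S" "K * \<bar>- z\<bar> \<ge> 2 * S" using KS by simp_all
    have A: "fst (av A v) = w * fst v + - y * snd v" "snd (av A v) = - z * fst v + x * snd v"
       "fst (av A v) = - y * snd v + w * fst v" "snd (av A v) = x * snd v + - z * fst v"
      by (simp_all add: av_def A_def)
    show ?thesis
    proof (cases e)
      case True
      then have v: "\<bar>fst v\<bar> > K * \<bar>snd v\<bar>" using that by (simp add: dcone_def)
      show ?thesis unfolding dcone_def A(1,2)
        using cone_disjoint_aux[OF K1 v KS'(2) b(1) b(5)] cone_disjoint_aux[OF K1 v KS(4) b(2) b(6)] by simp
    next
      case False
      then have v: "\<bar>snd v\<bar> > K * \<bar>fst v\<bar>" using that by (simp add: dcone_def)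
      show ?thesis unfolding dcone_def A(3,4)
        using cone_disjoint_aux[OF K1 v KS(1) b(3) b(7)] cone_disjoint_aux[OF K1 v KS'(1) b(4) b(8)] by simp
    qed
  qed
  define v0 where "v0 = (1 :: real, k)"
  have v0: "\<not> dcone K e v0" "\<not> dcone K e (av A v0)" "v0 \<noteq> 0" for e
  proof -
    show "\<not> dcone K e v0" using Kk k(1) by (auto simp: dcone_def v0_def)
    have "av A v0 = (w - y * k, x * k - z)" by (simp add: av_def A_def v0_def)
    then show "\<not> dcone K e (av A v0)" using Ku by (auto simp: dcone_def)
    show "v0 \<noteq> 0" by (simp add: v0_def prod_eq_iff)
  qed
  have Av: "av A v \<noteq> 0" if "v \<noteq> 0" for v
  proof
    assume "av A v = 0"
    then have "av (mt x y z w) (av A v) = 0" by (simp add: av_def prod_eq_iff)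
    then have "v = 0" by (simp add: Ag flip: av_mult)
    then show False using that by simp
  qed
  have moveX: "dcone K e (av (m (if e then xx else inv xx)) v)" if "v \<noteq> 0" "\<not> dcone K (\<not> e) v" for e v
  proof -
    have "dcone K e (av (\<Delta> e) v)" unfolding \<Delta>_def by (rule cone_diag[OF K1 L that])
    then show ?thesis using letX[of e] by (auto simp: pm_def av_minus)
  qed
  have moveY: "dcone K e (av A (av (m (if e then yy else inv yy)) v))" if "v \<noteq> 0" "\<not> dcone K (\<not> e) (av A v)" for e v
  proof -
    have "dcone K e (av (\<Delta> e) (av A v))" unfolding \<Delta>_def by (rule cone_diag[OF K1 L Av[OF that(1)] that(2)])
    also have "av (\<Delta> e) (av A v) = av ((A ** mt x y z w) ** \<Delta> e ** A) v" by (simp add: Ag av_mult)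
    also have "\<dots> = av A (av (mt x y z w ** \<Delta> e ** A) v)" by (simp add: matrix_mul_assoc flip: av_mult)
    finally have c: "dcone K e (av A (av (mt x y z w ** \<Delta> e ** A) v))" .
    then show ?thesis using letY[of e] by (auto simp: pm_def av_minus av_uminus)
  qed
  have XY: "xx \<noteq> yy"
  proof
    assume "xx = yy"
    then show False using disjXY[OF moveX[OF v0(3,1), of True]] moveY[OF v0(3,2), of True] by simp
  qed
  have move: "reg s e (av (m (if e then s else inv s)) v)" if "s \<in> {xx, yy}" "v \<noteq> 0" "\<not> reg s (\<not> e) v" for s e v
    using that moveX[of v e] moveY[of v e] XY by (auto simp: reg_def)
  have disj: "\<not> reg s' e' v" if "s \<in> {xx, yy}" "s' \<in> {xx, yy}" "reg s e v" "\<not> (s' = s \<and> e' = e)" for s s' e e' v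
  proof (cases "s = s'")
    case True
    then have "e' = (\<not> e)" using that by auto
    then show ?thesis using cone_disjoint[OF K1] that(3) True by (auto simp: reg_def)
  next
    case False
    have "s \<in> {xx, yy}" "s' \<in> {xx, yy}" by fact+
    with False consider "s = xx" "s' = yy" | "s = yy" "s' = xx" by auto
    then show ?thesis
    proof cases
      case 1
      then show ?thesis using disjXY[of e v e'] that(3) XY by (auto simp: reg_def)
    next
      case 2
      then show ?thesis using disjXY[of e' v e] that(3) XY by (auto simp: reg_def)
    qed
  qed
  have reg0: "v \<noteq> 0" if "reg s e v" for s e v
  proof
    assume "v = 0"
    moreover have "av A 0 = 0" by (simp add: av_def prod_eq_iff)
    ultimately show False using that by (auto simp: reg_def dcone_def split: if_splits)
  qed
  have let_H: "(if e then s else inv s) \<in> H" if "s \<in> {xx, yy}" for s e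
    using that Xm(1) YH subgroup.m_inv_closed[OF H] by auto
  \<comment> \<open>The ping-pong invariant: a nonempty reduced word carries \<open>v0\<close> into
    the region of its first letter. As \<open>v0\<close> lies in no region, such a word is not
    trivial.\<close>
  have main: "word_value G u \<in> H \<and> (u \<noteq> [] \<longrightarrow> (case hd u of (s, e) \<Rightarrow> reg s e (av (m (word_value G u)) v0)))"
    if "fst ` set u \<subseteq> {xx, yy}" "reduced_word u" for u
    using that
  proof (induction u)
    case Nil
    show ?case using subgroup.one_closed[OF H] by (simp add: word_value_def)
  next
    case (Cons c u)
    obtain s e where c: "c = (s, e)" by force
    have s: "s \<in> {xx, yy}" using Cons.prems c by auto
    have red: "reduced_word u" using Cons.prems(2) by (cases u) (auto simp: reduced_word_def)
    have IH: "word_value G u \<in> H" "u \<noteq> [] \<Longrightarrow> (case hd u of (s, e) \<Rightarrow> reg s e (av (m (word_value G u)) v0))"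
      using Cons.IH Cons.prems(1) red by auto
    define v where "v = av (m (word_value G u)) v0"
    have v: "v \<noteq> 0 \<and> \<not> reg s (\<not> e) v"
    proof (cases u)
      case Nil
      have "pm (m \<one>) (mat 1)" by (rule prep_one[OF H m])
      then have "v = v0 \<or> v = - v0" unfolding v_def using Nil by (auto simp: word_value_def pm_def av_minus)
      then show ?thesis using v0 by (auto simp: reg_def av_uminus)
    next
      case (Cons d u')
      obtain s' e' where d: "d = (s', e')" by force
      have r: "reg s' e' v" using IH(2) Cons d by (simp add: v_def)
      have s': "s' \<in> {xx, yy}" using Cons.prems(1) Cons d by auto
      have "\<not> (s = s' \<and> e \<noteq> e')" using Cons.prems(2) Cons c d by (simp add: reduced_word_def)
      then show ?thesis using disj[OF s' s r, of "\<not> e"] reg0[OF r] by auto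
    qed
    define b where "b = (if e then s else inv s)"
    have bH: "b \<in> H" unfolding b_def by (rule let_H[OF s])
    have wv: "word_value G (c # u) = b \<otimes> word_value G u" by (simp add: c word_value_Cons b_def)
    have "reg s e (av (m b) v)" unfolding b_def using move[OF s] v by blast
    moreover have "av (m b) v = av (m b ** m (word_value G u)) v0" by (simp add: v_def av_mult)
    ultimately have "reg s e (av (m (b \<otimes> word_value G u)) v0)"
      using prep_mult[OF m bH IH(1)] by (auto simp: pm_def av_minus reg_minus)
    then show ?case using wv c subgroup.m_closed[OF H bH IH(1)] by simp
  qed
  have "word_value G u \<noteq> \<one>" if u: "u \<noteq> []" "fst ` set u \<subseteq> {xx, yy}" "reduced_word u" for u
  proof
    assume e: "word_value G u = \<one>"
    obtain s e where h: "hd u = (s, e)" by force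
    have "reg s e (av (m \<one>) v0)" using main[OF u(2,3)] u(1) h e by simp
    then have "reg s e v0" using prep_one[OF H m] by (auto simp: pm_def av_minus reg_minus)
    then show False using v0 by (cases "s = xx") (simp_all add: reg_def)
  qed
  then show ?thesis using Xm(1) YH XY by blast
qed

subsection \<open>Lifts of projective transformations to the universal cover of the projective line\<close>

text \<open>The sine comes first so that the ratio of the two coordinates, on which matrices act by
  fractional linear maps, is \<open>tan \<theta>\<close>.\<close>

definition ev :: "real \<Rightarrow> real \<times> real" where "ev \<theta> = (sin \<theta>, cos \<theta>)"

lemma ev_nonzero [simp]: "ev \<theta> \<noteq> 0"
proof
  assume "ev \<theta> = 0"
  then have "sin \<theta> = 0" "cos \<theta> = 0" by (auto simp: ev_def prod_eq_iff)
  then show False using sin_cos_squared_add[of \<theta>] by simp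
qed

lemma ev_add_pi [simp]: "ev (\<theta> + pi) = - ev \<theta>" by (simp add: ev_def prod_eq_iff)

lemma ev_eq_iff: "ev \<alpha> = ev \<beta> \<longleftrightarrow> (\<exists>k :: int. \<alpha> = \<beta> + 2 * pi * k)"
  unfolding ev_def using sin_cos_eq_iff[of \<alpha> \<beta>] by auto

lemma scaled_ev_eq:
  assumes "r > 0" "s > 0" "r *\<^sub>R ev \<alpha> = s *\<^sub>R ev \<beta>"
  shows "r = s" "ev \<alpha> = ev \<beta>"
proof -
  have e: "r * sin \<alpha> = s * sin \<beta>" "r * cos \<alpha> = s * cos \<beta>" using assms(3) by (auto simp: ev_def)
  have "(r * sin \<alpha>)\<^sup>2 + (r * cos \<alpha>)\<^sup>2 = r\<^sup>2" for r \<alpha> :: real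
    using sin_cos_squared_add[of \<alpha>] by (simp add: power_mult_distrib flip: distrib_left)
  then have "r\<^sup>2 = s\<^sup>2" using e by metis
  then show rs: "r = s" using assms by (simp add: power2_eq_iff_nonneg)
  then show "ev \<alpha> = ev \<beta>" using assms by simp
qed

lemma av_scaleR: "av A (r *\<^sub>R v) = r *\<^sub>R av A v"
  by (simp add: av_def prod_eq_iff algebra_simps)

text \<open>A lift to the line of the action on rays, not on lines: the factor \<open>r\<close> is
  positive. Thus a matrix and its negative have different lifts, which differ by odd multiples of
  \<open>pi\<close>, and the lift determines the matrix up to a positive factor.\<close>

definition plift :: "real^2^2 \<Rightarrow> (real \<Rightarrow> real) \<Rightarrow> bool" where
  "plift A g \<longleftrightarrow> continuous_on UNIV g \<and> (\<forall>\<theta>. \<exists>r>0. av A (ev \<theta>) = r *\<^sub>R ev (g \<theta>))"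

lemma plift_cont: "plift A g \<Longrightarrow> continuous_on UNIV g" by (simp add: plift_def)

lemma plift_D: "plift A g \<Longrightarrow> \<exists>r>0. av A (ev \<theta>) = r *\<^sub>R ev (g \<theta>)" by (simp add: plift_def)

lemma continuous_2pi_multiple_const:
  assumes "continuous_on UNIV f" "\<And>x. \<exists>k :: int. f x = 2 * pi * k"
  shows "f x = f (y :: real)"
proof -
  have "f constant_on UNIV"
  proof (rule continuous_discrete_range_constant)
    fix x :: real
    show "\<exists>e>0. \<forall>y. y \<in> UNIV \<and> f y \<noteq> f x \<longrightarrow> e \<le> norm (f y - f x)"
    proof (intro exI[of _ "2 * pi"] conjI allI impI)
      fix y assume y: "y \<in> UNIV \<and> f y \<noteq> f x"
      obtain k l :: int where kl: "f x = 2 * pi * k" "f y = 2 * pi * l" using assms(2) by metis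
      then have "k \<noteq> l" using y by auto
      then have "1 \<le> \<bar>real_of_int (l - k)\<bar>" by linarith
      then have "2 * pi * 1 \<le> 2 * pi * \<bar>real_of_int (l - k)\<bar>" by (intro mult_left_mono) auto
      moreover have "norm (f y - f x) = 2 * pi * \<bar>real_of_int (l - k)\<bar>"
        unfolding kl by (simp add: abs_mult flip: right_diff_distrib)
      ultimately show "2 * pi \<le> norm (f y - f x)" by simp
    qed simp
  qed (use assms in auto)
  then show ?thesis by (auto simp: constant_on_def)
qed

lemma plift_diff:
  assumes "plift A g" "plift A h"
  shows "\<exists>k :: int. \<forall>\<theta>. g \<theta> = h \<theta> + 2 * pi * k"
proof -
  have ex: "\<exists>k :: int. g \<theta> - h \<theta> = 2 * pi * k" for \<theta>
  proof -
    obtain r s where "r > 0" "s > 0" "r *\<^sub>R ev (g \<theta>) = s *\<^sub>R ev (h \<theta>)"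
      using plift_D[OF assms(1)] plift_D[OF assms(2)] by metis
    then have "ev (g \<theta>) = ev (h \<theta>)" by (rule scaled_ev_eq(2))
    then show ?thesis by (simp add: ev_eq_iff diff_eq_eq add.commute)
  qed
  have "continuous_on UNIV (\<lambda>\<theta>. g \<theta> - h \<theta>)" by (intro continuous_intros plift_cont[OF assms(1)] plift_cont[OF assms(2)])
  then have c: "g \<theta> - h \<theta> = g 0 - h 0" for \<theta> using continuous_2pi_multiple_const ex by blast
  obtain k :: int where "g 0 - h 0 = 2 * pi * k" using ex by blast
  then have "g \<theta> = h \<theta> + 2 * pi * k" for \<theta> using c[of \<theta>] by linarith
  then show ?thesis by blast
qed

lemma plift_unique:
  assumes "plift A g" "plift A h" "g \<theta> = h \<theta>" shows "g = h"
proof -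
  obtain k :: int where k: "\<And>\<theta>. g \<theta> = h \<theta> + 2 * pi * k" using plift_diff[OF assms(1,2)] by blast
  then have "2 * pi * k = 0" using assms(3) k[of \<theta>] by linarith
  then show ?thesis using k by auto
qed

lemma plift_shift2:
  assumes "plift A g" shows "plift A (\<lambda>\<theta>. g \<theta> + 2 * pi * of_int k)"
proof -
  have "ev (g \<theta> + 2 * pi * of_int k) = ev (g \<theta>)" for \<theta> by (auto simp: ev_eq_iff)
  then show ?thesis using assms by (auto simp: plift_def intro!: continuous_intros)
qed

text \<open>The image of the unit circle, read as a curve of nonzero complex numbers, has a
  continuous logarithm over the contractible line. Its imaginary part is a lift, and a multiple of
  \<open>2 * pi\<close> adjusts the prescribed value.\<close>

lemma plift_exists:
  assumes A: "det A \<noteq> 0" and v: "r > 0" "av A (ev \<theta>0) = r *\<^sub>R ev y0"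
  obtains g where "plift A g" "g \<theta>0 = y0"
proof -
  obtain a b c d where A': "A = mt a b c d" by (rule mt_cases)
  have inj: "v = 0" if "av A v = 0" for v
  proof -
    have "av (adj A) (av A v) = det A *\<^sub>R v"
      by (simp add: A' av_def prod_eq_iff algebra_simps)
    moreover have "av (adj A) 0 = 0" by (simp add: av_def prod_eq_iff)
    ultimately show ?thesis using that A by simp
  qed
  define f where "f = (\<lambda>\<theta>. Complex (snd (av A (ev \<theta>))) (fst (av A (ev \<theta>))))"
  have fc: "continuous_on UNIV f"
    unfolding f_def by (intro continuous_intros) (auto simp: av_def ev_def intro!: continuous_intros)
  have f0: "f \<theta> \<noteq> 0" for \<theta>
  proof
    assume "f \<theta> = 0"
    then have "av A (ev \<theta>) = 0" by (simp add: f_def complex_eq_iff prod_eq_iff)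
    then have "ev \<theta> = 0" by (rule inj)
    then show False by simp
  qed
  obtain w where w: "continuous_on UNIV w" "\<And>\<theta>. f \<theta> = exp (w \<theta>)"
    using continuous_logarithm_on_contractible[of UNIV f] fc f0
    by (metis UNIV_I contractible_UNIV)
  define g where "g = (\<lambda>\<theta>. Im (w \<theta>))"
  have lg: "plift A g"
    unfolding plift_def
  proof (intro conjI allI)
    show "continuous_on UNIV g" unfolding g_def by (intro continuous_intros w)
    fix \<theta>
    have "av A (ev \<theta>) = (Im (f \<theta>), Re (f \<theta>))" by (simp add: f_def)
    also have "\<dots> = exp (Re (w \<theta>)) *\<^sub>R ev (g \<theta>)" by (simp add: w(2) Im_exp Re_exp ev_def g_def)
    finally show "\<exists>r>0. av A (ev \<theta>) = r *\<^sub>R ev (g \<theta>)" by (intro exI[of _ "exp (Re (w \<theta>))"]) simp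
  qed
  obtain s where s: "s > 0" "av A (ev \<theta>0) = s *\<^sub>R ev (g \<theta>0)" using plift_D[OF lg] by blast
  then have "ev y0 = ev (g \<theta>0)" using scaled_ev_eq(2)[OF v(1) s(1)] v(2) by simp
  then obtain k :: int where "y0 = g \<theta>0 + 2 * pi * k" unfolding ev_eq_iff by blast
  then show ?thesis using that[OF plift_shift2[OF lg, of k]] by simp
qed

lemma plift_comp:
  assumes "plift A g" "plift B h" shows "plift (A ** B) (g \<circ> h)"
  unfolding plift_def
proof (intro conjI allI)
  show "continuous_on UNIV (g \<circ> h)"
    by (rule continuous_on_compose[OF plift_cont[OF assms(2)] continuous_on_subset[OF plift_cont[OF assms(1)]]]) simp
  fix \<theta>
  obtain r s where "r > 0" "av B (ev \<theta>) = r *\<^sub>R ev (h \<theta>)" "s > 0" "av A (ev (h \<theta>)) = s *\<^sub>R ev (g (h \<theta>))"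
    using plift_D[OF assms(1)] plift_D[OF assms(2)] by metis
  then show "\<exists>r>0. av (A ** B) (ev \<theta>) = r *\<^sub>R ev ((g \<circ> h) \<theta>)"
    by (intro exI[of _ "r * s"]) (simp add: av_mult av_scaleR)
qed

lemma av_scaled_matrix: "av (s *\<^sub>R A) v = s *\<^sub>R av A v"
  by (simp add: av_def prod_eq_iff algebra_simps)

lemma plift_scaleR:
  assumes "plift A g" "s > 0" shows "plift (s *\<^sub>R A) g"
  unfolding plift_def
proof (intro conjI allI plift_cont[OF assms(1)])
  fix \<theta>
  obtain r where "r > 0" "av A (ev \<theta>) = r *\<^sub>R ev (g \<theta>)" using plift_D[OF assms(1)] by blast
  then show "\<exists>r>0. av (s *\<^sub>R A) (ev \<theta>) = r *\<^sub>R ev (g \<theta>)"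
    using assms(2) by (intro exI[of _ "s * r"]) (simp add: av_scaled_matrix)
qed

lemma plift_id: "plift (mat 1) (\<lambda>\<theta>. \<theta>)"
  unfolding plift_def by (auto intro!: exI[of _ 1] continuous_intros)

lemma plift_pi: "plift (- mat 1) (\<lambda>\<theta>. \<theta> + pi)"
  unfolding plift_def by (auto intro!: exI[of _ 1] continuous_intros simp: av_minus)

lemma plift_uminus: "plift (mt (- 1) 0 0 1) uminus"
  unfolding plift_def by (auto intro!: exI[of _ 1] continuous_intros simp: av_def ev_def)

text \<open>All lifts of projective transformations to the universal cover of the projective line,
  including those reversing orientation. The increasing ones, \<open>GP\<close>, form the universal
  covering group of PSL_2(R).\<close>

definition GG :: "(real \<Rightarrow> real) set" where "GG = {g. \<exists>A. det A \<noteq> 0 \<and> plift A g}"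

definition GP :: "(real \<Rightarrow> real) set" where "GP = {g \<in> GG. strict_mono g}"

lemma GG_cont: "g \<in> GG \<Longrightarrow> continuous_on UNIV g" by (auto simp: GG_def plift_def)

lemma GG_isCont: "g \<in> GG \<Longrightarrow> isCont g x" using GG_cont by (simp add: continuous_on_eq_continuous_at)

lemma GG_comp: "g \<in> GG \<Longrightarrow> h \<in> GG \<Longrightarrow> g \<circ> h \<in> GG"
  unfolding GG_def using plift_comp by (auto simp: det_mul) (metis det_mul mult_eq_0_iff)

lemma GG_id: "id \<in> GG" "(\<lambda>\<theta>. \<theta>) \<in> GG"
proof -
  show "(\<lambda>\<theta>. \<theta>) \<in> GG" unfolding GG_def by (auto intro!: exI[of _ "mat 1"] plift_id)
  then show "id \<in> GG" by (simp add: id_def)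
qed

lemma GG_uminus: "uminus \<in> GG"
  unfolding GG_def by (auto intro!: exI[of _ "mt (- 1) 0 0 1"] plift_uminus)

lemma GG_inverse:
  assumes "g \<in> GG" obtains h where "h \<in> GG" "\<And>\<theta>. h (g \<theta>) = \<theta>" "\<And>\<theta>. g (h \<theta>) = \<theta>"
proof -
  obtain A where A: "det A \<noteq> 0" "plift A g" using assms by (auto simp: GG_def)
  then obtain B where B: "A ** B = mat 1" "B ** A = mat 1" using invertible_det_nz[of A] by (auto simp: invertible_def)
  have dB: "det B \<noteq> 0" using B(1) by (metis det_I det_mul mult_zero_right zero_neq_one)
  obtain r where r: "r > 0" "av A (ev 0) = r *\<^sub>R ev (g 0)" using plift_D[OF A(2)] by blast
  have "av B (av A (ev 0)) = ev 0" by (simp add: B flip: av_mult)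
  then have "r *\<^sub>R av B (ev (g 0)) = ev 0" by (simp add: r av_scaleR)
  then have "av B (ev (g 0)) = (1 / r) *\<^sub>R ev 0" using r(1) by (metis divideR_right eq_vector_fraction_iff inverse_eq_divide less_irrefl scaleR_one)
  then obtain h where h: "plift B h" "h (g 0) = 0" using plift_exists[OF dB, of "1 / r" "g 0" 0] r(1) by auto
  have "h \<circ> g = (\<lambda>\<theta>. \<theta>)"
    using plift_unique[OF _ plift_id, of "h \<circ> g" 0] plift_comp[OF h(1) A(2)] B h by simp
  then have hg: "h (g \<theta>) = \<theta>" for \<theta> by (metis comp_apply)
  have "g \<circ> h = (\<lambda>\<theta>. \<theta>)"
    using plift_unique[OF _ plift_id, of "g \<circ> h" "g 0"] plift_comp[OF A(2) h(1)] B h by simp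
  then have gh: "g (h \<theta>) = \<theta>" for \<theta> by (metis comp_apply)
  have "h \<in> GG" using dB h(1) by (auto simp: GG_def)
  then show ?thesis using that hg gh by blast
qed

lemma GG_inverse_ex: "g \<in> GG \<Longrightarrow> \<exists>h\<in>GG. (\<forall>\<theta>. h (g \<theta>) = \<theta>) \<and> (\<forall>\<theta>. g (h \<theta>) = \<theta>)"
  by (metis GG_inverse)

lemma GG_inj: "g \<in> GG \<Longrightarrow> inj g" by (metis GG_inverse injI)

lemma GG_mono_cases:
  assumes "g \<in> GG" obtains "strict_mono g" | "strict_antimono_on UNIV g"
  using injective_eq_monotone_map[of UNIV g] GG_inj[OF assms] GG_cont[OF assms] is_interval_univ by blast

lemma antimono_uminus: "strict_antimono_on UNIV g \<longleftrightarrow> strict_mono (g \<circ> uminus)" for g :: "real \<Rightarrow> real"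
  unfolding monotone_on_def by (auto; metis minus_minus neg_less_iff_less)

lemma GP_GG: "g \<in> GP \<Longrightarrow> g \<in> GG" by (simp add: GP_def)

lemma GP_less: "g \<in> GP \<Longrightarrow> g x < g y \<longleftrightarrow> x < y" by (simp add: GP_def strict_mono_less)

lemma GP_le: "g \<in> GP \<Longrightarrow> g x \<le> g y \<longleftrightarrow> x \<le> y" by (simp add: GP_def strict_mono_less_eq)

lemma GP_id: "id \<in> GP" by (simp add: GP_def GG_id strict_mono_def)

lemma GP_comp: "g \<in> GP \<Longrightarrow> h \<in> GP \<Longrightarrow> g \<circ> h \<in> GP"
  by (simp add: GP_def GG_comp strict_mono_def)

lemma GP_inverse:
  assumes "g \<in> GP" obtains h where "h \<in> GP" "\<And>\<theta>. h (g \<theta>) = \<theta>" "\<And>\<theta>. g (h \<theta>) = \<theta>"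
proof -
  obtain h where h: "h \<in> GG" "\<And>\<theta>. h (g \<theta>) = \<theta>" "\<And>\<theta>. g (h \<theta>) = \<theta>"
    using GG_inverse[OF GP_GG[OF assms]] by blast
  have "strict_mono h"
    unfolding strict_mono_def using GP_less[OF assms] h(3) by metis
  then show ?thesis using that h by (simp add: GP_def)
qed

lemma GG_orientation:
  assumes "g \<in> GG" obtains "g \<in> GP" | "g \<circ> uminus \<in> GP"
  using GG_mono_cases[OF assms] antimono_uminus[of g] GG_comp[OF assms GG_uminus] assms
  by (metis (mono_tags, lifting) GP_def mem_Collect_eq)

lemma cross_av:
  "fst (av A u) * snd (av A v) - snd (av A u) * fst (av A v) = det A * (fst u * snd v - snd u * fst v)"
  by (cases A rule: mt_cases) (simp add: av_def algebra_simps)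

lemma cross_ev: "fst (ev \<alpha>) * snd (ev \<beta>) - snd (ev \<alpha>) * fst (ev \<beta>) = sin (\<alpha> - \<beta>)"
  by (simp add: ev_def sin_diff)

lemma plift_cross:
  assumes "plift A g"
  obtains k where "k > 0" "k * sin (g \<alpha> - g \<beta>) = det A * sin (\<alpha> - \<beta>)"
proof -
  obtain r s where rs: "r > 0" "av A (ev \<alpha>) = r *\<^sub>R ev (g \<alpha>)" "s > 0" "av A (ev \<beta>) = s *\<^sub>R ev (g \<beta>)"
    using plift_D[OF assms] by metis
  have "(r * s) * (fst (ev (g \<alpha>)) * snd (ev (g \<beta>)) - snd (ev (g \<alpha>)) * fst (ev (g \<beta>)))
     = fst (r *\<^sub>R ev (g \<alpha>)) * snd (s *\<^sub>R ev (g \<beta>)) - snd (r *\<^sub>R ev (g \<alpha>)) * fst (s *\<^sub>R ev (g \<beta>))"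
    by (simp add: algebra_simps)
  also have "\<dots> = det A * (fst (ev \<alpha>) * snd (ev \<beta>) - snd (ev \<alpha>) * fst (ev \<beta>))"
    unfolding rs(2,4)[symmetric] by (rule cross_av)
  finally have "(r * s) * sin (g \<alpha> - g \<beta>) = det A * sin (\<alpha> - \<beta>)" unfolding cross_ev .
  then show ?thesis using that[of "r * s"] rs by simp
qed

lemma plift_close:
  assumes "plift A g"
  obtains \<beta> where "\<alpha> < \<beta>" "\<beta> < \<alpha> + pi" "\<bar>g \<beta> - g \<alpha>\<bar> < pi"
proof -
  have "isCont g \<alpha>" using plift_cont[OF assms] by (simp add: continuous_on_eq_continuous_at)
  then obtain d where d: "d > 0" "\<And>x. \<bar>x - \<alpha>\<bar> < d \<Longrightarrow> \<bar>g x - g \<alpha>\<bar> < pi"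
    unfolding continuous_at_eps_delta dist_real_def using pi_gt_zero by blast
  define e where "e = min d pi"
  have "e > 0" "e \<le> d" "e \<le> pi" using d(1) by (auto simp: e_def)
  then have "\<alpha> < \<alpha> + e / 2" "\<alpha> + e / 2 < \<alpha> + pi" "\<bar>\<alpha> + e / 2 - \<alpha>\<bar> < d" by auto
  then show ?thesis using that d(2) by blast
qed

text \<open>A matrix multiplies the cross product of two vectors by its determinant. For close
  angles the sign of the cross product is that of the difference of the angles, so the determinant
  decides monotonicity.\<close>

lemma plift_mono_iff_det:
  assumes A: "plift A g" "det A \<noteq> 0"
  shows "strict_mono g \<longleftrightarrow> det A > 0"
proof -
  obtain \<beta> where \<beta>: "0 < \<beta>" "\<beta> < 0 + pi" "\<bar>g \<beta> - g 0\<bar> < pi" using plift_close[OF A(1), of 0] by blast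
  obtain k where k: "k > 0" "k * sin (g \<beta> - g 0) = det A * sin (\<beta> - 0)" using plift_cross[OF A(1)] by blast
  have sb: "sin \<beta> > 0" using \<beta> by (simp add: sin_gt_zero)
  have "g \<in> GG" using A by (auto simp: GG_def)
  then show ?thesis
  proof (cases rule: GG_mono_cases)
    case 1
    then have "g \<beta> - g 0 > 0" using \<beta> by (simp add: strict_mono_def)
    then have "sin (g \<beta> - g 0) > 0" using \<beta> by (intro sin_gt_zero) auto
    then have "det A * sin \<beta> > 0" using k by (metis diff_zero mult_pos_pos)
    then show ?thesis using 1 sb by (simp add: zero_less_mult_iff)
  next
    case 2
    then have l: "g \<beta> - g 0 < 0" using \<beta> by (simp add: monotone_on_def)
    then have "sin (g 0 - g \<beta>) > 0" using \<beta> by (intro sin_gt_zero) auto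
    then have "sin (g \<beta> - g 0) < 0" using sin_minus[of "g \<beta> - g 0"] by simp
    then have "det A * sin \<beta> < 0" using k by (metis diff_zero mult_pos_neg)
    then have "det A < 0" using sb by (simp add: mult_less_0_iff)
    moreover have "\<not> strict_mono g" using l \<beta> by (metis diff_gt_0_iff_gt minus_diff_eq neg_less_0_iff_less not_less_iff_gr_or_eq strict_monoD)
    ultimately show ?thesis by simp
  qed
qed

lemma infinite_tan_image:
  fixes \<alpha> \<beta> :: real
  assumes "\<alpha> < \<beta>" shows "infinite (tan ` {\<theta>. \<alpha> < \<theta> \<and> \<theta> < \<beta> \<and> cos \<theta> \<noteq> 0})"
proof -
  have "\<exists>\<theta>0. \<alpha> < \<theta>0 \<and> \<theta>0 < \<beta> \<and> cos \<theta>0 \<noteq> 0"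
  proof (cases "cos ((\<alpha> + \<beta>) / 2) = 0")
    case True
    define d where "d = min pi ((\<beta> - \<alpha>) / 2) / 2"
    have m: "min pi ((\<beta> - \<alpha>) / 2) > 0" "min pi ((\<beta> - \<alpha>) / 2) \<le> pi" "min pi ((\<beta> - \<alpha>) / 2) \<le> (\<beta> - \<alpha>) / 2"
      using assms min.cobounded1[of pi "(\<beta> - \<alpha>) / 2"] min.cobounded2[of pi "(\<beta> - \<alpha>) / 2"] by (simp, blast, blast)
    have d: "d > 0" "d < pi" "d < (\<beta> - \<alpha>) / 2" using m unfolding d_def by linarith+
    have "sin ((\<alpha> + \<beta>) / 2) \<noteq> 0" using True sin_cos_squared_add[of "(\<alpha> + \<beta>) / 2"] by auto
    then have "cos ((\<alpha> + \<beta>) / 2 + d) \<noteq> 0" using True sin_gt_zero[OF d(1,2)] by (simp add: cos_add)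
    moreover have "\<alpha> < (\<alpha> + \<beta>) / 2 + d" "(\<alpha> + \<beta>) / 2 + d < \<beta>" using d assms by argo+
    ultimately show ?thesis by blast
  next
    case False
    then show ?thesis using assms by (intro exI[of _ "(\<alpha> + \<beta>) / 2"]) auto
  qed
  then obtain \<theta>0 where \<theta>0: "\<alpha> < \<theta>0" "\<theta>0 < \<beta>" "cos \<theta>0 \<noteq> 0" by blast
  have "isCont cos \<theta>0" by simp
  then obtain e where e: "e > 0" "\<And>x. \<bar>x - \<theta>0\<bar> < e \<Longrightarrow> \<bar>cos x - cos \<theta>0\<bar> < \<bar>cos \<theta>0\<bar>"
    unfolding continuous_at_eps_delta dist_real_def using \<theta>0(3) by (metis zero_less_abs_iff)
  define d where "d = min (min e pi) (\<beta> - \<theta>0)"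
  have d: "d > 0" "d \<le> e" "d \<le> pi" "d \<le> \<beta> - \<theta>0" using e \<theta>0 by (auto simp: d_def)
  have sub: "{\<theta>0 <..< \<theta>0 + d} \<subseteq> {\<theta>. \<alpha> < \<theta> \<and> \<theta> < \<beta> \<and> cos \<theta> \<noteq> 0}"
  proof
    fix x assume x: "x \<in> {\<theta>0 <..< \<theta>0 + d}"
    have "cos x \<noteq> 0" using e(2)[of x] x d by auto
    then show "x \<in> {\<theta>. \<alpha> < \<theta> \<and> \<theta> < \<beta> \<and> cos \<theta> \<noteq> 0}" using x \<theta>0 d by auto
  qed
  have inj: "inj_on tan {\<theta>0 <..< \<theta>0 + d}"
  proof (rule linorder_inj_onI')
    fix x y assume xy: "x \<in> {\<theta>0 <..< \<theta>0 + d}" "y \<in> {\<theta>0 <..< \<theta>0 + d}" "x < y"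
    have c: "cos x \<noteq> 0" "cos y \<noteq> 0" using xy sub by blast+
    have "sin (y - x) > 0" using xy d by (intro sin_gt_zero) auto
    then show "tan x \<noteq> tan y" using c by (auto simp: tan_def sin_diff field_simps)
  qed
  have "infinite {\<theta>0 <..< \<theta>0 + d}" using d(1) by (intro infinite_Ioo) simp
  then have "infinite (tan ` {\<theta>0 <..< \<theta>0 + d})" using inj finite_imageD by blast
  then show ?thesis using sub by (meson finite_subset image_mono)
qed

text \<open>If the lifts agree on an interval, every direction in it is an eigendirection of
  \<open>adj A ** B\<close>. A matrix with infinitely many eigendirections is scalar, and the sign
  of its eigenvalue ensures that the two matrices differ by a positive factor.\<close>

lemma GG_rigid:
  assumes g: "g \<in> GG" and h: "h \<in> GG" and ab: "\<alpha> < \<beta>" and eq: "\<And>\<theta>. \<alpha> < \<theta> \<Longrightarrow> \<theta> < \<beta> \<Longrightarrow> g \<theta> = h \<theta>"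
  shows "g = h"
proof -
  obtain A where A: "det A \<noteq> 0" "plift A g" using g by (auto simp: GG_def)
  obtain B where B: "det B \<noteq> 0" "plift B h" using h by (auto simp: GG_def)
  obtain p q r s where C: "adj A ** B = mt p q r s" by (rule mt_cases)
  have adjA: "av (adj A) (av A v) = det A *\<^sub>R v" for v
    by (cases A rule: mt_cases) (simp add: av_def prod_eq_iff algebra_simps)
  have eig: "\<exists>k. k * det A > 0 \<and> av (mt p q r s) (ev \<theta>) = k *\<^sub>R ev \<theta>" if th: "\<alpha> < \<theta>" "\<theta> < \<beta>" for \<theta>
  proof -
    obtain u v where uv: "u > 0" "av A (ev \<theta>) = u *\<^sub>R ev (g \<theta>)" "v > 0" "av B (ev \<theta>) = v *\<^sub>R ev (g \<theta>)"
      using plift_D[OF A(2)] plift_D[OF B(2)] eq[OF th] by metis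
    have "av B (ev \<theta>) = (v / u) *\<^sub>R av A (ev \<theta>)" using uv by simp
    then have "av (mt p q r s) (ev \<theta>) = (v / u * det A) *\<^sub>R ev \<theta>"
      by (simp add: C[symmetric] av_mult av_scaleR adjA)
    moreover have "v / u * det A * det A > 0" using uv(1,3) A(1)
      by (metis divide_pos_pos mult.assoc mult_pos_pos not_real_square_gt_zero)
    ultimately show ?thesis by blast
  qed
  \<comment> \<open>The quadratic polynomial whose roots are the slopes of the
    eigendirections.\<close>
  define P where "P = [:q, p - s, - r:]"
  have "tan ` {\<theta>. \<alpha> < \<theta> \<and> \<theta> < \<beta> \<and> cos \<theta> \<noteq> 0} \<subseteq> {x. poly P x = 0}"
  proof (rule image_subsetI)
    fix \<theta> assume th: "\<theta> \<in> {\<theta>. \<alpha> < \<theta> \<and> \<theta> < \<beta> \<and> cos \<theta> \<noteq> 0}"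
    then obtain k where "av (mt p q r s) (ev \<theta>) = k *\<^sub>R ev \<theta>" using eig by blast
    then have e: "p * sin \<theta> + q * cos \<theta> = k * sin \<theta>" "r * sin \<theta> + s * cos \<theta> = k * cos \<theta>"
      by (auto simp: av_def ev_def)
    have "(p * sin \<theta> + q * cos \<theta>) * cos \<theta> = (r * sin \<theta> + s * cos \<theta>) * sin \<theta>" unfolding e by simp
    moreover have "sin \<theta> = tan \<theta> * cos \<theta>" using th by (simp add: tan_def)
    ultimately have "cos \<theta> * cos \<theta> * (p * tan \<theta> + q) = cos \<theta> * cos \<theta> * ((r * tan \<theta> + s) * tan \<theta>)"
      by (simp add: algebra_simps)
    then have "p * tan \<theta> + q = (r * tan \<theta> + s) * tan \<theta>" using th by simp
    then show "tan \<theta> \<in> {x. poly P x = 0}" by (simp add: P_def algebra_simps)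
  qed
  then have "infinite {x. poly P x = 0}" using infinite_tan_image[OF ab] finite_subset by blast
  then have "P = 0" using poly_roots_finite by blast
  then have C': "q = 0" "p = s" "r = 0" by (auto simp: P_def)
  have AB: "det A *\<^sub>R B = p *\<^sub>R A"
  proof -
    have "A ** (adj A ** B) = det A *\<^sub>R B"
    proof -
      obtain a b c d where A': "A = mt a b c d" by (rule mt_cases)
      obtain a' b' c' d' where B': "B = mt a' b' c' d'" by (rule mt_cases)
      show ?thesis unfolding A' B' by (simp add: mat2_eq_iff algebra_simps)
    qed
    moreover have "A ** mt p 0 0 p = p *\<^sub>R A"
    proof -
      obtain a b c d where A': "A = mt a b c d" by (rule mt_cases)
      show ?thesis unfolding A' by (simp add: mat2_eq_iff algebra_simps)
    qed
    ultimately show ?thesis using C C' by simp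
  qed
  obtain k where k: "k * det A > 0" "av (mt p q r s) (ev ((\<alpha> + \<beta>) / 2)) = k *\<^sub>R ev ((\<alpha> + \<beta>) / 2)"
    using eig[of "(\<alpha> + \<beta>) / 2"] ab by auto
  have "av (mt p q r s) v = p *\<^sub>R v" for v using C' by (simp add: av_def prod_eq_iff)
  then have "k = p" using k(2) ev_nonzero by (metis scaleR_cancel_right)
  then have pA: "p * det A > 0" using k by simp
  define c where "c = det A / p"
  have p0: "p \<noteq> 0" using pA by auto
  have c: "c > 0" using pA by (auto simp: c_def zero_less_divide_iff zero_less_mult_iff)
  have "c *\<^sub>R B = (1 / p) *\<^sub>R (det A *\<^sub>R B)" by (simp add: c_def)
  also have "\<dots> = A" unfolding AB using p0 by simp
  finally have "plift A h" using plift_scaleR[OF B(2) c] by simp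
  then show ?thesis using plift_unique[OF A(2), of h "(\<alpha> + \<beta>) / 2"] eq[of "(\<alpha> + \<beta>) / 2"] ab by simp
qed

text \<open>Since the negated identity is central, \<open>g\<close> commutes with the shift by
  \<open>pi\<close> up to a multiple of \<open>2 * pi\<close>. Hence it multiplies the shift by a
  positive integer, and so does its inverse; the product of the two integers is 1.\<close>

lemma GP_shift_pi:
  assumes g: "g \<in> GP" shows "g (\<theta> + pi) = g \<theta> + pi"
proof -
  have step: "\<exists>m :: int. (1 :: int) \<le> m \<and> (\<forall>\<theta>. f (\<theta> + pi) = f \<theta> + m * pi)" if f: "f \<in> GP" for f
  proof -
    obtain A where A: "det A \<noteq> 0" "plift A f" using f by (auto simp: GP_def GG_def)
    have "plift (- A) (f \<circ> (\<lambda>\<theta>. \<theta> + pi))" using plift_comp[OF A(2) plift_pi] by (simp add: matrix_minus_mult)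
    moreover have "plift (- A) ((\<lambda>\<theta>. \<theta> + pi) \<circ> f)" using plift_comp[OF plift_pi A(2)] by (simp add: matrix_minus_mult)
    ultimately obtain k :: int where "\<forall>\<theta>. (f \<circ> (\<lambda>\<theta>. \<theta> + pi)) \<theta> = ((\<lambda>\<theta>. \<theta> + pi) \<circ> f) \<theta> + 2 * pi * k"
      using plift_diff[of "- A" "f \<circ> (\<lambda>\<theta>. \<theta> + pi)" "(\<lambda>\<theta>. \<theta> + pi) \<circ> f"] by blast
    then have k: "f (\<theta> + pi) = f \<theta> + pi + 2 * pi * k" for \<theta> by (simp add: o_def)
    then have e: "f (\<theta> + pi) = f \<theta> + (1 + 2 * k) * pi" for \<theta> unfolding k by (simp add: algebra_simps)
    have "f 0 < f (0 + pi)" using GP_less[OF f] by simp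
    then have "0 < real_of_int (1 + 2 * k) * pi" using e[of 0] by simp
    then have "1 + 2 * k \<ge> 1" by (simp add: zero_less_mult_iff)
    then show ?thesis using e by (intro exI[of _ "1 + 2 * k"]) auto
  qed
  obtain h where h: "h \<in> GP" "\<And>\<theta>. h (g \<theta>) = \<theta>" "\<And>\<theta>. g (h \<theta>) = \<theta>" using GP_inverse[OF g] by blast
  obtain m :: int where m1: "(1 :: int) \<le> m" and "\<forall>\<theta>. g (\<theta> + pi) = g \<theta> + m * pi" using step[OF g] by (elim exE conjE)
  then have m2: "g (\<theta> + pi) = g \<theta> + m * pi" for \<theta> by blast
  note m = m1 m2
  obtain n :: int where n1: "(1 :: int) \<le> n" and "\<forall>\<theta>. h (\<theta> + pi) = h \<theta> + n * pi" using step[OF h(1)] by (elim exE conjE)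
  then have n2: "h (\<theta> + pi) = h \<theta> + n * pi" for \<theta> by blast
  note n = n1 n2
  have hk: "h (\<theta> + real k * pi) = h \<theta> + real k * (n * pi)" for \<theta> k
  proof (induction k)
    case (Suc k)
    have e: "\<theta> + real (Suc k) * pi = (\<theta> + real k * pi) + pi" by (simp add: algebra_simps)
    show ?case unfolding e n(2) Suc by (simp add: algebra_simps)
  qed simp
  have "real (nat m) = m" using m(1) by simp
  then have "h (g \<theta> + m * pi) = h (g \<theta>) + m * (n * pi)" using hk[of "g \<theta>" "nat m"] by simp
  then have "\<theta> + pi = \<theta> + m * (n * pi)" using m(2)[of \<theta>] h(2) by metis
  then have "real_of_int (m * n) * pi = 1 * pi" by simp
  then have "real_of_int (m * n) = 1" by (simp only: mult_cancel_right) simp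
  then have "m * n = 1" by (simp only: of_int_eq_1_iff)
  then have "m = 1" using m(1) n(1) by (simp add: zmult_eq_1_iff)
  then show ?thesis using m(2) by simp
qed

lemma GP_pi: "(\<lambda>\<theta>. \<theta> + of_int k * pi) \<in> GP"
proof -
  have 1: "(\<lambda>\<theta>. \<theta> + pi) \<in> GG"
  proof -
    have "det (- mat 1 :: real^2^2) \<noteq> 0" by (simp add: mat_1_eq_mt)
    then show ?thesis unfolding GG_def using plift_pi by blast
  qed
  obtain h where h: "h \<in> GG" "\<forall>\<theta>. h (\<theta> + pi) = \<theta>" "\<forall>\<theta>. h \<theta> + pi = \<theta>"
    using GG_inverse_ex[OF 1] by (elim bexE conjE)
  have "h = (\<lambda>\<theta>. \<theta> - pi)"
  proof
    show "h \<theta> = \<theta> - pi" for \<theta> using h(3)[rule_format, of \<theta>] by linarith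
  qed
  then have 2: "(\<lambda>\<theta>. \<theta> - pi) \<in> GG" using h(1) by simp
  have "(\<lambda>\<theta>. \<theta> + of_int k * pi) \<in> GG"
  proof (induction k rule: int_induct[where k = 0])
    case base
    show ?case by (simp add: GG_id)
  next
    case (step1 i)
    show ?case using GG_comp[OF 1 step1(2)] by (simp add: o_def algebra_simps)
  next
    case (step2 i)
    show ?case using GG_comp[OF 2 step2(2)] by (simp add: o_def algebra_simps)
  qed
  then show ?thesis by (simp add: GP_def strict_mono_def)
qed

subsection \<open>The matrix of an orientation-preserving lift\<close>

text \<open>The covering homomorphism from \<open>GP\<close> to SL_2(R). As lifts refer to rays,
  there is no sign left to choose.\<close>

definition mx :: "(real \<Rightarrow> real) \<Rightarrow> real^2^2" where
  "mx g = (SOME A. det A = 1 \<and> plift A g)"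

lemma mx:
  assumes "g \<in> GP" shows "det (mx g) = 1" "plift (mx g) g"
proof -
  obtain A where A: "det A \<noteq> 0" "plift A g" using assms by (auto simp: GP_def GG_def)
  then have pos: "det A > 0" using plift_mono_iff_det assms by (auto simp: GP_def)
  define s where "s = 1 / sqrt (det A)"
  have s: "s > 0" using pos by (simp add: s_def)
  have "s * s * det A = 1" using pos by (simp add: s_def)
  then have "det (s *\<^sub>R A) = 1" by (cases A rule: mt_cases) (simp add: det_2 algebra_simps)
  then have "det (s *\<^sub>R A) = 1 \<and> plift (s *\<^sub>R A) g" using plift_scaleR[OF A(2) s] by simp
  then have "det (mx g) = 1 \<and> plift (mx g) g" unfolding mx_def by (rule someI)
  then show "det (mx g) = 1" "plift (mx g) g" by auto
qed

text \<open>The directions \<open>0\<close> and \<open>pi / 2\<close> give the columns up to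
  positive factors, and \<open>pi / 4\<close>, the direction of their sum, equates the two factors;
  the determinant makes them 1.\<close>

lemma mx_unique:
  assumes "plift A g" "plift B g" "det A = 1" "det B = 1" shows "A = B"
proof -
  have g: "g \<in> GG" unfolding GG_def using assms(1,3) by (auto intro!: exI[of _ A])
  obtain r s where 1: "r > 0" "av A (ev 0) = r *\<^sub>R ev (g 0)" "s > 0" "av B (ev 0) = s *\<^sub>R ev (g 0)"
    using plift_D[OF assms(1)] plift_D[OF assms(2)] by metis
  obtain r' s' where 2: "r' > 0" "av A (ev (pi/2)) = r' *\<^sub>R ev (g (pi/2))" "s' > 0" "av B (ev (pi/2)) = s' *\<^sub>R ev (g (pi/2))"
    using plift_D[OF assms(1)] plift_D[OF assms(2)] by metis
  obtain r'' s'' where 3: "r'' > 0" "av A (ev (pi/4)) = r'' *\<^sub>R ev (g (pi/4))" "s'' > 0" "av B (ev (pi/4)) = s'' *\<^sub>R ev (g (pi/4))"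
    using plift_D[OF assms(1)] plift_D[OF assms(2)] by metis
  have b0: "av B (ev 0) = (s / r) *\<^sub>R av A (ev 0)" "av B (ev (pi/2)) = (s' / r') *\<^sub>R av A (ev (pi/2))"
    "av B (ev (pi/4)) = (s'' / r'') *\<^sub>R av A (ev (pi/4))" using 1 2 3 by simp_all
  obtain a b c d where A: "A = mt a b c d" by (rule mt_cases)
  obtain a' b' c' d' where B: "B = mt a' b' c' d'" by (rule mt_cases)
  define l where "l = s / r" define m where "m = s' / r'" define n where "n = s'' / r''"
  have e: "b' = l * b" "d' = l * d" "a' = m * a" "c' = m * c"
    using b0(1,2) by (auto simp: A B av_def ev_def l_def m_def)
  have e45: "ev (pi / 4) = (sqrt 2 / 2) *\<^sub>R (1, 1)" by (simp add: ev_def sin_45 cos_45)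
  have "(sqrt 2 / 2) *\<^sub>R av B (1, 1) = (sqrt 2 / 2) *\<^sub>R (n *\<^sub>R av A (1, 1))"
    using b0(3) unfolding e45 av_scaleR n_def by (simp add: mult.commute)
  then have "av B (1, 1) = n *\<^sub>R av A (1, 1)" by (simp only: scaleR_cancel_left) simp
  then have "a' + b' = n * (a + b)" "c' + d' = n * (c + d)" by (simp_all add: A B av_def)
  then have f: "(m - n) * a = (n - l) * b" "(m - n) * c = (n - l) * d" using e by (simp_all add: algebra_simps)
  have dt: "a * d - b * c = 1" using assms(3) A by simp
  have "(m - n) * (a * d - b * c) = 0"
  proof -
    have "(m - n) * (a * d - b * c) = ((m - n) * a) * d - b * ((m - n) * c)" by (simp add: algebra_simps)
    then show ?thesis unfolding f by (simp add: algebra_simps)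
  qed
  then have mn: "m = n" using dt by simp
  have "(n - l) * (a * d - b * c) = a * ((n - l) * d) - c * ((n - l) * b)" by (simp add: algebra_simps)
  then have nl: "n = l" using dt by (simp add: f[symmetric] mn)
  have "l * l * (a * d - b * c) = 1" using assms(4) by (simp add: B e mn nl algebra_simps)
  then have "l * l = 1 * 1" using dt by simp
  moreover have "l > 0" using 1 by (simp add: l_def)
  ultimately have "l = 1" by (metis mult_strict_mono' not_less_iff_gr_or_eq order_less_imp_le zero_less_one)
  then show ?thesis by (simp add: A B e mn nl)
qed

lemma mx_comp: "g \<in> GP \<Longrightarrow> h \<in> GP \<Longrightarrow> mx (g \<circ> h) = mx g ** mx h"
  by (rule mx_unique[OF mx(2)[OF GP_comp] plift_comp[OF mx(2) mx(2)] mx(1)[OF GP_comp]])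
     (simp_all add: det_mul mx)

lemma mx_id: "mx (\<lambda>\<theta>. \<theta>) = mat 1"
proof -
  have "(\<lambda>\<theta>. \<theta>) \<in> GP" using GP_id by (simp add: id_def)
  then show ?thesis using mx_unique[OF mx(2) plift_id mx(1)] by simp
qed

text \<open>The kernel of the map from \<open>GP\<close> to PSL_2(R) is the group of translations by
  integral multiples of \<open>pi\<close>, the deck group of the universal cover of the projective
  line.\<close>

lemma pm_mx_id_iff:
  assumes "g \<in> GP"
  shows "pm (mx g) (mat 1) \<longleftrightarrow> (\<exists>k :: int. \<forall>\<theta>. g \<theta> = \<theta> + k * pi)"
proof
  assume "pm (mx g) (mat 1)"
  then consider "plift (mat 1) g" | "plift (- mat 1) g" using mx(2)[OF assms] by (auto simp: pm_def)
  then show "\<exists>k :: int. \<forall>\<theta>. g \<theta> = \<theta> + k * pi"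
  proof cases
    case 1
    then obtain k :: int where "\<And>\<theta>. g \<theta> = \<theta> + 2 * pi * k" using plift_diff[OF 1 plift_id] by blast
    then show ?thesis by (intro exI[of _ "2 * k"]) (simp add: algebra_simps)
  next
    case 2
    then obtain k :: int where "\<And>\<theta>. g \<theta> = \<theta> + pi + 2 * pi * k" using plift_diff[OF 2 plift_pi] by blast
    then show ?thesis by (intro exI[of _ "1 + 2 * k"]) (simp add: algebra_simps)
  qed
next
  assume "\<exists>k :: int. \<forall>\<theta>. g \<theta> = \<theta> + k * pi"
  then obtain k :: int where k: "g = (\<lambda>\<theta>. \<theta> + k * pi)" by blast
  have "ev (\<theta> + k * pi) = (if even k then ev \<theta> else - ev \<theta>)" for \<theta>
  proof (cases "even k")
    case True
    then obtain j where "k = 2 * j" by blast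
    then have "ev (\<theta> + k * pi) = ev \<theta>" unfolding ev_eq_iff by (intro exI[of _ j]) simp
    then show ?thesis using True by simp
  next
    case False
    then obtain j where "k = 2 * j + 1" by (metis oddE)
    then have "ev (\<theta> + k * pi) = ev (\<theta> + pi)" unfolding ev_eq_iff by (intro exI[of _ j]) (simp add: algebra_simps)
    then show ?thesis using False by simp
  qed
  then have "plift (if even k then mat 1 else - mat 1) g"
    unfolding plift_def k by (auto intro!: continuous_intros exI[of _ 1] simp: av_minus)
  moreover have "det (if even k then mat 1 else - mat 1 :: real^2^2) = 1" by (simp add: mat_1_eq_mt)
  ultimately have "mx g = (if even k then mat 1 else - mat 1)" using mx_unique mx[OF assms] by blast
  then show "pm (mx g) (mat 1)" by (simp add: pm_def)
qed

subsection \<open>Projective charts of the circle\<close>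

abbreviation BB :: "real set" where "BB \<equiv> {- (pi / 2) <..< pi / 2}"

text \<open>The circle is a quotient of the affine line, the projective line without its pole. In
  the angular coordinate the affine line is \<open>BB\<close>; that is why germs below are required
  to take values in \<open>BB\<close>.\<close>

definition tau :: "real \<Rightarrow> circle" where "tau \<theta> = proj (tan \<theta>)"

lemma BB_cos: "\<theta> \<in> BB \<Longrightarrow> cos \<theta> > 0"
  using cos_gt_zero_pi[of \<theta>] by simp

lemma BB_tan_inj: "\<theta> \<in> BB \<Longrightarrow> \<phi> \<in> BB \<Longrightarrow> tan \<theta> = tan \<phi> \<Longrightarrow> \<theta> = \<phi>"
  by (metis arctan_unique greaterThanLessThan_iff minus_divide_left)

lemma BB_arctan: "arctan x \<in> BB"
  using arctan_bounded[of x] by simp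

lemma open_BB: "open BB" by simp

lemma tau_surj: obtains \<theta> where "\<theta> \<in> BB" "tau \<theta> = z"
proof -
  obtain t where "proj t = z" by (rule proj_surj)
  then have "tau (arctan t) = z" by (simp add: tau_def tan_arctan)
  then show ?thesis using that BB_arctan by blast
qed

lemma tau_eq_iff: "tau \<theta> = tau \<phi> \<longleftrightarrow> tan \<theta> - tan \<phi> \<in> \<int>"
  by (simp add: tau_def proj_eq_iff)

lemma tan_plift:
  assumes "plift A g" "cos \<theta> \<noteq> 0"
  shows "tan (g \<theta>) = (A $ 1 $ 1 * tan \<theta> + A $ 1 $ 2) / (A $ 2 $ 1 * tan \<theta> + A $ 2 $ 2)"
proof -
  obtain r where r: "r > 0" "av A (ev \<theta>) = r *\<^sub>R ev (g \<theta>)" using plift_D[OF assms(1)] by blast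
  have e: "A $ 1 $ 1 * sin \<theta> + A $ 1 $ 2 * cos \<theta> = r * sin (g \<theta>)" "A $ 2 $ 1 * sin \<theta> + A $ 2 $ 2 * cos \<theta> = r * cos (g \<theta>)"
    using r(2) by (auto simp: av_def ev_def)
  have "tan (g \<theta>) = (r * sin (g \<theta>)) / (r * cos (g \<theta>))" using r by (simp add: tan_def)
  also have "\<dots> = (A $ 1 $ 1 * sin \<theta> + A $ 1 $ 2 * cos \<theta>) / (A $ 2 $ 1 * sin \<theta> + A $ 2 $ 2 * cos \<theta>)"
    unfolding e ..
  also have "\<dots> = ((A $ 1 $ 1 * tan \<theta> + A $ 1 $ 2) * cos \<theta>) / ((A $ 2 $ 1 * tan \<theta> + A $ 2 $ 2) * cos \<theta>)"
    using assms(2) by (simp add: tan_def distrib_right)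
  finally show ?thesis using assms(2) by simp
qed

lemma projective_germ_lift:
  assumes dt: "a * d - b * c \<noteq> 0" and t: "\<theta>0 \<in> BB" "c * tan \<theta>0 + d \<noteq> 0"
  obtains A g where "det A \<noteq> 0" "plift A g" "g \<theta>0 = arctan ((a * tan \<theta>0 + b) / (c * tan \<theta>0 + d))"
    "\<And>\<theta>. cos \<theta> \<noteq> 0 \<Longrightarrow> tan (g \<theta>) = (a * tan \<theta> + b) / (c * tan \<theta> + d)"
proof -
  define y where "y = arctan ((a * tan \<theta>0 + b) / (c * tan \<theta>0 + d))"
  have ty: "tan y = (a * tan \<theta>0 + b) / (c * tan \<theta>0 + d)" by (simp add: y_def tan_arctan)
  have cy: "cos y > 0" using BB_cos BB_arctan by (simp add: y_def)
  have c0: "cos \<theta>0 > 0" using BB_cos t by simp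
  define r where "r = cos \<theta>0 * (c * tan \<theta>0 + d) / cos y"
  have r0: "r \<noteq> 0" using t c0 cy by (simp add: r_def)
  have "cos \<theta>0 * (c * tan \<theta>0 + d) * tan y = cos \<theta>0 * (a * tan \<theta>0 + b)" using t(2) by (simp add: ty)
  moreover have "r * sin y = cos \<theta>0 * (c * tan \<theta>0 + d) * tan y" "r * cos y = cos \<theta>0 * (c * tan \<theta>0 + d)"
    using cy by (simp_all add: r_def tan_def)
  moreover have "sin \<theta>0 = cos \<theta>0 * tan \<theta>0" using c0 by (simp add: tan_def)
  ultimately have e: "av (mt a b c d) (ev \<theta>0) = r *\<^sub>R ev y"
    by (simp add: av_def ev_def algebra_simps)
  \<comment> \<open>Of the two matrices with the same fractional linear map, the one carrying the
    ray at \<open>\<theta>0\<close> to a ray with positive cosine is taken, so that the lift starts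
    in \<open>BB\<close>.\<close>
  define \<sigma> where "\<sigma> = sgn r"
  have s: "\<sigma> \<noteq> 0" "\<sigma> * r > 0" using r0 by (auto simp: \<sigma>_def sgn_mult_abs sgn_if)
  define A where "A = mt (\<sigma> * a) (\<sigma> * b) (\<sigma> * c) (\<sigma> * d)"
  have "det A = \<sigma> * \<sigma> * (a * d - b * c)" by (simp add: A_def algebra_simps)
  then have dA: "det A \<noteq> 0" using s dt by simp
  have "av A (ev \<theta>0) = \<sigma> *\<^sub>R av (mt a b c d) (ev \<theta>0)" by (simp add: A_def av_def algebra_simps)
  then have "av A (ev \<theta>0) = (\<sigma> * r) *\<^sub>R ev y" unfolding e by simp
  then obtain g where g: "plift A g" "g \<theta>0 = y" using plift_exists[OF dA s(2)] by blast
  have "tan (g \<theta>) = (a * tan \<theta> + b) / (c * tan \<theta> + d)" if "cos \<theta> \<noteq> 0" for \<theta>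
  proof -
    have "tan (g \<theta>) = (\<sigma> * (a * tan \<theta> + b)) / (\<sigma> * (c * tan \<theta> + d))"
      using tan_plift[OF g(1) that] by (simp add: A_def distrib_left mult.assoc)
    then show ?thesis using s by simp
  qed
  then show ?thesis using that dA g by (simp add: y_def)
qed

text \<open>Translation by the integer \<open>k\<close> in the angular coordinate. These are the
  deck transformations of the projection from the line to the circle, hence the only ambiguity when
  maps into the circle are lifted.\<close>

definition tr :: "int \<Rightarrow> real \<Rightarrow> real" where
  "tr k = (SOME g. g \<in> GP \<and> (\<forall>\<theta>\<in>BB. g \<theta> \<in> BB \<and> tan (g \<theta>) = tan \<theta> + of_int k))"

lemma tr_ex: "\<exists>g. g \<in> GP \<and> (\<forall>\<theta>\<in>BB. g \<theta> \<in> BB \<and> tan (g \<theta>) = tan \<theta> + of_int k)"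
proof -
  have d: "1 * 1 - of_int k * 0 \<noteq> (0 :: real)" "0 \<in> BB" "0 * tan 0 + 1 \<noteq> (0 :: real)" by simp_all
  obtain A g where g0: "det A \<noteq> 0" "plift A g" "g 0 = arctan ((1 * tan 0 + of_int k) / (0 * tan 0 + 1))"
    "\<And>\<theta>. cos \<theta> \<noteq> 0 \<Longrightarrow> tan (g \<theta>) = (1 * tan \<theta> + of_int k) / (0 * tan \<theta> + 1)"
    using projective_germ_lift[OF d] by blast
  have g: "det A \<noteq> 0" "plift A g" "g 0 = arctan (of_int k)" "\<And>\<theta>. cos \<theta> \<noteq> 0 \<Longrightarrow> tan (g \<theta>) = tan \<theta> + of_int k"
    using g0 by simp_all
  have GG: "g \<in> GG" using g by (auto simp: GG_def)
  have cg: "cos (g \<theta>) \<noteq> 0" if th: "\<theta> \<in> BB" for \<theta>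
  proof
    assume c: "cos (g \<theta>) = 0"
    define \<alpha> where "\<alpha> = arctan (- of_int k)"
    show False
    proof (cases "\<theta> = \<alpha>")
      case False
      \<comment> \<open>With division by zero equal to zero the tangent vanishes where the cosine
        does. So the formula for \<open>tan (g \<theta>)\<close> excludes a pole everywhere except
        at the angle with tangent \<open>- k\<close>, which needs the matrix itself.\<close>
      have "tan (g \<theta>) = 0" using c by (simp add: tan_def)
      then have "tan \<theta> = - of_int k" using g(4)[of \<theta>] BB_cos[OF th] by simp
      then show False using BB_tan_inj[OF th BB_arctan] False by (simp add: \<alpha>_def tan_arctan)
    next
      case True
      obtain r where r: "r > 0" "av A (ev \<theta>) = r *\<^sub>R ev (g \<theta>)" using plift_D[OF g(2)] by blast
      obtain r0 where r0: "r0 > 0" "av A (ev 0) = r0 *\<^sub>R ev (g 0)" using plift_D[OF g(2)] by blast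
      have c0: "cos (g 0) > 0" using g(3) BB_arctan BB_cos by simp
      have A22: "A $ 2 $ 2 = r0 * cos (g 0)" "A $ 1 $ 2 = r0 * sin (g 0)" using r0(2) by (auto simp: av_def ev_def)
      have "A $ 2 $ 1 * sin \<theta> + A $ 2 $ 2 * cos \<theta> = 0" using r(2) c by (simp add: av_def ev_def)
      then have z: "A $ 2 $ 1 * tan \<theta> + A $ 2 $ 2 = 0" using BB_cos[OF th] by (simp add: tan_def field_simps)
      have p: "A $ 1 $ 1 * tan \<phi> + A $ 1 $ 2 = (tan \<phi> + of_int k) * (A $ 2 $ 1 * tan \<phi> + A $ 2 $ 2)"
        if "\<phi> \<in> BB" "A $ 2 $ 1 * tan \<phi> + A $ 2 $ 2 \<noteq> 0" for \<phi>
        using tan_plift[OF g(2), of \<phi>] g(4)[of \<phi>] BB_cos[OF that(1)] that(2) by (simp add: field_simps)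
      have inf: "infinite (UNIV :: real set)" by (rule infinite_UNIV_char_0)
      \<comment> \<open>The fractional linear map of \<open>A\<close> agrees with the translation at
        infinitely many points; comparing coefficients gives \<open>A $ 2 $ 1 = 0\<close>, so
        \<open>A\<close> is affine and has no pole in \<open>BB\<close>.\<close>
      define P where "P = [:A $ 1 $ 2 - of_int k * A $ 2 $ 2, A $ 1 $ 1 - A $ 2 $ 2 - of_int k * A $ 2 $ 1, - (A $ 2 $ 1):]"
      have "UNIV \<subseteq> {x. poly P x = 0} \<union> {x. poly [:A $ 2 $ 2, A $ 2 $ 1:] x = 0}"
      proof
        fix x :: real
        show "x \<in> {x. poly P x = 0} \<union> {x. poly [:A $ 2 $ 2, A $ 2 $ 1:] x = 0}"
        proof (cases "A $ 2 $ 1 * x + A $ 2 $ 2 = 0")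
          case True
          then show ?thesis by (simp add: algebra_simps)
        next
          case False
          then show ?thesis using p[OF BB_arctan, of x] by (simp add: tan_arctan P_def algebra_simps)
        qed
      qed
      moreover have "[:A $ 2 $ 2, A $ 2 $ 1:] \<noteq> 0" using A22(1) r0(1) c0 by auto
      then have "finite {x. poly [:A $ 2 $ 2, A $ 2 $ 1:] x = 0}" by (rule poly_roots_finite)
      ultimately have "infinite {x. poly P x = 0}" using inf by (metis finite_Un finite_subset)
      then have "P = 0" using poly_roots_finite by blast
      then have "A $ 2 $ 1 = 0" by (simp add: P_def)
      then show False using z A22(1) r0(1) c0 by simp
    qed
  qed
  have BBg: "g \<theta> \<in> BB" if th: "\<theta> \<in> BB" for \<theta>
  proof -
    have con: "connected (g ` BB)"
      by (intro connected_continuous_image continuous_on_subset[OF GG_cont[OF GG]]) auto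
    have nz: "pi / 2 \<notin> g ` BB" "- (pi / 2) \<notin> g ` BB" 
      using cg cos_pi_half cos_minus[of "pi / 2"] by (metis imageE)+
    have 0: "g 0 \<in> g ` BB" "g \<theta> \<in> g ` BB" using th by auto
    have g0: "- (pi / 2) < g 0" "g 0 < pi / 2" using g(3) BB_arctan[of "of_int k"] by auto
    show ?thesis
    proof (rule ccontr)
      assume "g \<theta> \<notin> BB"
      then consider "g \<theta> \<ge> pi / 2" | "g \<theta> \<le> - (pi / 2)" by fastforce
      then show False
      proof cases
        case 1
        then show False using connectedD_interval[OF con 0, of "pi / 2"] g0 nz by auto
      next
        case 2
        then show False using connectedD_interval[OF con 0(2,1), of "- (pi / 2)"] g0 nz by auto
      qed
    qed
  qed
  have t: "tan (g \<theta>) = tan \<theta> + of_int k" if "\<theta> \<in> BB" for \<theta> using g(4) BB_cos[OF that] by simp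
  have b4: "pi / 4 \<in> BB" using pi_gt_zero by auto
  have "strict_mono g"
  proof (rule GG_mono_cases[OF GG])
    assume "strict_antimono_on UNIV g"
    then have "g (pi / 4) < g 0" by (simp add: monotone_on_def)
    then have "tan (g (pi / 4)) < tan (g 0)" using BBg[OF b4] BBg[of 0] by (intro tan_monotone) auto
    then show "strict_mono g" using t[OF b4] t[of 0] by (simp add: tan_45)
  qed
  then show ?thesis using GG BBg t by (auto simp: GP_def)
qed

lemma tr: "tr k \<in> GP" "\<theta> \<in> BB \<Longrightarrow> tr k \<theta> \<in> BB" "\<theta> \<in> BB \<Longrightarrow> tan (tr k \<theta>) = tan \<theta> + of_int k"
  using someI_ex[OF tr_ex[of k]] by (auto simp: tr_def)

lemma tau_tr: "\<theta> \<in> BB \<Longrightarrow> tau (tr k \<theta>) = tau \<theta>"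
  by (simp add: tau_eq_iff tr)

lemma tau_eq_tr:
  assumes "\<theta> \<in> BB" "\<phi> \<in> BB" "tau \<theta> = tau \<phi>"
  obtains k where "\<theta> = tr k \<phi>"
proof -
  obtain k where "tan \<theta> - tan \<phi> = of_int k" using assms(3) by (auto simp: tau_eq_iff elim: Ints_cases)
  then have "tan \<theta> = tan (tr k \<phi>)" using tr(3)[OF assms(2), of k] by simp
  then show ?thesis using that BB_tan_inj[OF assms(1) tr(2)[OF assms(2)]] by blast
qed

lemma continuous_Ints_const:
  fixes f :: "real \<Rightarrow> real"
  assumes "continuous_on S f" "connected S" "\<And>x. x \<in> S \<Longrightarrow> f x \<in> \<int>" "x \<in> S" "y \<in> S"
  shows "f x = f y"
proof -
  have "f constant_on S"
  proof (rule continuous_discrete_range_constant[OF assms(2,1)])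
    fix x assume x: "x \<in> S"
    show "\<exists>e>0. \<forall>y. y \<in> S \<and> f y \<noteq> f x \<longrightarrow> e \<le> norm (f y - f x)"
    proof (intro exI[of _ 1] conjI allI impI)
      fix y assume y: "y \<in> S \<and> f y \<noteq> f x"
      then have "f y - f x \<in> \<int>" "f y - f x \<noteq> 0" using assms(3) x by auto
      then show "1 \<le> norm (f y - f x)" using Ints_nonzero_abs_ge1[of "f y - f x"] by simp
    qed simp
  qed
  then show ?thesis using assms(4,5) by (auto simp: constant_on_def)
qed

text \<open>The difference of the two tangents is continuous and integral on the interval, hence a
  constant \<open>k\<close>; rigidity then extends the relation from the interval to the whole
  line.\<close>

lemma tau_agree:
  assumes g: "g \<in> GG" and h: "h \<in> GG" and ab: "\<alpha> < \<beta>"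
    and eq: "\<And>v. \<alpha> < v \<Longrightarrow> v < \<beta> \<Longrightarrow> g v \<in> BB \<and> h v \<in> BB \<and> tau (g v) = tau (h v)"
  obtains k where "g = tr k \<circ> h"
proof -
  have c: "continuous_on {\<alpha><..<\<beta>} (\<lambda>v. tan (g v) - tan (h v))"
  proof (rule continuous_on_diff)
    have n: "\<forall>x\<in>{\<alpha><..<\<beta>}. cos (g x) \<noteq> 0" "\<forall>x\<in>{\<alpha><..<\<beta>}. cos (h x) \<noteq> 0"
      using eq BB_cos by (metis greaterThanLessThan_iff less_irrefl)+
    have gh: "continuous_on {\<alpha><..<\<beta>} g" "continuous_on {\<alpha><..<\<beta>} h"
      by (rule continuous_on_subset[OF GG_cont[OF g] subset_UNIV], rule continuous_on_subset[OF GG_cont[OF h] subset_UNIV])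
    show "continuous_on {\<alpha><..<\<beta>} (\<lambda>v. tan (g v))" by (rule Transcendental.continuous_on_tan[OF gh(1) n(1)])
    show "continuous_on {\<alpha><..<\<beta>} (\<lambda>v. tan (h v))" by (rule Transcendental.continuous_on_tan[OF gh(2) n(2)])
  qed
  define m where "m = (\<alpha> + \<beta>) / 2"
  have m: "\<alpha> < m" "m < \<beta>" using ab by (auto simp: m_def)
  have int: "tan (g v) - tan (h v) \<in> \<int>" if "v \<in> {\<alpha><..<\<beta>}" for v using eq that by (simp add: tau_eq_iff)
  obtain k where k: "tan (g m) - tan (h m) = of_int k" using int[of m] m by (auto elim: Ints_cases)
  have "g v = (tr k \<circ> h) v" if v: "\<alpha> < v" "v < \<beta>" for v
  proof -
    have "tan (g v) - tan (h v) = of_int k"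
      using continuous_Ints_const[OF c _ int, of v m] k v m by simp
    then have "tan (g v) = tan (tr k (h v))" using tr(3)[of "h v" k] eq[OF v] by simp
    then show ?thesis using BB_tan_inj[of "g v" "tr k (h v)"] tr(2)[of "h v" k] eq[OF v] by simp
  qed
  then have "g = tr k \<circ> h" by (intro GG_rigid[OF g GG_comp[OF GP_GG[OF tr(1)] h] ab])
  then show ?thesis using that by blast
qed

lemma eventually_at_right_interval:
  fixes u :: real
  assumes "eventually P (at_right u)"
  obtains e where "e > 0" "\<And>v. u < v \<Longrightarrow> v < u + e \<Longrightarrow> P v"
proof -
  obtain b where "b > u" "\<And>v. u < v \<Longrightarrow> v < b \<Longrightarrow> P v"
    using assms unfolding eventually_at_right_field by blast
  then show ?thesis using that[of "b - u"] by auto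
qed

lemma eventually_at_right_intervalI:
  fixes u :: real
  assumes "e > 0" "\<And>v. u < v \<Longrightarrow> v < u + e \<Longrightarrow> P v"
  shows "eventually P (at_right u)"
  unfolding eventually_at_right_field using assms by (intro exI[of _ "u + e"]) auto

lemma eventually_nhds_interval:
  fixes u :: real
  assumes "eventually P (nhds u)"
  obtains e where "e > 0" "\<And>v. u - e < v \<Longrightarrow> v < u + e \<Longrightarrow> P v"
proof -
  obtain e where "e > 0" "\<And>v. dist v u < e \<Longrightarrow> P v" using assms unfolding eventually_nhds_metric by blast
  then show ?thesis using that[of e] by (auto simp: dist_real_def)
qed

lemma eventually_nhds_intervalI:
  fixes u :: real
  assumes "a < u" "u < b" "\<And>v. a < v \<Longrightarrow> v < b \<Longrightarrow> P v"
  shows "eventually P (nhds u)"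
  using eventually_nhds_in_open[of "{a<..<b}" u] assms by (auto elim!: eventually_mono)

lemma GG_eventually_BB:
  assumes "g \<in> GG" "g u \<in> BB" shows "eventually (\<lambda>v. g v \<in> BB) (nhds u)"
proof -
  have "(g \<longlongrightarrow> g u) (nhds u)" using GG_isCont[OF assms(1), of u] by (simp add: isCont_def tendsto_nhds_iff)
  then show ?thesis using assms(2) by (rule topological_tendstoD[OF _ open_BB])
qed

lemma locally_projective_tau:
  assumes f: "locally_projective_at f (tau \<phi>)" and \<phi>: "\<phi> \<in> BB"
  obtains h where "h \<in> GG" "h \<phi> \<in> BB" "\<forall>\<^sub>F \<theta> in nhds \<phi>. f (tau \<theta>) = tau (h \<theta>)"
proof -
  have "proj (tan \<phi>) = tau \<phi>" by (simp add: tau_def)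
  then obtain a b c d where *: "a * d - b * c \<noteq> 0" "c * tan \<phi> + d \<noteq> 0"
     "\<forall>\<^sub>F u in nhds (tan \<phi>). f (proj u) = proj ((a * u + b) / (c * u + d))"
    using f unfolding locally_projective_at_def by blast
  obtain A h where h: "det A \<noteq> 0" "plift A h" "h \<phi> = arctan ((a * tan \<phi> + b) / (c * tan \<phi> + d))"
    "\<And>\<theta>. cos \<theta> \<noteq> 0 \<Longrightarrow> tan (h \<theta>) = (a * tan \<theta> + b) / (c * tan \<theta> + d)"
    using projective_germ_lift[OF *(1) \<phi> *(2)] by blast
  have GG: "h \<in> GG" using h by (auto simp: GG_def)
  have "isCont tan \<phi>" using BB_cos[OF \<phi>] by (intro isCont_tan) simp
  then have lim: "(tan \<longlongrightarrow> tan \<phi>) (nhds \<phi>)" by (simp add: isCont_def tendsto_nhds_iff)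
  have "\<forall>\<^sub>F \<theta> in nhds \<phi>. f (proj (tan \<theta>)) = proj ((a * tan \<theta> + b) / (c * tan \<theta> + d))"
    by (rule eventually_compose_filterlim[OF *(3) lim])
  moreover have "\<forall>\<^sub>F \<theta> in nhds \<phi>. \<theta> \<in> BB" using eventually_nhds_in_open[OF open_BB \<phi>] .
  ultimately have "\<forall>\<^sub>F \<theta> in nhds \<phi>. f (tau \<theta>) = tau (h \<theta>)"
  proof eventually_elim
    case (elim \<theta>)
    then show ?case using h(4)[of \<theta>] BB_cos[of \<theta>] by (simp add: tau_def)
  qed
  then show ?thesis using that GG h(3) BB_arctan by simp
qed

text \<open>Two local lifts that overlap differ by some \<open>tr k\<close>, which preserves
  \<open>BB\<close> and does not change \<open>tau\<close>. So a lift that is valid near one point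
  stays valid on neighbouring intervals, and connectedness spreads it over the whole
  interval.\<close>

lemma projective_continuation:
  fixes F :: "real \<Rightarrow> circle"
  assumes ab: "\<alpha> < \<beta>"
    and loc: "\<And>v. \<alpha> < v \<Longrightarrow> v < \<beta> \<Longrightarrow> \<exists>g\<in>GG. g v \<in> BB \<and> (\<forall>\<^sub>F w in nhds v. F w = tau (g w))"
  obtains g where "g \<in> GG" "\<And>v. \<alpha> < v \<Longrightarrow> v < \<beta> \<Longrightarrow> g v \<in> BB \<and> F v = tau (g v)"
proof -
  define m where "m = (\<alpha> + \<beta>) / 2"
  have m: "m \<in> {\<alpha><..<\<beta>}" using ab by (auto simp: m_def)
  obtain g where g: "g \<in> GG" "g m \<in> BB" "\<forall>\<^sub>F w in nhds m. F w = tau (g w)" using loc[of m] m by auto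
  define P where "P = (\<lambda>v. g v \<in> BB \<and> (\<forall>\<^sub>F w in nhds v. F w = tau (g w)))"
  have "P v" if v: "v \<in> {\<alpha><..<\<beta>}" for v
  proof (rule connected_induction_simple[of "{\<alpha><..<\<beta>}" m v P])
    fix a assume a: "a \<in> {\<alpha><..<\<beta>}"
    obtain h where h: "h \<in> GG" "h a \<in> BB" "\<forall>\<^sub>F w in nhds a. F w = tau (h w)" using loc[of a] a by auto
    have "\<forall>\<^sub>F w in nhds a. F w = tau (h w) \<and> h w \<in> BB"
      using h(3) GG_eventually_BB[OF h(1,2)] by (rule eventually_conj)
    then obtain e where e: "e > 0" "\<And>w. a - e < w \<Longrightarrow> w < a + e \<Longrightarrow> F w = tau (h w) \<and> h w \<in> BB"
      by (rule eventually_nhds_interval) blast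
    define T where "T = {\<alpha><..<\<beta>} \<inter> {a - e <..< a + e}"
    show "\<exists>T. openin (top_of_set {\<alpha><..<\<beta>}) T \<and> a \<in> T \<and> (\<forall>x\<in>T. \<forall>y\<in>T. P x \<longrightarrow> P y)"
    proof (intro exI[of _ T] conjI ballI impI)
      show "openin (top_of_set {\<alpha><..<\<beta>}) T" unfolding T_def by (intro openin_open_Int) simp
      show "a \<in> T" using a e by (auto simp: T_def)
      fix x y assume x: "x \<in> T" and y: "y \<in> T" and Px: "P x"
      have "\<forall>\<^sub>F w in nhds x. F w = tau (g w) \<and> g w \<in> BB"
        using Px GG_eventually_BB[OF g(1)] by (auto simp: P_def intro: eventually_conj)
      then obtain d where d: "d > 0" "\<And>w. x - d < w \<Longrightarrow> w < x + d \<Longrightarrow> F w = tau (g w) \<and> g w \<in> BB"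
        by (rule eventually_nhds_interval) blast
      have xx: "x < min (x + d) (a + e)" using d(1) x by (auto simp: T_def)
      obtain k where k: "g = tr k \<circ> h"
      proof (rule tau_agree[OF g(1) h(1) xx])
        fix v assume v: "x < v" "v < min (x + d) (a + e)"
        have "F v = tau (g v) \<and> g v \<in> BB" using d v by auto
        moreover have "F v = tau (h v) \<and> h v \<in> BB" using e(2)[of v] v x by (auto simp: T_def)
        ultimately show "g v \<in> BB \<and> h v \<in> BB \<and> tau (g v) = tau (h v)" by auto
      qed
      have yy: "a - e < y" "y < a + e" using y by (auto simp: T_def)
      have gy: "g w \<in> BB \<and> F w = tau (g w)" if "a - e < w" "w < a + e" for w
        using e(2)[OF that] tr(2)[of "h w" k] tau_tr[of "h w" k] by (simp add: k)
      then have "\<forall>\<^sub>F w in nhds y. F w = tau (g w)" by (intro eventually_nhds_intervalI[OF yy]) blast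
      then show "P y" using gy[OF yy] by (simp add: P_def)
    qed
  next
    show "P m" using g by (simp add: P_def)
  qed (use m v in auto)
  then have "g v \<in> BB \<and> F v = tau (g v)" if "\<alpha> < v" "v < \<beta>" for v
    using that eventually_nhds_x_imp_x[of "\<lambda>w. F w = tau (g w)" v] by (auto simp: P_def)
  then show ?thesis using that g(1) by blast
qed

text \<open>At a pole the map would wind infinitely often around the circle.\<close>

lemma projective_endpoint:
  assumes g: "g \<in> GG" and e: "\<epsilon> > 0"
    and B: "\<And>v. u < v \<Longrightarrow> v < u + \<epsilon> \<Longrightarrow> g v \<in> BB"
    and inj: "inj_on (\<lambda>v. tau (g v)) {u<..<u+\<epsilon>}"
  shows "g u \<in> BB"
proof (rule ccontr)
  assume nB: "g u \<notin> BB"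
  have cont: "continuous_on S g" for S using continuous_on_subset[OF GG_cont[OF g]] by blast
  have cl: "g u \<in> {- (pi / 2)..pi / 2}"
  proof (rule Lim_in_closed_set)
    show "(g \<longlongrightarrow> g u) (at_right u)" using GG_isCont[OF g] by (simp add: isCont_def filterlim_at_split)
    show "\<forall>\<^sub>F v in at_right u. g v \<in> {- (pi / 2)..pi / 2}"
      by (rule eventually_at_right_intervalI[OF e]) (use B in force)
  qed auto
  define v where "v = u + \<epsilon> / 2"
  have v: "u < v" "v < u + \<epsilon>" using e by (auto simp: v_def)
  note gv = B[OF v]
  \<comment> \<open>Between \<open>g u\<close> and \<open>g v\<close> no other angle can have the
    same image in the circle as \<open>g v\<close>: it would be attained by the intermediate value
    theorem, against injectivity. At a pole, adding or subtracting 1 in the tangent produces such an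
    angle.\<close>
  have contra: False if y: "y \<in> BB" "y \<noteq> g v" "tau y = tau (g v)" "(g u < y \<and> y < g v) \<or> (g v < y \<and> y < g u)" for y
  proof -
    have "\<exists>w. u \<le> w \<and> w \<le> v \<and> g w = y"
    proof (cases "g u < y")
      case True
      then show ?thesis using IVT'[of g u y v] y v cont[of "{u..v}"] by auto
    next
      case False
      then show ?thesis using IVT2'[of g v y u] y v cont[of "{u..v}"] by auto
    qed
    then obtain w where w: "u \<le> w" "w \<le> v" "g w = y" by blast
    have "w \<noteq> u" "w \<noteq> v" using w y by auto
    then have "w \<in> {u<..<u+\<epsilon>}" "v \<in> {u<..<u+\<epsilon>}" using w v by auto
    then have "w = v" using inj_onD[OF inj, of w v] w y by simp
    then show False using \<open>w \<noteq> v\<close> by simp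
  qed
  have tm: "tan (g v) < tan y \<Longrightarrow> y \<in> BB \<Longrightarrow> g v < y" "tan y < tan (g v) \<Longrightarrow> y \<in> BB \<Longrightarrow> y < g v" for y
    using gv tan_monotone[of y "g v"] tan_monotone[of "g v" y] by (metis greaterThanLessThan_iff linorder_neqE less_asym minus_divide_left)+
  from nB cl consider "g u = pi / 2" | "g u = - (pi / 2)" by fastforce
  then show False
  proof cases
    case 1
    define y where "y = arctan (tan (g v) + 1)"
    have y: "y \<in> BB" "tan y = tan (g v) + 1" using BB_arctan by (simp_all add: y_def tan_arctan)
    have "g v < y" using tm(1) y by simp
    then show False using contra[of y] y 1 by (simp add: tau_eq_iff)
  next
    case 2
    define y where "y = arctan (tan (g v) - 1)"
    have y: "y \<in> BB" "tan y = tan (g v) - 1" using BB_arctan by (simp_all add: y_def tan_arctan)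
    have "y < g v" using tm(2) y by simp
    then show False using contra[of y] y 2 by (simp add: tau_eq_iff)
  qed
qed

subsection \<open>One-sided projective germs\<close>

text \<open>A projective germ on the right of \<open>u\<close>. The value at \<open>u\<close> itself
  is irrelevant, and \<open>g u \<in> BB\<close> says that the one-sided limit is a point of the
  circle and not the pole. In \<open>reg_via\<close> one map serves both sides, which gives a
  genuine projective germ.\<close>

definition rreg :: "(real \<Rightarrow> circle) \<Rightarrow> real \<Rightarrow> bool" where
  "rreg \<pi> u \<longleftrightarrow> (\<exists>g\<in>GG. g u \<in> BB \<and> (\<forall>\<^sub>F v in at_right u. \<pi> v = tau (g v)))"

definition lreg :: "(real \<Rightarrow> circle) \<Rightarrow> real \<Rightarrow> bool" where
  "lreg \<pi> u \<longleftrightarrow> (\<exists>g\<in>GG. g u \<in> BB \<and> (\<forall>\<^sub>F v in at_left u. \<pi> v = tau (g v)))"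

definition reg_via :: "(real \<Rightarrow> real) \<Rightarrow> (real \<Rightarrow> circle) \<Rightarrow> real \<Rightarrow> bool" where
  "reg_via g \<pi> u \<longleftrightarrow> g \<in> GG \<and> g u \<in> BB \<and> (\<forall>\<^sub>F v in at u. \<pi> v = tau (g v))"

lemma lreg_iff: "lreg \<pi> u \<longleftrightarrow> rreg (\<pi> \<circ> uminus) (- u)"
proof
  assume "lreg \<pi> u"
  then obtain g where g: "g \<in> GG" "g u \<in> BB" "\<forall>\<^sub>F v in at_left u. \<pi> v = tau (g v)" by (auto simp: lreg_def)
  then show "rreg (\<pi> \<circ> uminus) (- u)"
    unfolding rreg_def using GG_comp[OF g(1) GG_uminus]
    by (intro bexI[of _ "g \<circ> uminus"]) (auto simp: eventually_at_left_to_right)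
next
  assume "rreg (\<pi> \<circ> uminus) (- u)"
  then obtain g where g: "g \<in> GG" "g (- u) \<in> BB" "\<forall>\<^sub>F v in at_right (- u). \<pi> (- v) = tau (g v)" by (auto simp: rreg_def)
  then show "lreg \<pi> u"
    unfolding lreg_def using GG_comp[OF g(1) GG_uminus]
    by (intro bexI[of _ "g \<circ> uminus"]) (auto simp: eventually_at_left_to_right)
qed

lemma reg_via_imp: "reg_via g \<pi> u \<Longrightarrow> rreg \<pi> u \<and> lreg \<pi> u"
  unfolding reg_via_def rreg_def lreg_def by (auto simp: eventually_at_split)

lemma tau_inj_near:
  assumes g: "g \<in> GG" "g u \<in> BB"
  obtains e where "e > 0" "\<And>v. u - e < v \<Longrightarrow> v < u + e \<Longrightarrow> g v \<in> BB" "inj_on (\<lambda>v. tau (g v)) {u - e<..<u + e}"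
proof -
  have "isCont (\<lambda>v. tan (g v)) u"
    using GG_isCont[OF g(1), of u] BB_cos[OF g(2)] by (intro isCont_tan') auto
  then have "((\<lambda>v. tan (g v)) \<longlongrightarrow> tan (g u)) (nhds u)" by (simp add: isCont_def tendsto_nhds_iff)
  then have "\<forall>\<^sub>F v in nhds u. dist (tan (g v)) (tan (g u)) < 1 / 2" by (rule tendstoD) simp
  then have "\<forall>\<^sub>F v in nhds u. g v \<in> BB \<and> dist (tan (g v)) (tan (g u)) < 1 / 2"
    using GG_eventually_BB[OF g] by eventually_elim simp
  then obtain e where e: "e > 0" "\<And>v. u - e < v \<Longrightarrow> v < u + e \<Longrightarrow> g v \<in> BB \<and> dist (tan (g v)) (tan (g u)) < 1 / 2"
    by (rule eventually_nhds_interval) blast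
  have "inj_on (\<lambda>v. tau (g v)) {u - e<..<u + e}"
  proof (rule inj_onI)
    fix v w assume vw: "v \<in> {u - e<..<u + e}" "w \<in> {u - e<..<u + e}" "tau (g v) = tau (g w)"
    have "tan (g v) - tan (g w) \<in> \<int>" using vw(3) by (simp add: tau_eq_iff)
    moreover have "\<bar>tan (g v) - tan (g w)\<bar> < 1"
      using e(2)[of v] e(2)[of w] vw(1,2) unfolding dist_real_def by (simp; linarith)
    ultimately have "tan (g v) = tan (g w)" using Ints_nonzero_abs_less1 by force
    then have "g v = g w" using BB_tan_inj e(2) vw by simp
    then show "v = w" using GG_inj[OF g(1)] by (simp add: inj_def)
  qed
  then show ?thesis using that e by blast
qed

lemma rreg_interval:
  assumes "rreg \<pi> u"
  obtains g e where "g \<in> GG" "g u \<in> BB" "e > 0" "\<And>v. u < v \<Longrightarrow> v < u + e \<Longrightarrow> g v \<in> BB \<and> \<pi> v = tau (g v)"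
    "inj_on (\<lambda>v. tau (g v)) {u<..<u + e}"
proof -
  obtain g where g: "g \<in> GG" "g u \<in> BB" "\<forall>\<^sub>F v in at_right u. \<pi> v = tau (g v)" using assms by (auto simp: rreg_def)
  obtain e where e: "e > 0" "\<And>v. u - e < v \<Longrightarrow> v < u + e \<Longrightarrow> g v \<in> BB" "inj_on (\<lambda>v. tau (g v)) {u - e<..<u + e}"
    using tau_inj_near[OF g(1,2)] by blast
  obtain d where d: "d > 0" "\<And>v. u < v \<Longrightarrow> v < u + d \<Longrightarrow> \<pi> v = tau (g v)"
    using g(3) by (rule eventually_at_right_interval) blast
  show ?thesis
  proof (rule that[OF g(1,2), of "min d e"])
    show "min d e > 0" using d e by simp
    show "g v \<in> BB \<and> \<pi> v = tau (g v)" if "u < v" "v < u + min d e" for v using that d(2)[of v] e(1) e(2)[of v] by simp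
    show "inj_on (\<lambda>v. tau (g v)) {u<..<u + min d e}" by (rule inj_on_subset[OF e(3)]) (use e(1) in auto)
  qed
qed

lemma inj_on_avoids_finite:
  fixes u :: real
  assumes "inj_on F {u<..<u + e}" "e > 0" "finite D"
  shows "\<forall>\<^sub>F v in at_right u. F v \<notin> D"
proof -
  define K where "K = {v \<in> {u<..<u + e}. F v \<in> D}"
  have "finite (F ` K)" using assms(3) by (rule rev_finite_subset) (auto simp: K_def)
  moreover have "inj_on F K" by (rule inj_on_subset[OF assms(1)]) (auto simp: K_def)
  ultimately have "finite K" using finite_imageD by blast
  then have "\<not> u islimpt K" by (rule islimpt_finite)
  then have "\<forall>\<^sub>F v in at u. v \<notin> K" by (simp add: islimpt_iff_eventually)
  then have "\<forall>\<^sub>F v in at_right u. v \<notin> K" by (simp add: eventually_at_split)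
  moreover have "\<forall>\<^sub>F v in at_right u. v \<in> {u<..<u + e}" using assms(2) by (intro eventually_at_right_real) simp
  ultimately show ?thesis by eventually_elim (auto simp: K_def)
qed

lemma rreg_avoids:
  assumes "rreg \<pi> u" "finite D" shows "\<forall>\<^sub>F v in at_right u. \<pi> v \<notin> D"
proof -
  obtain g e where g: "e > 0" "\<And>v. u < v \<Longrightarrow> v < u + e \<Longrightarrow> g v \<in> BB \<and> \<pi> v = tau (g v)"
    "inj_on (\<lambda>v. tau (g v)) {u<..<u + e}" using rreg_interval[OF assms(1)] by metis
  have "inj_on \<pi> {u<..<u + e}" using g(2,3) by (simp add: inj_on_def)
  then show ?thesis by (rule inj_on_avoids_finite[OF _ g(1) assms(2)])
qed

lemma reg_avoids:
  assumes "rreg \<pi> u" "lreg \<pi> u" "finite D" shows "\<forall>\<^sub>F v in at u. \<pi> v \<notin> D"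
  using rreg_avoids[OF assms(1,3)] rreg_avoids[OF assms(2)[unfolded lreg_iff] assms(3)]
  by (simp add: eventually_at_split eventually_at_left_to_right)

text \<open>A one-sided germ soon leaves the finitely many singularities of \<open>f\<close>, so the
  composite continues to a single lift on an interval with end point \<open>u\<close>. The lift has
  no pole at \<open>u\<close> because \<open>f\<close> is injective off its singularities; this is
  where invertibility of the transformations enters.\<close>

lemma rreg_post_compose:
  assumes f: "piecewise_projective f" and \<pi>: "rreg \<pi> u"
  shows "rreg (f \<circ> \<pi>) u"
proof -
  obtain F F' f' where F: "finite F" "homeomorphism (- F) (- F') f f'" "\<And>x. x \<notin> F \<Longrightarrow> locally_projective_at f x"
    using f unfolding piecewise_projective_def by blast
  have finj: "x = y" if "x \<notin> F" "y \<notin> F" "f x = f y" for x y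
    using F(2) that unfolding homeomorphism_def by (metis ComplI)
  obtain g e0 where g: "g \<in> GG" "g u \<in> BB" "e0 > 0" "\<And>v. u < v \<Longrightarrow> v < u + e0 \<Longrightarrow> g v \<in> BB \<and> \<pi> v = tau (g v)"
    "inj_on (\<lambda>v. tau (g v)) {u<..<u + e0}" using rreg_interval[OF \<pi>] by metis
  obtain e1 where e1: "e1 > 0" "\<And>v. u < v \<Longrightarrow> v < u + e1 \<Longrightarrow> tau (g v) \<notin> F"
    using inj_on_avoids_finite[OF g(5,3) F(1)] by (rule eventually_at_right_interval) blast
  define e where "e = min e0 e1"
  have e: "e > 0" using g e1 by (simp add: e_def)
  have eg: "g v \<in> BB" "\<pi> v = tau (g v)" "tau (g v) \<notin> F" if "u < v" "v < u + e" for v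
    using g(4)[of v] e1(2)[of v] that by (auto simp: e_def)
  have "\<exists>h\<in>GG. h v \<in> BB \<and> (\<forall>\<^sub>F w in nhds v. f (tau (g w)) = tau (h w))" if v: "u < v" "v < u + e" for v
  proof -
    obtain h where h: "h \<in> GG" "h (g v) \<in> BB" "\<forall>\<^sub>F \<theta> in nhds (g v). f (tau \<theta>) = tau (h \<theta>)"
      using locally_projective_tau[OF F(3)[OF eg(3)[OF v]] eg(1)[OF v]] by blast
    have "(g \<longlongrightarrow> g v) (nhds v)" using GG_isCont[OF g(1), of v] by (simp add: isCont_def tendsto_nhds_iff)
    then have "\<forall>\<^sub>F w in nhds v. f (tau (g w)) = tau (h (g w))" by (rule eventually_compose_filterlim[OF h(3)])
    then show ?thesis using GG_comp[OF h(1) g(1)] h(2) by (intro bexI[of _ "h \<circ> g"]) auto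
  qed
  then obtain h where h: "h \<in> GG" "\<And>v. u < v \<Longrightarrow> v < u + e \<Longrightarrow> h v \<in> BB \<and> f (tau (g v)) = tau (h v)"
    using projective_continuation[of u "u + e" "\<lambda>w. f (tau (g w))"] e by auto
  have "inj_on (\<lambda>v. tau (h v)) {u<..<u+e}"
  proof (rule inj_onI)
    fix v w assume vw: "v \<in> {u<..<u+e}" "w \<in> {u<..<u+e}" "tau (h v) = tau (h w)"
    have "f (tau (g v)) = f (tau (g w))" using h(2)[of v] h(2)[of w] vw by auto
    then have "tau (g v) = tau (g w)" using finj eg(3)[of v] eg(3)[of w] vw by auto
    then show "v = w" using inj_onD[OF g(5), of v w] vw by (auto simp: e_def)
  qed
  then have "h u \<in> BB" using projective_endpoint[OF h(1) e, of u] h(2) by blast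
  moreover have "\<forall>\<^sub>F v in at_right u. (f \<circ> \<pi>) v = tau (h v)"
    by (rule eventually_at_right_intervalI[OF e]) (use eg(2) h(2) in auto)
  ultimately show ?thesis unfolding rreg_def using h(1) by blast
qed

lemma lreg_post_compose:
  assumes "piecewise_projective f" "lreg \<pi> u" shows "lreg (f \<circ> \<pi>) u"
  using rreg_post_compose[OF assms(1) assms(2)[unfolded lreg_iff]] unfolding lreg_iff by (simp add: comp_assoc)

lemma reg_via_post_compose:
  assumes f: "locally_projective_at f (tau (g u))" and \<pi>: "reg_via g \<pi> u"
  obtains h where "reg_via h (f \<circ> \<pi>) u"
proof -
  have g: "g \<in> GG" "g u \<in> BB" "\<forall>\<^sub>F v in at u. \<pi> v = tau (g v)" using \<pi> by (auto simp: reg_via_def)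
  obtain h where h: "h \<in> GG" "h (g u) \<in> BB" "\<forall>\<^sub>F \<theta> in nhds (g u). f (tau \<theta>) = tau (h \<theta>)"
    using locally_projective_tau[OF f g(2)] by blast
  have "(g \<longlongrightarrow> g u) (at u)" using GG_isCont[OF g(1), of u] by (simp add: isCont_def)
  then have "\<forall>\<^sub>F w in at u. f (tau (g w)) = tau (h (g w))" by (rule eventually_compose_filterlim[OF h(3)])
  then have "\<forall>\<^sub>F w in at u. (f \<circ> \<pi>) w = tau ((h \<circ> g) w)" using g(3) by eventually_elim simp
  then show ?thesis using that[of "h \<circ> g"] GG_comp[OF h(1) g(1)] h(2) by (simp add: reg_via_def)
qed

lemma GP_filterlim:
  assumes "j \<in> GP"
  shows "filterlim j (at (j u)) (at u)" "filterlim j (at_right (j u)) (at_right u)" "filterlim j (at_left (j u)) (at_left u)"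
proof -
  have t: "(j \<longlongrightarrow> j u) (at u)" using GG_isCont[OF GP_GG[OF assms]] by (simp add: isCont_def)
  have lt: "j v < j w \<longleftrightarrow> v < w" for v w by (rule GP_less[OF assms])
  have ne: "j v = j u \<longleftrightarrow> v = u" for v using lt[of v u] lt[of u v] by force
  show "filterlim j (at (j u)) (at u)" using t unfolding filterlim_at by (simp add: eventually_at_filter ne)
  show "filterlim j (at_right (j u)) (at_right u)"
    using tendsto_mono[OF at_le[OF subset_UNIV] t] unfolding filterlim_at by (simp add: eventually_at_filter ne lt)
  show "filterlim j (at_left (j u)) (at_left u)"
    using tendsto_mono[OF at_le[OF subset_UNIV] t] unfolding filterlim_at by (simp add: eventually_at_filter ne lt)
qed

lemmas GP_eventually =
  eventually_compose_filterlim[OF _ GP_filterlim(1)]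
  eventually_compose_filterlim[OF _ GP_filterlim(2)]
  eventually_compose_filterlim[OF _ GP_filterlim(3)]

lemma rreg_reparam:
  assumes "j \<in> GP" "rreg \<psi> (j u)" "\<forall>\<^sub>F w in at_right u. \<pi> w = \<psi> (j w)" shows "rreg \<pi> u"
proof -
  obtain g where g: "g \<in> GG" "g (j u) \<in> BB" "\<forall>\<^sub>F v in at_right (j u). \<psi> v = tau (g v)" using assms(2) by (auto simp: rreg_def)
  have "\<forall>\<^sub>F w in at_right u. \<psi> (j w) = tau (g (j w))" by (rule GP_eventually(2)[OF g(3) assms(1)])
  then have "\<forall>\<^sub>F w in at_right u. \<pi> w = tau ((g \<circ> j) w)" using assms(3) by eventually_elim simp
  then show ?thesis unfolding rreg_def using GG_comp[OF g(1) GP_GG[OF assms(1)]] g(2) by (intro bexI[of _ "g \<circ> j"]) auto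
qed

lemma lreg_reparam:
  assumes "j \<in> GP" "lreg \<psi> (j u)" "\<forall>\<^sub>F w in at_left u. \<pi> w = \<psi> (j w)" shows "lreg \<pi> u"
proof -
  obtain g where g: "g \<in> GG" "g (j u) \<in> BB" "\<forall>\<^sub>F v in at_left (j u). \<psi> v = tau (g v)" using assms(2) by (auto simp: lreg_def)
  have "\<forall>\<^sub>F w in at_left u. \<psi> (j w) = tau (g (j w))" by (rule GP_eventually(3)[OF g(3) assms(1)])
  then have "\<forall>\<^sub>F w in at_left u. \<pi> w = tau ((g \<circ> j) w)" using assms(3) by eventually_elim simp
  then show ?thesis unfolding lreg_def using GG_comp[OF g(1) GP_GG[OF assms(1)]] g(2) by (intro bexI[of _ "g \<circ> j"]) auto
qed

lemma reg_via_reparam: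
  assumes "j \<in> GP" "reg_via g \<psi> (j u)" "\<forall>\<^sub>F w in at u. \<pi> w = \<psi> (j w)" shows "reg_via (g \<circ> j) \<pi> u"
proof -
  have g: "g \<in> GG" "g (j u) \<in> BB" "\<forall>\<^sub>F v in at (j u). \<psi> v = tau (g v)" using assms(2) by (auto simp: reg_via_def)
  have "\<forall>\<^sub>F w in at u. \<psi> (j w) = tau (g (j w))" by (rule GP_eventually(1)[OF g(3) assms(1)])
  then have "\<forall>\<^sub>F w in at u. \<pi> w = tau ((g \<circ> j) w)" using assms(3) by eventually_elim simp
  then show ?thesis unfolding reg_via_def using GG_comp[OF g(1) GP_GG[OF assms(1)]] g(2) by auto
qed

lemma right_agree:
  assumes g: "g \<in> GG" "g u \<in> BB" and h: "h \<in> GG" "h u \<in> BB"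
    and eq: "\<forall>\<^sub>F w in at_right u. tau (g w) = tau (h w)"
  obtains k where "g = tr k \<circ> h"
proof -
  obtain e1 where e1: "e1 > 0" "\<And>w. u < w \<Longrightarrow> w < u + e1 \<Longrightarrow> tau (g w) = tau (h w)"
    using eq by (rule eventually_at_right_interval) blast
  have "\<forall>\<^sub>F w in nhds u. g w \<in> BB \<and> h w \<in> BB"
    using GG_eventually_BB[OF g] GG_eventually_BB[OF h] by (rule eventually_conj)
  then obtain e2 where e2: "e2 > 0" "\<And>w. u - e2 < w \<Longrightarrow> w < u + e2 \<Longrightarrow> g w \<in> BB \<and> h w \<in> BB"
    by (rule eventually_nhds_interval) blast
  show ?thesis
  proof (rule tau_agree[OF g(1) h(1), of u "u + min e1 e2"])
    show "u < u + min e1 e2" using e1 e2 by simp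
    show "g v \<in> BB \<and> h v \<in> BB \<and> tau (g v) = tau (h v)" if "u < v" "v < u + min e1 e2" for v
      using e1(2)[of v] e2(2)[of v] that e2(1) by simp
  qed (rule that)
qed

lemma left_agree:
  assumes g: "g \<in> GG" "g u \<in> BB" and h: "h \<in> GG" "h u \<in> BB"
    and eq: "\<forall>\<^sub>F w in at_left u. tau (g w) = tau (h w)"
  obtains k where "g = tr k \<circ> h"
proof -
  obtain k where k: "g \<circ> uminus = tr k \<circ> (h \<circ> uminus)"
    using right_agree[of "g \<circ> uminus" "- u" "h \<circ> uminus"] GG_comp[OF g(1) GG_uminus] GG_comp[OF h(1) GG_uminus] g(2) h(2) eq
    by (auto simp: eventually_at_left_to_right)
  have "g w = (tr k \<circ> h) w" for w using fun_cong[OF k, of "- w"] by simp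
  then have "g = tr k \<circ> h" by blast
  then show ?thesis by (rule that)
qed

lemma GG_at_BB:
  assumes "g \<in> GG" "g u \<in> BB" shows "\<forall>\<^sub>F w in at u. g w \<in> BB"
  using GG_eventually_BB[OF assms] by (simp add: eventually_nhds_conv_at)

lemma reg_via_agree:
  assumes "reg_via g \<pi> u" "reg_via h \<psi> u"
    and "(\<forall>\<^sub>F w in at_right u. \<pi> w = \<psi> w) \<or> (\<forall>\<^sub>F w in at_left u. \<pi> w = \<psi> w)"
  shows "\<forall>\<^sub>F w in at u. \<pi> w = \<psi> w"
proof -
  have g: "g \<in> GG" "g u \<in> BB" "\<forall>\<^sub>F v in at u. \<pi> v = tau (g v)" using assms(1) by (auto simp: reg_via_def)
  have h: "h \<in> GG" "h u \<in> BB" "\<forall>\<^sub>F v in at u. \<psi> v = tau (h v)" using assms(2) by (auto simp: reg_via_def)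
  obtain k where k: "g = tr k \<circ> h"
    using assms(3)
  proof
    assume a: "\<forall>\<^sub>F w in at_right u. \<pi> w = \<psi> w"
    have "\<forall>\<^sub>F w in at_right u. \<pi> w = tau (g w)" "\<forall>\<^sub>F w in at_right u. \<psi> w = tau (h w)"
      using g(3) h(3) by (auto simp: eventually_at_split)
    with a have "\<forall>\<^sub>F w in at_right u. tau (g w) = tau (h w)" by eventually_elim simp
    then show ?thesis using right_agree[OF g(1,2) h(1,2)] that by blast
  next
    assume a: "\<forall>\<^sub>F w in at_left u. \<pi> w = \<psi> w"
    have "\<forall>\<^sub>F w in at_left u. \<pi> w = tau (g w)" "\<forall>\<^sub>F w in at_left u. \<psi> w = tau (h w)"
      using g(3) h(3) by (auto simp: eventually_at_split)
    with a have "\<forall>\<^sub>F w in at_left u. tau (g w) = tau (h w)" by eventually_elim simp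
    then show ?thesis using left_agree[OF g(1,2) h(1,2)] that by blast
  qed
  show ?thesis using g(3) h(3) GG_at_BB[OF h(1,2)]
    by eventually_elim (simp add: k tau_tr)
qed

subsection \<open>The commensurating action\<close>

text \<open>Only increasing reparametrisations are allowed, so that left and right halves are never
  exchanged. In consequence each point of the circle carries two classes of projective germs, one
  for each orientation.\<close>

definition eqv :: "real \<Rightarrow> (real \<Rightarrow> circle) \<Rightarrow> real \<Rightarrow> (real \<Rightarrow> circle) \<Rightarrow> bool" where
  "eqv u \<pi> v \<psi> \<longleftrightarrow> (\<exists>j\<in>GP. j u = v \<and> (\<forall>\<^sub>F w in at u. \<pi> w = \<psi> (j w)))"

lemma eqv_refl: "eqv u \<pi> u \<pi>"
  unfolding eqv_def using GP_id by (intro bexI[of _ id]) auto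

lemma GP_inverse_ex: "g \<in> GP \<Longrightarrow> \<exists>h\<in>GP. (\<forall>\<theta>. h (g \<theta>) = \<theta>) \<and> (\<forall>\<theta>. g (h \<theta>) = \<theta>)"
  by (metis GP_inverse)

lemma eqv_sym: assumes "eqv u \<pi> v \<psi>" shows "eqv v \<psi> u \<pi>"
proof -
  obtain j where j: "j \<in> GP" "j u = v" "\<forall>\<^sub>F w in at u. \<pi> w = \<psi> (j w)" using assms by (auto simp: eqv_def)
  obtain h where h: "h \<in> GP" "\<forall>\<theta>. h (j \<theta>) = \<theta>" "\<forall>\<theta>. j (h \<theta>) = \<theta>" using GP_inverse_ex[OF j(1)] by blast
  have hv: "h v = u" using h(2) j(2) by blast
  have "\<forall>\<^sub>F w in at v. \<pi> (h w) = \<psi> (j (h w))" by (rule GP_eventually(1)[OF _ h(1)]) (simp add: hv j(3))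
  then have "\<forall>\<^sub>F w in at v. \<psi> w = \<pi> (h w)" by eventually_elim (simp add: h(3))
  then show ?thesis unfolding eqv_def using h(1) hv by blast
qed

lemma eqv_trans: assumes "eqv u \<pi> v \<psi>" "eqv v \<psi> x \<rho>" shows "eqv u \<pi> x \<rho>"
proof -
  obtain j where j: "j \<in> GP" "j u = v" "\<forall>\<^sub>F w in at u. \<pi> w = \<psi> (j w)" using assms by (auto simp: eqv_def)
  obtain i where i: "i \<in> GP" "i v = x" "\<forall>\<^sub>F w in at v. \<psi> w = \<rho> (i w)" using assms by (auto simp: eqv_def)
  have "\<forall>\<^sub>F w in at u. \<psi> (j w) = \<rho> (i (j w))" by (rule GP_eventually(1)[OF _ j(1)]) (simp add: j(2) i(3))
  then have "\<forall>\<^sub>F w in at u. \<pi> w = \<rho> ((i \<circ> j) w)" using j(3) by eventually_elim simp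
  then show ?thesis unfolding eqv_def using GP_comp[OF i(1) j(1)] i(2) j(2) by (intro bexI[of _ "i \<circ> j"]) auto
qed

definition cls :: "real \<Rightarrow> (real \<Rightarrow> circle) \<Rightarrow> (real \<times> (real \<Rightarrow> circle)) set" where
  "cls u \<pi> = {(v, \<psi>). eqv u \<pi> v \<psi>}"

lemma cls_eq_iff: "cls u \<pi> = cls v \<psi> \<longleftrightarrow> eqv u \<pi> v \<psi>"
proof
  assume "cls u \<pi> = cls v \<psi>"
  then have "(v, \<psi>) \<in> cls u \<pi>" using eqv_refl by (auto simp: cls_def)
  then show "eqv u \<pi> v \<psi>" by (simp add: cls_def)
next
  assume a: "eqv u \<pi> v \<psi>"
  show "cls u \<pi> = cls v \<psi>"
    unfolding cls_def using eqv_trans[OF a] eqv_trans[OF eqv_sym[OF a]] by auto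
qed

definition EE :: "real \<Rightarrow> (real \<Rightarrow> circle) \<Rightarrow> bool" where "EE u \<pi> \<longleftrightarrow> rreg \<pi> u \<and> lreg \<pi> u"

lemma EE_eqv: assumes "eqv u \<pi> v \<psi>" "EE v \<psi>" shows "EE u \<pi>"
proof -
  obtain j where j: "j \<in> GP" "j u = v" "\<forall>\<^sub>F w in at u. \<pi> w = \<psi> (j w)" using assms by (auto simp: eqv_def)
  then show ?thesis using assms(2) rreg_reparam[OF j(1), of \<psi> u \<pi>] lreg_reparam[OF j(1), of \<psi> u \<pi>]
    by (auto simp: EE_def eventually_at_split)
qed

definition act :: "(circle \<Rightarrow> circle) set \<Rightarrow> (real \<times> (real \<Rightarrow> circle)) set \<Rightarrow> (real \<times> (real \<Rightarrow> circle)) set" where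
  "act A C = (case SOME z. z \<in> C of (u, \<pi>) \<Rightarrow> cls u ((SOME f. f \<in> A) \<circ> \<pi>))"

lemma PC_Proj_mem:
  assumes "A \<in> carrier PC_Proj" "f \<in> A"
  shows "piecewise_projective f" "A = cofinite_eq `` {f}"
proof -
  obtain f0 where f0: "piecewise_projective f0" "A = cofinite_eq `` {f0}" using assms(1) by (auto simp: in_PC_Proj_iff)
  have fin: "finite {x. f0 x \<noteq> f x}" using assms(2) f0(2) by (simp add: cofinite_eq_def)
  show "piecewise_projective f" using piecewise_projective_cong[OF f0(1) fin] .
  show "A = cofinite_eq `` {f}" unfolding f0(2) cofinite_class_eq_iff by (rule fin)
qed

lemma PC_Proj_mem_ex: "A \<in> carrier PC_Proj \<Longrightarrow> \<exists>f. f \<in> A"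
  using equiv_class_self[OF equiv_cofinite_eq] by (auto simp: in_PC_Proj_iff)

text \<open>The choices in \<open>act\<close> are harmless: representatives of a group element
  differ on a finite set, which a regular germ avoids near its base point, and representatives of a
  class differ by a reparametrisation of the source.\<close>

lemma act_cls:
  assumes A: "A \<in> carrier PC_Proj" "f \<in> A" and E: "EE u \<pi>"
  shows "act A (cls u \<pi>) = cls u (f \<circ> \<pi>)"
proof -
  obtain v \<psi> where z: "(SOME z. z \<in> cls u \<pi>) = (v, \<psi>)" by force
  have "(u, \<pi>) \<in> cls u \<pi>" using eqv_refl by (simp add: cls_def)
  then have "(v, \<psi>) \<in> cls u \<pi>" unfolding z[symmetric] by (rule someI)
  then have "eqv u \<pi> v \<psi>" by (simp add: cls_def)
  then obtain j where j: "j \<in> GP" "j u = v" "\<forall>\<^sub>F w in at u. \<pi> w = \<psi> (j w)" by (auto simp: eqv_def)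
  define f' where "f' = (SOME f. f \<in> A)"
  have "f' \<in> A" unfolding f'_def by (rule someI[of "\<lambda>f. f \<in> A", OF A(2)])
  then have "finite {x. f x \<noteq> f' x}" using PC_Proj_mem(2)[OF A] by (simp add: cofinite_eq_def)
  then have "\<forall>\<^sub>F w in at u. \<pi> w \<notin> {x. f x \<noteq> f' x}"
    using reg_avoids[of \<pi> u] E by (simp only: EE_def)
  then have "\<forall>\<^sub>F w in at u. (f \<circ> \<pi>) w = (f' \<circ> \<psi>) (j w)" using j(3) by eventually_elim auto
  then have "eqv u (f \<circ> \<pi>) v (f' \<circ> \<psi>)" unfolding eqv_def using j by blast
  then show ?thesis unfolding act_def z f'_def[symmetric] prod.case cls_eq_iff by (rule eqv_sym)
qed

lemma EE_post_compose: "piecewise_projective f \<Longrightarrow> EE u \<pi> \<Longrightarrow> EE u (f \<circ> \<pi>)"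
  by (simp add: EE_def rreg_post_compose lreg_post_compose)

text \<open>The class of the tautological germ at \<open>x\<close> in either orientation. By
  \<open>reg_via_cls\<close> there are no other projective germs over \<open>x\<close>, so finitely
  many base points carry finitely many classes.\<close>

definition mcl :: "circle \<times> bool \<Rightarrow> (real \<times> (real \<Rightarrow> circle)) set" where
  "mcl = (\<lambda>(x, or). let \<phi> = (SOME \<phi>. \<phi> \<in> BB \<and> tau \<phi> = x) in if or then cls \<phi> tau else cls (- \<phi>) (tau \<circ> uminus))"

lemma reg_via_eqv:
  assumes g: "reg_via g \<pi> u" and h: "reg_via h \<psi> v" and x: "tau (g u) = tau (h v)" and o: "g \<in> GP \<longleftrightarrow> h \<in> GP"
  shows "eqv u \<pi> v \<psi>"
proof -
  have g': "g \<in> GG" "g u \<in> BB" "\<forall>\<^sub>F v in at u. \<pi> v = tau (g v)" using g by (auto simp: reg_via_def)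
  have h': "h \<in> GG" "h v \<in> BB" "\<forall>\<^sub>F w in at v. \<psi> w = tau (h w)" using h by (auto simp: reg_via_def)
  obtain k where k: "h v = tr k (g u)" using tau_eq_tr[OF h'(2) g'(2)] x by metis
  obtain i where i: "i \<in> GG" "\<forall>\<theta>. i (h \<theta>) = \<theta>" "\<forall>\<theta>. h (i \<theta>) = \<theta>" using GG_inverse_ex[OF h'(1)] by blast
  define j where "j = i \<circ> (tr k \<circ> g)"
  have jGG: "j \<in> GG" unfolding j_def by (intro GG_comp i g' GP_GG tr)
  have trless: "tr k a < tr k b \<longleftrightarrow> a < b" for a b by (rule GP_less[OF tr(1)])
  have "strict_mono j"
  proof (cases "g \<in> GP")
    case True
    have hl: "h a < h b \<longleftrightarrow> a < b" for a b using GP_less o True by blast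
    have "j a < j b" if "a < b" for a b
    proof -
      have "h (j a) < h (j b)" using that GP_less[OF True] trless i(3) by (simp add: j_def)
      then show ?thesis by (simp add: hl)
    qed
    then show ?thesis by (simp add: strict_mono_def)
  next
    case False
    have "g \<circ> uminus \<in> GP" "h \<circ> uminus \<in> GP" using False o g'(1) h'(1) by (metis GG_orientation)+
    then have gl: "g a < g b \<longleftrightarrow> b < a" and hl: "h a < h b \<longleftrightarrow> b < a" for a b
      using GP_less[of "g \<circ> uminus" "- a" "- b"] GP_less[of "h \<circ> uminus" "- a" "- b"] by auto
    have "j a < j b" if "a < b" for a b
    proof -
      have "h (j b) < h (j a)" using that gl trless i(3) by (simp add: j_def)
      then show ?thesis by (simp add: hl)
    qed
    then show ?thesis by (simp add: strict_mono_def)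
  qed
  then have jGP: "j \<in> GP" using jGG by (simp add: GP_def)
  have ju: "j u = v" using i(2) by (simp add: j_def k[symmetric])
  have "\<forall>\<^sub>F w in at u. \<psi> (j w) = tau (h (j w))" by (rule GP_eventually(1)[OF _ jGP]) (simp add: ju h'(3))
  then have "\<forall>\<^sub>F w in at u. \<pi> w = \<psi> (j w)" using g'(3) GG_at_BB[OF g'(1,2)]
    by eventually_elim (simp add: j_def i(3) tau_tr)
  then show ?thesis unfolding eqv_def using jGP ju by blast
qed

lemma reg_via_cls:
  assumes g: "reg_via g \<pi> u" shows "cls u \<pi> = mcl (tau (g u), g \<in> GP)"
proof -
  define \<phi> where "\<phi> = (SOME \<phi>. \<phi> \<in> BB \<and> tau \<phi> = tau (g u))"
  have "\<exists>\<phi>. \<phi> \<in> BB \<and> tau \<phi> = tau (g u)" using tau_surj by metis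
  then have "\<phi> \<in> BB \<and> tau \<phi> = tau (g u)" unfolding \<phi>_def by (rule someI_ex)
  then have \<phi>: "\<phi> \<in> BB" "tau \<phi> = tau (g u)" by auto
  have 1: "reg_via id tau \<phi>" using \<phi> GG_id by (simp add: reg_via_def)
  have 2: "reg_via uminus (tau \<circ> uminus) (- \<phi>)" using \<phi> GG_uminus by (simp add: reg_via_def)
  have nP: "uminus \<notin> GP" using GP_less[of uminus 0 1] by auto
  have m: "mcl (tau (g u), o') = (if o' then cls \<phi> tau else cls (- \<phi>) (tau \<circ> uminus))" for o'
    by (simp only: mcl_def prod.case Let_def \<phi>_def)
  show ?thesis
  proof (cases "g \<in> GP")
    case True
    then show ?thesis using reg_via_eqv[OF g 1] \<phi>(2) GP_id by (simp add: m cls_eq_iff)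
  next
    case False
    then show ?thesis using reg_via_eqv[OF g 2] \<phi>(2) nP by (simp add: m cls_eq_iff)
  qed
qed

lemma reg_via_point_unique:
  assumes "reg_via g \<pi> u" "reg_via h \<pi> u" shows "tau (g u) = tau (h u)"
proof -
  have g: "g \<in> GG" "g u \<in> BB" "\<forall>\<^sub>F v in at u. \<pi> v = tau (g v)" using assms(1) by (auto simp: reg_via_def)
  have h: "h \<in> GG" "h u \<in> BB" "\<forall>\<^sub>F v in at u. \<pi> v = tau (h v)" using assms(2) by (auto simp: reg_via_def)
  have "\<forall>\<^sub>F w in at u. tau (g w) = tau (h w)" using g(3) h(3) by eventually_elim simp
  then have "\<forall>\<^sub>F w in at_right u. tau (g w) = tau (h w)" by (simp add: eventually_at_split)
  then obtain k where "g = tr k \<circ> h" using right_agree[OF g(1,2) h(1,2)] by blast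
  then show ?thesis using tau_tr[OF h(2)] by simp
qed

definition side :: "bool \<Rightarrow> real \<Rightarrow> real filter" where
  "side s u = (if s then at_right u else at_left u)"

lemma side_le: "eventually Q (at u) \<Longrightarrow> eventually Q (side s u)"
  by (simp add: side_def eventually_at_split)

text \<open>The two classes have representatives with a common right half (\<open>s\<close> true) or
  left half (\<open>s\<close> false). Two members of an invariant set related in this way compete
  for the same gluing.\<close>

definition sided :: "bool \<Rightarrow> (real \<times> (real \<Rightarrow> circle)) set \<Rightarrow> (real \<times> (real \<Rightarrow> circle)) set \<Rightarrow> bool" where
  "sided s C C' \<longleftrightarrow> (\<exists>u \<pi> \<psi>. C = cls u \<pi> \<and> C' = cls u \<psi> \<and> EE u \<pi> \<and> EE u \<psi> \<and>
     (\<forall>\<^sub>F w in side s u. \<pi> w = \<psi> w))"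

lemma sided_join:
  assumes "sided s C1 C" "sided s C2 C" shows "sided s C1 C2"
proof -
  obtain u \<pi> \<psi> where 1: "C1 = cls u \<pi>" "C = cls u \<psi>" "EE u \<pi>" "EE u \<psi>" "\<forall>\<^sub>F w in side s u. \<pi> w = \<psi> w"
    using assms(1) by (auto simp: sided_def)
  obtain v \<pi>' \<psi>' where 2: "C2 = cls v \<pi>'" "C = cls v \<psi>'" "EE v \<pi>'" "EE v \<psi>'" "\<forall>\<^sub>F w in side s v. \<pi>' w = \<psi>' w"
    using assms(2) by (auto simp: sided_def)
  have "eqv u \<psi> v \<psi>'" using 1(2) 2(2) cls_eq_iff by metis
  then obtain j where j: "j \<in> GP" "j u = v" "\<forall>\<^sub>F w in at u. \<psi> w = \<psi>' (j w)" by (auto simp: eqv_def)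
  have e: "eqv u (\<pi>' \<circ> j) v \<pi>'" unfolding eqv_def using j(1,2) by (intro bexI[of _ j]) auto
  have "\<forall>\<^sub>F w in side s u. \<pi>' (j w) = \<psi>' (j w)"
    using 2(5) j(2) GP_eventually(2)[OF _ j(1), of _ u] GP_eventually(3)[OF _ j(1), of _ u] by (simp add: side_def split: if_splits)
  then have "\<forall>\<^sub>F w in side s u. \<pi> w = (\<pi>' \<circ> j) w" using 1(5) side_le[OF j(3), of s] by eventually_elim simp
  moreover have "C2 = cls u (\<pi>' \<circ> j)" using e 2(1) cls_eq_iff by metis
  ultimately show ?thesis unfolding sided_def using 1(1,3) EE_eqv[OF e 2(3)] by blast
qed

lemma sided_act:
  assumes A: "A \<in> carrier PC_Proj" and s: "sided s C C'" shows "sided s (act A C) (act A C')"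
proof -
  obtain u \<pi> \<psi> where 1: "C = cls u \<pi>" "C' = cls u \<psi>" "EE u \<pi>" "EE u \<psi>" "\<forall>\<^sub>F w in side s u. \<pi> w = \<psi> w"
    using s by (auto simp: sided_def)
  obtain f where f: "f \<in> A" using PC_Proj_mem_ex[OF A] by blast
  have "\<forall>\<^sub>F w in side s u. (f \<circ> \<pi>) w = (f \<circ> \<psi>) w" using 1(5) by eventually_elim simp
  then show ?thesis
    unfolding sided_def 1(1,2) act_cls[OF A f 1(3)] act_cls[OF A f 1(4)]
    using EE_post_compose[OF PC_Proj_mem(1)[OF A f]] 1(3,4) by blast
qed

definition MM :: "(real \<times> (real \<Rightarrow> circle)) set set" where
  "MM = {cls u \<pi> | u \<pi>. \<exists>g. reg_via g \<pi> u}"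

lemma cls_in_MM: "cls u \<pi> \<in> MM \<longleftrightarrow> (\<exists>g. reg_via g \<pi> u)"
proof
  assume "cls u \<pi> \<in> MM"
  then obtain v \<psi> g where "eqv u \<pi> v \<psi>" "reg_via g \<psi> v" by (auto simp: MM_def cls_eq_iff)
  then show "\<exists>g. reg_via g \<pi> u" using reg_via_reparam unfolding eqv_def by blast
qed (auto simp: MM_def)

lemma sided_MM_eq:
  assumes "C \<in> MM" "C' \<in> MM" "sided s C C'" shows "C = C'"
proof -
  obtain u \<pi> \<psi> where 1: "C = cls u \<pi>" "C' = cls u \<psi>" "EE u \<pi>" "EE u \<psi>" "\<forall>\<^sub>F w in side s u. \<pi> w = \<psi> w"
    using assms(3) by (auto simp: sided_def)
  obtain g h where gh: "reg_via g \<pi> u" "reg_via h \<psi> u" using assms(1,2) 1(1,2) cls_in_MM by metis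
  have "\<forall>\<^sub>F w in at u. \<pi> w = \<psi> w" using reg_via_agree[OF gh] 1(5) by (cases s) (auto simp: side_def)
  then have "eqv u \<pi> u \<psi>" unfolding eqv_def using GP_id by (intro bexI[of _ id]) auto
  then show ?thesis using 1 by (simp add: cls_eq_iff)
qed

text \<open>
  \<open>P\<close> is the \<open>\<Gamma>\<close>-invariant set of germs supplied by Property FW: up to reparametrisation it
  differs from the set of genuine projective germs by finitely many germs, located over \<open>S\<close>.
\<close>

locale devel =
  fixes \<Gamma> :: "(circle \<Rightarrow> circle) set set" and S :: "circle set" and P :: "real \<Rightarrow> (real \<Rightarrow> circle) \<Rightarrow> bool"
  assumes \<Gamma>: "subgroup \<Gamma> PC_Proj"
    and P_reg: "P u \<pi> \<Longrightarrow> EE u \<pi>"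
    and P_eqv: "P u \<pi> \<Longrightarrow> eqv u \<pi> v \<psi> \<Longrightarrow> P v \<psi>"
    and P_act: "P u \<pi> \<Longrightarrow> A \<in> \<Gamma> \<Longrightarrow> f \<in> A \<Longrightarrow> P u (f \<circ> \<pi>)"
    and P_det: "P u \<pi> \<Longrightarrow> P u \<psi> \<Longrightarrow> \<forall>\<^sub>F w in side s u. \<pi> w = \<psi> w \<Longrightarrow> \<forall>\<^sub>F w in at u. \<pi> w = \<psi> w"
    and S_fin: "finite S"
    and P_generic: "reg_via g \<pi> u \<Longrightarrow> tau (g u) \<notin> S \<Longrightarrow> P u \<pi>"

text \<open>A lift \<open>h\<close> of the germ satisfies
  \<open>h = tr k \<circ> (h \<circ> j)\<close> for some \<open>k\<close>. Evaluation at the fixed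
  point \<open>u\<close> gives \<open>k = 0\<close>, and then injectivity and rigidity give the
  identity.\<close>

lemma self_germ_trivial:
  assumes E: "EE u \<psi>" and j: "j \<in> GP" "j u = u" and eq: "\<forall>\<^sub>F w in side s u. \<psi> w = \<psi> (j w)"
  shows "j = id"
proof -
  have "\<exists>h\<in>GG. h u \<in> BB \<and> (\<forall>\<^sub>F w in side s u. \<psi> w = tau (h w))"
    using E by (cases s) (auto simp: EE_def rreg_def lreg_def side_def)
  then obtain h where h: "h \<in> GG" "h u \<in> BB" "\<forall>\<^sub>F w in side s u. \<psi> w = tau (h w)" by blast
  have "\<forall>\<^sub>F w in side s u. \<psi> (j w) = tau (h (j w))"
    using h(3) j(2) GP_eventually(2)[OF _ j(1), of _ u] GP_eventually(3)[OF _ j(1), of _ u] by (simp add: side_def split: if_splits)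
  then have e: "\<forall>\<^sub>F w in side s u. tau (h w) = tau ((h \<circ> j) w)" using eq h(3) by eventually_elim simp
  have hj: "h \<circ> j \<in> GG" "(h \<circ> j) u \<in> BB" using GG_comp[OF h(1) GP_GG[OF j(1)]] h(2) j(2) by auto
  obtain k where k: "h = tr k \<circ> (h \<circ> j)"
  proof (cases s)
    case True
    then have a: "\<forall>\<^sub>F w in at_right u. tau (h w) = tau ((h \<circ> j) w)" using e by (simp only: side_def if_True)
    show ?thesis by (rule right_agree[OF h(1,2) hj a]) (rule that)
  next
    case False
    then have a: "\<forall>\<^sub>F w in at_left u. tau (h w) = tau ((h \<circ> j) w)" using e by (simp only: side_def if_False)
    show ?thesis by (rule left_agree[OF h(1,2) hj a]) (rule that)
  qed
  have "h u = tr k (h u)" using fun_cong[OF k, of u] j(2) by simp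
  then have "tan (h u) = tan (h u) + of_int k" using tr(3)[OF h(2), of k] by simp
  then have k0: "k = 0" by simp
  have t0: "tr 0 \<theta> = \<theta>" if "\<theta> \<in> BB" for \<theta> using BB_tan_inj[OF tr(2)[OF that] that, of 0] tr(3)[OF that, of 0] by simp
  have "\<forall>\<^sub>F w in nhds u. (h \<circ> j) w \<in> BB" by (rule GG_eventually_BB[OF hj])
  then obtain e where e: "e > 0" "\<And>w. u - e < w \<Longrightarrow> w < u + e \<Longrightarrow> (h \<circ> j) w \<in> BB"
    by (rule eventually_nhds_interval) blast
  have "j w = id w" if "u - e < w" "w < u + e" for w
  proof -
    have "h w = h (j w)" using fun_cong[OF k, of w] t0 e(2)[OF that] k0 by simp
    then show ?thesis using GG_inj[OF h(1)] by (simp add: inj_def)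
  qed
  then show ?thesis using GG_rigid[OF GP_GG[OF j(1)] GG_id(1), of "u - e" "u + e"] e(1) by simp
qed

text \<open>The set \<open>MM\<close> of projective germs is commensurated: a group element can take
  a germ out of \<open>MM\<close> only if the base point of the germ is one of its finitely many
  singularities. Transfixing \<open>MM\<close> gives \<open>N\<close>, which is then thinned out so
  that half a germ determines the other half.\<close>

theorem devel_exists:
  assumes \<Gamma>: "subgroup \<Gamma> PC_Proj" and FW: "property_FW (PC_Proj\<lparr>carrier := \<Gamma>\<rparr>)"
  shows "\<exists>S P. devel \<Gamma> S P"
proof -
  interpret PC: group PC_Proj by (rule group_PC_Proj)
  have \<Gamma>c: "A \<in> carrier PC_Proj" if "A \<in> \<Gamma>" for A using subgroup.subset[OF \<Gamma>] that by blast
  have grp: "group (PC_Proj\<lparr>carrier := \<Gamma>\<rparr>)" using PC.subgroup_imp_group[OF \<Gamma>] .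
  define Y where "Y = {cls u \<pi> | u \<pi>. EE u \<pi>}"
  have YE: "\<exists>u \<pi>. C = cls u \<pi> \<and> EE u \<pi>" if "C \<in> Y" for C using that by (auto simp: Y_def)
  have MY: "MM \<subseteq> Y" unfolding MM_def Y_def EE_def using reg_via_imp by blast
  have actY: "act A C \<in> Y" if A: "A \<in> carrier PC_Proj" and C: "C \<in> Y" for A C
  proof -
    obtain u \<pi> where C': "C = cls u \<pi>" "EE u \<pi>" using YE[OF C] by blast
    obtain f where f: "f \<in> A" using PC_Proj_mem_ex[OF A] by blast
    show ?thesis unfolding C'(1) act_cls[OF A f C'(2)] Y_def
      using EE_post_compose[OF PC_Proj_mem(1)[OF A f] C'(2)] by blast
  qed
  have act_one: "act \<one>\<^bsub>PC_Proj\<^esub> C = C" if C: "C \<in> Y" for C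
  proof -
    obtain u \<pi> where C': "C = cls u \<pi>" "EE u \<pi>" using YE[OF C] by blast
    have "id \<in> \<one>\<^bsub>PC_Proj\<^esub>" by (simp add: PC_Proj_def cofinite_eq_def)
    then show ?thesis unfolding C'(1) using act_cls[OF PC.one_closed _ C'(2), of id] by simp
  qed
  have act_mult: "act (A \<otimes>\<^bsub>PC_Proj\<^esub> A') C = act A (act A' C)"
    if A: "A \<in> carrier PC_Proj" "A' \<in> carrier PC_Proj" and C: "C \<in> Y" for A A' C
  proof -
    obtain u \<pi> where C': "C = cls u \<pi>" "EE u \<pi>" using YE[OF C] by blast
    obtain f f' where f: "f \<in> A" "f' \<in> A'" using PC_Proj_mem_ex A by blast
    have "A \<otimes>\<^bsub>PC_Proj\<^esub> A' = cofinite_eq `` {f \<circ> f'}"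
      using PC_Proj_mult[OF PC_Proj_mem(1)[OF A(2) f(2)], of f] PC_Proj_mem(2)[OF A(1) f(1)] PC_Proj_mem(2)[OF A(2) f(2)] by simp
    then have "f \<circ> f' \<in> A \<otimes>\<^bsub>PC_Proj\<^esub> A'" by (simp add: cofinite_eq_def)
    then have "act (A \<otimes>\<^bsub>PC_Proj\<^esub> A') C = cls u (f \<circ> f' \<circ> \<pi>)"
      unfolding C'(1) by (rule act_cls[OF PC.m_closed[OF A] _ C'(2)])
    moreover have "act A (act A' C) = cls u (f \<circ> (f' \<circ> \<pi>))"
      unfolding C'(1) act_cls[OF A(2) f(2) C'(2)]
      by (rule act_cls[OF A(1) f(1) EE_post_compose[OF PC_Proj_mem(1)[OF A(2) f(2)] C'(2)]])
    ultimately show ?thesis by (simp add: comp_assoc)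
  qed
  have com: "finite (act A ` MM - MM)" if A: "A \<in> carrier PC_Proj" for A
  proof -
    obtain f where f: "f \<in> A" using PC_Proj_mem_ex[OF A] by blast
    obtain F where F: "finite F" "\<And>x. x \<notin> F \<Longrightarrow> locally_projective_at f x"
      using PC_Proj_mem(1)[OF A f] unfolding piecewise_projective_def by blast
    have "act A ` MM - MM \<subseteq> act A ` mcl ` (F \<times> UNIV)"
    proof
      fix C assume C: "C \<in> act A ` MM - MM"
      then obtain u \<pi> g where C': "C = act A (cls u \<pi>)" "reg_via g \<pi> u" by (auto simp: MM_def)
      have E: "EE u \<pi>" using reg_via_imp[OF C'(2)] by (simp add: EE_def)
      have "tau (g u) \<in> F"
      proof (rule ccontr)
        assume "tau (g u) \<notin> F"
        then obtain h where "reg_via h (f \<circ> \<pi>) u" using reg_via_post_compose[OF F(2) C'(2)] by blast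
        then have "C \<in> MM" unfolding C'(1) act_cls[OF A f E] cls_in_MM by blast
        then show False using C by blast
      qed
      then show "C \<in> act A ` mcl ` (F \<times> UNIV)" unfolding C'(1) reg_via_cls[OF C'(2)] by blast
    qed
    moreover have "finite (act A ` mcl ` (F \<times> UNIV))" using F(1) by simp
    ultimately show ?thesis by (rule finite_subset)
  qed
  have "\<exists>N\<subseteq>Y. (\<forall>A\<in>carrier (PC_Proj\<lparr>carrier := \<Gamma>\<rparr>). \<forall>C\<in>N. act A C \<in> N) \<and> finite (sym_diff MM N)"
    by (rule property_FW_D[OF FW grp, of Y act MM]) (simp_all add: actY act_one act_mult com MY \<Gamma>c)
  then obtain N where N: "N \<subseteq> Y" "\<forall>A\<in>\<Gamma>. \<forall>C\<in>N. act A C \<in> N" "finite (MM - N)" "finite (N - MM)"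
    by (auto simp del: finite_Diff2)
  \<comment> \<open>All germs sharing a half with another member of \<open>N\<close> are removed.
    The rule is invariant under the group, while selecting one competitor would not be.\<close>
  define N1 where "N1 = {C \<in> N. \<forall>s. \<forall>C'\<in>N. sided s C C' \<longrightarrow> C' = C}"
  have N1_inv: "act A C \<in> N1" if A: "A \<in> \<Gamma>" and C: "C \<in> N1" for A C
  proof -
    have A': "inv\<^bsub>PC_Proj\<^esub> A \<in> \<Gamma>" by (rule subgroup.m_inv_closed[OF \<Gamma> A])
    have CN: "C \<in> N" using C by (simp add: N1_def)
    have "C' = act A C" if C': "C' \<in> N" "sided s (act A C) C'" for s C'
    proof -
      have e1: "act (inv\<^bsub>PC_Proj\<^esub> A) (act A C) = C"
        using act_mult[OF \<Gamma>c[OF A'] \<Gamma>c[OF A], of C] act_one[of C] CN N(1) \<Gamma>c[OF A] by auto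
      have e2: "act A (act (inv\<^bsub>PC_Proj\<^esub> A) C') = C'"
        using act_mult[OF \<Gamma>c[OF A] \<Gamma>c[OF A'], of C'] act_one[of C'] C'(1) N(1) \<Gamma>c[OF A] by auto
      have "sided s C (act (inv\<^bsub>PC_Proj\<^esub> A) C')" using sided_act[OF \<Gamma>c[OF A'] C'(2)] unfolding e1 .
      moreover have "act (inv\<^bsub>PC_Proj\<^esub> A) C' \<in> N" using N(2) A' C'(1) by blast
      ultimately have "act (inv\<^bsub>PC_Proj\<^esub> A) C' = C" using C by (auto simp: N1_def)
      then show ?thesis using e2 by simp
    qed
    then show ?thesis using N(2) A CN by (simp add: N1_def)
  qed
  \<comment> \<open>A projective germ of \<open>N\<close> is lost only to a competitor
    \<open>C'\<close> outside \<open>MM\<close>. As projective germs with a common half coincide, it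
    is recovered from \<open>C'\<close> and the side; so the loss is finite, like
    \<open>N - MM\<close>.\<close>
  define ch where "ch = (\<lambda>s C'. SOME C. C \<in> MM \<and> sided s C C')"
  have "MM - N1 \<subseteq> (MM - N) \<union> (\<Union>s. ch s ` (N - MM))"
  proof
    fix C assume C: "C \<in> MM - N1"
    show "C \<in> (MM - N) \<union> (\<Union>s. ch s ` (N - MM))"
    proof (cases "C \<in> N")
      case True
      then obtain s C' where C': "C' \<in> N" "sided s C C'" "C' \<noteq> C" using C by (auto simp: N1_def)
      have nM: "C' \<notin> MM" using sided_MM_eq[OF _ _ C'(2)] C C'(3) by blast
      have "ch s C' \<in> MM \<and> sided s (ch s C') C'" unfolding ch_def
        by (rule someI[of "\<lambda>C. C \<in> MM \<and> sided s C C'" C]) (use C C' in blast)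
      then have "C = ch s C'" using sided_MM_eq[OF _ _ sided_join[OF C'(2)]] C by blast
      then show ?thesis using C'(1) nM by blast
    qed (use C in blast)
  qed
  moreover have "finite ((MM - N) \<union> (\<Union>s. ch s ` (N - MM)))" using N(3,4) by simp
  ultimately have finN1: "finite (MM - N1)" by (rule finite_subset)
  \<comment> \<open>The base point in the circle of a class of projective germs; \<open>S\<close>
    collects the base points of the missing ones.\<close>
  define pt where "pt = (\<lambda>C. SOME x. \<exists>u \<pi> g. C = cls u \<pi> \<and> reg_via g \<pi> u \<and> x = tau (g u))"
  have pt: "pt (cls u \<pi>) = tau (g u)" if g: "reg_via g \<pi> u" for g u \<pi>
  proof -
    have "\<exists>v \<psi> h. cls u \<pi> = cls v \<psi> \<and> reg_via h \<psi> v \<and> pt (cls u \<pi>) = tau (h v)"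
      unfolding pt_def by (rule someI_ex) (use g in blast)
    then obtain v \<psi> h where h: "eqv u \<pi> v \<psi>" "reg_via h \<psi> v" "pt (cls u \<pi>) = tau (h v)"
      by (auto simp: cls_eq_iff)
    obtain j where j: "j \<in> GP" "j u = v" "\<forall>\<^sub>F w in at u. \<pi> w = \<psi> (j w)" using h(1) by (auto simp: eqv_def)
    have "reg_via (h \<circ> j) \<pi> u" using reg_via_reparam[OF j(1), of h \<psi> u \<pi>] h(2) j by simp
    then show ?thesis using reg_via_point_unique[OF g] h(3) j(2) by simp
  qed
  define S where "S = pt ` (MM - N1)"
  define P where "P = (\<lambda>u \<pi>. EE u \<pi> \<and> cls u \<pi> \<in> N1)"
  have "devel \<Gamma> S P"
  proof (rule devel.intro)
    show "subgroup \<Gamma> PC_Proj" by (rule \<Gamma>)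
    show "EE u \<pi>" if "P u \<pi>" for u \<pi> using that by (simp add: P_def)
    show "P v \<psi>" if "P u \<pi>" "eqv u \<pi> v \<psi>" for u \<pi> v \<psi>
    proof -
      have "cls u \<pi> = cls v \<psi>" using that(2) by (simp add: cls_eq_iff)
      then show ?thesis using that EE_eqv[OF eqv_sym[OF that(2)]] by (simp add: P_def)
    qed
    show "P u (f \<circ> \<pi>)" if "P u \<pi>" "A \<in> \<Gamma>" "f \<in> A" for u \<pi> A f
      using that N1_inv[OF that(2), of "cls u \<pi>"] act_cls[OF \<Gamma>c[OF that(2)] that(3), of u \<pi>]
        EE_post_compose[OF PC_Proj_mem(1)[OF \<Gamma>c[OF that(2)] that(3)], of u \<pi>] by (simp add: P_def)
    show "\<forall>\<^sub>F w in at u. \<pi> w = \<psi> w" if p: "P u \<pi>" "P u \<psi>" "\<forall>\<^sub>F w in side s u. \<pi> w = \<psi> w" for u \<pi> \<psi> s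
    proof -
      have E: "EE u \<pi>" "EE u \<psi>" "cls u \<pi> \<in> N1" "cls u \<psi> \<in> N1" using p by (auto simp: P_def)
      have "sided s (cls u \<pi>) (cls u \<psi>)" unfolding sided_def using E(1,2) p(3) by blast
      then have "cls u \<psi> = cls u \<pi>" using E(3,4) by (auto simp: N1_def)
      then have "eqv u \<pi> u \<psi>" by (simp add: cls_eq_iff[symmetric])
      then obtain j where j: "j \<in> GP" "j u = u" "\<forall>\<^sub>F w in at u. \<pi> w = \<psi> (j w)" by (auto simp: eqv_def)
      have "\<forall>\<^sub>F w in side s u. \<psi> w = \<psi> (j w)" using p(3) side_le[OF j(3), of s] by eventually_elim simp
      then have "j = id" by (rule self_germ_trivial[OF E(2) j(1,2)])
      then show ?thesis using j(3) by simp
    qed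
    show "finite S" using finN1 by (simp add: S_def)
    show "P u \<pi>" if g: "reg_via g \<pi> u" "tau (g u) \<notin> S" for g \<pi> u
    proof -
      have "cls u \<pi> \<in> MM" using g(1) cls_in_MM by blast
      moreover have "cls u \<pi> \<notin> MM - N1"
      proof
        assume "cls u \<pi> \<in> MM - N1"
        then have "pt (cls u \<pi>) \<in> S" unfolding S_def by (rule imageI)
        then show False using g(2) pt[OF g(1)] by simp
      qed
      ultimately show ?thesis using reg_via_imp[OF g(1)] by (simp add: P_def EE_def)
    qed
  qed
  then show ?thesis by blast
qed

subsection \<open>Developments\<close>

text \<open>Germs ignore the value at their base point. Prescribing it as the limit from the right
  makes functions with the same punctured germs equal, so that developments can be compared
  pointwise.\<close>

definition norm_at :: "(real \<Rightarrow> circle) \<Rightarrow> real \<Rightarrow> bool" where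
  "norm_at \<pi> u \<longleftrightarrow> (\<exists>g\<in>GG. g u \<in> BB \<and> (\<forall>\<^sub>F v in at_right u. \<pi> v = tau (g v)) \<and> \<pi> u = tau (g u))"

definition nz :: "(real \<Rightarrow> circle) \<Rightarrow> real \<Rightarrow> circle" where
  "nz \<pi> u = (SOME x. \<exists>g\<in>GG. g u \<in> BB \<and> (\<forall>\<^sub>F v in at_right u. \<pi> v = tau (g v)) \<and> x = tau (g u))"

lemma right_value_unique:
  assumes "g \<in> GG" "g u \<in> BB" "\<forall>\<^sub>F v in at_right u. \<pi> v = tau (g v)"
    and "h \<in> GG" "h u \<in> BB" "\<forall>\<^sub>F v in at_right u. \<psi> v = tau (h v)"
    and "\<forall>\<^sub>F v in at_right u. \<pi> v = \<psi> v"
  shows "tau (g u) = tau (h u)"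
proof -
  have "\<forall>\<^sub>F v in at_right u. tau (g v) = tau (h v)" using assms(3,6,7) by eventually_elim simp
  then obtain k where "g = tr k \<circ> h" using right_agree[OF assms(1,2,4,5)] by blast
  then show ?thesis using tau_tr[OF assms(5)] by simp
qed

lemma nz_eq:
  assumes "g \<in> GG" "g u \<in> BB" "\<forall>\<^sub>F v in at_right u. \<pi> v = tau (g v)"
  shows "nz \<pi> u = tau (g u)"
proof -
  have "\<exists>h\<in>GG. h u \<in> BB \<and> (\<forall>\<^sub>F v in at_right u. \<pi> v = tau (h v)) \<and> nz \<pi> u = tau (h u)"
    unfolding nz_def by (rule someI_ex) (use assms in blast)
  then obtain h where "h \<in> GG" "h u \<in> BB" "\<forall>\<^sub>F v in at_right u. \<pi> v = tau (h v)" "nz \<pi> u = tau (h u)" by blast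
  then show ?thesis using right_value_unique[OF assms, of h \<pi>] by simp
qed

lemma nz_on_interval:
  assumes g: "g \<in> GG" and e: "\<And>v. a < v \<Longrightarrow> v < b \<Longrightarrow> g v \<in> BB \<and> \<pi> v = tau (g v)" and v: "a < v" "v < b"
  shows "nz \<pi> v = tau (g v)"
proof (rule nz_eq[OF g])
  show "g v \<in> BB" using e v by blast
  show "\<forall>\<^sub>F w in at_right v. \<pi> w = tau (g w)"
    by (rule eventually_at_right_intervalI[of "b - v"]) (use e v in auto)
qed

lemma eventually_at_left_interval:
  fixes u :: real
  assumes "eventually Q (at_left u)"
  obtains e where "e > 0" "\<And>v. u - e < v \<Longrightarrow> v < u \<Longrightarrow> Q v"
proof -
  obtain b where "b < u" "\<And>v. b < v \<Longrightarrow> v < u \<Longrightarrow> Q v"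
    using assms unfolding eventually_at_left_field by blast
  then show ?thesis using that[of "u - b"] by auto
qed

lemma eventually_at_left_intervalI:
  fixes u :: real
  assumes "e > 0" "\<And>v. u - e < v \<Longrightarrow> v < u \<Longrightarrow> Q v"
  shows "eventually Q (at_left u)"
  unfolding eventually_at_left_field using assms by (intro exI[of _ "u - e"]) auto

lemma lreg_interval:
  assumes "lreg \<pi> u"
  obtains g e where "g \<in> GG" "g u \<in> BB" "e > 0" "\<And>v. u - e < v \<Longrightarrow> v < u \<Longrightarrow> g v \<in> BB \<and> \<pi> v = tau (g v)"
proof -
  obtain g where g: "g \<in> GG" "g u \<in> BB" "\<forall>\<^sub>F v in at_left u. \<pi> v = tau (g v)" using assms by (auto simp: lreg_def)
  have "\<forall>\<^sub>F v in at_left u. g v \<in> BB" using GG_at_BB[OF g(1,2)] by (simp add: eventually_at_split)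
  then have "\<forall>\<^sub>F v in at_left u. g v \<in> BB \<and> \<pi> v = tau (g v)" using g(3) by eventually_elim simp
  then obtain e where "e > 0" "\<And>v. u - e < v \<Longrightarrow> v < u \<Longrightarrow> g v \<in> BB \<and> \<pi> v = tau (g v)"
    by (rule eventually_at_left_interval) blast
  then show ?thesis using that g(1,2) by blast
qed

lemma nz_eventually:
  assumes "EE u \<pi>" shows "\<forall>\<^sub>F w in at u. nz \<pi> w = \<pi> w"
proof -
  obtain g e where g: "g \<in> GG" "g u \<in> BB" "e > 0" "\<And>v. u < v \<Longrightarrow> v < u + e \<Longrightarrow> g v \<in> BB \<and> \<pi> v = tau (g v)"
    using rreg_interval[of \<pi> u] assms unfolding EE_def by metis
  obtain h d where h: "h \<in> GG" "h u \<in> BB" "d > 0" "\<And>v. u - d < v \<Longrightarrow> v < u \<Longrightarrow> h v \<in> BB \<and> \<pi> v = tau (h v)"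
    using lreg_interval[of \<pi> u] assms unfolding EE_def by metis
  have "\<forall>\<^sub>F w in at_right u. nz \<pi> w = \<pi> w"
    by (rule eventually_at_right_intervalI[OF g(3)]) (use nz_on_interval[OF g(1,4)] g(4) in auto)
  moreover have "\<forall>\<^sub>F w in at_left u. nz \<pi> w = \<pi> w"
    by (rule eventually_at_left_intervalI[OF h(3)]) (use nz_on_interval[OF h(1,4)] h(4) in auto)
  ultimately show ?thesis by (simp add: eventually_at_split)
qed

lemma norm_at_nz:
  assumes "EE u \<pi>" shows "norm_at (nz \<pi>) u"
proof -
  obtain g where g: "g \<in> GG" "g u \<in> BB" "\<forall>\<^sub>F v in at_right u. \<pi> v = tau (g v)" using assms by (auto simp: EE_def rreg_def)
  have "\<forall>\<^sub>F w in at_right u. nz \<pi> w = \<pi> w" using nz_eventually[OF assms] by (simp add: eventually_at_split)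
  then have "\<forall>\<^sub>F w in at_right u. nz \<pi> w = tau (g w)" using g(3) by eventually_elim simp
  then show ?thesis unfolding norm_at_def using g nz_eq[OF g] by blast
qed

lemma norm_at_eqI:
  assumes "norm_at \<pi> u" "norm_at \<psi> u" "\<forall>\<^sub>F w in at_right u. \<pi> w = \<psi> w" shows "\<pi> u = \<psi> u"
proof -
  obtain g where g: "g \<in> GG" "g u \<in> BB" "\<forall>\<^sub>F v in at_right u. \<pi> v = tau (g v)" "\<pi> u = tau (g u)" using assms(1) by (auto simp: norm_at_def)
  obtain h where h: "h \<in> GG" "h u \<in> BB" "\<forall>\<^sub>F v in at_right u. \<psi> v = tau (h v)" "\<psi> u = tau (h u)" using assms(2) by (auto simp: norm_at_def)
  show ?thesis using right_value_unique[OF g(1-3) h(1-3) assms(3)] g(4) h(4) by simp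
qed

lemma norm_at_cong:
  assumes "norm_at \<pi> u" "\<forall>\<^sub>F w in nhds u. \<pi> w = \<psi> w" shows "norm_at \<psi> u"
proof -
  obtain g where g: "g \<in> GG" "g u \<in> BB" "\<forall>\<^sub>F v in at_right u. \<pi> v = tau (g v)" "\<pi> u = tau (g u)" using assms(1) by (auto simp: norm_at_def)
  have "\<forall>\<^sub>F w in at_right u. \<pi> w = \<psi> w" "\<pi> u = \<psi> u"
    using assms(2) by (simp_all add: eventually_nhds_conv_at eventually_at_split)
  note e = this
  have "\<forall>\<^sub>F w in at_right u. \<psi> w = tau (g w)" using e(1) g(3) by eventually_elim simp
  then show ?thesis unfolding norm_at_def using g e(2) by (intro bexI[of _ g]) auto
qed

lemma norm_at_reparam:
  assumes j: "j \<in> GP" and n: "norm_at \<pi> (j u)" shows "norm_at (\<pi> \<circ> j) u"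
proof -
  obtain g where g: "g \<in> GG" "g (j u) \<in> BB" "\<forall>\<^sub>F v in at_right (j u). \<pi> v = tau (g v)" "\<pi> (j u) = tau (g (j u))"
    using n by (auto simp: norm_at_def)
  have "\<forall>\<^sub>F v in at_right u. \<pi> (j v) = tau (g (j v))" by (rule GP_eventually(2)[OF g(3) j])
  then show ?thesis unfolding norm_at_def using GG_comp[OF g(1) GP_GG[OF j]] g by (intro bexI[of _ "g \<circ> j"]) auto
qed

lemma eqv_id: "\<forall>\<^sub>F w in at u. \<pi> w = \<psi> w \<Longrightarrow> eqv u \<pi> u \<psi>"
  unfolding eqv_def using GP_id by (intro bexI[of _ id]) auto

lemma eqv_comp: "j \<in> GP \<Longrightarrow> eqv (j u) \<pi> u (\<pi> \<circ> j)"
  by (rule eqv_sym) (auto simp: eqv_def intro!: bexI[of _ j])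

text \<open>Just to the right of \<open>a\<close> each of the two functions is given by a single
  lift, so agreement near one point of that interval, or near its left end, makes the lifts equal up
  to some \<open>tr k\<close> and spreads over the interval. The size \<open>e\<close> depends on
  \<open>a\<close> only, as the connectedness argument requires.\<close>

lemma right_spread:
  assumes "rreg \<pi> a" "rreg \<psi> a"
  shows "\<exists>e>0. (\<forall>x w. a < x \<and> x < a + e \<and> (\<forall>\<^sub>F w in at x. \<pi> w = \<psi> w) \<and> a < w \<and> w < a + e \<longrightarrow> \<pi> w = \<psi> w) \<and>
    ((\<forall>\<^sub>F w in at_right a. \<pi> w = \<psi> w) \<longrightarrow> (\<forall>w. a < w \<and> w < a + e \<longrightarrow> \<pi> w = \<psi> w))"
proof -
  obtain g e1 where g: "g \<in> GG" "g a \<in> BB" "e1 > 0" "\<And>v. a < v \<Longrightarrow> v < a + e1 \<Longrightarrow> g v \<in> BB \<and> \<pi> v = tau (g v)"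
    using rreg_interval[OF assms(1)] by metis
  obtain h e2 where h: "h \<in> GG" "h a \<in> BB" "e2 > 0" "\<And>v. a < v \<Longrightarrow> v < a + e2 \<Longrightarrow> h v \<in> BB \<and> \<psi> v = tau (h v)"
    using rreg_interval[OF assms(2)] by metis
  define e where "e = min e1 e2"
  have e: "e > 0" using g h by (simp add: e_def)
  have ge: "g v \<in> BB \<and> \<pi> v = tau (g v)" "h v \<in> BB \<and> \<psi> v = tau (h v)" if "a < v" "v < a + e" for v
    using g(4)[of v] h(4)[of v] that by (auto simp: e_def)
  have spread: "\<pi> w = \<psi> w" if k: "g = tr k \<circ> h" and w: "a < w" "w < a + e" for k w
    using ge[OF w] tau_tr[of "h w" k] k by simp
  show ?thesis
  proof (rule exI[of _ e], intro conjI allI impI e; (elim conjE)?)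
    fix x w assume x: "a < x" "x < a + e" "\<forall>\<^sub>F w in at x. \<pi> w = \<psi> w" and w: "a < w" "w < a + e"
    have "\<forall>\<^sub>F w in at_right x. \<pi> w = \<psi> w" using x(3) by (simp add: eventually_at_split)
    moreover have "\<forall>\<^sub>F w in at_right x. a < w \<and> w < a + e"
      by (rule eventually_at_right_intervalI[of "a + e - x"]) (use x in auto)
    ultimately have "\<forall>\<^sub>F w in at_right x. tau (g w) = tau (h w)"
      by eventually_elim (use ge in metis)
    then obtain k where "g = tr k \<circ> h" using right_agree[of g x h] g(1) h(1) ge[OF x(1,2)] by blast
    then show "\<pi> w = \<psi> w" using spread w by blast
  next
    fix w assume r: "\<forall>\<^sub>F w in at_right a. \<pi> w = \<psi> w" and w: "a < w" "w < a + e"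
    have "\<forall>\<^sub>F w in at_right a. a < w \<and> w < a + e"
      by (rule eventually_at_right_intervalI[of e]) (use e in auto)
    then have "\<forall>\<^sub>F w in at_right a. tau (g w) = tau (h w)" using r
      by eventually_elim (use ge in metis)
    then obtain k where "g = tr k \<circ> h" using right_agree[of g a h] g h by blast
    then show "\<pi> w = \<psi> w" using spread w by blast
  qed
qed

lemma eventually_at_uminus: "(\<forall>\<^sub>F w in at (- x). Q (- w)) \<longleftrightarrow> (\<forall>\<^sub>F w in at x. Q w)" for x :: real
  by (auto simp: eventually_at_split eventually_at_left_to_right)

lemma left_spread:
  assumes "lreg \<pi> a" "lreg \<psi> a"
  shows "\<exists>e>0. (\<forall>x w. a - e < x \<and> x < a \<and> (\<forall>\<^sub>F w in at x. \<pi> w = \<psi> w) \<and> a - e < w \<and> w < a \<longrightarrow> \<pi> w = \<psi> w) \<and>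
    ((\<forall>\<^sub>F w in at_left a. \<pi> w = \<psi> w) \<longrightarrow> (\<forall>w. a - e < w \<and> w < a \<longrightarrow> \<pi> w = \<psi> w))"
proof -
  obtain e where e: "e > 0"
    "\<forall>x w. - a < x \<and> x < - a + e \<and> (\<forall>\<^sub>F w in at x. (\<pi> \<circ> uminus) w = (\<psi> \<circ> uminus) w) \<and> - a < w \<and> w < - a + e \<longrightarrow> (\<pi> \<circ> uminus) w = (\<psi> \<circ> uminus) w"
    "(\<forall>\<^sub>F w in at_right (- a). (\<pi> \<circ> uminus) w = (\<psi> \<circ> uminus) w) \<longrightarrow> (\<forall>w. - a < w \<and> w < - a + e \<longrightarrow> (\<pi> \<circ> uminus) w = (\<psi> \<circ> uminus) w)"
    using right_spread[OF assms[unfolded lreg_iff]] by (elim exE conjE) (rule that)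
  show ?thesis
  proof (rule exI[of _ e], intro conjI allI impI e(1); (elim conjE)?)
    fix x w assume x: "a - e < x" "x < a" "\<forall>\<^sub>F w in at x. \<pi> w = \<psi> w" and w: "a - e < w" "w < a"
    have "\<forall>\<^sub>F w in at (- x). (\<pi> \<circ> uminus) w = (\<psi> \<circ> uminus) w"
      using x(3) eventually_at_uminus[of "\<lambda>w. \<pi> w = \<psi> w" x] by simp
    then show "\<pi> w = \<psi> w" using spec[OF spec[OF e(2), of "- x"], of "- w"] x(1,2) w by simp
  next
    fix w assume x: "\<forall>\<^sub>F w in at_left a. \<pi> w = \<psi> w" and w: "a - e < w" "w < a"
    have "\<forall>\<^sub>F w in at_right (- a). (\<pi> \<circ> uminus) w = (\<psi> \<circ> uminus) w"
      using x by (simp add: eventually_at_left_to_right)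
    then show "\<pi> w = \<psi> w" using spec[OF mp[OF e(3)], of "- w"] w by simp
  qed
qed

context devel
begin

text \<open>A map \<open>\<pi>\<close> of this kind need not be continuous: where \<open>P\<close>
  glues half-germs of different maps it jumps in the circle, although it counts as projective for
  the new structure.\<close>

definition dev :: "real set \<Rightarrow> (real \<Rightarrow> circle) \<Rightarrow> bool" where
  "dev U \<pi> \<longleftrightarrow> open U \<and> connected U \<and> U \<noteq> {} \<and> (\<forall>u\<in>U. P u \<pi> \<and> norm_at \<pi> u)"

lemma dev_D: "dev U \<pi> \<Longrightarrow> u \<in> U \<Longrightarrow> P u \<pi>" "dev U \<pi> \<Longrightarrow> u \<in> U \<Longrightarrow> norm_at \<pi> u" "dev U \<pi> \<Longrightarrow> u \<in> U \<Longrightarrow> EE u \<pi>"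
  using P_reg by (auto simp: dev_def)

lemma dev_nz:
  assumes "open U" "connected U" "U \<noteq> {}" "\<And>u. u \<in> U \<Longrightarrow> P u \<pi>"
  shows "dev U (nz \<pi>)"
  unfolding dev_def
proof (intro conjI ballI assms(1-3))
  fix u assume u: "u \<in> U"
  have E: "EE u \<pi>" using P_reg assms(4) u by blast
  have "\<forall>\<^sub>F w in at u. \<pi> w = nz \<pi> w" using nz_eventually[OF E] by eventually_elim simp
  then show "P u (nz \<pi>)" using P_eqv[OF assms(4)[OF u] eqv_id] by blast
  show "norm_at (nz \<pi>) u" by (rule norm_at_nz[OF E])
qed

lemma dev_cong:
  assumes "dev U \<pi>" "\<And>u. u \<in> U \<Longrightarrow> \<pi> u = \<psi> u" shows "dev U \<psi>"
proof -
  have "open U" using assms(1) by (simp add: dev_def)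
  have "\<forall>\<^sub>F w in nhds u. \<pi> w = \<psi> w" if "u \<in> U" for u
    using eventually_nhds_in_open[OF \<open>open U\<close> that] by eventually_elim (rule assms(2))
  then have "P u \<psi>" "norm_at \<psi> u" if "u \<in> U" for u
    using that norm_at_cong[OF dev_D(2)[OF assms(1) that]] P_eqv[OF dev_D(1)[OF assms(1) that] eqv_id]
    by (auto simp: eventually_nhds_conv_at)
  then show ?thesis using assms(1) by (simp add: dev_def)
qed

text \<open>Analytic continuation for the reglued structure: the points near which two developments
  agree form an open and closed subset of the common interval.\<close>

lemma dev_unique:
  assumes d: "dev U \<pi>" "dev U' \<psi>" and u0: "u0 \<in> U" "u0 \<in> U'" "\<forall>\<^sub>F w in at u0. \<pi> w = \<psi> w"
    and u: "u \<in> U" "u \<in> U'"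
  shows "\<pi> u = \<psi> u"
proof -
  define W where "W = U \<inter> U'"
  have W: "open W" using d by (auto simp: W_def dev_def)
  have Wc: "connected W"
    using d by (simp add: W_def dev_def is_interval_Int flip: is_interval_connected_1)
  have Wu: "u0 \<in> W" "u \<in> W" using u0 u by (auto simp: W_def)
  have PW: "P v \<pi>" "P v \<psi>" "EE v \<pi>" "EE v \<psi>" "norm_at \<pi> v" "norm_at \<psi> v" if "v \<in> W" for v
    using dev_D[OF d(1)] dev_D[OF d(2)] that by (auto simp: W_def)
  have "\<forall>\<^sub>F w in at u. \<pi> w = \<psi> w"
  proof (rule connected_induction_simple[where P = "\<lambda>u. \<forall>\<^sub>F w in at u. \<pi> w = \<psi> w", OF Wc Wu u0(3)])
    fix a assume a: "a \<in> W"
    have r: "rreg \<pi> a" "rreg \<psi> a" "lreg \<pi> a" "lreg \<psi> a" using PW(3,4)[OF a] by (auto simp: EE_def)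
    obtain e1 where e1: "e1 > 0"
      "\<forall>x w. a < x \<and> x < a + e1 \<and> (\<forall>\<^sub>F w in at x. \<pi> w = \<psi> w) \<and> a < w \<and> w < a + e1 \<longrightarrow> \<pi> w = \<psi> w"
      "(\<forall>\<^sub>F w in at_right a. \<pi> w = \<psi> w) \<longrightarrow> (\<forall>w. a < w \<and> w < a + e1 \<longrightarrow> \<pi> w = \<psi> w)"
      using right_spread[OF r(1,2)] by (elim exE conjE) (rule that)
    obtain e2 where e2: "e2 > 0"
      "\<forall>x w. a - e2 < x \<and> x < a \<and> (\<forall>\<^sub>F w in at x. \<pi> w = \<psi> w) \<and> a - e2 < w \<and> w < a \<longrightarrow> \<pi> w = \<psi> w"
      "(\<forall>\<^sub>F w in at_left a. \<pi> w = \<psi> w) \<longrightarrow> (\<forall>w. a - e2 < w \<and> w < a \<longrightarrow> \<pi> w = \<psi> w)"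
      using left_spread[OF r(3,4)] by (elim exE conjE) (rule that)
    define T where "T = W \<inter> {a - e2<..<a + e1}"
    show "\<exists>T. openin (top_of_set W) T \<and> a \<in> T \<and> (\<forall>x\<in>T. \<forall>y\<in>T. (\<forall>\<^sub>F w in at x. \<pi> w = \<psi> w) \<longrightarrow> (\<forall>\<^sub>F w in at y. \<pi> w = \<psi> w))"
    proof (intro exI[of _ T] conjI ballI impI)
      show "openin (top_of_set W) T" unfolding T_def by (intro openin_open_Int) simp
      show "a \<in> T" using a e1(1) e2(1) by (simp add: T_def)
      fix x y assume x: "x \<in> T" and y: "y \<in> T" and Q: "\<forall>\<^sub>F w in at x. \<pi> w = \<psi> w"
      \<comment> \<open>Agreement on one side extends up to \<open>a\<close>; across
        \<open>a\<close>, where the functions may break, it is carried by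
        \<open>P_det\<close>.\<close>
      have at_a: "\<forall>\<^sub>F w in at a. \<pi> w = \<psi> w"
      proof -
        consider "x = a" | "x < a" | "a < x" by linarith
        then show ?thesis
        proof cases
          case 2
          have "\<forall>\<^sub>F w in at_left a. \<pi> w = \<psi> w"
            by (rule eventually_at_left_intervalI[OF e2(1)]) (use spec[OF e2(2), of x] 2 Q x in \<open>simp add: T_def\<close>)
          then show ?thesis using P_det[OF PW(1,2)[OF a], of False] by (simp add: side_def)
        next
          case 3
          have "\<forall>\<^sub>F w in at_right a. \<pi> w = \<psi> w"
            by (rule eventually_at_right_intervalI[OF e1(1)]) (use spec[OF e1(2), of x] 3 Q x in \<open>simp add: T_def\<close>)
          then show ?thesis using P_det[OF PW(1,2)[OF a], of True] by (simp add: side_def)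
        qed (use Q in simp)
      qed
      then have lr: "\<forall>\<^sub>F w in at_left a. \<pi> w = \<psi> w" "\<forall>\<^sub>F w in at_right a. \<pi> w = \<psi> w" by (auto simp: eventually_at_split)
      have eq: "\<pi> w = \<psi> w" if "a - e2 < w" "w < a + e1" "w \<noteq> a" for w
        using spec[OF mp[OF e1(3) lr(2)], of w] spec[OF mp[OF e2(3) lr(1)], of w] that by linarith
      show "\<forall>\<^sub>F w in at y. \<pi> w = \<psi> w"
      proof (cases "y = a")
        case False
        have "open ({a - e2<..<a + e1} - {a})" by (intro open_Diff) auto
        moreover have "y \<in> {a - e2<..<a + e1} - {a}" using y False by (auto simp: T_def)
        ultimately have "\<forall>\<^sub>F w in nhds y. w \<in> {a - e2<..<a + e1} - {a}" by (rule eventually_nhds_in_open)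
        then have "\<forall>\<^sub>F w in nhds y. \<pi> w = \<psi> w" by eventually_elim (use eq in auto)
        then show ?thesis by (simp add: eventually_nhds_conv_at)
      qed (use at_a in simp)
    qed
  qed
  then have "\<forall>\<^sub>F w in at_right u. \<pi> w = \<psi> w" by (simp add: eventually_at_split)
  then show ?thesis using norm_at_eqI PW(5,6)[OF Wu(2)] by blast
qed

lemma dev_eventually: "dev U \<pi> \<Longrightarrow> (\<And>w. w \<in> U \<Longrightarrow> \<pi> w = \<psi> w) \<Longrightarrow> u \<in> U \<Longrightarrow> \<forall>\<^sub>F w in at u. \<pi> w = \<psi> w"
proof -
  assume d: "dev U \<pi>" and eq: "\<And>w. w \<in> U \<Longrightarrow> \<pi> w = \<psi> w" and u: "u \<in> U"
  have "\<forall>\<^sub>F w in nhds u. w \<in> U" using d u by (intro eventually_nhds_in_open) (auto simp: dev_def)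
  then have "\<forall>\<^sub>F w in nhds u. \<pi> w = \<psi> w" by eventually_elim (rule eq)
  then show ?thesis by (simp add: eventually_nhds_conv_at)
qed

text \<open>
  Maximal developments play the role of the connected components of the projective structure
  defined by \<open>P\<close>; they are unique up to reparametrisation by \<open>GP\<close>, so \<open>\<Gamma>\<close> permutes them.
\<close>

definition maxdev :: "real set \<Rightarrow> (real \<Rightarrow> circle) \<Rightarrow> bool" where
  "maxdev U \<pi> \<longleftrightarrow> dev U \<pi> \<and> (\<forall>V \<psi> w. dev V \<psi> \<and> w \<in> V \<and> w \<in> U \<and> (\<forall>\<^sub>F x in at w. \<psi> x = \<pi> x) \<longrightarrow>
     V \<subseteq> U \<and> (\<forall>v\<in>V. \<psi> v = \<pi> v))"

lemma maxdev_dev: "maxdev U \<pi> \<Longrightarrow> dev U \<pi>" by (simp add: maxdev_def)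

lemma maxdev_D:
  assumes "maxdev U \<pi>" "dev V \<psi>" "w \<in> V" "w \<in> U" "\<forall>\<^sub>F x in at w. \<psi> x = \<pi> x"
  shows "V \<subseteq> U" "\<And>v. v \<in> V \<Longrightarrow> \<psi> v = \<pi> v"
  using assms unfolding maxdev_def by blast+

lemma dev_join:
  assumes d: "dev U \<pi>" "dev V \<psi>" and w: "w \<in> V" "w \<in> U" "\<forall>\<^sub>F x in at w. \<psi> x = \<pi> x"
  shows "dev (U \<union> V) (\<lambda>x. if x \<in> U then \<pi> x else \<psi> x)"
proof -
  define \<rho> where "\<rho> = (\<lambda>x. if x \<in> U then \<pi> x else \<psi> x)"
  have eq: "\<psi> x = \<pi> x" if "x \<in> U" "x \<in> V" for x using dev_unique[OF d(2,1) w that(2,1)] .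
  have 1: "dev U \<rho>" by (rule dev_cong[OF d(1)]) (simp add: \<rho>_def)
  have 2: "dev V \<rho>" by (rule dev_cong[OF d(2)]) (simp add: \<rho>_def eq)
  have "connected (U \<union> V)" using 1 2 w by (intro connected_Un) (auto simp: dev_def)
  then have "dev (U \<union> V) \<rho>" using 1 2 by (auto simp: dev_def)
  then show ?thesis by (simp add: \<rho>_def)
qed

text \<open>All developments with the given germ at \<open>u0\<close> agree wherever they are both
  defined, by \<open>dev_unique\<close>, so their union is itself a development and the largest
  one.\<close>

lemma maxdev_exists:
  assumes d0: "dev V0 \<psi>0"
  obtains U \<pi> where "maxdev U \<pi>" "V0 \<subseteq> U" "\<And>v. v \<in> V0 \<Longrightarrow> \<pi> v = \<psi>0 v"
proof -
  obtain u0 where u0: "u0 \<in> V0" using d0 by (auto simp: dev_def)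
  define D where "D = {(V, \<psi>). dev V \<psi> \<and> u0 \<in> V \<and> (\<forall>\<^sub>F w in at u0. \<psi> w = \<psi>0 w)}"
  have D: "dev V \<psi>" "u0 \<in> V" "\<forall>\<^sub>F w in at u0. \<psi> w = \<psi>0 w" if "(V, \<psi>) \<in> D" for V \<psi> using that by (auto simp: D_def)
  have D0: "(V0, \<psi>0) \<in> D" using d0 u0 by (simp add: D_def)
  have con: "\<psi> v = \<psi>' v" if a: "(V, \<psi>) \<in> D" and b: "(V', \<psi>') \<in> D" and v: "v \<in> V" "v \<in> V'" for V \<psi> V' \<psi>' v
  proof -
    have "\<forall>\<^sub>F w in at u0. \<psi> w = \<psi>' w" using D(3)[OF a] D(3)[OF b] by eventually_elim simp
    then show ?thesis using dev_unique[OF D(1)[OF a] D(1)[OF b] D(2)[OF a] D(2)[OF b] _ v] by blast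
  qed
  define U where "U = (\<Union>(V, \<psi>)\<in>D. V)"
  define \<pi> where "\<pi> = (\<lambda>v. (SOME x. \<exists>V \<psi>. (V, \<psi>) \<in> D \<and> v \<in> V \<and> x = \<psi> v))"
  have pi: "\<pi> v = \<psi> v" if a: "(V, \<psi>) \<in> D" and v: "v \<in> V" for V \<psi> v
  proof -
    have "\<exists>V \<psi>. (V, \<psi>) \<in> D \<and> v \<in> V \<and> \<pi> v = \<psi> v" unfolding \<pi>_def by (rule someI_ex) (use a v in blast)
    then show ?thesis using con[OF _ a _ v] by metis
  qed
  have VU: "V \<subseteq> U" if "(V, \<psi>) \<in> D" for V \<psi> using that by (auto simp: U_def)
  have dv: "dev V \<pi>" if "(V, \<psi>) \<in> D" for V \<psi>
    by (rule dev_cong[OF D(1)[OF that]]) (simp add: pi[OF that])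
  have dU: "dev U \<pi>"
    unfolding dev_def
  proof (intro conjI ballI)
    show "open U" unfolding U_def using D(1) by (auto simp: dev_def)
    have "u0 \<in> (\<Inter>(V, \<psi>)\<in>D. V)" using D(2) by auto
    then show "connected U" unfolding U_def
      by (intro connected_Union) (use D(1) in \<open>auto simp: dev_def\<close>)
    show "U \<noteq> {}" using VU[OF D0] u0 by auto
    fix u assume "u \<in> U"
    then obtain V \<psi> where V: "(V, \<psi>) \<in> D" "u \<in> V" by (auto simp: U_def)
    show "P u \<pi>" "norm_at \<pi> u" using dev_D[OF dv[OF V(1)] V(2)] by auto
  qed
  have u0U: "u0 \<in> U" using VU[OF D0] u0 by auto
  have "maxdev U \<pi>"
    unfolding maxdev_def
  proof (intro conjI allI impI dU; elim conjE)
    fix V \<psi> w assume V: "dev V \<psi>" "w \<in> V" "w \<in> U" "\<forall>\<^sub>F x in at w. \<psi> x = \<pi> x"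
    define \<rho> where "\<rho> = (\<lambda>x. if x \<in> U then \<pi> x else \<psi> x)"
    have dj: "dev (U \<union> V) \<rho>" unfolding \<rho>_def by (rule dev_join[OF dU V])
    have "\<forall>\<^sub>F x in at u0. \<pi> x = \<psi>0 x" using dev_eventually[OF dv[OF D0] pi[OF D0] u0] .
    moreover have "\<forall>\<^sub>F x in at u0. \<pi> x = \<rho> x" using dev_eventually[OF dU _ u0U, of \<rho>] by (simp add: \<rho>_def)
    ultimately have "\<forall>\<^sub>F x in at u0. \<rho> x = \<psi>0 x" by eventually_elim simp
    then have "(U \<union> V, \<rho>) \<in> D" using dj u0U by (simp add: D_def)
    then have sub: "V \<subseteq> U" using VU by blast
    moreover have "\<psi> v = \<pi> v" if "v \<in> V" for v
      using dev_unique[OF V(1) dU V(2,3,4) that] sub that by blast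
    ultimately show "V \<subseteq> U" "\<forall>v\<in>V. \<psi> v = \<pi> v" by blast+
  qed
  then show ?thesis using that VU[OF D0] pi[OF D0] by blast
qed

lemma GP_vimage_image: "j \<in> GP \<Longrightarrow> \<exists>i\<in>GP. (\<forall>\<theta>. i (j \<theta>) = \<theta>) \<and> (\<forall>\<theta>. j (i \<theta>) = \<theta>) \<and> (\<forall>U. j -` U = i ` U)"
proof -
  assume "j \<in> GP"
  then obtain i where i: "i \<in> GP" "\<forall>\<theta>. i (j \<theta>) = \<theta>" "\<forall>\<theta>. j (i \<theta>) = \<theta>" using GP_inverse_ex by blast
  have "j -` U = i ` U" for U
  proof
    show "j -` U \<subseteq> i ` U" using i(2) by (metis image_eqI subsetI vimageD)
    show "i ` U \<subseteq> j -` U" using i(3) by auto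
  qed
  then show ?thesis using i by blast
qed

lemma dev_reparam:
  assumes j: "j \<in> GP" and d: "dev U \<pi>" shows "dev (j -` U) (\<pi> \<circ> j)"
proof -
  obtain i where "i \<in> GP \<and> (\<forall>\<theta>. i (j \<theta>) = \<theta>) \<and> (\<forall>\<theta>. j (i \<theta>) = \<theta>) \<and> (\<forall>U. j -` U = i ` U)"
    using bexE[OF GP_vimage_image[OF j]] by metis
  then have i: "i \<in> GP" "j -` U = i ` U" by simp_all
  have U: "open U" "connected U" "U \<noteq> {}" using d by (simp_all add: dev_def)
  have "open (j -` U)" by (rule open_vimage[OF U(1) GG_cont[OF GP_GG[OF j]]])
  moreover have "connected (j -` U)" unfolding i(2)
    by (rule connected_continuous_image[OF continuous_on_subset[OF GG_cont[OF GP_GG[OF i(1)]] subset_UNIV] U(2)])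
  moreover have "j -` U \<noteq> {}" using U(3) i(2) by simp
  moreover have "P u (\<pi> \<circ> j) \<and> norm_at (\<pi> \<circ> j) u" if "u \<in> j -` U" for u
  proof
    have u: "j u \<in> U" using that by simp
    show "P u (\<pi> \<circ> j)" by (rule P_eqv[OF dev_D(1)[OF d u] eqv_comp[OF j]])
    show "norm_at (\<pi> \<circ> j) u" by (rule norm_at_reparam[OF j dev_D(2)[OF d u]])
  qed
  ultimately show ?thesis by (simp add: dev_def)
qed

lemma maxdev_reparam:
  assumes j: "j \<in> GP" and m: "maxdev U \<pi>" shows "maxdev (j -` U) (\<pi> \<circ> j)"
  unfolding maxdev_def
proof (intro conjI allI impI dev_reparam[OF j maxdev_dev[OF m]]; elim conjE)
  fix V \<psi> w assume V: "dev V \<psi>" "w \<in> V" "w \<in> j -` U" "\<forall>\<^sub>F x in at w. \<psi> x = (\<pi> \<circ> j) x"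
  obtain i where i: "i \<in> GP" "\<forall>\<theta>. i (j \<theta>) = \<theta>" "\<forall>\<theta>. j (i \<theta>) = \<theta>" using GP_inverse_ex[OF j] by blast
  have "\<forall>\<^sub>F x in at (j w). \<psi> (i x) = (\<pi> \<circ> j) (i x)"
    by (rule GP_eventually(1)[OF _ i(1)]) (simp add: i(2) V(4)[unfolded o_def])
  then have e: "\<forall>\<^sub>F x in at (j w). (\<psi> \<circ> i) x = \<pi> x" by (simp add: i(3))
  note mm = maxdev_D[OF m dev_reparam[OF i(1) V(1)] _ _ e]
  have "i -` V \<subseteq> U" "\<And>v. v \<in> i -` V \<Longrightarrow> (\<psi> \<circ> i) v = \<pi> v" using mm V(2,3) i(2) by auto
  then have "j v \<in> U" "\<psi> v = \<pi> (j v)" if "v \<in> V" for v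
    using that i(2) by (metis comp_apply subsetD vimageI)+
  then show "V \<subseteq> j -` U" "\<forall>v\<in>V. \<psi> v = (\<pi> \<circ> j) v" by auto
qed

end

lemma PC_Proj_mult_mem:
  assumes "A \<in> carrier PC_Proj" "B \<in> carrier PC_Proj" "f \<in> A" "g \<in> B"
  shows "f \<circ> g \<in> A \<otimes>\<^bsub>PC_Proj\<^esub> B"
proof -
  have "A \<otimes>\<^bsub>PC_Proj\<^esub> B = cofinite_eq `` {f \<circ> g}"
    using PC_Proj_mem[OF assms(1,3)] PC_Proj_mem[OF assms(2,4)] PC_Proj_mult by simp
  then show ?thesis using equiv_class_self[OF equiv_cofinite_eq] by simp
qed

lemma PC_Proj_one_mem: "id \<in> \<one>\<^bsub>PC_Proj\<^esub>"
  using equiv_class_self[OF equiv_cofinite_eq] by (simp add: PC_Proj_def)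

lemma PC_Proj_mem_eq: "A \<in> carrier PC_Proj \<Longrightarrow> f \<in> A \<Longrightarrow> g \<in> A \<Longrightarrow> finite {x. f x \<noteq> g x}"
  using PC_Proj_mem(2)[of A f] by (simp add: cofinite_eq_def)

lemma EE_agree:
  assumes "EE u \<pi>" "finite {x. f x \<noteq> g x}" shows "\<forall>\<^sub>F w in at u. f (\<pi> w) = g (\<pi> w)"
proof -
  have "\<forall>\<^sub>F w in at u. \<pi> w \<notin> {x. f x \<noteq> g x}" using reg_avoids[of \<pi> u] assms by (simp only: EE_def)
  then show ?thesis by eventually_elim simp
qed

lemma PC_Proj_inv_mem:
  assumes "A \<in> carrier PC_Proj" "f \<in> A" "g \<in> inv\<^bsub>PC_Proj\<^esub> A"
  shows "finite {x. (g \<circ> f) x \<noteq> id x}"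
proof -
  interpret group PC_Proj by (rule group_PC_Proj)
  have "g \<circ> f \<in> inv\<^bsub>PC_Proj\<^esub> A \<otimes>\<^bsub>PC_Proj\<^esub> A" by (rule PC_Proj_mult_mem[OF inv_closed[OF assms(1)] assms(1,3,2)])
  then have "g \<circ> f \<in> \<one>\<^bsub>PC_Proj\<^esub>" using assms(1) by simp
  then show ?thesis by (rule PC_Proj_mem_eq[OF one_closed _ PC_Proj_one_mem])
qed

text \<open>The class \<open>A\<close> carries one development to another, the square being closed
  by the reparametrisation \<open>j\<close>. It commutes on punctured germs only, so every
  representative \<open>f\<close> of \<open>A\<close> qualifies. For the neutral element and equal
  developments, the maps \<open>j\<close> are the deck transformations.\<close>

definition Rel :: "(circle \<Rightarrow> circle) set \<Rightarrow> real set \<Rightarrow> (real \<Rightarrow> circle) \<Rightarrow> real set \<Rightarrow> (real \<Rightarrow> circle) \<Rightarrow> (real \<Rightarrow> real) \<Rightarrow> bool" where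
  "Rel A U \<pi> U' \<pi>' j \<longleftrightarrow> j \<in> GP \<and> U = j -` U' \<and> (\<forall>f\<in>A. \<forall>u\<in>U. \<forall>\<^sub>F w in at u. f (\<pi> w) = \<pi>' (j w))"

lemma RelI:
  assumes "A \<in> carrier PC_Proj" "f \<in> A" "j \<in> GP" "U = j -` U'" and E: "\<And>u. u \<in> U \<Longrightarrow> EE u \<pi>"
    and f: "\<And>u. u \<in> U \<Longrightarrow> \<forall>\<^sub>F w in at u. f (\<pi> w) = \<pi>' (j w)"
  shows "Rel A U \<pi> U' \<pi>' j"
  unfolding Rel_def
proof (intro conjI ballI assms(3,4))
  fix g u assume g: "g \<in> A" and u: "u \<in> U"
  have "\<forall>\<^sub>F w in at u. g (\<pi> w) = f (\<pi> w)" by (rule EE_agree[OF E[OF u] PC_Proj_mem_eq[OF assms(1) g assms(2)]])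
  then show "\<forall>\<^sub>F w in at u. g (\<pi> w) = \<pi>' (j w)" using f[OF u] by eventually_elim simp
qed

lemma Rel_mult:
  assumes A: "A \<in> carrier PC_Proj" and B: "B \<in> carrier PC_Proj"
    and R: "Rel A U \<pi> U' \<pi>' i" and R': "Rel B U' \<pi>' U'' \<pi>'' j" and E: "\<And>u. u \<in> U \<Longrightarrow> EE u \<pi>"
  shows "Rel (B \<otimes>\<^bsub>PC_Proj\<^esub> A) U \<pi> U'' \<pi>'' (j \<circ> i)"
proof -
  interpret group PC_Proj by (rule group_PC_Proj)
  obtain f where f: "f \<in> A" using PC_Proj_mem_ex[OF A] by blast
  obtain g where g: "g \<in> B" using PC_Proj_mem_ex[OF B] by blast
  have i: "i \<in> GP" "U = i -` U'" and j: "j \<in> GP" "U' = j -` U''" using R R' by (simp_all add: Rel_def)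
  show ?thesis
  proof (rule RelI[OF m_closed[OF B A] PC_Proj_mult_mem[OF B A g f] GP_comp[OF j(1) i(1)] _ E])
    show "U = (j \<circ> i) -` U''" using i(2) j(2) by (simp add: vimage_comp)
    fix u assume u: "u \<in> U"
    have 1: "\<forall>\<^sub>F w in at u. f (\<pi> w) = \<pi>' (i w)" using R f u by (simp add: Rel_def)
    have "i u \<in> U'" using u i(2) by simp
    then have "\<forall>\<^sub>F w in at (i u). g (\<pi>' w) = \<pi>'' (j w)" using R' g by (simp add: Rel_def)
    then have "\<forall>\<^sub>F w in at u. g (\<pi>' (i w)) = \<pi>'' (j (i w))" by (rule GP_eventually(1)[OF _ i(1)])
    with 1 show "\<forall>\<^sub>F w in at u. (g \<circ> f) (\<pi> w) = \<pi>'' ((j \<circ> i) w)" by eventually_elim simp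
  qed
qed

lemma Rel_inv:
  assumes A: "A \<in> carrier PC_Proj" and R: "Rel A U \<pi> U' \<pi>' j"
    and i: "i \<in> GP" "\<forall>\<theta>. i (j \<theta>) = \<theta>" "\<forall>\<theta>. j (i \<theta>) = \<theta>"
    and E: "\<And>u. u \<in> U \<Longrightarrow> EE u \<pi>" and E': "\<And>u. u \<in> U' \<Longrightarrow> EE u \<pi>'"
  shows "Rel (inv\<^bsub>PC_Proj\<^esub> A) U' \<pi>' U \<pi> i"
proof -
  interpret group PC_Proj by (rule group_PC_Proj)
  obtain f where f: "f \<in> A" using PC_Proj_mem_ex[OF A] by blast
  obtain g where g: "g \<in> inv\<^bsub>PC_Proj\<^esub> A" using PC_Proj_mem_ex[OF inv_closed[OF A]] by blast
  have U: "U = j -` U'" using R by (simp add: Rel_def)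
  have U': "x \<in> U' \<longleftrightarrow> i x \<in> U" for x using U i(3) by simp
  show ?thesis
  proof (rule RelI[OF inv_closed[OF A] g i(1) _ E'])
    show "U' = i -` U" using U' by blast
    fix u assume u: "u \<in> U'"
    define v where "v = i u"
    have v: "v \<in> U" using u U' by (simp add: v_def)
    have "\<forall>\<^sub>F w in at v. f (\<pi> w) = \<pi>' (j w)" using R f v by (simp add: Rel_def)
    moreover have "\<forall>\<^sub>F w in at v. (g \<circ> f) (\<pi> w) = id (\<pi> w)"
      by (rule EE_agree[OF E[OF v] PC_Proj_inv_mem[OF A f g]])
    ultimately have "\<forall>\<^sub>F w in at v. g (\<pi>' (j w)) = \<pi> w" by eventually_elim simp
    then have "\<forall>\<^sub>F w in at u. g (\<pi>' (j (i w))) = \<pi> (i w)" unfolding v_def by (rule GP_eventually(1)[OF _ i(1)])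
    then show "\<forall>\<^sub>F w in at u. g (\<pi>' w) = \<pi> (i w)" using i(3) by simp
  qed
qed

lemma Rel_one_iff:
  assumes "\<And>u. u \<in> U \<Longrightarrow> EE u \<pi>"
  shows "Rel \<one>\<^bsub>PC_Proj\<^esub> U \<pi> U' \<pi>' j \<longleftrightarrow> j \<in> GP \<and> U = j -` U' \<and> (\<forall>u\<in>U. \<forall>\<^sub>F w in at u. \<pi> w = \<pi>' (j w))"
proof
  interpret group PC_Proj by (rule group_PC_Proj)
  assume a: "j \<in> GP \<and> U = j -` U' \<and> (\<forall>u\<in>U. \<forall>\<^sub>F w in at u. \<pi> w = \<pi>' (j w))"
  show "Rel \<one>\<^bsub>PC_Proj\<^esub> U \<pi> U' \<pi>' j"
    by (rule RelI[OF one_closed PC_Proj_one_mem _ _ assms]) (use a in simp_all)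
next
  assume "Rel \<one>\<^bsub>PC_Proj\<^esub> U \<pi> U' \<pi>' j"
  then show "j \<in> GP \<and> U = j -` U' \<and> (\<forall>u\<in>U. \<forall>\<^sub>F w in at u. \<pi> w = \<pi>' (j w))"
    using PC_Proj_one_mem unfolding Rel_def by (auto simp: Ball_def dest!: spec[of _ id])
qed

subsection \<open>A finite atlas\<close>

definition orient :: "bool \<Rightarrow> real \<Rightarrow> real" where "orient s = (if s then id else uminus)"

lemma orient [simp]: "orient s (orient s x) = x" "orient s \<in> GG"
  by (auto simp: orient_def GG_id GG_uminus)

lemma orient_BB [simp]: "orient s x \<in> BB \<longleftrightarrow> x \<in> BB" by (auto simp: orient_def)

lemma GG_orient:
  assumes g: "g \<in> GG" shows "orient (g \<in> GP) \<circ> g \<in> GP"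
proof (cases "g \<in> GP")
  case False
  have "g \<circ> uminus \<in> GP" by (rule GG_orientation[OF g]) (use False in simp_all)
  then have "g a < g b \<longleftrightarrow> b < a" for a b using GP_less[of "g \<circ> uminus" "- a" "- b"] by simp
  then have "strict_mono (uminus \<circ> g)" by (simp add: strict_mono_def)
  moreover have "uminus \<circ> g \<in> GG" by (rule GG_comp[OF GG_uminus g])
  moreover have "orient (g \<in> GP) = uminus" using False by (simp add: orient_def)
  ultimately show ?thesis by (simp only: GP_def mem_Collect_eq)
qed (simp add: orient_def)

text \<open>The arc of angles above all cut points in \<open>a\<close> and below all others.
  Indexing by subsets of \<open>K\<close> avoids enumerating the cut points in order; a subset that
  is not an initial segment merely gives the empty set.\<close>

definition cut_arc :: "real set \<Rightarrow> real set \<Rightarrow> real set" where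
  "cut_arc K a = (\<Inter>s\<in>a. {arctan s<..}) \<inter> (\<Inter>s\<in>K - a. {..<arctan s})"

lemma mem_cut_arc: "\<theta> \<in> cut_arc K a \<longleftrightarrow> (\<forall>s\<in>a. arctan s < \<theta>) \<and> (\<forall>s\<in>K - a. \<theta> < arctan s)"
  by (auto simp: cut_arc_def)

context
  fixes K a :: "real set" assumes K: "finite K" "1 \<in> K" and a: "a \<subseteq> K" "0 \<in> a" "1 \<notin> a"
begin

lemma open_cut_arc: "open (cut_arc K a)"
  unfolding cut_arc_def using K a(1) finite_subset by (intro open_Int open_INT) auto

lemma connected_cut_arc: "connected (cut_arc K a)"
proof -
  have "z \<in> cut_arc K a" if "x \<in> cut_arc K a" "y \<in> cut_arc K a" "x \<le> z" "z \<le> y" for x y z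
    using that unfolding mem_cut_arc by (meson le_less_trans less_le_trans)
  then have "is_interval (cut_arc K a)" unfolding is_interval_1 by blast
  then show ?thesis by (simp add: is_interval_connected_1)
qed

lemma cut_arc_D:
  assumes "\<theta> \<in> cut_arc K a"
  shows "\<theta> \<in> BB" "0 < tan \<theta>" "tan \<theta> < 1" "tan \<theta> \<notin> K"
proof -
  have lo: "arctan s < \<theta>" if "s \<in> a" for s using assms that by (simp add: mem_cut_arc)
  have hi: "\<theta> < arctan s" if "s \<in> K" "s \<notin> a" for s using assms that by (simp add: mem_cut_arc)
  have t: "0 < \<theta>" "\<theta> < pi / 4" using lo[OF a(2)] hi[OF K(2) a(3)] by (simp_all add: arctan_one)
  then show B: "\<theta> \<in> BB" using pi_gt_zero by auto
  show "0 < tan \<theta>" using t B by (intro tan_gt_zero) auto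
  show "tan \<theta> < 1" using tan_monotone[of \<theta> "pi / 4"] t B by (simp add: tan_45)
  have "arctan (tan \<theta>) = \<theta>" using B by (intro arctan_tan) auto
  then show "tan \<theta> \<notin> K" using lo[of "tan \<theta>"] hi[of "tan \<theta>"] by (metis less_irrefl)
qed

end

lemma cut_arc_I:
  assumes "\<theta> \<in> BB" "0 < tan \<theta>" "tan \<theta> < 1" "tan \<theta> \<notin> K" "0 \<in> K" "1 \<in> K"
  shows "\<exists>a\<subseteq>K. 0 \<in> a \<and> 1 \<notin> a \<and> \<theta> \<in> cut_arc K a"
proof -
  define a where "a = {s\<in>K. s < tan \<theta>}"
  have e: "arctan (tan \<theta>) = \<theta>" using assms(1) by (intro arctan_tan) auto
  have "arctan s < \<theta>" if "s \<in> a" for s using arctan_monotone[of s "tan \<theta>"] that e by (simp add: a_def)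
  moreover have "\<theta> < arctan s" if s: "s \<in> K - a" for s
  proof -
    have "s \<noteq> tan \<theta>" using s assms(4) by auto
    then have "tan \<theta> < s" using s by (auto simp: a_def)
    then show ?thesis using arctan_monotone[of "tan \<theta>" s] e by simp
  qed
  ultimately have "\<theta> \<in> cut_arc K a" by (simp add: cut_arc_def)
  then show ?thesis using assms by (intro exI[of _ a]) (auto simp: a_def)
qed

text \<open>Immediately to the right of \<open>u\<close> the germ avoids the finitely many points
  under \<open>K\<close>, so each of its nearby values lies over one of the arcs after an integer
  translation of the coordinate.\<close>

lemma rreg_arc:
  assumes r: "rreg \<pi> u" and K: "finite K" "0 \<in> K" "1 \<in> K"
  shows "\<forall>\<^sub>F v in at_right u. \<exists>g a. reg_via g \<pi> v \<and> a \<subseteq> K \<and> 0 \<in> a \<and> 1 \<notin> a \<and> g v \<in> cut_arc K a"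
proof -
  obtain g e where g: "g \<in> GG" "g u \<in> BB" "e > 0" "\<And>v. u < v \<Longrightarrow> v < u + e \<Longrightarrow> g v \<in> BB \<and> \<pi> v = tau (g v)"
    using rreg_interval[OF r] by metis
  have "\<forall>\<^sub>F v in at_right u. \<pi> v \<notin> proj ` K" using rreg_avoids[OF r] K(1) by simp
  moreover have "\<forall>\<^sub>F v in at_right u. u < v \<and> v < u + e" by (rule eventually_at_right_intervalI[OF g(3)]) simp
  ultimately show ?thesis
  proof eventually_elim
    case (elim v)
    have gv: "g v \<in> BB" "\<pi> v = tau (g v)" using g(4)[of v] elim(2) by auto
    \<comment> \<open>This translation brings the coordinate into the unit interval; the value
      \<open>0\<close> is excluded because it belongs to \<open>K\<close>.\<close>
    define k where "k = - \<lfloor>tan (g v)\<rfloor>"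
    define h where "h = tr k \<circ> g"
    have h: "h \<in> GG" "h v \<in> BB" "tan (h v) = tan (g v) + of_int k"
      unfolding h_def using GG_comp[OF GP_GG[OF tr(1)] g(1)] tr(2,3)[OF gv(1)] by auto
    have "tau (h v) = \<pi> v" using gv tau_tr by (simp add: h_def)
    then have "proj (tan (h v)) \<notin> proj ` K" using elim(1) by (simp add: tau_def)
    then have nK: "tan (h v) \<notin> K" by (rule contrapos_nn) (rule imageI)
    then have "tan (h v) \<noteq> 0" using K(2) by auto
    then have "0 < tan (h v)" "tan (h v) < 1" unfolding h(3) k_def by linarith+
    then obtain a where a: "a \<subseteq> K" "0 \<in> a" "1 \<notin> a" "h v \<in> cut_arc K a" using cut_arc_I[OF h(2) _ _ nK K(2,3)] by blast
    have "open {u<..<u+e}" "v \<in> {u<..<u+e}" using elim(2) by auto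
    then have "\<forall>\<^sub>F w in nhds v. w \<in> {u<..<u+e}" by (rule eventually_nhds_in_open)
    then have "\<forall>\<^sub>F w in nhds v. \<pi> w = tau (h w)"
      by eventually_elim (use g(4) tau_tr in \<open>simp add: h_def\<close>)
    then have "reg_via h \<pi> v" using h(1,2) by (simp add: reg_via_def eventually_nhds_conv_at)
    then show ?case using a by blast
  qed
qed

context devel
begin

lemma \<Gamma>_carrier: "A \<in> \<Gamma> \<Longrightarrow> A \<in> carrier PC_Proj" using subgroup.subset[OF \<Gamma>] by blast

lemma maxdev_act:
  assumes m: "maxdev U \<pi>" and A: "A \<in> \<Gamma>" "f \<in> A" shows "maxdev U (nz (f \<circ> \<pi>))"
proof -
  have d: "dev U \<pi>" by (rule maxdev_dev[OF m])
  then have U: "open U" "connected U" "U \<noteq> {}" by (simp_all add: dev_def)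
  have Pf: "P u (f \<circ> \<pi>)" if "u \<in> U" for u by (rule P_act[OF dev_D(1)[OF d that] A])
  have d': "dev U (nz (f \<circ> \<pi>))" by (rule dev_nz[OF U Pf])
  have iA: "inv\<^bsub>PC_Proj\<^esub> A \<in> \<Gamma>" by (rule subgroup.m_inv_closed[OF \<Gamma> A(1)])
  obtain g where g: "g \<in> inv\<^bsub>PC_Proj\<^esub> A" using PC_Proj_mem_ex[OF \<Gamma>_carrier[OF iA]] by blast
  show ?thesis
    unfolding maxdev_def
  proof (intro conjI allI impI d'; elim conjE)
    fix V \<psi> w assume V: "dev V \<psi>" "w \<in> V" "w \<in> U" "\<forall>\<^sub>F x in at w. \<psi> x = nz (f \<circ> \<pi>) x"
    have V': "open V" "connected V" "V \<noteq> {}" using V(1) by (simp_all add: dev_def)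
    have Pg: "P u (g \<circ> \<psi>)" if "u \<in> V" for u by (rule P_act[OF dev_D(1)[OF V(1) that] iA g])
    have dg: "dev V (nz (g \<circ> \<psi>))" by (rule dev_nz[OF V' Pg])
    have "\<forall>\<^sub>F x in at w. nz (g \<circ> \<psi>) x = (g \<circ> \<psi>) x" by (rule nz_eventually[OF P_reg[OF Pg[OF V(2)]]])
    moreover have "\<forall>\<^sub>F x in at w. nz (f \<circ> \<pi>) x = (f \<circ> \<pi>) x" by (rule nz_eventually[OF P_reg[OF Pf[OF V(3)]]])
    moreover have "\<forall>\<^sub>F x in at w. (g \<circ> f) (\<pi> x) = id (\<pi> x)"
      by (rule EE_agree[OF dev_D(3)[OF d V(3)] PC_Proj_inv_mem[OF \<Gamma>_carrier[OF A(1)] A(2) g]])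
    ultimately have "\<forall>\<^sub>F x in at w. nz (g \<circ> \<psi>) x = \<pi> x" using V(4) by eventually_elim simp
    then show sub: "V \<subseteq> U" by (rule maxdev_D(1)[OF m dg V(2,3)])
    show "\<forall>v\<in>V. \<psi> v = nz (f \<circ> \<pi>) v"
    proof
      fix v assume "v \<in> V"
      then show "\<psi> v = nz (f \<circ> \<pi>) v" using dev_unique[OF V(1) d' V(2,3,4)] sub by blast
    qed
  qed
qed

lemma maxdev_match:
  assumes m: "maxdev U \<pi>" "maxdev U' \<pi>'" and j: "j \<in> GP" and v: "v \<in> U" "j v \<in> U'"
    and eq: "\<forall>\<^sub>F w in at v. \<pi> w = \<pi>' (j w)"
  shows "U = j -` U'" "\<And>u. u \<in> U \<Longrightarrow> \<pi> u = \<pi>' (j u)"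
proof -
  note m' = maxdev_reparam[OF j m(2)]
  have v': "v \<in> j -` U'" using v by simp
  have e: "\<forall>\<^sub>F w in at v. \<pi> w = (\<pi>' \<circ> j) w" "\<forall>\<^sub>F w in at v. (\<pi>' \<circ> j) w = \<pi> w" using eq by (simp_all add: eq_commute)
  show "U = j -` U'"
    using maxdev_D(1)[OF m' maxdev_dev[OF m(1)] v(1) v' e(1)] maxdev_D(1)[OF m(1) maxdev_dev[OF m'] v' v(1) e(2)] by blast
  show "\<pi> u = \<pi>' (j u)" if "u \<in> U" for u
    using maxdev_D(2)[OF m' maxdev_dev[OF m(1)] v(1) v' e(1) that] by simp
qed

text \<open>The base points \<open>K\<close> cut the circle into arcs over which the tautological developments, in both
  orientations, are defined; every maximal development is a reparametrisation of an extension of one of these.\<close>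

lemma cuts_exist: "\<exists>K. finite K \<and> 0 \<in> K \<and> 1 \<in> K \<and> (\<forall>t. 0 < t \<and> t < 1 \<and> t \<notin> K \<longrightarrow> proj t \<notin> S)"
proof -
  have "\<exists>t. 0 \<le> t \<and> t < 1 \<and> proj t = s" for s
  proof -
    obtain t where "proj t = s" by (rule proj_surj)
    then have "proj (frac t) = s" using proj_eq_iff[of "frac t" t] by (simp add: frac_def)
    then show ?thesis using frac_ge_0 frac_lt_1 by blast
  qed
  then obtain r where r: "\<And>s. 0 \<le> r s \<and> r s < 1 \<and> proj (r s) = s" by metis
  have "t \<in> r ` S" if t: "0 < t" "t < 1" "proj t \<in> S" for t :: real
  proof -
    have "t - r (proj t) \<in> \<int>" using r[of "proj t"] by (simp flip: proj_eq_iff)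
    moreover have "\<bar>t - r (proj t)\<bar> < 1" using r[of "proj t"] t by linarith
    ultimately have "t - r (proj t) = 0" using Ints_nonzero_abs_less1 by blast
    then show ?thesis using t(3) by force
  qed
  then show ?thesis using S_fin by (intro exI[of _ "{0, 1} \<union> r ` S"]) auto
qed

lemma cut_arc_dev:
  assumes K: "finite K" "0 \<in> K" "1 \<in> K" "\<And>t. 0 < t \<and> t < 1 \<and> t \<notin> K \<longrightarrow> proj t \<notin> S"
    and a: "a \<subseteq> K" "0 \<in> a" "1 \<notin> a" and ne: "cut_arc K a \<noteq> {}"
  shows "dev (orient s -` cut_arc K a) (tau \<circ> orient s)"
proof -
  define W where "W = orient s -` cut_arc K a"
  have W: "open W" unfolding W_def by (rule open_vimage[OF open_cut_arc[OF K(1,3) a] GG_cont]) simp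
  have im: "W = orient s ` cut_arc K a" unfolding W_def by (auto intro: image_eqI[of _ _ "orient s _"])
  have "connected W" unfolding im
    by (rule connected_continuous_image[OF continuous_on_subset[OF GG_cont subset_UNIV] connected_cut_arc[OF K(1,3) a]]) simp
  moreover have "W \<noteq> {}" using ne im by simp
  moreover have "P u (tau \<circ> orient s) \<and> norm_at (tau \<circ> orient s) u" if "u \<in> W" for u
  proof
    have u: "orient s u \<in> cut_arc K a" using that by (simp add: W_def)
    note d = cut_arc_D[OF K(1,3) a u]
    have r: "reg_via (orient s) (tau \<circ> orient s) u" using d(1) by (simp add: reg_via_def)
    have "tau (orient s u) \<notin> S" using K(4) d by (simp add: tau_def)
    then show "P u (tau \<circ> orient s)" by (rule P_generic[OF r])
    show "norm_at (tau \<circ> orient s) u"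
      unfolding norm_at_def using d(1) by (intro bexI[of _ "orient s"]) auto
  qed
  ultimately show ?thesis using W unfolding W_def dev_def by blast
qed

text \<open>All that the group theory needs from the geometry. The clause for
  \<open>U = UNIV\<close> excludes a line that never repeats itself, that is, it provides a
  nontrivial deck transformation. The last clause makes the action on the atlas faithful.\<close>

definition atlas :: "(real set \<times> (real \<Rightarrow> circle)) set \<Rightarrow> bool" where
  "atlas CI \<longleftrightarrow> finite CI \<and> (\<forall>(U, \<pi>)\<in>CI. maxdev U \<pi> \<and> (U = UNIV \<longrightarrow> (\<exists>j. j \<noteq> id \<and> Rel \<one>\<^bsub>PC_Proj\<^esub> U \<pi> U \<pi> j))) \<and>
     (\<forall>A\<in>\<Gamma>. \<forall>(U, \<pi>)\<in>CI. \<exists>(U', \<pi>')\<in>CI. \<exists>j. Rel A U \<pi> U' \<pi>' j) \<and>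
     (\<forall>A\<in>\<Gamma>. (\<forall>(U, \<pi>)\<in>CI. Rel A U \<pi> U \<pi> id) \<longrightarrow> A = \<one>\<^bsub>PC_Proj\<^esub>)"

lemma atlas_exists: "\<exists>CI. atlas CI"
proof -
  obtain K where K: "finite K" "0 \<in> K" "1 \<in> K" "\<And>t. 0 < t \<and> t < 1 \<and> t \<notin> K \<longrightarrow> proj t \<notin> S"
    using cuts_exist by metis
  define I where "I = {a. a \<subseteq> K \<and> 0 \<in> a \<and> 1 \<notin> a \<and> cut_arc K a \<noteq> {}} \<times> (UNIV :: bool set)"
  have I_fin: "finite I" unfolding I_def using K(1) by (intro finite_cartesian_product) auto
  have "\<exists>U \<pi>. maxdev U \<pi> \<and> orient s -` cut_arc K a \<subseteq> U \<and> (\<forall>v\<in>orient s -` cut_arc K a. \<pi> v = (tau \<circ> orient s) v)"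
    if "(a, s) \<in> I" for a s
  proof -
    have a: "a \<subseteq> K" "0 \<in> a" "1 \<notin> a" "cut_arc K a \<noteq> {}" using that by (auto simp: I_def)
    obtain U \<pi> where "maxdev U \<pi>" "orient s -` cut_arc K a \<subseteq> U" "\<And>v. v \<in> orient s -` cut_arc K a \<Longrightarrow> \<pi> v = (tau \<circ> orient s) v"
      by (rule maxdev_exists[OF cut_arc_dev[OF K a]]) blast
    then show ?thesis by blast
  qed
  then have "\<forall>i\<in>I. \<exists>d. maxdev (fst d) (snd d) \<and> orient (snd i) -` cut_arc K (fst i) \<subseteq> fst d \<and>
      (\<forall>v\<in>orient (snd i) -` cut_arc K (fst i). snd d v = (tau \<circ> orient (snd i)) v)" by auto
  then obtain D where D: "\<forall>i\<in>I. maxdev (fst (D i)) (snd (D i)) \<and> orient (snd i) -` cut_arc K (fst i) \<subseteq> fst (D i) \<and>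
      (\<forall>v\<in>orient (snd i) -` cut_arc K (fst i). snd (D i) v = (tau \<circ> orient (snd i)) v)" by metis
  define Uc pc where "Uc = (\<lambda>a s. fst (D (a, s)))" and "pc = (\<lambda>a s. snd (D (a, s)))"
  have Dm: "maxdev (Uc a s) (pc a s)" and DU: "\<And>v. orient s v \<in> cut_arc K a \<Longrightarrow> v \<in> Uc a s"
    and Dv: "\<And>v. orient s v \<in> cut_arc K a \<Longrightarrow> pc a s v = tau (orient s v)" if "(a, s) \<in> I" for a s
    using D[rule_format, OF that] by (auto simp: Uc_def pc_def)
  define CI where "CI = D ` I"
  have CI: "c \<in> CI \<longleftrightarrow> (\<exists>a s. (a, s) \<in> I \<and> c = (Uc a s, pc a s))" for c
    by (auto simp: CI_def Uc_def pc_def image_iff Bex_def)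
  have match: "(a, g \<in> GP) \<in> I" "orient (g \<in> GP) \<circ> g \<in> GP" "U = (orient (g \<in> GP) \<circ> g) -` Uc a (g \<in> GP)"
      "\<And>u. u \<in> U \<Longrightarrow> \<pi> u = pc a (g \<in> GP) ((orient (g \<in> GP) \<circ> g) u)"
    if m: "maxdev U \<pi>" and v: "v \<in> U" and g: "reg_via g \<pi> v" and a: "a \<subseteq> K" "0 \<in> a" "1 \<notin> a" "g v \<in> cut_arc K a" for U \<pi> v g a
  proof -
    define s where "s = (g \<in> GP)"
    define j where "j = orient s \<circ> g"
    have gG: "g \<in> GG" "\<forall>\<^sub>F w in at v. \<pi> w = tau (g w)" using g by (auto simp: reg_via_def)
    have I: "(a, s) \<in> I" using a by (auto simp: I_def)
    have j: "j \<in> GP" unfolding j_def s_def by (rule GG_orient[OF gG(1)])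
    have jv: "j v \<in> Uc a s" by (rule DU[OF I]) (simp add: j_def a)
    have "isCont g v" by (rule GG_isCont[OF gG(1)])
    then have "(g \<longlongrightarrow> g v) (at v)" by (simp add: isCont_def)
    then have "\<forall>\<^sub>F w in at v. g w \<in> cut_arc K a" using open_cut_arc[OF K(1,3) a(1-3)] a(4) by (rule topological_tendstoD)
    then have "\<forall>\<^sub>F w in at v. \<pi> w = pc a s (j w)" using gG(2)
      by eventually_elim (simp add: Dv[OF I] j_def)
    note mm = maxdev_match[OF m Dm[OF I] j v jv this]
    show "(a, g \<in> GP) \<in> I" "orient (g \<in> GP) \<circ> g \<in> GP" "U = (orient (g \<in> GP) \<circ> g) -` Uc a (g \<in> GP)"
      using I j mm(1) by (simp_all only: j_def s_def)
    show "\<pi> u = pc a (g \<in> GP) ((orient (g \<in> GP) \<circ> g) u)" if "u \<in> U" for u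
      using mm(2)[OF that] by (simp only: j_def s_def)
  qed
  have cover: "\<exists>a s j. (a, s) \<in> I \<and> j \<in> GP \<and> U = j -` Uc a s \<and> (\<forall>u\<in>U. \<pi> u = pc a s (j u))" if m: "maxdev U \<pi>" for U \<pi>
  proof -
    have d: "dev U \<pi>" by (rule maxdev_dev[OF m])
    then obtain u where u: "u \<in> U" "open U" by (auto simp: dev_def)
    have "\<forall>\<^sub>F v in nhds u. v \<in> U" by (rule eventually_nhds_in_open[OF u(2,1)])
    then have "\<forall>\<^sub>F v in at_right u. v \<in> U" by (simp add: eventually_nhds_conv_at eventually_at_split)
    moreover have "\<forall>\<^sub>F v in at_right u. \<exists>g a. reg_via g \<pi> v \<and> a \<subseteq> K \<and> 0 \<in> a \<and> 1 \<notin> a \<and> g v \<in> cut_arc K a"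
      by (rule rreg_arc[OF _ K(1-3)]) (use dev_D(3)[OF d u(1)] in \<open>simp add: EE_def\<close>)
    ultimately have "\<forall>\<^sub>F v in at_right u. v \<in> U \<and> (\<exists>g a. reg_via g \<pi> v \<and> a \<subseteq> K \<and> 0 \<in> a \<and> 1 \<notin> a \<and> g v \<in> cut_arc K a)"
      by (rule eventually_conj)
    then obtain v where "v \<in> U \<and> (\<exists>g a. reg_via g \<pi> v \<and> a \<subseteq> K \<and> 0 \<in> a \<and> 1 \<notin> a \<and> g v \<in> cut_arc K a)"
      using eventually_happens'[OF trivial_limit_at_right_real] by blast
    then obtain g a where ga: "v \<in> U" "reg_via g \<pi> v" "a \<subseteq> K" "0 \<in> a" "1 \<notin> a" "g v \<in> cut_arc K a" by blast
    note mm = match[OF m ga]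
    show ?thesis using mm by (intro exI[of _ a], intro exI[of _ "g \<in> GP"], intro exI[of _ "orient (g \<in> GP) \<circ> g"]) blast
  qed
  \<comment> \<open>Pigeonhole: points spread along the line all have germs over one of finitely
    many oriented arcs, so two of them use the same chart. Comparing the two identifications with
    that chart yields a self-map of the development.\<close>
  have self: "\<exists>j. j \<noteq> id \<and> Rel \<one>\<^bsub>PC_Proj\<^esub> U \<pi> U \<pi> j" if m: "maxdev U \<pi>" and U: "U = UNIV" for U \<pi>
  proof -
    have d: "dev U \<pi>" by (rule maxdev_dev[OF m])
    have "\<exists>v g a. of_nat n * (2 * pi) < v \<and> v < of_nat n * (2 * pi) + 1 \<and> reg_via g \<pi> v \<and> a \<subseteq> K \<and> 0 \<in> a \<and> 1 \<notin> a \<and> g v \<in> cut_arc K a" for n :: nat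
    proof -
      define u where "u = of_nat n * (2 * pi)"
      have "EE u \<pi>" using dev_D(3)[OF d] U by simp
      then have r: "rreg \<pi> u" by (simp add: EE_def)
      have "\<forall>\<^sub>F v in at_right u. u < v \<and> v < u + 1" by (rule eventually_at_right_intervalI[of 1]) auto
      then have "\<forall>\<^sub>F v in at_right u. (u < v \<and> v < u + 1) \<and> (\<exists>g a. reg_via g \<pi> v \<and> a \<subseteq> K \<and> 0 \<in> a \<and> 1 \<notin> a \<and> g v \<in> cut_arc K a)"
        using rreg_arc[OF r K(1-3)] by (rule eventually_conj)
      then obtain v where "(u < v \<and> v < u + 1) \<and> (\<exists>g a. reg_via g \<pi> v \<and> a \<subseteq> K \<and> 0 \<in> a \<and> 1 \<notin> a \<and> g v \<in> cut_arc K a)"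
        using eventually_happens'[OF trivial_limit_at_right_real] by blast
      then show ?thesis unfolding u_def by blast
    qed
    then obtain v g a where vga: "\<And>n :: nat. of_nat n * (2 * pi) < v n \<and> v n < of_nat n * (2 * pi) + 1 \<and> reg_via (g n) \<pi> (v n)
        \<and> a n \<subseteq> K \<and> 0 \<in> a n \<and> 1 \<notin> a n \<and> g n (v n) \<in> cut_arc K (a n)" by metis
    define s where "s = (\<lambda>n. g n \<in> GP)"
    define j where "j = (\<lambda>n. orient (s n) \<circ> g n)"
    have mt: "(a n, s n) \<in> I" "j n \<in> GP" "\<pi> u = pc (a n) (s n) (j n u)" for n u
      using match[OF m, of "v n" "g n" "a n"] vga[of n] U by (simp_all add: s_def j_def)
    have "finite (range (\<lambda>n. (a n, s n)))" by (rule finite_subset[OF _ I_fin]) (use mt(1) in auto)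
    then have "\<not> inj (\<lambda>n. (a n, s n))" using finite_imageD[of "\<lambda>n. (a n, s n)" UNIV] infinite_UNIV_nat by blast
    then obtain n m where nm: "n \<noteq> m" "a n = a m" "s n = s m" by (auto simp: inj_def)
    have lt: "\<exists>n m. n < m \<and> a n = a m \<and> s n = s m" using nm by (metis linorder_neqE)
    then obtain n m where nm: "n < m" "a n = a m" "s n = s m" by blast
    obtain i where i: "i \<in> GP" "\<forall>\<theta>. i (j m \<theta>) = \<theta>" "\<forall>\<theta>. j m (i \<theta>) = \<theta>" using GP_inverse_ex[OF mt(2)[of m]] by blast
    have "Rel \<one>\<^bsub>PC_Proj\<^esub> U \<pi> U \<pi> (i \<circ> j n)"
    proof (subst Rel_one_iff)
      show "EE u \<pi>" if "u \<in> U" for u by (rule dev_D(3)[OF d that])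
      have "\<pi> w = \<pi> ((i \<circ> j n) w)" for w
        using mt(3)[of w n] mt(3)[of "i (j n w)" m] i(3) nm by simp
      then show "i \<circ> j n \<in> GP \<and> U = (i \<circ> j n) -` U \<and> (\<forall>u\<in>U. \<forall>\<^sub>F w in at u. \<pi> w = \<pi> ((i \<circ> j n) w))"
        using GP_comp[OF i(1) mt(2)] U by (auto intro!: always_eventually)
    qed
    moreover have "i \<circ> j n \<noteq> id"
    proof
      assume "i \<circ> j n = id"
      then have "i (j n (v m)) = v m" by (metis comp_apply id_apply)
      then have jj: "j n (v m) = j m (v m)" using i(3) by metis
      have BB: "j k (v k) \<in> BB" for k
        proof -
        have "g k (v k) \<in> BB" using vga[of k] by (intro cut_arc_D(1)[OF K(1,3), of "a k"]) auto
        then show ?thesis using orient_BB[of "s k" "g k (v k)"] by (simp only: j_def comp_apply)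
      qed
      \<comment> \<open>Sampling at multiples of \<open>2 * pi\<close>, with an error below 1,
        separates the points by more than \<open>pi\<close>. Were the self-map the identity,
        \<open>j n\<close> would send two such points into \<open>BB\<close>, an interval of length
        \<open>pi\<close>, although by \<open>GP_shift_pi\<close> their images are more than
        \<open>pi\<close> apart.\<close>
      have "of_nat n * (2 * pi) + 2 * pi \<le> of_nat m * (2 * pi)"
        using mult_right_mono[of "of_nat (Suc n)" "of_nat m" "2 * pi"] nm(1) by (simp add: distrib_right)
      then have "v n + pi < v m" using vga[of n] vga[of m] pi_gt3 by linarith
      then have "j n (v n + pi) < j n (v m)" by (simp add: GP_less[OF mt(2)])
      then have "j n (v n) + pi < j m (v m)" by (simp add: GP_shift_pi[OF mt(2)] jj)
      then show False using BB[of n] BB[of m] by auto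
    qed
    ultimately show ?thesis by blast
  qed
  have "atlas CI"
    unfolding atlas_def
  proof (intro conjI ballI impI)
    show "finite CI" using I_fin by (simp add: CI_def)
    fix c assume "c \<in> CI"
    then obtain a s where c: "(a, s) \<in> I" "c = (Uc a s, pc a s)" unfolding CI by blast
    show "case c of (U, \<pi>) \<Rightarrow> maxdev U \<pi> \<and> (U = UNIV \<longrightarrow> (\<exists>j. j \<noteq> id \<and> Rel \<one>\<^bsub>PC_Proj\<^esub> U \<pi> U \<pi> j))"
      unfolding c(2) prod.case using Dm[OF c(1)] self[OF Dm[OF c(1)]] by blast
  next
    fix A c assume A: "A \<in> \<Gamma>" and "c \<in> CI"
    then obtain a s where c: "(a, s) \<in> I" "c = (Uc a s, pc a s)" unfolding CI by blast
    obtain f where f: "f \<in> A" using PC_Proj_mem_ex[OF \<Gamma>_carrier[OF A]] by blast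
    have d: "dev (Uc a s) (pc a s)" by (rule maxdev_dev[OF Dm[OF c(1)]])
    have E: "\<And>u. u \<in> Uc a s \<Longrightarrow> EE u (pc a s)" by (rule dev_D(3)[OF d])
    obtain a' s' j where j: "(a', s') \<in> I" "j \<in> GP" "Uc a s = j -` Uc a' s'" "\<forall>u\<in>Uc a s. nz (f \<circ> pc a s) u = pc a' s' (j u)"
      using cover[OF maxdev_act[OF Dm[OF c(1)] A f]] by blast
    have dn: "dev (Uc a s) (nz (f \<circ> pc a s))" by (rule maxdev_dev[OF maxdev_act[OF Dm[OF c(1)] A f]])
    have "Rel A (Uc a s) (pc a s) (Uc a' s') (pc a' s') j"
    proof (rule RelI[OF \<Gamma>_carrier[OF A] f j(2,3) E])
      fix u assume u: "u \<in> Uc a s"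
      have "\<forall>\<^sub>F w in at u. nz (f \<circ> pc a s) w = pc a' s' (j w)"
        by (rule dev_eventually[OF dn _ u]) (use j(4) in blast)
      moreover have "\<forall>\<^sub>F w in at u. nz (f \<circ> pc a s) w = (f \<circ> pc a s) w"
        by (rule nz_eventually[OF P_reg[OF P_act[OF dev_D(1)[OF d u] A f]]])
      ultimately show "\<forall>\<^sub>F w in at u. f (pc a s w) = pc a' s' (j w)" by eventually_elim simp
    qed
    moreover have "(Uc a' s', pc a' s') \<in> CI" using j(1) CI by blast
    ultimately show "case c of (U, \<pi>) \<Rightarrow> \<exists>(U', \<pi>')\<in>CI. \<exists>j. Rel A U \<pi> U' \<pi>' j"
      unfolding c(2) prod.case by blast
  next
    interpret group PC_Proj by (rule group_PC_Proj)
    \<comment> \<open>Over the arcs the charts are the tautological developments, so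
      \<open>f\<close> fixes points near each angle considered; being locally projective there, it
      also fixes the point itself. Only the singularities of \<open>f\<close> and the points under
      \<open>K\<close> remain.\<close>
    fix A assume A: "A \<in> \<Gamma>" and fx: "\<forall>(U, \<pi>)\<in>CI. Rel A U \<pi> U \<pi> id"
    obtain f where f: "f \<in> A" using PC_Proj_mem_ex[OF \<Gamma>_carrier[OF A]] by blast
    note pf = PC_Proj_mem[OF \<Gamma>_carrier[OF A] f]
    obtain F F' f' where F: "finite F" "\<And>x. x \<notin> F \<Longrightarrow> locally_projective_at f x"
      using pf(1) unfolding piecewise_projective_def by blast
    have "f x = x" if x: "x \<notin> F" "x \<notin> proj ` K" for x
    proof -
      obtain t where t: "proj t = x" by (rule proj_surj)
      define \<theta> where "\<theta> = arctan (frac t)"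
      have th: "\<theta> \<in> BB" "tan \<theta> = frac t" using BB_arctan by (simp_all add: \<theta>_def tan_arctan)
      have px: "proj (frac t) = x" using t proj_eq_iff[of "frac t" t] by (simp add: frac_def)
      then have nK: "tan \<theta> \<notin> K" using x(2) th(2) by auto
      then have "tan \<theta> \<noteq> 0" using K(2) by auto
      then have "0 < tan \<theta>" "tan \<theta> < 1" using th(2) frac_ge_0[of t] frac_lt_1[of t] by auto
      then obtain a where a: "a \<subseteq> K" "0 \<in> a" "1 \<notin> a" "\<theta> \<in> cut_arc K a" using cut_arc_I[OF th(1) _ _ nK K(2,3)] by blast
      have I: "(a, True) \<in> I" using a by (auto simp: I_def)
      have x': "tau \<theta> = x" using px th(2) by (simp add: tau_def)
      have "Rel A (Uc a True) (pc a True) (Uc a True) (pc a True) id" using fx I CI by fastforce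
      moreover have "\<theta> \<in> Uc a True" by (rule DU[OF I]) (simp add: orient_def a)
      ultimately have e: "\<forall>\<^sub>F w in at \<theta>. f (pc a True w) = pc a True w" using f by (simp add: Rel_def)
      have "\<forall>\<^sub>F w in nhds \<theta>. w \<in> cut_arc K a" by (rule eventually_nhds_in_open[OF open_cut_arc[OF K(1,3) a(1-3)] a(4)])
      then have "\<forall>\<^sub>F w in at \<theta>. w \<in> cut_arc K a" by (simp add: eventually_nhds_conv_at)
      then have e2: "\<forall>\<^sub>F w in at \<theta>. f (tau w) = tau w" using e
        by eventually_elim (use Dv[OF I] in \<open>simp add: orient_def\<close>)
      obtain h where h: "h \<in> GG" "h \<theta> \<in> BB" "\<forall>\<^sub>F w in nhds \<theta>. f (tau w) = tau (h w)"
        using locally_projective_tau[of f \<theta>] F(2)[OF x(1)] x' th(1) by metis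
      have "\<forall>\<^sub>F w in at \<theta>. f (tau w) = tau (h w)" using h(3) by (simp add: eventually_nhds_conv_at)
      then have "\<forall>\<^sub>F w in at \<theta>. tau (h w) = tau (id w)" using e2 by eventually_elim simp
      then have "\<forall>\<^sub>F w in at_right \<theta>. tau (h w) = tau (id w)" by (simp add: eventually_at_split)
      then obtain k where "h = tr k \<circ> id" using right_agree[OF h(1,2) GG_id(1)] th(1) by (metis id_apply)
      then have "tau (h \<theta>) = tau \<theta>" using tau_tr[OF th(1)] by simp
      then show ?thesis using eventually_nhds_x_imp_x[OF h(3)] x' by simp
    qed
    then have "{x. f x \<noteq> id x} \<subseteq> F \<union> proj ` K" by auto
    then have "finite {x. f x \<noteq> id x}" using F(1) K(1) by (meson finite_Un finite_imageI finite_subset)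
    then show "A = \<one>\<^bsub>PC_Proj\<^esub>" unfolding pf(2) by (simp add: PC_Proj_def cofinite_class_eq_iff)
  qed
  then show ?thesis by blast
qed

end

interpretation PC: group PC_Proj by (rule group_PC_Proj)

subsection \<open>Commuting matrices\<close>

text \<open>The stabiliser of a nonzero vector is a one-parameter unipotent group; \<open>t\<close>
  is the parameter. In particular it is commutative.\<close>

lemma unipotent_form:
  assumes "det A = 1" "av A v = v" "v \<noteq> 0"
  shows "\<exists>t. A = mt (1 - t * fst v * snd v) (t * (fst v)\<^sup>2) (- (t * (snd v)\<^sup>2)) (1 + t * fst v * snd v)"
proof -
  obtain a b c d where A: "A = mt a b c d" by (rule mt_cases)
  obtain x y where v: "v = (x, y)" by force
  have e: "a * x + b * y = x" "c * x + d * y = y" "a * d - b * c = 1"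
    using assms(1,2) by (simp_all add: A v av_def)
  show ?thesis
  proof (cases "x = 0")
    case True
    then have y: "y \<noteq> 0" using assms(3) by (auto simp: v zero_prod_def)
    have "b = 0" "d = 1" using e y True by auto
    moreover then have "a = 1" using e(3) by simp
    ultimately show ?thesis using y True by (intro exI[of _ "- c / y\<^sup>2"]) (simp add: A v)
  next
    case False
    define t where "t = b / x\<^sup>2"
    have b: "b = t * x\<^sup>2" using False by (simp add: t_def)
    have "x * a = x * (1 - t * x * y)" using e(1) by (simp add: b algebra_simps power2_eq_square)
    then have a: "a = 1 - t * x * y" using False by simp
    have "x * d - x * (1 + t * x * y) = x * (a * d - b * c - 1) + t * x\<^sup>2 * (c * x + d * y - y)"
      unfolding a b by (simp add: algebra_simps power2_eq_square)
    then have "x * d = x * (1 + t * x * y)" using e by simp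
    then have d: "d = 1 + t * x * y" using False by simp
    have "x * c = x * (- (t * y\<^sup>2))" using e(2) by (simp add: d algebra_simps power2_eq_square)
    then have "c = - (t * y\<^sup>2)" by (simp only: mult_left_cancel[OF False])
    then show ?thesis using a b d by (intro exI[of _ t]) (simp add: A v)
  qed
qed

lemma unipotents_commute:
  assumes "det A = 1" "det B = 1" "av A v = v" "av B v = v" "v \<noteq> 0"
  shows "A ** B = B ** A"
proof -
  obtain s where s: "A = mt (1 - s * fst v * snd v) (s * (fst v)\<^sup>2) (- (s * (snd v)\<^sup>2)) (1 + s * fst v * snd v)"
    using unipotent_form assms by blast
  obtain t where t: "B = mt (1 - t * fst v * snd v) (t * (fst v)\<^sup>2) (- (t * (snd v)\<^sup>2)) (1 + t * fst v * snd v)"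
    using unipotent_form assms by blast
  show ?thesis unfolding s t by (simp add: mat2_eq_iff algebra_simps power2_eq_square)
qed

text \<open>Modulo scalars a matrix is described by the difference of its diagonal entries and its
  two off-diagonal entries. Two matrices commute exactly when these triples are proportional, and
  the triple of \<open>M\<close> is nonzero because \<open>M\<close> has determinant 1 and is not
  plus or minus the identity.\<close>

lemma centralizer_commute:
  assumes A: "A ** M = M ** A" and B: "B ** M = M ** B" and M: "det M = 1" "\<not> pm M (mat 1)"
  shows "A ** B = B ** A"
proof -
  obtain a b c d where M': "M = mt a b c d" by (rule mt_cases)
  obtain p q r s where A': "A = mt p q r s" by (rule mt_cases)
  obtain p' q' r' s' where B': "B = mt p' q' r' s'" by (rule mt_cases)
  have 1: "q * c = b * r" "(p - s) * b = (a - d) * q" "(p - s) * c = (a - d) * r"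
  proof -
    have "mt p q r s ** mt a b c d = mt a b c d ** mt p q r s" using A unfolding M' A' .
    then have e: "p * a + q * c = a * p + b * r" "p * b + q * d = a * q + b * s" "r * a + s * c = c * p + d * r"
      by (simp_all only: mt_mult mat2_eq_iff mt_nth)
    show "q * c = b * r" by (insert e(1), simp only: left_diff_distrib right_diff_distrib mult.commute; linarith)
    show "(p - s) * b = (a - d) * q" by (insert e(2), simp only: left_diff_distrib right_diff_distrib mult.commute; linarith)
    show "(p - s) * c = (a - d) * r" by (insert e(3), simp only: left_diff_distrib right_diff_distrib mult.commute; linarith)
  qed
  have 2: "q' * c = b * r'" "(p' - s') * b = (a - d) * q'" "(p' - s') * c = (a - d) * r'"
  proof -
    have "mt p' q' r' s' ** mt a b c d = mt a b c d ** mt p' q' r' s'" using B unfolding M' B' .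
    then have e: "p' * a + q' * c = a * p' + b * r'" "p' * b + q' * d = a * q' + b * s'" "r' * a + s' * c = c * p' + d * r'"
      by (simp_all only: mt_mult mat2_eq_iff mt_nth)
    show "q' * c = b * r'" by (insert e(1), simp only: left_diff_distrib right_diff_distrib mult.commute; linarith)
    show "(p' - s') * b = (a - d) * q'" by (insert e(2), simp only: left_diff_distrib right_diff_distrib mult.commute; linarith)
    show "(p' - s') * c = (a - d) * r'" by (insert e(3), simp only: left_diff_distrib right_diff_distrib mult.commute; linarith)
  qed
  have w: "a - d \<noteq> 0 \<or> b \<noteq> 0 \<or> c \<noteq> 0"
  proof (rule ccontr)
    assume n: "\<not> ?thesis"
    then have "a * a = 1" using M(1) by (simp add: M')
    then have "a = 1 \<or> a = - 1" by (simp add: square_eq_1_iff)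
    then show False using M(2) n by (auto simp: M' pm_def mat_1_eq_mt mat2_eq_iff)
  qed
  \<comment> \<open>Two triples proportional to the same nonzero triple are proportional to each
    other.\<close>
  have par: "x1 * y2 = x2 * y1 \<and> x1 * y3 = x3 * y1 \<and> x2 * y3 = x3 * y2"
    if x: "x2 * w3 = w2 * x3" "x1 * w2 = w1 * x2" "x1 * w3 = w1 * x3"
      and y: "y2 * w3 = w2 * y3" "y1 * w2 = w1 * y2" "y1 * w3 = w1 * y3"
      and w: "w1 \<noteq> 0 \<or> w2 \<noteq> 0 \<or> w3 \<noteq> 0" for x1 x2 x3 y1 y2 y3 w1 w2 w3 :: real
  proof -
    consider "w1 \<noteq> 0" | "w2 \<noteq> 0" | "w3 \<noteq> 0" using w by blast
    then show ?thesis
    proof cases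
      case 1
      have "x2 = x1 * w2 / w1" "x3 = x1 * w3 / w1" "y2 = y1 * w2 / w1" "y3 = y1 * w3 / w1" using x y 1 by simp_all
      then show ?thesis by simp
    next
      case 2
      have "x1 = w1 * x2 / w2" "x3 = x2 * w3 / w2" "y1 = w1 * y2 / w2" "y3 = y2 * w3 / w2" using x y 2 by (simp_all add: eq_divide_eq mult.commute)
      then show ?thesis by simp
    next
      case 3
      have "x1 = w1 * x3 / w3" "x2 = w2 * x3 / w3" "y1 = w1 * y3 / w3" "y2 = w2 * y3 / w3" using x y 3 by (simp_all add: eq_divide_eq)
      then show ?thesis by simp
    qed
  qed
  have "(p - s) * q' = q * (p' - s')" "(p - s) * r' = r * (p' - s')" "q * r' = r * q'"
    using par[OF 1 2 w] by auto
  note e = this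
  have "p * p' + q * r' = p' * p + q' * r" by (insert e(3), simp only: mult.commute; linarith)
  moreover have "p * q' + q * s' = p' * q + q' * s" by (insert e(1), simp only: left_diff_distrib right_diff_distrib mult.commute; linarith)
  moreover have "r * p' + s * r' = r' * p + s' * r" by (insert e(2), simp only: left_diff_distrib right_diff_distrib mult.commute; linarith)
  moreover have "r * q' + s * s' = r' * q + s' * s" by (insert e(3), simp only: mult.commute; linarith)
  ultimately show ?thesis unfolding A' B' mt_mult mat2_eq_iff mt_nth by blast
qed

lemma vimage_inverse_fixed: "U = j -` U \<Longrightarrow> \<forall>\<theta>. j (i \<theta>) = \<theta> \<Longrightarrow> U = i -` U"
proof -
  assume U: "U = j -` U" and i: "\<forall>\<theta>. j (i \<theta>) = \<theta>"
  have "y \<in> U \<longleftrightarrow> j y \<in> U" for y by (subst U) simp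
  from this[of "i _"] have "x \<in> U \<longleftrightarrow> i x \<in> U" for x using i by simp
  then show "U = i -` U" by blast
qed

text \<open>A proper interval is bounded on one side, and increasing bijections preserving it fix
  its supremum or infimum. One and the same end works for all of them.\<close>

lemma invariant_interval_end:
  fixes U :: "real set"
  assumes U: "connected U" "U \<noteq> {}" "U \<noteq> UNIV"
  shows "\<exists>e. \<forall>j\<in>GP. U = j -` U \<longrightarrow> j e = e"
proof -
  obtain z where z: "z \<notin> U" using U(3) by blast
  have "bdd_above U \<or> bdd_below U"
  proof (rule ccontr)
    assume n: "\<not> ?thesis"
    then obtain x y where "x \<in> U" "x < z" "y \<in> U" "z < y" unfolding bdd_above_def bdd_below_def by (metis not_le)
    then show False using connectedD_interval[OF U(1), of x y z] z by auto
  qed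
  then show ?thesis
  proof
    assume b: "bdd_above U"
    have le: "Sup U \<le> j (Sup U)" if j: "j \<in> GP" "U = j -` U" for j
    proof -
      obtain i where i: "i \<in> GP" "\<forall>\<theta>. i (j \<theta>) = \<theta>" "\<forall>\<theta>. j (i \<theta>) = \<theta>" using GP_inverse_ex[OF j(1)] by blast
      have "u \<le> j (Sup U)" if "u \<in> U" for u
      proof -
        have "i u \<in> U" using that by (subst (asm) vimage_inverse_fixed[OF j(2) i(3)]) simp
        then have "i u \<le> Sup U" using b by (rule cSup_upper)
        then have "j (i u) \<le> j (Sup U)" by (simp add: GP_le[OF j(1)])
        then show ?thesis using i(3) by simp
      qed
      then show ?thesis by (intro cSup_least U(2))
    qed
    have "j (Sup U) = Sup U" if j: "j \<in> GP" "U = j -` U" for j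
    proof -
      obtain i where i: "i \<in> GP" "\<forall>\<theta>. i (j \<theta>) = \<theta>" "\<forall>\<theta>. j (i \<theta>) = \<theta>" using GP_inverse_ex[OF j(1)] by blast
      have "U = i -` U" by (rule vimage_inverse_fixed[OF j(2) i(3)])
      then have "j (Sup U) \<le> j (i (Sup U))" using le[OF i(1)] by (simp add: GP_le[OF j(1)])
      then show ?thesis using le[OF j] i(3) by simp
    qed
    then show ?thesis by blast
  next
    assume b: "bdd_below U"
    have le: "j (Inf U) \<le> Inf U" if j: "j \<in> GP" "U = j -` U" for j
    proof -
      obtain i where i: "i \<in> GP" "\<forall>\<theta>. i (j \<theta>) = \<theta>" "\<forall>\<theta>. j (i \<theta>) = \<theta>" using GP_inverse_ex[OF j(1)] by blast
      have "j (Inf U) \<le> u" if "u \<in> U" for u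
      proof -
        have "i u \<in> U" using that by (subst (asm) vimage_inverse_fixed[OF j(2) i(3)]) simp
        then have "Inf U \<le> i u" using b by (rule cInf_lower)
        then have "j (Inf U) \<le> j (i u)" by (simp add: GP_le[OF j(1)])
        then show ?thesis using i(3) by simp
      qed
      then show ?thesis by (intro cInf_greatest U(2))
    qed
    have "j (Inf U) = Inf U" if j: "j \<in> GP" "U = j -` U" for j
    proof -
      obtain i where i: "i \<in> GP" "\<forall>\<theta>. i (j \<theta>) = \<theta>" "\<forall>\<theta>. j (i \<theta>) = \<theta>" using GP_inverse_ex[OF j(1)] by blast
      have "U = i -` U" by (rule vimage_inverse_fixed[OF j(2) i(3)])
      then have "j (i (Inf U)) \<le> j (Inf U)" using le[OF i(1)] by (simp add: GP_le[OF j(1)])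
      then show ?thesis using le[OF j] i(3) by simp
    qed
    then show ?thesis by blast
  qed
qed

subsection \<open>The stabiliser of a maximal development\<close>

locale component = devel +
  fixes \<Gamma>1 :: "(circle \<Rightarrow> circle) set set" and U :: "real set" and \<pi> :: "real \<Rightarrow> circle"
  assumes \<Gamma>1: "subgroup \<Gamma>1 PC_Proj" "\<Gamma>1 \<subseteq> \<Gamma>"
    and FW1: "property_FW (PC_Proj\<lparr>carrier := \<Gamma>1\<rparr>)"
    and maxdev: "maxdev U \<pi>" and stab: "A \<in> \<Gamma>1 \<Longrightarrow> \<exists>j. Rel A U \<pi> U \<pi> j"
begin

abbreviation RR where "RR A j \<equiv> Rel A U \<pi> U \<pi> j"

text \<open>The elements acting trivially on the component: they fix all points of the development
  up to punctured germs.\<close>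

definition fixer :: "(circle \<Rightarrow> circle) set set" where "fixer = {A \<in> \<Gamma>1. RR A id}"

lemma dev: "dev U \<pi>" by (rule maxdev_dev[OF maxdev])

lemma EE_U: "u \<in> U \<Longrightarrow> EE u \<pi>" by (rule dev_D(3)[OF dev])

lemma \<Gamma>1_carrier: "A \<in> \<Gamma>1 \<Longrightarrow> A \<in> carrier PC_Proj" using subgroup.subset[OF \<Gamma>1(1)] by blast

lemma RR_GP: "RR A j \<Longrightarrow> j \<in> GP" by (simp add: Rel_def)

lemma RR_U: "RR A j \<Longrightarrow> U = j -` U" unfolding Rel_def by blast

lemma RR_mult: "A \<in> carrier PC_Proj \<Longrightarrow> B \<in> carrier PC_Proj \<Longrightarrow> RR A i \<Longrightarrow> RR B j \<Longrightarrow> RR (A \<otimes>\<^bsub>PC_Proj\<^esub> B) (i \<circ> j)"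
  by (rule Rel_mult[OF _ _ _ _ EE_U])

lemma RR_inv: "A \<in> carrier PC_Proj \<Longrightarrow> RR A j \<Longrightarrow> i \<in> GP \<Longrightarrow> \<forall>\<theta>. i (j \<theta>) = \<theta> \<Longrightarrow> \<forall>\<theta>. j (i \<theta>) = \<theta> \<Longrightarrow> RR (inv\<^bsub>PC_Proj\<^esub> A) i"
  by (rule Rel_inv[OF _ _ _ _ _ EE_U EE_U])

lemma RR_one: "RR \<one>\<^bsub>PC_Proj\<^esub> j \<longleftrightarrow> j \<in> GP \<and> U = j -` U \<and> (\<forall>u\<in>U. \<forall>\<^sub>F w in at u. \<pi> w = \<pi> (j w))"
  by (rule Rel_one_iff[OF EE_U])

lemma RR_id: "RR \<one>\<^bsub>PC_Proj\<^esub> id" by (simp add: RR_one GP_id)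

lemma RR_one_mult: "RR \<one>\<^bsub>PC_Proj\<^esub> i \<Longrightarrow> RR \<one>\<^bsub>PC_Proj\<^esub> j \<Longrightarrow> RR \<one>\<^bsub>PC_Proj\<^esub> (i \<circ> j)"
  using RR_mult[OF PC.one_closed PC.one_closed, of i j] by simp

lemma RR_one_inv: "RR \<one>\<^bsub>PC_Proj\<^esub> j \<Longrightarrow> i \<in> GP \<Longrightarrow> \<forall>\<theta>. i (j \<theta>) = \<theta> \<Longrightarrow> \<forall>\<theta>. j (i \<theta>) = \<theta> \<Longrightarrow> RR \<one>\<^bsub>PC_Proj\<^esub> i"
  using RR_inv[OF PC.one_closed, of j i] by simp

text \<open>Deck transformations act freely, since half a germ has no nontrivial reparametrisation
  into itself.\<close>

lemma RR_free: assumes "RR \<one>\<^bsub>PC_Proj\<^esub> j" "u \<in> U" "j u = u" shows "j = id"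
proof -
  have "\<forall>\<^sub>F w in at u. \<pi> w = \<pi> (j w)" using assms(1,2) by (simp add: RR_one)
  then have "\<forall>\<^sub>F w in side True u. \<pi> w = \<pi> (j w)" by (rule side_le)
  then show ?thesis by (rule self_germ_trivial[OF EE_U[OF assms(2)] RR_GP[OF assms(1)] assms(3)])
qed

lemma subgroup_RR:
  assumes id: "Q id" and comp: "\<And>i j. i \<in> GP \<Longrightarrow> j \<in> GP \<Longrightarrow> Q i \<Longrightarrow> Q j \<Longrightarrow> Q (i \<circ> j)"
    and inverse: "\<And>i j. i \<in> GP \<Longrightarrow> j \<in> GP \<Longrightarrow> Q j \<Longrightarrow> \<forall>\<theta>. i (j \<theta>) = \<theta> \<Longrightarrow> \<forall>\<theta>. j (i \<theta>) = \<theta> \<Longrightarrow> Q i"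
  shows "subgroup {A \<in> \<Gamma>1. \<exists>j. RR A j \<and> Q j} PC_Proj"
proof (rule PC.subgroupI)
  show "{A \<in> \<Gamma>1. \<exists>j. RR A j \<and> Q j} \<subseteq> carrier PC_Proj" using \<Gamma>1_carrier by auto
  show "{A \<in> \<Gamma>1. \<exists>j. RR A j \<and> Q j} \<noteq> {}" using RR_id id subgroup.one_closed[OF \<Gamma>1(1)] by blast
  fix A assume "A \<in> {A \<in> \<Gamma>1. \<exists>j. RR A j \<and> Q j}"
  then obtain i where i: "A \<in> \<Gamma>1" "RR A i" "Q i" by blast
  obtain i' where i': "i' \<in> GP" "\<forall>\<theta>. i' (i \<theta>) = \<theta>" "\<forall>\<theta>. i (i' \<theta>) = \<theta>" using GP_inverse_ex[OF RR_GP[OF i(2)]] by blast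
  have "RR (inv\<^bsub>PC_Proj\<^esub> A) i'" by (rule RR_inv[OF \<Gamma>1_carrier[OF i(1)] i(2) i'])
  moreover have "Q i'" by (rule inverse[OF i'(1) RR_GP[OF i(2)] i(3) i'(2,3)])
  ultimately show "inv\<^bsub>PC_Proj\<^esub> A \<in> {A \<in> \<Gamma>1. \<exists>j. RR A j \<and> Q j}" using subgroup.m_inv_closed[OF \<Gamma>1(1) i(1)] by blast
  fix B assume "B \<in> {A \<in> \<Gamma>1. \<exists>j. RR A j \<and> Q j}"
  then obtain j where j: "B \<in> \<Gamma>1" "RR B j" "Q j" by blast
  have "RR (A \<otimes>\<^bsub>PC_Proj\<^esub> B) (i \<circ> j)" by (rule RR_mult[OF \<Gamma>1_carrier[OF i(1)] \<Gamma>1_carrier[OF j(1)] i(2) j(2)])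
  moreover have "Q (i \<circ> j)" by (rule comp[OF RR_GP[OF i(2)] RR_GP[OF j(2)] i(3) j(3)])
  ultimately show "A \<otimes>\<^bsub>PC_Proj\<^esub> B \<in> {A \<in> \<Gamma>1. \<exists>j. RR A j \<and> Q j}" using subgroup.m_closed[OF \<Gamma>1(1) i(1) j(1)] by blast
qed

lemma subgroup_fixer: "subgroup fixer PC_Proj"
proof -
  have "subgroup {A \<in> \<Gamma>1. \<exists>j. RR A j \<and> j = id} PC_Proj"
    by (rule subgroup_RR) (auto simp: fun_eq_iff)
  then show ?thesis by (simp add: fixer_def)
qed

lemma RR_commutator:
  assumes "A \<in> carrier PC_Proj" "B \<in> carrier PC_Proj" "RR A i" "RR B j"
    and "i' \<in> GP" "\<forall>\<theta>. i' (i \<theta>) = \<theta>" "\<forall>\<theta>. i (i' \<theta>) = \<theta>" and "j' \<in> GP" "\<forall>\<theta>. j' (j \<theta>) = \<theta>" "\<forall>\<theta>. j (j' \<theta>) = \<theta>"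
  shows "RR (A \<otimes>\<^bsub>PC_Proj\<^esub> B \<otimes>\<^bsub>PC_Proj\<^esub> inv\<^bsub>PC_Proj\<^esub> A \<otimes>\<^bsub>PC_Proj\<^esub> inv\<^bsub>PC_Proj\<^esub> B) (i \<circ> j \<circ> i' \<circ> j')"
  by (intro RR_mult RR_inv PC.m_closed PC.inv_closed) (use assms in simp_all)

text \<open>Two applications of \<open>fin_index_commutators\<close>, through the subgroup described
  by \<open>Q\<close>. An element \<open>A\<close> determines \<open>j\<close> only up to deck
  transformations, so membership asks for some \<open>j\<close> with \<open>Q\<close>, and no
  homomorphism to the group of reparametrisations is needed.\<close>

lemma metabelian_stabiliser:
  assumes id: "Q id" and comp: "\<And>i j. i \<in> GP \<Longrightarrow> j \<in> GP \<Longrightarrow> Q i \<Longrightarrow> Q j \<Longrightarrow> Q (i \<circ> j)"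
    and inverse: "\<And>i j. i \<in> GP \<Longrightarrow> j \<in> GP \<Longrightarrow> Q j \<Longrightarrow> \<forall>\<theta>. i (j \<theta>) = \<theta> \<Longrightarrow> \<forall>\<theta>. j (i \<theta>) = \<theta> \<Longrightarrow> Q i"
    and com: "\<And>A B i j i' j'. A \<in> \<Gamma>1 \<Longrightarrow> B \<in> \<Gamma>1 \<Longrightarrow> RR A i \<Longrightarrow> RR B j \<Longrightarrow> i' \<in> GP \<Longrightarrow> \<forall>\<theta>. i' (i \<theta>) = \<theta> \<Longrightarrow> \<forall>\<theta>. i (i' \<theta>) = \<theta>
       \<Longrightarrow> j' \<in> GP \<Longrightarrow> \<forall>\<theta>. j' (j \<theta>) = \<theta> \<Longrightarrow> \<forall>\<theta>. j (j' \<theta>) = \<theta> \<Longrightarrow> Q (i \<circ> j \<circ> i' \<circ> j')"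
    and abel: "\<And>i j. i \<in> GP \<Longrightarrow> j \<in> GP \<Longrightarrow> Q i \<Longrightarrow> Q j \<Longrightarrow> i \<circ> j = j \<circ> i"
  shows "PC.fin_index \<Gamma>1 fixer"
proof -
  define L where "L = {A \<in> \<Gamma>1. \<exists>j. RR A j \<and> Q j}"
  have L: "subgroup L PC_Proj" unfolding L_def by (rule subgroup_RR[OF id comp inverse])
  have LG: "L \<subseteq> \<Gamma>1" by (auto simp: L_def)
  have KL: "fixer \<subseteq> L" using id by (auto simp: L_def fixer_def)
  have 1: "PC.fin_index \<Gamma>1 L"
  proof (rule PC.fin_index_commutators[OF \<Gamma>1(1) L LG FW1])
    fix A B assume AB: "A \<in> \<Gamma>1" "B \<in> \<Gamma>1"
    obtain i where i: "RR A i" using stab[OF AB(1)] by blast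
    obtain j where j: "RR B j" using stab[OF AB(2)] by blast
    obtain i' where i': "i' \<in> GP" "\<forall>\<theta>. i' (i \<theta>) = \<theta>" "\<forall>\<theta>. i (i' \<theta>) = \<theta>" using GP_inverse_ex[OF RR_GP[OF i]] by blast
    obtain j' where j': "j' \<in> GP" "\<forall>\<theta>. j' (j \<theta>) = \<theta>" "\<forall>\<theta>. j (j' \<theta>) = \<theta>" using GP_inverse_ex[OF RR_GP[OF j]] by blast
    note C = RR_commutator[OF \<Gamma>1_carrier[OF AB(1)] \<Gamma>1_carrier[OF AB(2)] i j i' j']
    have "A \<otimes>\<^bsub>PC_Proj\<^esub> B \<otimes>\<^bsub>PC_Proj\<^esub> inv\<^bsub>PC_Proj\<^esub> A \<otimes>\<^bsub>PC_Proj\<^esub> inv\<^bsub>PC_Proj\<^esub> B \<in> \<Gamma>1"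
      by (intro subgroup.m_closed[OF \<Gamma>1(1)] subgroup.m_inv_closed[OF \<Gamma>1(1)] AB)
    then show "A \<otimes>\<^bsub>PC_Proj\<^esub> B \<otimes>\<^bsub>PC_Proj\<^esub> inv\<^bsub>PC_Proj\<^esub> A \<otimes>\<^bsub>PC_Proj\<^esub> inv\<^bsub>PC_Proj\<^esub> B \<in> L"
      unfolding L_def using C com[OF AB i j i' j'] by blast
  qed
  have FWL: "property_FW (PC_Proj\<lparr>carrier := L\<rparr>)" by (rule PC.property_FW_fin_index[OF \<Gamma>1(1) L LG 1 FW1])
  have 2: "PC.fin_index L fixer"
  proof (rule PC.fin_index_commutators[OF L subgroup_fixer KL FWL])
    fix A B assume AB: "A \<in> L" "B \<in> L"
    obtain i where i: "A \<in> \<Gamma>1" "RR A i" "Q i" using AB(1) by (auto simp: L_def)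
    obtain j where j: "B \<in> \<Gamma>1" "RR B j" "Q j" using AB(2) by (auto simp: L_def)
    obtain i' where i': "i' \<in> GP" "\<forall>\<theta>. i' (i \<theta>) = \<theta>" "\<forall>\<theta>. i (i' \<theta>) = \<theta>" using GP_inverse_ex[OF RR_GP[OF i(2)]] by blast
    obtain j' where j': "j' \<in> GP" "\<forall>\<theta>. j' (j \<theta>) = \<theta>" "\<forall>\<theta>. j (j' \<theta>) = \<theta>" using GP_inverse_ex[OF RR_GP[OF j(2)]] by blast
    note C = RR_commutator[OF \<Gamma>1_carrier[OF i(1)] \<Gamma>1_carrier[OF j(1)] i(2) j(2) i' j']
    have ij: "i (j \<theta>) = j (i \<theta>)" for \<theta>
      using fun_cong[OF abel[OF RR_GP[OF i(2)] RR_GP[OF j(2)] i(3) j(3)], of \<theta>] by simp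
    have "i \<circ> j \<circ> i' \<circ> j' = id" by (simp add: fun_eq_iff ij i'(3) j'(3))
    then have "RR (A \<otimes>\<^bsub>PC_Proj\<^esub> B \<otimes>\<^bsub>PC_Proj\<^esub> inv\<^bsub>PC_Proj\<^esub> A \<otimes>\<^bsub>PC_Proj\<^esub> inv\<^bsub>PC_Proj\<^esub> B) id" using C by simp
    moreover have "A \<otimes>\<^bsub>PC_Proj\<^esub> B \<otimes>\<^bsub>PC_Proj\<^esub> inv\<^bsub>PC_Proj\<^esub> A \<otimes>\<^bsub>PC_Proj\<^esub> inv\<^bsub>PC_Proj\<^esub> B \<in> \<Gamma>1"
      by (intro subgroup.m_closed[OF \<Gamma>1(1)] subgroup.m_inv_closed[OF \<Gamma>1(1)] i(1) j(1))
    ultimately show "A \<otimes>\<^bsub>PC_Proj\<^esub> B \<otimes>\<^bsub>PC_Proj\<^esub> inv\<^bsub>PC_Proj\<^esub> A \<otimes>\<^bsub>PC_Proj\<^esub> inv\<^bsub>PC_Proj\<^esub> B \<in> fixer"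
      by (simp add: fixer_def)
  qed
  show ?thesis by (rule PC.fin_index_trans[OF subgroup.subset[OF \<Gamma>1(1)] L LG 1 2])
qed

lemma mx_inverse: "i \<in> GP \<Longrightarrow> j \<in> GP \<Longrightarrow> \<forall>\<theta>. i (j \<theta>) = \<theta> \<Longrightarrow> mx i ** mx j = mat 1"
proof -
  assume a: "i \<in> GP" "j \<in> GP" "\<forall>\<theta>. i (j \<theta>) = \<theta>"
  have "i \<circ> j = (\<lambda>\<theta>. \<theta>)" using a(3) by (simp add: fun_eq_iff)
  then show ?thesis using mx_comp[OF a(1,2)] mx_id by simp
qed

text \<open>All \<open>j\<close> fix one end \<open>e\<close> of the interval, so
  \<open>ev e\<close> is a common eigenvector of their matrices. Commutators have eigenvalue 1 on
  it, and matrices fixing a vector commute. Their lifts then commute too, as both composites fix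
  \<open>e\<close>.\<close>

lemma proper_component:
  assumes "U \<noteq> UNIV" shows "PC.fin_index \<Gamma>1 fixer"
proof -
  have "connected U" "U \<noteq> {}" using dev by (simp_all add: dev_def)
  then obtain e where e: "\<forall>j\<in>GP. U = j -` U \<longrightarrow> j e = e" using invariant_interval_end assms by blast
  have eigen: "\<exists>r>0. av (mx j) (ev e) = r *\<^sub>R ev e" if "j \<in> GP" "j e = e" for j
    using plift_D[OF mx(2)[OF that(1)], of e] that(2) by simp
  show ?thesis
  proof (rule metabelian_stabiliser[where Q = "\<lambda>j. j e = e \<and> av (mx j) (ev e) = ev e"])
    show "id e = e \<and> av (mx id) (ev e) = ev e" using mx_id by (simp add: id_def)
    show "(i \<circ> j) e = e \<and> av (mx (i \<circ> j)) (ev e) = ev e"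
      if "i \<in> GP" "j \<in> GP" "i e = e \<and> av (mx i) (ev e) = ev e" "j e = e \<and> av (mx j) (ev e) = ev e" for i j
      using that by (simp add: mx_comp av_mult)
    show "i e = e \<and> av (mx i) (ev e) = ev e"
      if "i \<in> GP" "j \<in> GP" "j e = e \<and> av (mx j) (ev e) = ev e" "\<forall>\<theta>. i (j \<theta>) = \<theta>" "\<forall>\<theta>. j (i \<theta>) = \<theta>" for i j
    proof
      show "i e = e" using that(3,4) by metis
      have "av (mx i) (av (mx j) (ev e)) = ev e" using mx_inverse[OF that(1,2,4)] by (simp flip: av_mult)
      then show "av (mx i) (ev e) = ev e" using that(3) by simp
    qed
    show "i \<circ> j = j \<circ> i"
      if ij: "i \<in> GP" "j \<in> GP" "i e = e \<and> av (mx i) (ev e) = ev e" "j e = e \<and> av (mx j) (ev e) = ev e" for i j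
    proof (rule plift_unique[of "mx i ** mx j" _ _ e])
      show "plift (mx i ** mx j) (i \<circ> j)" by (rule plift_comp[OF mx(2)[OF ij(1)] mx(2)[OF ij(2)]])
      have "mx i ** mx j = mx j ** mx i" using ij by (intro unipotents_commute[of _ _ "ev e"] mx(1)) simp_all
      then show "plift (mx i ** mx j) (j \<circ> i)" using plift_comp[OF mx(2)[OF ij(2)] mx(2)[OF ij(1)]] by simp
      show "(i \<circ> j) e = (j \<circ> i) e" using ij by simp
    qed
    show "(i \<circ> j \<circ> i' \<circ> j') e = e \<and> av (mx (i \<circ> j \<circ> i' \<circ> j')) (ev e) = ev e"
      if AB: "RR A i" "RR B j" and i': "i' \<in> GP" "\<forall>\<theta>. i' (i \<theta>) = \<theta>" "\<forall>\<theta>. i (i' \<theta>) = \<theta>"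
        and j': "j' \<in> GP" "\<forall>\<theta>. j' (j \<theta>) = \<theta>" "\<forall>\<theta>. j (j' \<theta>) = \<theta>" for A B i j i' j'
    proof
      have i: "i \<in> GP" "i e = e" using AB(1) e RR_U[OF AB(1)] RR_GP by blast+
      have j: "j \<in> GP" "j e = e" using AB(2) e RR_U[OF AB(2)] RR_GP by blast+
      have i'e: "i' e = e" using i'(2) i(2) by metis
      have j'e: "j' e = e" using j'(2) j(2) by metis
      show "(i \<circ> j \<circ> i' \<circ> j') e = e" using i j i'e j'e by simp
      obtain r where r: "av (mx i) (ev e) = r *\<^sub>R ev e" using eigen[OF i] by blast
      obtain s where s: "av (mx j) (ev e) = s *\<^sub>R ev e" using eigen[OF j] by blast
      obtain r' where r': "av (mx i') (ev e) = r' *\<^sub>R ev e" using eigen[OF i'(1) i'e] by blast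
      obtain s' where s': "av (mx j') (ev e) = s' *\<^sub>R ev e" using eigen[OF j'(1) j'e] by blast
      have "av (mx i') (av (mx i) (ev e)) = ev e" using mx_inverse[OF i'(1) i(1) i'(2)] by (simp flip: av_mult)
      then have "(r * r') *\<^sub>R ev e = 1 *\<^sub>R ev e" by (simp add: r r' av_scaleR)
      then have rr: "r * r' = 1" by (simp only: scaleR_cancel_right ev_nonzero simp_thms)
      have "av (mx j') (av (mx j) (ev e)) = ev e" using mx_inverse[OF j'(1) j(1) j'(2)] by (simp flip: av_mult)
      then have "(s * s') *\<^sub>R ev e = 1 *\<^sub>R ev e" by (simp add: s s' av_scaleR)
      then have ss: "s * s' = 1" by (simp only: scaleR_cancel_right ev_nonzero simp_thms)
      have "av (mx (i \<circ> j \<circ> i' \<circ> j')) (ev e) = (s' * (r' * (s * r))) *\<^sub>R ev e"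
        using i j i' j' by (simp add: mx_comp GP_comp av_mult r s r' s' av_scaleR)
      also have "s' * (r' * (s * r)) = (r * r') * (s * s')" by simp
      finally show "av (mx (i \<circ> j \<circ> i' \<circ> j')) (ev e) = ev e" by (simp only: rr ss mult_1 scaleR_one)
    qed
  qed
qed

end

context component
begin

text \<open>A deck transformation other than the identity has no fixed point on the line, so its
  displacement keeps a constant sign.\<close>

lemma RR_one_compare:
  assumes UU: "U = UNIV" and k: "RR \<one>\<^bsub>PC_Proj\<^esub> k" and a: "a < k a" shows "b < k b"
proof (rule ccontr)
  assume n: "\<not> b < k b"
  have ne: "k x - x \<noteq> 0" for x
  proof
    assume "k x - x = 0"
    then have "k = id" using RR_free[OF k, of x] UU by simp
    then show False using a by simp
  qed
  have con: "connected ((\<lambda>x. k x - x) ` UNIV)"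
    by (intro connected_continuous_image continuous_on_diff GG_cont[OF GP_GG[OF RR_GP[OF k]]] continuous_on_id) simp
  have "0 \<in> (\<lambda>x. k x - x) ` UNIV"
    by (rule connectedD_interval[OF con, of "k b - b" "k a - a"]) (use n a in auto)
  then obtain x where "0 = k x - x" by (rule imageE)
  then show False using ne[of x] by simp
qed

lemma RR_one_value: assumes UU: "U = UNIV" and k: "RR \<one>\<^bsub>PC_Proj\<^esub> k" shows "\<pi> (k x) = \<pi> x"
proof -
  have "dev (k -` U) (\<pi> \<circ> k)" by (rule dev_reparam[OF RR_GP[OF k] dev])
  moreover have "\<forall>u\<in>U. \<forall>\<^sub>F w in at u. \<pi> w = \<pi> (k w)" using k unfolding RR_one by (elim conjE)
  then have "\<forall>\<^sub>F w in at 0. \<pi> w = (\<pi> \<circ> k) w" using UU by simp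
  ultimately have "\<pi> x = (\<pi> \<circ> k) x" using dev_unique[OF dev, of "k -` U" "\<pi> \<circ> k" 0 x] UU by simp
  then show ?thesis by simp
qed

text \<open>The deck group is discrete. The orbit of \<open>0\<close> lies in a fibre of
  \<open>\<pi>\<close>; if its positive part accumulated at its infimum from the right, the right
  germ of \<open>\<pi>\<close> there would not be injective.\<close>

lemma least_period:
  assumes UU: "U = UNIV" and j: "RR \<one>\<^bsub>PC_Proj\<^esub> j" "j \<noteq> id"
  shows "\<exists>T. RR \<one>\<^bsub>PC_Proj\<^esub> T \<and> 0 < T 0 \<and> (\<forall>k. RR \<one>\<^bsub>PC_Proj\<^esub> k \<and> 0 < k 0 \<longrightarrow> T 0 \<le> k 0)"
proof -
  define D where "D = {k 0 | k. RR \<one>\<^bsub>PC_Proj\<^esub> k \<and> 0 < k 0}"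
  have "D \<noteq> {}"
  proof (cases "0 < j 0")
    case True
    then show ?thesis using j(1) by (auto simp: D_def)
  next
    case False
    have "j 0 \<noteq> 0" using RR_free[OF j(1), of 0] UU j(2) by auto
    then have j0: "j 0 < 0" using False by simp
    obtain i where i: "i \<in> GP" "\<forall>\<theta>. i (j \<theta>) = \<theta>" "\<forall>\<theta>. j (i \<theta>) = \<theta>" using GP_inverse_ex[OF RR_GP[OF j(1)]] by blast
    have "i (j 0) < i 0" using j0 by (simp add: GP_less[OF i(1)])
    then have "0 < i 0" using i(2) by simp
    then show ?thesis using RR_one_inv[OF j(1) i] by (auto simp: D_def)
  qed
  have bdd: "bdd_below D" by (auto simp: D_def bdd_below_def intro!: exI[of _ 0])
  define \<delta> where "\<delta> = Inf D"
  have "\<delta> \<in> D"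
  proof (rule ccontr)
    assume n: "\<delta> \<notin> D"
    have "EE \<delta> \<pi>" using EE_U UU by simp
    then have "rreg \<pi> \<delta>" by (simp add: EE_def)
    then obtain g e where g: "e > 0" "\<And>v. \<delta> < v \<Longrightarrow> v < \<delta> + e \<Longrightarrow> g v \<in> BB \<and> \<pi> v = tau (g v)"
      "inj_on (\<lambda>v. tau (g v)) {\<delta><..<\<delta> + e}" using rreg_interval by metis
    have gap: "\<exists>d\<in>D. \<delta> < d \<and> d < c" if "\<delta> < c" for c
    proof -
      have "Inf D < c" using that by (simp add: \<delta>_def)
      then obtain d where d: "d \<in> D" "d < c" using cInf_lessD[OF \<open>D \<noteq> {}\<close>] by blast
      have "\<delta> \<le> d" unfolding \<delta>_def by (rule cInf_lower[OF d(1) bdd])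
      then have "\<delta> < d" using d(1) n by (metis order_le_imp_less_or_eq)
      then show ?thesis using d by blast
    qed
    obtain d1 where d1: "d1 \<in> D" "\<delta> < d1" "d1 < \<delta> + e" using gap[of "\<delta> + e"] g(1) by auto
    obtain d2 where d2: "d2 \<in> D" "\<delta> < d2" "d2 < d1" using gap[of d1] d1(2) by auto
    have D0: "\<pi> d = \<pi> 0" if "d \<in> D" for d using that RR_one_value[OF UU] by (auto simp: D_def)
    have "tau (g d1) = tau (g d2)" using g(2)[of d1] g(2)[of d2] d1 d2 D0[OF d1(1)] D0[OF d2(1)] by simp
    then have "d1 = d2" using inj_onD[OF g(3), of d1 d2] d1 d2 by simp
    then show False using d2(3) by simp
  qed
  then obtain T where T: "RR \<one>\<^bsub>PC_Proj\<^esub> T" "0 < T 0" "T 0 = \<delta>" by (auto simp: D_def)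
  have "T 0 \<le> k 0" if "RR \<one>\<^bsub>PC_Proj\<^esub> k" "0 < k 0" for k
    unfolding T(3) \<delta>_def by (rule cInf_lower[OF _ bdd]) (use that in \<open>auto simp: D_def\<close>)
  then show ?thesis using T by blast
qed

text \<open>Conjugation by \<open>j\<close> preserves the deck group and the sign of displacements,
  hence should preserve the least positive element \<open>T\<close>. The conjugates of
  \<open>T\<close> by \<open>j\<close> and by its inverse both displace \<open>0\<close> at least as
  far as \<open>T\<close> does; together these bounds force equality at \<open>0\<close>, and
  freeness does the rest.\<close>

lemma period_commutes:
  assumes UU: "U = UNIV" and T: "RR \<one>\<^bsub>PC_Proj\<^esub> T" "0 < T 0" "\<forall>k. RR \<one>\<^bsub>PC_Proj\<^esub> k \<and> 0 < k 0 \<longrightarrow> T 0 \<le> k 0"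
    and A: "A \<in> \<Gamma>1" and j: "RR A j"
  shows "j \<circ> T = T \<circ> j"
proof -
  have conj_period: "RR \<one>\<^bsub>PC_Proj\<^esub> (j \<circ> T \<circ> i) \<and> T 0 \<le> j (T (i 0))"
    if A: "A \<in> carrier PC_Proj" and j: "RR A j" and i: "i \<in> GP" "\<forall>\<theta>. i (j \<theta>) = \<theta>" "\<forall>\<theta>. j (i \<theta>) = \<theta>" for A i j
  proof -
    have "RR (A \<otimes>\<^bsub>PC_Proj\<^esub> \<one>\<^bsub>PC_Proj\<^esub> \<otimes>\<^bsub>PC_Proj\<^esub> inv\<^bsub>PC_Proj\<^esub> A) (j \<circ> T \<circ> i)"
      by (intro RR_mult RR_inv[OF A j i] PC.m_closed PC.inv_closed PC.one_closed A j T(1))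
    then have R: "RR \<one>\<^bsub>PC_Proj\<^esub> (j \<circ> T \<circ> i)" using A by simp
    have "j 0 < j (T 0)" using T(2) by (simp add: GP_less[OF RR_GP[OF j]])
    then have "j 0 < (j \<circ> T \<circ> i) (j 0)" using i(2) by simp
    then have "0 < (j \<circ> T \<circ> i) 0" by (rule RR_one_compare[OF UU R])
    then show ?thesis using R T(3) by auto
  qed
  obtain i where i: "i \<in> GP" "\<forall>\<theta>. i (j \<theta>) = \<theta>" "\<forall>\<theta>. j (i \<theta>) = \<theta>" using GP_inverse_ex[OF RR_GP[OF j]] by blast
  note Ac = \<Gamma>1_carrier[OF A]
  have 1: "RR \<one>\<^bsub>PC_Proj\<^esub> (j \<circ> T \<circ> i)" "T 0 \<le> j (T (i 0))" using conj_period[OF Ac j i] by auto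
  have 2: "T 0 \<le> i (T (j 0))"
    using conj_period[OF PC.inv_closed[OF Ac] RR_inv[OF Ac j i] RR_GP[OF j] i(3,2)] by auto
  obtain T' where T': "T' \<in> GP" "\<forall>\<theta>. T' (T \<theta>) = \<theta>" "\<forall>\<theta>. T (T' \<theta>) = \<theta>" using GP_inverse_ex[OF RR_GP[OF T(1)]] by blast
  have W: "RR \<one>\<^bsub>PC_Proj\<^esub> (T' \<circ> (j \<circ> T \<circ> i))" by (rule RR_one_mult[OF RR_one_inv[OF T(1) T'] 1(1)])
  have "\<not> T 0 < j (T (i 0))"
  proof
    assume "T 0 < j (T (i 0))"
    then have "T' (T 0) < T' (j (T (i 0)))" by (simp add: GP_less[OF T'(1)])
    then have "0 < (T' \<circ> (j \<circ> T \<circ> i)) 0" using T'(2) by simp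
    then have "j 0 < (T' \<circ> (j \<circ> T \<circ> i)) (j 0)" by (rule RR_one_compare[OF UU W])
    then have "j 0 < T' (j (T 0))" using i(2) by simp
    then have "T (j 0) < T (T' (j (T 0)))" by (simp add: GP_less[OF RR_GP[OF T(1)]])
    then have "T (j 0) < j (T 0)" using T'(3) by simp
    then have "i (T (j 0)) < i (j (T 0))" by (simp add: GP_less[OF i(1)])
    then show False using i(2) 2 by simp
  qed
  then have "(T' \<circ> (j \<circ> T \<circ> i)) 0 = 0" using 1(2) T'(2) by (metis comp_apply less_eq_real_def)
  then have "T' \<circ> (j \<circ> T \<circ> i) = id" using RR_free[OF W, of 0] UU by simp
  then have "T' (j (T (i \<theta>))) = \<theta>" for \<theta> by (metis comp_apply id_apply)
  from this[of "j _"] have "T' (j (T \<theta>)) = j \<theta>" for \<theta> using i(2) by simp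
  then have "T (j \<theta>) = j (T \<theta>)" for \<theta> using T'(3) by metis
  then show ?thesis by (simp add: fun_eq_iff)
qed

text \<open>Matrices of the stabiliser centralise the nonscalar matrix of \<open>T\<close> and
  therefore commute. So commutators of lifts cover the identity, which makes them translations by
  multiples of \<open>pi\<close>, and these commute with one another.\<close>

lemma hyperbolic_period:
  assumes T: "T \<in> GP" "\<And>A j. A \<in> \<Gamma>1 \<Longrightarrow> RR A j \<Longrightarrow> j \<circ> T = T \<circ> j" "\<not> pm (mx T) (mat 1)"
  shows "PC.fin_index \<Gamma>1 fixer"
proof (rule metabelian_stabiliser[where Q = "\<lambda>j. \<exists>k :: int. \<forall>\<theta>. j \<theta> = \<theta> + k * pi"])
  show "\<exists>k :: int. \<forall>\<theta>. id \<theta> = \<theta> + k * pi" by (rule exI[of _ 0]) simp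
  show "\<exists>k :: int. \<forall>\<theta>. (i \<circ> j) \<theta> = \<theta> + k * pi"
    if ij: "\<exists>k :: int. \<forall>\<theta>. i \<theta> = \<theta> + k * pi" "\<exists>k :: int. \<forall>\<theta>. j \<theta> = \<theta> + k * pi" for i j
  proof -
    obtain k l :: int where "\<forall>\<theta>. i \<theta> = \<theta> + k * pi" "\<forall>\<theta>. j \<theta> = \<theta> + l * pi" using ij by blast
    then show ?thesis by (intro exI[of _ "k + l"]) (simp add: algebra_simps)
  qed
  show "i \<circ> j = j \<circ> i"
    if ij: "\<exists>k :: int. \<forall>\<theta>. i \<theta> = \<theta> + k * pi" "\<exists>k :: int. \<forall>\<theta>. j \<theta> = \<theta> + k * pi" for i j
  proof -
    obtain k l :: int where "\<forall>\<theta>. i \<theta> = \<theta> + k * pi" "\<forall>\<theta>. j \<theta> = \<theta> + l * pi" using ij by blast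
    then show ?thesis by (simp add: fun_eq_iff algebra_simps)
  qed
  show "\<exists>k :: int. \<forall>\<theta>. i \<theta> = \<theta> + k * pi"
    if ij: "\<exists>k :: int. \<forall>\<theta>. j \<theta> = \<theta> + k * pi" "\<forall>\<theta>. j (i \<theta>) = \<theta>" for i j
  proof -
    obtain k :: int where k: "\<forall>\<theta>. j \<theta> = \<theta> + k * pi" using ij(1) by blast
    have "i \<theta> = \<theta> + of_int (- k) * pi" for \<theta> using ij(2)[rule_format, of \<theta>] k by simp
    then show ?thesis by blast
  qed
  show "\<exists>k :: int. \<forall>\<theta>. (i \<circ> j \<circ> i' \<circ> j') \<theta> = \<theta> + k * pi"
    if AB: "A \<in> \<Gamma>1" "B \<in> \<Gamma>1" "RR A i" "RR B j" and i': "i' \<in> GP" "\<forall>\<theta>. i' (i \<theta>) = \<theta>" "\<forall>\<theta>. i (i' \<theta>) = \<theta>"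
      and j': "j' \<in> GP" "\<forall>\<theta>. j' (j \<theta>) = \<theta>" "\<forall>\<theta>. j (j' \<theta>) = \<theta>" for A B i j i' j'
  proof -
    note i = RR_GP[OF AB(3)] and j = RR_GP[OF AB(4)]
    have MT: "mx h ** mx T = mx T ** mx h" if "A \<in> \<Gamma>1" "RR A h" for A h
      using T(2)[OF that] mx_comp[OF RR_GP[OF that(2)] T(1)] mx_comp[OF T(1) RR_GP[OF that(2)]] by simp
    have c: "mx i ** mx j = mx j ** mx i"
      by (rule centralizer_commute[OF MT[OF AB(1,3)] MT[OF AB(2,4)] mx(1)[OF T(1)] T(3)])
    have "mx (i \<circ> j \<circ> i' \<circ> j') = mx i ** mx j ** mx i' ** mx j'"
      using i j i'(1) j'(1) by (simp add: mx_comp GP_comp)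
    also have "\<dots> = mx j ** (mx i ** mx i') ** mx j'" unfolding c by (simp only: matrix_mul_assoc)
    also have "\<dots> = mat 1" using mx_inverse[OF i i'(1,3)] mx_inverse[OF j j'(1,3)] by simp
    finally have "pm (mx (i \<circ> j \<circ> i' \<circ> j')) (mat 1)" by simp
    then show ?thesis using pm_mx_id_iff[of "i \<circ> j \<circ> i' \<circ> j'"] i j i'(1) j'(1) GP_comp by blast
  qed
qed

text \<open>Here the deck group dies in PSL_2(R), so the matrix of \<open>j\<close> depends up to
  sign only on the group element. The kernel of the resulting representation acts by translations by
  multiples of \<open>pi\<close>; modulo the deck group, generated by \<open>k\<close> times
  \<open>pi\<close>, only \<open>k\<close> classes remain.\<close>

lemma shift_period:
  assumes UU: "U = UNIV" and T: "RR \<one>\<^bsub>PC_Proj\<^esub> T" "0 < T 0" "\<forall>k. RR \<one>\<^bsub>PC_Proj\<^esub> k \<and> 0 < k 0 \<longrightarrow> T 0 \<le> k 0"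
    and k: "\<forall>\<theta>. T \<theta> = \<theta> + of_int k * pi"
  shows "\<exists>m. PC.prep \<Gamma>1 m \<and> PC.fin_index (PC.pker \<Gamma>1 m) fixer"
proof -
  define p where "p = of_int k * pi"
  have Tp: "T = (\<lambda>\<theta>. \<theta> + p)" using k by (auto simp: p_def)
  have p: "p > 0" using T(2) by (simp add: Tp)
  have kpos: "k > 0" using p by (simp add: p_def zero_less_mult_iff)
  have shiftGP: "(\<lambda>\<theta>. \<theta> + of_int q * p) \<in> GP" for q :: int
    using GP_pi[of "q * k"] by (simp add: p_def mult.assoc)
  have shift: "RR \<one>\<^bsub>PC_Proj\<^esub> (\<lambda>\<theta>. \<theta> + of_int q * p)" for q :: int
  proof (induction q rule: int_induct[where k = 0])
    case base
    show ?case using RR_id by (simp add: id_def)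
  next
    case (step1 q)
    have "T \<circ> (\<lambda>\<theta>. \<theta> + of_int q * p) = (\<lambda>\<theta>. \<theta> + of_int (q + 1) * p)" by (simp add: Tp fun_eq_iff algebra_simps)
    then show ?case using RR_one_mult[OF T(1) step1(2)] by simp
  next
    case (step2 q)
    have "RR \<one>\<^bsub>PC_Proj\<^esub> (\<lambda>\<theta>. \<theta> + of_int (- 1) * p)" by (rule RR_one_inv[OF T(1) shiftGP]) (simp_all add: Tp)
    moreover have "(\<lambda>\<theta>. \<theta> + of_int (- 1) * p) \<circ> (\<lambda>\<theta>. \<theta> + of_int q * p) = (\<lambda>\<theta>. \<theta> + of_int (q - 1) * p)"
      by (simp add: fun_eq_iff algebra_simps)
    ultimately show ?case using RR_one_mult step2(2) by metis
  qed
  \<comment> \<open>Division with remainder: subtracting the right multiple of \<open>p\<close>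
    leaves a displacement of \<open>0\<close> below that of \<open>T\<close>, which is zero by
    minimality.\<close>
  have all_shift: "\<exists>q :: int. \<forall>\<theta>. n \<theta> = \<theta> + of_int q * p" if n: "RR \<one>\<^bsub>PC_Proj\<^esub> n" for n
  proof -
    define q where "q = \<lfloor>n 0 / p\<rfloor>"
    define n' where "n' = (\<lambda>\<theta>. \<theta> + of_int (- q) * p) \<circ> n"
    have R: "RR \<one>\<^bsub>PC_Proj\<^esub> n'" unfolding n'_def by (rule RR_one_mult[OF shift n])
    have "of_int q \<le> n 0 / p" "n 0 / p < of_int q + 1" unfolding q_def by linarith+
    then have "of_int q * p \<le> n 0" "n 0 < (of_int q + 1) * p" using p by (simp_all add: le_divide_eq divide_less_eq)
    then have b: "0 \<le> n' 0" "n' 0 < T 0" by (simp_all add: n'_def Tp algebra_simps)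
    have "\<not> 0 < n' 0" using T(3) R b(2) by force
    then have "n' 0 = 0" using b(1) by simp
    then have "n' = id" using RR_free[OF R, of 0] UU by simp
    then have "n \<theta> + of_int (- q) * p = \<theta>" for \<theta> unfolding n'_def by (metis comp_apply id_apply)
    then have "n \<theta> = \<theta> + of_int q * p" for \<theta> by (metis add_diff_cancel_right' diff_minus_eq_add mult_minus_left of_int_minus uminus_add_conv_diff add.commute)
    then show ?thesis by blast
  qed
  have shift_pm: "pm (mx n) (mat 1)" if n: "RR \<one>\<^bsub>PC_Proj\<^esub> n" for n
  proof -
    obtain q :: int where q: "\<forall>\<theta>. n \<theta> = \<theta> + of_int q * p" using all_shift[OF n] by blast
    have "\<forall>\<theta>. n \<theta> = \<theta> + of_int (q * k) * pi" using q by (simp add: p_def)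
    then show ?thesis using pm_mx_id_iff[OF RR_GP[OF n]] by blast
  qed
  \<comment> \<open>An arbitrary choice of a reparametrisation; \<open>mJ\<close> shows that another
    choice affects the matrix by a sign at most.\<close>
  define J where "J = (\<lambda>A. SOME j. RR A j)"
  define m where "m = (\<lambda>A. mx (J A))"
  have J: "RR A (J A)" if "A \<in> \<Gamma>1" for A unfolding J_def by (rule someI_ex[OF stab[OF that]])
  have mJ: "pm (mx j) (m A)" if A: "A \<in> \<Gamma>1" and j: "RR A j" for A j
  proof -
    note JA = J[OF A]
    obtain i where i: "i \<in> GP" "\<forall>\<theta>. i (J A \<theta>) = \<theta>" "\<forall>\<theta>. J A (i \<theta>) = \<theta>" using GP_inverse_ex[OF RR_GP[OF JA]] by blast
    have "RR (inv\<^bsub>PC_Proj\<^esub> A \<otimes>\<^bsub>PC_Proj\<^esub> A) (i \<circ> j)"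
      by (rule RR_mult[OF PC.inv_closed[OF \<Gamma>1_carrier[OF A]] \<Gamma>1_carrier[OF A] RR_inv[OF \<Gamma>1_carrier[OF A] JA i] j])
    then have R: "RR \<one>\<^bsub>PC_Proj\<^esub> (i \<circ> j)" using \<Gamma>1_carrier[OF A] by simp
    have "J A \<circ> (i \<circ> j) = j" using i(3) by (simp add: fun_eq_iff)
    then have "mx j = mx (J A) ** mx (i \<circ> j)" using mx_comp[OF RR_GP[OF JA] RR_GP[OF R]] by simp
    moreover have "pm (mx (J A) ** mx (i \<circ> j)) (mx (J A) ** mat 1)" by (rule pm_mult[OF pm_refl shift_pm[OF R]])
    ultimately show ?thesis by (simp add: m_def)
  qed
  have prep: "PC.prep \<Gamma>1 m"
    unfolding PC.prep_def
  proof (intro conjI ballI)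
    show "det (m A) = 1" if "A \<in> \<Gamma>1" for A unfolding m_def by (rule mx(1)[OF RR_GP[OF J[OF that]]])
    fix A B assume AB: "A \<in> \<Gamma>1" "B \<in> \<Gamma>1"
    have "RR (A \<otimes>\<^bsub>PC_Proj\<^esub> B) (J A \<circ> J B)" by (rule RR_mult[OF \<Gamma>1_carrier[OF AB(1)] \<Gamma>1_carrier[OF AB(2)] J[OF AB(1)] J[OF AB(2)]])
    then have "pm (mx (J A \<circ> J B)) (m (A \<otimes>\<^bsub>PC_Proj\<^esub> B))" by (rule mJ[OF subgroup.m_closed[OF \<Gamma>1(1) AB]])
    then have "pm (m (A \<otimes>\<^bsub>PC_Proj\<^esub> B)) (mx (J A \<circ> J B))" by (rule pm_sym)
    then show "pm (m (A \<otimes>\<^bsub>PC_Proj\<^esub> B)) (m A ** m B)"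
      using mx_comp[OF RR_GP[OF J[OF AB(1)]] RR_GP[OF J[OF AB(2)]]] by (simp add: m_def)
  qed
  define l where "l = (\<lambda>A. SOME l :: int. \<forall>\<theta>. J A \<theta> = \<theta> + of_int l * pi)"
  have l: "\<forall>\<theta>. J A \<theta> = \<theta> + of_int (l A) * pi" if "A \<in> PC.pker \<Gamma>1 m" for A
  proof -
    have A: "A \<in> \<Gamma>1" "pm (mx (J A)) (mat 1)" using that by (simp_all add: PC.pker_def m_def)
    have "\<exists>l :: int. \<forall>\<theta>. J A \<theta> = \<theta> + of_int l * pi" using A(2) pm_mx_id_iff[OF RR_GP[OF J[OF A(1)]]] by blast
    then show ?thesis unfolding l_def by (rule someI_ex)
  qed
  have "PC.fin_index (PC.pker \<Gamma>1 m) fixer"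
  proof (rule PC.fin_indexI[where \<phi> = "\<lambda>A. l A mod k"])
    have "(\<lambda>A. l A mod k) ` PC.pker \<Gamma>1 m \<subseteq> {0..<k}" using kpos by auto
    then show "finite ((\<lambda>A. l A mod k) ` PC.pker \<Gamma>1 m)" by (rule finite_subset) simp
    show "PC.pker \<Gamma>1 m \<subseteq> carrier PC_Proj" using \<Gamma>1_carrier by (auto simp: PC.pker_def)
    fix A B assume AB: "A \<in> PC.pker \<Gamma>1 m" "B \<in> PC.pker \<Gamma>1 m" and eq: "l A mod k = l B mod k"
    have AB1: "A \<in> \<Gamma>1" "B \<in> \<Gamma>1" using AB by (simp_all add: PC.pker_def)
    note Ac = \<Gamma>1_carrier[OF AB1(1)] and Bc = \<Gamma>1_carrier[OF AB1(2)]
    obtain q where q: "l B - l A = k * q" using eq by (metis mod_eq_dvd_iff dvdE)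
    obtain i where i: "i \<in> GP" "\<forall>\<theta>. i (J A \<theta>) = \<theta>" "\<forall>\<theta>. J A (i \<theta>) = \<theta>" using GP_inverse_ex[OF RR_GP[OF J[OF AB1(1)]]] by blast
    have R: "RR (inv\<^bsub>PC_Proj\<^esub> A \<otimes>\<^bsub>PC_Proj\<^esub> B) (i \<circ> J B)"
      by (rule RR_mult[OF PC.inv_closed[OF Ac] Bc RR_inv[OF Ac J[OF AB1(1)] i] J[OF AB1(2)]])
    have "RR (\<one>\<^bsub>PC_Proj\<^esub> \<otimes>\<^bsub>PC_Proj\<^esub> (inv\<^bsub>PC_Proj\<^esub> A \<otimes>\<^bsub>PC_Proj\<^esub> B)) ((\<lambda>\<theta>. \<theta> + of_int (- q) * p) \<circ> (i \<circ> J B))"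
      by (rule RR_mult[OF PC.one_closed PC.m_closed[OF PC.inv_closed[OF Ac] Bc] shift R])
    then have R': "RR (inv\<^bsub>PC_Proj\<^esub> A \<otimes>\<^bsub>PC_Proj\<^esub> B) ((\<lambda>\<theta>. \<theta> + of_int (- q) * p) \<circ> (i \<circ> J B))"
      using PC.m_closed[OF PC.inv_closed[OF Ac] Bc] by simp
    have lq: "of_int (l B) = (of_int (l A) + of_int k * of_int q :: real)" using q by (metis add.commute diff_add_cancel of_int_add of_int_mult)
    have "i (J B \<theta>) + of_int (- q) * p = \<theta>" for \<theta>
    proof -
      have "i x = x - of_int (l A) * pi" for x using i(3)[rule_format, of x] l[OF AB(1)] by (simp add: algebra_simps)
      then have "i (J B \<theta>) = \<theta> + of_int (l B) * pi - of_int (l A) * pi" using l[OF AB(2)] by simp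
      then show ?thesis by (simp add: lq p_def algebra_simps)
    qed
    then have "(\<lambda>\<theta>. \<theta> + of_int (- q) * p) \<circ> (i \<circ> J B) = id" by (simp add: fun_eq_iff)
    then have "RR (inv\<^bsub>PC_Proj\<^esub> A \<otimes>\<^bsub>PC_Proj\<^esub> B) id" using R' by simp
    moreover have "inv\<^bsub>PC_Proj\<^esub> A \<otimes>\<^bsub>PC_Proj\<^esub> B \<in> \<Gamma>1"
      by (intro subgroup.m_closed[OF \<Gamma>1(1)] subgroup.m_inv_closed[OF \<Gamma>1(1)] AB1)
    ultimately show "inv\<^bsub>PC_Proj\<^esub> A \<otimes>\<^bsub>PC_Proj\<^esub> B \<in> fixer" by (simp add: fixer_def)
  qed
  then show ?thesis using prep by blast
qed

theorem component_dichotomy: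
  assumes "U = UNIV \<longrightarrow> (\<exists>j. j \<noteq> id \<and> RR \<one>\<^bsub>PC_Proj\<^esub> j)"
  shows "PC.fin_index \<Gamma>1 fixer \<or> (\<exists>m. PC.prep \<Gamma>1 m \<and> PC.fin_index (PC.pker \<Gamma>1 m) fixer)"
proof (cases "U = UNIV")
  case UU: True
  then obtain j where j: "RR \<one>\<^bsub>PC_Proj\<^esub> j" "j \<noteq> id" using assms by blast
  obtain T where T: "RR \<one>\<^bsub>PC_Proj\<^esub> T" "0 < T 0" "\<forall>k. RR \<one>\<^bsub>PC_Proj\<^esub> k \<and> 0 < k 0 \<longrightarrow> T 0 \<le> k 0"
    using least_period[OF UU j] by blast
  show ?thesis
  proof (cases "pm (mx T) (mat 1)")
    case True
    then obtain k :: int where "\<forall>\<theta>. T \<theta> = \<theta> + of_int k * pi" using pm_mx_id_iff[OF RR_GP[OF T(1)]] by blast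
    then show ?thesis using shift_period[OF UU T] by blast
  next
    case False
    have "j \<circ> T = T \<circ> j" if "A \<in> \<Gamma>1" "RR A j" for A j by (rule period_commutes[OF UU T that])
    then show ?thesis using hyperbolic_period[OF RR_GP[OF T(1)] _ False] by blast
  qed
qed (use proper_component in blast)

end

subsection \<open>Assembling the components\<close>

definition psl :: "real^2^2 \<Rightarrow> (real^2^2) set" where "psl A = {A, - A}"

lemma psl_eq_iff: "psl A = psl B \<longleftrightarrow> pm A B"
  by (auto simp: psl_def pm_def doubleton_eq_iff)

lemma carrier_PSL2: "carrier PSL2 = psl ` {A. det A = 1}"
proof -
  have "{mat 1, - mat 1} #>\<^bsub>SL2\<^esub> A = psl A" for A
    by (auto simp: r_coset_def SL2_def psl_def matrix_minus_mult)
  then show ?thesis by (auto simp: PSL2_def FactGroup_def RCOSETS_def SL2_def)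
qed

lemma psl_mult: "psl A \<otimes>\<^bsub>PSL2\<^esub> psl B = psl (A ** B)"
  by (auto simp: PSL2_def FactGroup_def set_mult_def SL2_def psl_def matrix_minus_mult)

lemma one_PSL2: "\<one>\<^bsub>PSL2\<^esub> = psl (mat 1)"
  by (simp add: PSL2_def FactGroup_def psl_def)

context group
begin

text \<open>Since the preimage of a closed set contains both signs of each matrix, its defining
  polynomials vanish on both lifts of the image, as \<open>prep_zariski\<close> requires.\<close>

lemma prep_zariski_dense:
  assumes H: "subgroup H G" and m: "prep H m" and P: "P ** P' = mat 1" "P' ** P = mat 1"
    and a: "a \<in> H" "\<bar>l\<bar> > 1" "P' ** m a ** P = mt l 0 0 (1 / l)"
    and g: "g \<in> H" "\<And>i j. (P' ** m g ** P) $ i $ j \<noteq> 0"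
  shows "zariski_dense_PSL2 ((\<lambda>x. psl (m x)) ` H)"
  unfolding zariski_dense_PSL2_def
proof (intro conjI allI impI; (elim conjE)?)
  show "(\<lambda>x. psl (m x)) ` H \<subseteq> carrier PSL2" using prep_det[OF m] by (auto simp: carrier_PSL2)
  fix C assume C: "zariski_closed_PSL2 C" and sub: "(\<lambda>x. psl (m x)) ` H \<subseteq> C"
  obtain R where R: "C \<subseteq> carrier PSL2" "\<And>p. p \<in> R \<Longrightarrow> real_polynomial_function p" "\<Union>C = {A \<in> carrier SL2. \<forall>p\<in>R. p A = 0}"
    using C unfolding zariski_closed_PSL2_def by blast
  have "p (m x) = 0 \<and> p (- m x) = 0" if "p \<in> R" "x \<in> H" for p x
  proof -
    have "psl (m x) \<in> C" using sub that(2) by blast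
    then have "m x \<in> \<Union>C" "- m x \<in> \<Union>C" by (auto simp: psl_def)
    then show ?thesis using R(3) that(1) by simp
  qed
  then have "p A = 0" if "p \<in> R" "det A = 1" for p A
    using prep_zariski[OF H m P a g R(2)[OF that(1)] _ that(2)] that(1) by blast
  then have un: "A \<in> \<Union>C" if "det A = 1" for A using R(3) that by (simp add: SL2_def)
  show "C = carrier PSL2"
  proof
    show "carrier PSL2 \<subseteq> C"
    proof
      fix Y assume "Y \<in> carrier PSL2"
      then obtain A where A: "Y = psl A" "det A = 1" by (auto simp: carrier_PSL2)
      obtain Z where Z: "Z \<in> C" "A \<in> Z" using un[OF A(2)] by blast
      then obtain B where B: "Z = psl B" using R(1) by (auto simp: carrier_PSL2)
      then have "pm A B" using Z(2) by (auto simp: psl_def pm_def)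
      then have "psl A = psl B" by (simp only: psl_eq_iff)
      then show "Y \<in> C" using Z(1) A(1) B by simp
    qed
  qed (rule R(1))
qed

lemma fin_index_self: "subgroup H G \<Longrightarrow> fin_index H H"
  by (rule fin_indexI[where \<phi> = "\<lambda>_. ()"])
     (auto dest: subgroup.subset intro: subgroup.m_closed subgroup.m_inv_closed)

lemma fin_index_trivial:
  assumes "H \<subseteq> carrier G" "fin_index H K" "K \<subseteq> {\<one>}" shows "finite H"
proof -
  obtain \<phi> :: "'a \<Rightarrow> 'a set" where \<phi>: "finite (\<phi> ` H)"
      "\<And>x y. x \<in> H \<Longrightarrow> y \<in> H \<Longrightarrow> \<phi> x = \<phi> y \<Longrightarrow> inv x \<otimes> y \<in> K"
    using assms(2) unfolding fin_index_def by blast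
  have "inj_on \<phi> H"
  proof (rule inj_onI)
    fix x y assume xy: "x \<in> H" "y \<in> H" "\<phi> x = \<phi> y"
    have c: "x \<in> carrier G" "y \<in> carrier G" using xy assms(1) by auto
    have "inv x \<otimes> y = \<one>" using \<phi>(2)[OF xy] assms(3) by blast
    then have "x \<otimes> (inv x \<otimes> y) = x" using c by simp
    then show "x = y" using inv_cancel_left[OF c] by simp
  qed
  then show ?thesis using finite_imageD[OF \<phi>(1)] by blast
qed

lemma fin_index_finite_rcosets:
  assumes H: "subgroup H G" and K: "subgroup K G" and fi: "fin_index H K"
  shows "finite (rcosets\<^bsub>G\<lparr>carrier := H\<rparr>\<^esub> K)"
proof -
  obtain \<phi> :: "'a \<Rightarrow> 'a set" where \<phi>: "finite (\<phi> ` H)"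
      "\<And>x y. x \<in> H \<Longrightarrow> y \<in> H \<Longrightarrow> \<phi> x = \<phi> y \<Longrightarrow> inv x \<otimes> y \<in> K"
    using fi unfolding fin_index_def by blast
  have Hc: "x \<in> carrier G" if "x \<in> H" for x using subgroup.subset[OF H] that by blast
  \<comment> \<open>Passing to inverses exchanges the left cosets of \<open>fin_index\<close> with
    right cosets.\<close>
  have eq: "K #> x = K #> y" if "x \<in> H" "y \<in> H" "\<phi> (inv x) = \<phi> (inv y)" for x y
  proof -
    have "inv (inv x) \<otimes> inv y \<in> K"
      by (rule \<phi>(2)[OF subgroup.m_inv_closed[OF H that(1)] subgroup.m_inv_closed[OF H that(2)] that(3)])
    then have "x \<otimes> inv y \<in> K" using Hc that(1) by simp
    then have "K #> (x \<otimes> inv y) = K" using Hc that by (intro coset_join2 K) auto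
    then show ?thesis using Hc that by (intro coset_mult_inv1 subgroup.subset[OF K]) auto
  qed
  define r where "r = (\<lambda>v. SOME x. x \<in> H \<and> \<phi> (inv x) = v)"
  have "K #> x \<in> (\<lambda>v. K #> r v) ` (\<phi> ` H)" if x: "x \<in> H" for x
  proof
    have "r (\<phi> (inv x)) \<in> H \<and> \<phi> (inv (r (\<phi> (inv x)))) = \<phi> (inv x)"
      unfolding r_def by (rule someI[of _ x]) (simp add: x)
    then show "K #> x = K #> r (\<phi> (inv x))" using eq[OF x] by metis
    show "\<phi> (inv x) \<in> \<phi> ` H" using subgroup.m_inv_closed[OF H x] by blast
  qed
  then have "(\<lambda>x. K #> x) ` H \<subseteq> (\<lambda>v. K #> r v) ` (\<phi> ` H)" by blast
  then have "finite ((\<lambda>x. K #> x) ` H)" by (rule finite_subset) (use \<phi>(1) in blast)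
  moreover have "rcosets\<^bsub>G\<lparr>carrier := H\<rparr>\<^esub> K = (\<lambda>x. K #> x) ` H"
    by (auto simp: RCOSETS_def r_coset_def)
  ultimately show ?thesis by simp
qed

lemma word_value_subgroup:
  assumes "subgroup H G" "fst ` set w \<subseteq> H"
  shows "word_value (G\<lparr>carrier := H\<rparr>) w = word_value G w"
  using assms(2)
proof (induction w)
  case (Cons s w)
  obtain x e where s: "s = (x, e)" by force
  have "inv\<^bsub>G\<lparr>carrier := H\<rparr>\<^esub> x = inv x" using m_inv_consistent[OF assms(1)] Cons.prems s by simp
  then show ?case using Cons by (simp add: s word_value_Cons)
qed (simp add: word_value_def)

lemma free_pair_subgroup:
  assumes \<Gamma>: "subgroup \<Gamma> G" and xy: "x \<in> \<Gamma>" "y \<in> \<Gamma>" "x \<noteq> y"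
    and free: "\<And>w. w \<noteq> [] \<and> fst ` set w \<subseteq> {x, y} \<and> reduced_word w \<Longrightarrow> word_value G w \<noteq> \<one>"
  shows "\<exists>H. subgroup H (G\<lparr>carrier := \<Gamma>\<rparr>) \<and> free_group (G\<lparr>carrier := H\<rparr>) \<and> \<not> comm_group (G\<lparr>carrier := H\<rparr>)"
proof -
  have c: "x \<in> carrier G" "y \<in> carrier G" using xy subgroup.subset[OF \<Gamma>] by blast+
  define H where "H = generate G {x, y}"
  have H: "subgroup H G" unfolding H_def using c by (intro generate_is_subgroup) simp
  have H\<Gamma>: "H \<subseteq> \<Gamma>" unfolding H_def using xy by (intro generate_subgroup_incl[OF _ \<Gamma>]) simp
  have xyH: "{x, y} \<subseteq> H" unfolding H_def using generate.incl[of _ "{x, y}" G] by blast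
  have 1: "subgroup H (G\<lparr>carrier := \<Gamma>\<rparr>)" by (rule subgroup_incl[OF H \<Gamma> H\<Gamma>])
  have "free_generating_set (G\<lparr>carrier := H\<rparr>) {x, y}"
    unfolding free_generating_set_def
  proof (intro conjI allI impI)
    show "{x, y} \<subseteq> carrier (G\<lparr>carrier := H\<rparr>)" using xyH by simp
    show "generate (G\<lparr>carrier := H\<rparr>) {x, y} = carrier (G\<lparr>carrier := H\<rparr>)"
      using generate_consistent[OF xyH H] by (simp add: H_def)
    fix w :: "('a \<times> bool) list" assume w: "w \<noteq> [] \<and> fst ` set w \<subseteq> {x, y} \<and> reduced_word w"
    have "fst ` set w \<subseteq> H" using w xyH by blast
    then show "word_value (G\<lparr>carrier := H\<rparr>) w \<noteq> \<one>\<^bsub>G\<lparr>carrier := H\<rparr>\<^esub>"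
      using free[OF w] word_value_subgroup[OF H] by simp
  qed
  then have 2: "free_group (G\<lparr>carrier := H\<rparr>)"
    unfolding free_group_def using subgroup.subgroup_is_group[OF H is_group] by blast
  have "\<not> comm_group (G\<lparr>carrier := H\<rparr>)"
  proof
    assume "comm_group (G\<lparr>carrier := H\<rparr>)"
    then have "x \<otimes> y = y \<otimes> x" using xyH comm_monoid.m_comm[of "G\<lparr>carrier := H\<rparr>" x y] by (simp add: comm_group_def)
    then have "x \<otimes> y \<otimes> (inv x \<otimes> inv y) = y \<otimes> x \<otimes> (inv x \<otimes> inv y)" by simp
    also have "\<dots> = \<one>" using c by (simp add: m_assoc inv_cancel_left)
    \<comment> \<open>Noncommutativity comes from freeness: the commutator of the two generators is
      a nonempty reduced word.\<close>
    finally have "word_value G [(x, True), (y, True), (x, False), (y, False)] = \<one>"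
      using c by (simp add: word_value_def m_assoc)
    moreover have "reduced_word [(x, True), (y, True), (x, False), (y, False)]"
      using xy(3) by (simp add: reduced_word_def)
    ultimately show False using free[of "[(x, True), (y, True), (x, False), (y, False)]"] by simp
  qed
  then show ?thesis using 1 2 by blast
qed

text \<open>Components on which a finite index subgroup acts through a finite group are absorbed into \<open>\<Gamma>'\<close>;
  each of the remaining ones contributes a factor.\<close>

theorem PSL2_embedding:
  assumes \<Gamma>: "subgroup \<Gamma> G" and FW: "FW \<Gamma>" and \<Gamma>1: "subgroup \<Gamma>1 G" "\<Gamma>1 \<subseteq> \<Gamma>" and fi1: "fin_index \<Gamma> \<Gamma>1"
    and I: "finite I" and K: "\<And>c. c \<in> I \<Longrightarrow> subgroup (K c) G" "\<And>c. c \<in> I \<Longrightarrow> K c \<subseteq> \<Gamma>1"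
    and dich: "\<And>c. c \<in> I \<Longrightarrow> fin_index \<Gamma>1 (K c) \<or> (\<exists>m. prep \<Gamma>1 m \<and> fin_index (pker \<Gamma>1 m) (K c))"
    and triv: "\<Gamma>1 \<inter> (\<Inter>c\<in>I. K c) \<subseteq> {\<one>}"
  shows "(\<exists>(n::nat) \<Gamma>' h.
            subgroup \<Gamma>' (G\<lparr>carrier := \<Gamma>\<rparr>) \<and>
            finite (rcosets\<^bsub>G\<lparr>carrier := \<Gamma>\<rparr>\<^esub> \<Gamma>') \<and>
            h \<in> hom (G\<lparr>carrier := \<Gamma>'\<rparr>) (product_group {..<n} (\<lambda>_. PSL2)) \<and>
            finite (kernel (G\<lparr>carrier := \<Gamma>'\<rparr>) (product_group {..<n} (\<lambda>_. PSL2)) h) \<and>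
            (\<forall>i<n. zariski_dense_PSL2 ((\<lambda>\<gamma>. h \<gamma> i) ` \<Gamma>')))
       \<and> (finite \<Gamma> \<or>
          (\<exists>H. subgroup H (G\<lparr>carrier := \<Gamma>\<rparr>) \<and>
               free_group (G\<lparr>carrier := H\<rparr>) \<and>
               \<not> comm_group (G\<lparr>carrier := H\<rparr>)))"
proof -
  have \<Gamma>c: "\<Gamma> \<subseteq> carrier G" and \<Gamma>1c: "\<Gamma>1 \<subseteq> carrier G" using subgroup.subset \<Gamma> \<Gamma>1(1) by blast+
  have FW1: "FW \<Gamma>1" by (rule property_FW_fin_index[OF \<Gamma> \<Gamma>1 fi1 FW])
  define I1 where "I1 = {c \<in> I. fin_index \<Gamma>1 (K c)}"
  define I2 where "I2 = I - I1"
  have fin: "finite I1" "finite I2" using I by (simp_all add: I1_def I2_def)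
  have "\<forall>c\<in>I2. \<exists>m. prep \<Gamma>1 m \<and> fin_index (pker \<Gamma>1 m) (K c)" using dich by (auto simp: I1_def I2_def)
  then obtain m where m: "\<And>c. c \<in> I2 \<Longrightarrow> prep \<Gamma>1 (m c)" "\<And>c. c \<in> I2 \<Longrightarrow> fin_index (pker \<Gamma>1 (m c)) (K c)" by metis
  define \<Gamma>' where "\<Gamma>' = \<Gamma>1 \<inter> (\<Inter>c\<in>I1. K c)"
  have "subgroup (\<Inter> (insert \<Gamma>1 (K ` I1))) G"
    by (rule subgroups_Inter) (use \<Gamma>1(1) K(1) in \<open>auto simp: I1_def\<close>)
  then have \<Gamma>': "subgroup \<Gamma>' G" by (simp add: \<Gamma>'_def)
  have sub: "\<Gamma>' \<subseteq> \<Gamma>1" by (simp add: \<Gamma>'_def)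
  have fi': "fin_index \<Gamma>1 \<Gamma>'"
    unfolding \<Gamma>'_def by (subst fin_index_INT[OF fin(1) \<Gamma>1c]) (auto simp: I1_def fin_index_self[OF \<Gamma>1(1)])
  have FW': "FW \<Gamma>'" by (rule property_FW_fin_index[OF \<Gamma>1(1) \<Gamma>' sub fi' FW1])
  have fi: "fin_index \<Gamma> \<Gamma>'" by (rule fin_index_trans[OF \<Gamma>c \<Gamma>1 fi1 fi'])
  have m': "prep \<Gamma>' (m c)" if "c \<in> I2" for c by (rule prep_subset[OF m(1)[OF that] sub])
  \<comment> \<open>Were the kernel of finite index in \<Gamma>', it would be so in \<Gamma>1, and
    with it \<open>K c\<close>; but such components belong to \<open>I1\<close>. So the second
    alternative of \<open>prep_dichotomy\<close> holds on \<Gamma>' itself.\<close>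
  have data: "\<exists>P P' a g l. P ** P' = mat 1 \<and> P' ** P = mat 1 \<and> a \<in> \<Gamma>' \<and> g \<in> \<Gamma>' \<and> \<bar>l\<bar> > 1 \<and>
       P' ** m c a ** P = mt l 0 0 (1 / l) \<and> (\<forall>i j. (P' ** m c g ** P) $ i $ j \<noteq> 0)" if c: "c \<in> I2" for c
  proof -
    have "\<not> fin_index \<Gamma>' (pker \<Gamma>' (m c))"
    proof
      assume "fin_index \<Gamma>' (pker \<Gamma>' (m c))"
      then have "fin_index \<Gamma>1 (pker \<Gamma>' (m c))" by (rule fin_index_trans[OF \<Gamma>1c \<Gamma>' sub fi'])
      then have "fin_index \<Gamma>1 (pker \<Gamma>1 (m c))"
        by (rule fin_index_mono) (use sub in \<open>auto simp: pker_def\<close>)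
      moreover have "pker \<Gamma>1 (m c) \<subseteq> \<Gamma>1" by (auto simp: pker_def)
      ultimately have "fin_index \<Gamma>1 (K c)"
        using fin_index_trans[OF \<Gamma>1c subgroup_pker[OF \<Gamma>1(1) m(1)[OF c]]] m(2)[OF c] by blast
      then show False using c by (simp add: I1_def I2_def)
    qed
    then show ?thesis using prep_dichotomy[OF \<Gamma>' m'[OF c] FW'] by blast
  qed
  obtain e where e: "bij_betw e {0..<card I2} I2" using ex_bij_betw_nat_finite[OF fin(2)] by blast
  define n where "n = card I2"
  have eI: "e i \<in> I2" if "i < n" for i using bij_betwE[OF e] that by (simp add: n_def)
  have Ie: "\<exists>i<n. c = e i" if "c \<in> I2" for c
  proof -
    have "c \<in> e ` {0..<card I2}" using that by (simp only: bij_betw_imp_surj_on[OF e])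
    then show ?thesis by (auto simp: n_def)
  qed
  define h where "h = (\<lambda>x. \<lambda>i\<in>{..<n}. psl (m (e i) x))"
  have hom: "h \<in> hom (G\<lparr>carrier := \<Gamma>'\<rparr>) (product_group {..<n} (\<lambda>_. PSL2))"
  proof (rule homI)
    fix x assume x: "x \<in> carrier (G\<lparr>carrier := \<Gamma>'\<rparr>)"
    show "h x \<in> carrier (product_group {..<n} (\<lambda>_. PSL2))"
      using x prep_det[OF m'[OF eI]] by (auto simp: h_def carrier_PSL2)
    fix y assume y: "y \<in> carrier (G\<lparr>carrier := \<Gamma>'\<rparr>)"
    have "psl (m (e i) (x \<otimes> y)) = psl (m (e i) x ** m (e i) y)" if "i < n" for i
      using prep_mult[OF m'[OF eI[OF that]]] x y by (simp add: psl_eq_iff)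
    then show "h (x \<otimes>\<^bsub>G\<lparr>carrier := \<Gamma>'\<rparr>\<^esub> y) = h x \<otimes>\<^bsub>product_group {..<n} (\<lambda>_. PSL2)\<^esub> h y"
      by (auto simp: h_def psl_mult fun_eq_iff restrict_def)
  qed
  define N where "N = kernel (G\<lparr>carrier := \<Gamma>'\<rparr>) (product_group {..<n} (\<lambda>_. PSL2)) h"
  have N_iff: "x \<in> N \<longleftrightarrow> x \<in> \<Gamma>' \<and> (\<forall>c\<in>I2. x \<in> pker \<Gamma>1 (m c))" for x
  proof -
    have "h x = \<one>\<^bsub>product_group {..<n} (\<lambda>_. PSL2)\<^esub> \<longleftrightarrow> (\<forall>i<n. pm (m (e i) x) (mat 1))"
      by (auto simp: h_def one_PSL2 psl_eq_iff fun_eq_iff restrict_def)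
    also have "\<dots> \<longleftrightarrow> (\<forall>c\<in>I2. pm (m c x) (mat 1))" using eI Ie by metis
    finally show ?thesis using sub by (auto simp: N_def kernel_def pker_def)
  qed
  have N: "subgroup N G"
  proof -
    have "subgroup (\<Inter> (insert \<Gamma>' ((\<lambda>c. pker \<Gamma>1 (m c)) ` I2))) G"
      by (rule subgroups_Inter) (use \<Gamma>' subgroup_pker[OF \<Gamma>1(1) m(1)] in auto)
    moreover have "\<Inter> (insert \<Gamma>' ((\<lambda>c. pker \<Gamma>1 (m c)) ` I2)) = N" using N_iff by auto
    ultimately show ?thesis by simp
  qed
  \<comment> \<open>The kernel \<open>N\<close> is finite: each remaining \<open>K c\<close> has
    finite index in it, and together with the components absorbed into \<Gamma>' they intersect in
    the neutral element.\<close>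
  have "fin_index N (N \<inter> (\<Inter>c\<in>I2. K c))"
  proof (subst fin_index_INT[OF fin(2) subgroup.subset[OF N]])
    show "fin_index N (K c)" if "c \<in> I2" for c
      by (rule fin_index_mono[OF m(2)[OF that]]) (use N_iff that in auto)
  qed (rule fin_index_self[OF N])
  moreover have "N \<inter> (\<Inter>c\<in>I2. K c) \<subseteq> {\<one>}"
  proof
    fix x assume x: "x \<in> N \<inter> (\<Inter>c\<in>I2. K c)"
    then have "x \<in> \<Gamma>'" by (simp add: N_iff)
    then have "x \<in> \<Gamma>1 \<inter> (\<Inter>c\<in>I. K c)" using x by (auto simp: \<Gamma>'_def I2_def)
    then show "x \<in> {\<one>}" using triv by blast
  qed
  ultimately have finN: "finite N" by (rule fin_index_trivial[OF subgroup.subset[OF N]])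
  have dense: "zariski_dense_PSL2 ((\<lambda>\<gamma>. h \<gamma> i) ` \<Gamma>')" if i: "i < n" for i
  proof -
    obtain P P' a g l where d: "P ** P' = mat 1" "P' ** P = mat 1" "a \<in> \<Gamma>'" "g \<in> \<Gamma>'" "\<bar>l\<bar> > 1"
       "P' ** m (e i) a ** P = mt l 0 0 (1 / l)" "\<forall>i' j. (P' ** m (e i) g ** P) $ i' $ j \<noteq> 0"
      using data[OF eI[OF i]] by blast
    have "zariski_dense_PSL2 ((\<lambda>x. psl (m (e i) x)) ` \<Gamma>')"
      by (rule prep_zariski_dense[OF \<Gamma>' m'[OF eI[OF i]] d(1,2,3,5,6,4)]) (use d(7) in blast)
    then show ?thesis using i by (simp add: h_def)
  qed
  have "finite \<Gamma> \<or> (\<exists>H. subgroup H (G\<lparr>carrier := \<Gamma>\<rparr>) \<and> free_group (G\<lparr>carrier := H\<rparr>) \<and> \<not> comm_group (G\<lparr>carrier := H\<rparr>))"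
  proof (cases "I2 = {}")
    case True
    \<comment> \<open>Without factors the map has a trivial target, so \<Gamma>' is its own finite
      kernel.\<close>
    then have "\<Gamma>' \<subseteq> N" using N_iff by auto
    then have "finite \<Gamma>'" using finN finite_subset by blast
    have "fin_index \<Gamma>' {\<one>}"
    proof (rule fin_indexI[where \<phi> = id])
      show "finite (id ` \<Gamma>')" using \<open>finite \<Gamma>'\<close> by simp
      show "\<Gamma>' \<subseteq> carrier G" by (rule subgroup.subset[OF \<Gamma>'])
      show "inv x \<otimes> y \<in> {\<one>}" if "x \<in> \<Gamma>'" "id x = id y" for x y
        using that subgroup.subset[OF \<Gamma>'] by auto
    qed
    then have "fin_index \<Gamma> {\<one>}" by (rule fin_index_trans[OF \<Gamma>c \<Gamma>' subset_trans[OF sub \<Gamma>1(2)] fi])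
    then show ?thesis using fin_index_trivial[OF \<Gamma>c] by blast
  next
    case False
    then obtain c where c: "c \<in> I2" by blast
    obtain P P' a g l where d: "P ** P' = mat 1" "P' ** P = mat 1" "a \<in> \<Gamma>'" "g \<in> \<Gamma>'" "\<bar>l\<bar> > 1"
       "P' ** m c a ** P = mt l 0 0 (1 / l)" "\<forall>i j. (P' ** m c g ** P) $ i $ j \<noteq> 0"
      using data[OF c] by blast
    have "\<exists>x\<in>\<Gamma>'. \<exists>y\<in>\<Gamma>'. x \<noteq> y \<and> (\<forall>w. w \<noteq> [] \<and> fst ` set w \<subseteq> {x, y} \<and> reduced_word w \<longrightarrow> word_value G w \<noteq> \<one>)"
      by (rule prep_free_pair[OF \<Gamma>' prep_conj[OF m'[OF c] d(1,2)] d(3,5,6,4)]) (use d(7) in blast)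
    then obtain x y where xy: "x \<in> \<Gamma>'" "y \<in> \<Gamma>'" "x \<noteq> y"
      "\<forall>w. w \<noteq> [] \<and> fst ` set w \<subseteq> {x, y} \<and> reduced_word w \<longrightarrow> word_value G w \<noteq> \<one>" by blast
    have "x \<in> \<Gamma>" "y \<in> \<Gamma>" using xy sub \<Gamma>1(2) by blast+
    then show ?thesis using free_pair_subgroup[OF \<Gamma> _ _ xy(3)] xy(4) by blast
  qed
  moreover have "subgroup \<Gamma>' (G\<lparr>carrier := \<Gamma>\<rparr>)" by (rule subgroup_incl[OF \<Gamma>' \<Gamma> subset_trans[OF sub \<Gamma>1(2)]])
  moreover have "finite (rcosets\<^bsub>G\<lparr>carrier := \<Gamma>\<rparr>\<^esub> \<Gamma>')" by (rule fin_index_finite_rcosets[OF \<Gamma> \<Gamma>' fi])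
  ultimately show ?thesis using hom finN[unfolded N_def] dense by blast
qed

end

theorem corollary1p9:
  fixes \<Gamma> :: "(circle \<Rightarrow> circle) set set"
  assumes "subgroup \<Gamma> PC_Proj"
    and "property_FW (PC_Proj\<lparr>carrier := \<Gamma>\<rparr>)"
  shows "(\<exists>(n::nat) \<Gamma>' h.
            subgroup \<Gamma>' (PC_Proj\<lparr>carrier := \<Gamma>\<rparr>) \<and>
            finite (rcosets\<^bsub>PC_Proj\<lparr>carrier := \<Gamma>\<rparr>\<^esub> \<Gamma>') \<and>
            h \<in> hom (PC_Proj\<lparr>carrier := \<Gamma>'\<rparr>) (product_group {..<n} (\<lambda>_. PSL2)) \<and>
            finite (kernel (PC_Proj\<lparr>carrier := \<Gamma>'\<rparr>) (product_group {..<n} (\<lambda>_. PSL2)) h) \<and>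
            (\<forall>i<n. zariski_dense_PSL2 ((\<lambda>\<gamma>. h \<gamma> i) ` \<Gamma>')))
       \<and> (finite \<Gamma> \<or>
          (\<exists>H. subgroup H (PC_Proj\<lparr>carrier := \<Gamma>\<rparr>) \<and>
               free_group (PC_Proj\<lparr>carrier := H\<rparr>) \<and>
               \<not> comm_group (PC_Proj\<lparr>carrier := H\<rparr>)))"
proof -
  obtain S P where "devel \<Gamma> S P" using devel_exists[OF assms] by blast
  then interpret devel \<Gamma> S P .
  obtain CI where "atlas CI" using atlas_exists by blast
  then have CI: "finite CI"
    and CI_max: "\<And>U \<pi>. (U, \<pi>) \<in> CI \<Longrightarrow> maxdev U \<pi> \<and> (U = UNIV \<longrightarrow> (\<exists>j. j \<noteq> id \<and> Rel \<one>\<^bsub>PC_Proj\<^esub> U \<pi> U \<pi> j))"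
    and CI_act: "\<And>A c. A \<in> \<Gamma> \<Longrightarrow> c \<in> CI \<Longrightarrow> \<exists>c'\<in>CI. \<exists>j. Rel A (fst c) (snd c) (fst c') (snd c') j"
    and CI_triv: "\<And>A. A \<in> \<Gamma> \<Longrightarrow> \<forall>(U, \<pi>)\<in>CI. Rel A U \<pi> U \<pi> id \<Longrightarrow> A = \<one>\<^bsub>PC_Proj\<^esub>"
    unfolding atlas_def by (fastforce simp: split_beta)+
  define rel where "rel = (\<lambda>A c c'. \<exists>j. Rel A (fst c) (snd c) (fst c') (snd c') j)"
  have E: "EE u (snd c)" if "c \<in> CI" "u \<in> fst c" for c u
    using CI_max[of "fst c" "snd c"] dev_D(3)[OF maxdev_dev] that by auto
  have rel_mult: "rel (B \<otimes>\<^bsub>PC_Proj\<^esub> A) c c''" if "A \<in> \<Gamma>" "B \<in> \<Gamma>" "c \<in> CI" "rel A c c'" "rel B c' c''" for A B c c' c''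
    using that(4,5) Rel_mult[OF \<Gamma>_carrier[OF that(1)] \<Gamma>_carrier[OF that(2)] _ _ E[OF that(3)]]
    unfolding rel_def by blast
  have rel_inv: "rel (inv\<^bsub>PC_Proj\<^esub> A) c' c" if "A \<in> \<Gamma>" "c \<in> CI" "c' \<in> CI" "rel A c c'" for A c c'
  proof -
    from \<open>rel A c c'\<close> obtain j where j: "Rel A (fst c) (snd c) (fst c') (snd c') j" by (auto simp: rel_def)
    then have "j \<in> GP" by (simp add: Rel_def)
    then obtain i where i: "i \<in> GP" "\<forall>\<theta>. i (j \<theta>) = \<theta>" "\<forall>\<theta>. j (i \<theta>) = \<theta>" using GP_inverse_ex by blast
    show ?thesis unfolding rel_def using Rel_inv[OF \<Gamma>_carrier[OF that(1)] j i E[OF that(2)] E[OF that(3)]] by blast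
  qed
  \<comment> \<open>The elements that preserve every chart of the atlas up to
    reparametrisation.\<close>
  define \<Gamma>1 where "\<Gamma>1 = {A \<in> \<Gamma>. \<forall>c\<in>CI. rel A c c}"
  have \<Gamma>1: "subgroup \<Gamma>1 PC_Proj"
  proof (rule PC.subgroupI)
    show "\<Gamma>1 \<subseteq> carrier PC_Proj" using \<Gamma>_carrier by (auto simp: \<Gamma>1_def)
    have "rel \<one>\<^bsub>PC_Proj\<^esub> c c" if c: "c \<in> CI" for c
    proof -
      have "Rel \<one>\<^bsub>PC_Proj\<^esub> (fst c) (snd c) (fst c) (snd c) id"
        by (rule RelI[OF PC.one_closed PC_Proj_one_mem GP_id _ E[OF c]]) simp_all
      then show ?thesis unfolding rel_def by blast
    qed
    then show "\<Gamma>1 \<noteq> {}" using subgroup.one_closed[OF \<Gamma>] by (auto simp: \<Gamma>1_def)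
    fix A assume A: "A \<in> \<Gamma>1"
    then show "inv\<^bsub>PC_Proj\<^esub> A \<in> \<Gamma>1" using rel_inv subgroup.m_inv_closed[OF \<Gamma>] by (simp add: \<Gamma>1_def)
    fix B assume B: "B \<in> \<Gamma>1"
    have "rel (A \<otimes>\<^bsub>PC_Proj\<^esub> B) c c" if "c \<in> CI" for c
      by (rule rel_mult[of B A c c c]) (use A B that in \<open>simp_all add: \<Gamma>1_def\<close>)
    then show "A \<otimes>\<^bsub>PC_Proj\<^esub> B \<in> \<Gamma>1" using A B subgroup.m_closed[OF \<Gamma>] by (simp add: \<Gamma>1_def)
  qed
  have \<Gamma>1_sub: "\<Gamma>1 \<subseteq> \<Gamma>" by (auto simp: \<Gamma>1_def)
  \<comment> \<open>Several charts may be reparametrisations of the same component, so the image of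
    a chart is not unique and one is chosen. Elements making the same choices differ by an element
    of \<Gamma>1, and there are finitely many maps from the atlas to itself.\<close>
  define \<phi> where "\<phi> = (\<lambda>A. \<lambda>c\<in>CI. SOME c'. c' \<in> CI \<and> rel A c c')"
  have \<phi>: "\<phi> A c \<in> CI \<and> rel A c (\<phi> A c)" if "A \<in> \<Gamma>" "c \<in> CI" for A c
  proof -
    have "\<exists>c'. c' \<in> CI \<and> rel A c c'" using CI_act[OF that] unfolding rel_def by blast
    then show ?thesis unfolding \<phi>_def using that(2) by (simp add: someI_ex[of "\<lambda>c'. c' \<in> CI \<and> rel A c c'"])
  qed
  have fi1: "PC.fin_index \<Gamma> \<Gamma>1"
  proof (rule PC.fin_indexI[where \<phi> = \<phi>])
    have "\<phi> ` \<Gamma> \<subseteq> CI \<rightarrow>\<^sub>E CI"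
    proof (rule image_subsetI)
      fix A assume A: "A \<in> \<Gamma>"
      show "\<phi> A \<in> CI \<rightarrow>\<^sub>E CI" by (rule PiE_I) (use \<phi>[OF A] in \<open>auto simp: \<phi>_def\<close>)
    qed
    then show "finite (\<phi> ` \<Gamma>)" by (rule finite_subset) (use CI in \<open>auto intro: finite_PiE\<close>)
    show "\<Gamma> \<subseteq> carrier PC_Proj" using \<Gamma>_carrier by blast
    fix A B assume AB: "A \<in> \<Gamma>" "B \<in> \<Gamma>" "\<phi> A = \<phi> B"
    have iA: "inv\<^bsub>PC_Proj\<^esub> A \<in> \<Gamma>" by (rule subgroup.m_inv_closed[OF \<Gamma> AB(1)])
    have "rel (inv\<^bsub>PC_Proj\<^esub> A \<otimes>\<^bsub>PC_Proj\<^esub> B) c c" if c: "c \<in> CI" for c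
    proof (rule rel_mult[OF AB(2) iA c])
      show "rel B c (\<phi> A c)" using \<phi>[OF AB(2) c] AB(3) by simp
      show "rel (inv\<^bsub>PC_Proj\<^esub> A) (\<phi> A c) c" by (rule rel_inv[OF AB(1) c]) (use \<phi>[OF AB(1) c] in simp_all)
    qed
    then show "inv\<^bsub>PC_Proj\<^esub> A \<otimes>\<^bsub>PC_Proj\<^esub> B \<in> \<Gamma>1" using subgroup.m_closed[OF \<Gamma> iA AB(2)] by (simp add: \<Gamma>1_def)
  qed
  have FW1: "property_FW (PC_Proj\<lparr>carrier := \<Gamma>1\<rparr>)"
    by (rule PC.property_FW_fin_index[OF \<Gamma> \<Gamma>1 \<Gamma>1_sub fi1 assms(2)])
  define K where "K = (\<lambda>c. {A \<in> \<Gamma>1. Rel A (fst c) (snd c) (fst c) (snd c) id})"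
  have comp: "component \<Gamma> S P \<Gamma>1 (fst c) (snd c)" if c: "c \<in> CI" for c
  proof (intro component.intro component_axioms.intro devel_axioms \<Gamma>1 \<Gamma>1_sub FW1)
    show "maxdev (fst c) (snd c)" using CI_max[of "fst c" "snd c"] c by simp
    show "\<exists>j. Rel A (fst c) (snd c) (fst c) (snd c) j" if "A \<in> \<Gamma>1" for A
      using that c by (simp add: \<Gamma>1_def rel_def)
  qed
  have K_eq: "component.fixer \<Gamma>1 (fst c) (snd c) = K c" if "c \<in> CI" for c
    using component.fixer_def[OF comp[OF that]] by (simp add: K_def)
  show ?thesis
  proof (rule PC.PSL2_embedding[OF \<Gamma> assms(2) \<Gamma>1 \<Gamma>1_sub fi1 CI])
    fix c assume c: "c \<in> CI"
    show "subgroup (K c) PC_Proj" using component.subgroup_fixer[OF comp[OF c]] K_eq[OF c] by simp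
    show "K c \<subseteq> \<Gamma>1" by (auto simp: K_def)
    have "fst c = UNIV \<longrightarrow> (\<exists>j. j \<noteq> id \<and> Rel \<one>\<^bsub>PC_Proj\<^esub> (fst c) (snd c) (fst c) (snd c) j)"
      using CI_max[of "fst c" "snd c"] c by simp
    then show "PC.fin_index \<Gamma>1 (K c) \<or> (\<exists>m. PC.prep \<Gamma>1 m \<and> PC.fin_index (PC.pker \<Gamma>1 m) (K c))"
      using component.component_dichotomy[OF comp[OF c]] K_eq[OF c] by simp
  next
    show "\<Gamma>1 \<inter> (\<Inter>c\<in>CI. K c) \<subseteq> {\<one>\<^bsub>PC_Proj\<^esub>}"
    proof
      fix A assume A: "A \<in> \<Gamma>1 \<inter> (\<Inter>c\<in>CI. K c)"
      then have "\<forall>(U, \<pi>)\<in>CI. Rel A U \<pi> U \<pi> id" by (auto simp: K_def)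
      then show "A \<in> {\<one>\<^bsub>PC_Proj\<^esub>}" using CI_triv[of A] A \<Gamma>1_sub by blast
    qed
  qed
qed

end
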